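(* Let $(M,g)$ be an $n$-dimensional ($n\ge 3$) simply connected closed Riemannian manifold with scalar curvature $\mathrm{R}>0$ everywhere. Then there exists a constant $C(n,Y)$, depending only on $n$ and the Yamabe constant $Y:=Y(M,[g])$, such that $$\mathrm{diam}(M)\le C(n,Y)\int_M \mathrm{R}^{\frac{n-1}{2}}\,dv.$$ In particular, one can take $$C(n,Y)=4\max\left\{w_n^{-1},\ \left(2en^{-1}Y\right)^{-\frac n2}e^{\frac{17n-18}{n-2}\cdot 2^n}\right\},$$ where $w_n$ is the volume of the unit $n$-sphere $\mathbb{S}^n$.
   Context: Closed means compact without boundary. $dv$ is the Riemannian volume element of $g$. The diameter is $\mathrm{diam}(M)=\max\{dist(x,y): x,y\in M\}$, where $dist$ is the geodesic distance of $g$. The unit $n$-sphere $\mathbb{S}^n\subset\mathbb{R}^{n+1}$ carries its standard metric, and $w_n$ is its $n$-dimensional volume. The Yamabe constant of the conformal class $[g]$ is $$Y(M,[g])=\inf_{0<\varphi\in C^\infty(M)}\frac{\frac{4(n-1)}{n-2}\int_M|\nabla\varphi|^2dv+\int_M \mathrm{R}\,\varphi^2dv}{\left(\int_M\varphi^{\frac{2n}{n-2}}dv\right)^{\frac{n-2}{n}}}.$$ It is finite, and it is positive when $\mathrm{R}>0$. *)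

theory Defs
  imports "HOL-Analysis.Analysis"
begin

section \<open>Smooth functions on open subsets of a normed space\<close>

text \<open>Only meant for open \<open>S\<close>, where \<open>frechet_derivative f (at x)\<close> depends on \<open>f\<close> inside \<open>S\<close> only.\<close>

fun Ck_on :: "nat \<Rightarrow> 'e::real_normed_vector set \<Rightarrow> ('e \<Rightarrow> 'f::real_normed_vector) \<Rightarrow> bool" where
  "Ck_on 0 S f \<longleftrightarrow> continuous_on S f"
| "Ck_on (Suc k) S f \<longleftrightarrow>
     (\<forall>x\<in>S. f differentiable (at x)) \<and>
     (\<forall>v. Ck_on k S (\<lambda>x. frechet_derivative f (at x) v))"

definition smooth_on :: "'e::real_normed_vector set \<Rightarrow> ('e \<Rightarrow> 'f::real_normed_vector) \<Rightarrow> bool" where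
  "smooth_on S f \<longleftrightarrow> (\<forall>k. Ck_on k S f)"

definition pderiv_at :: "'n::finite \<Rightarrow> (real^'n \<Rightarrow> 'f::real_normed_vector) \<Rightarrow> real^'n \<Rightarrow> 'f" where
  "pderiv_at i f x = frechet_derivative f (at x) (axis i 1)"


section \<open>Smooth manifolds\<close>

text \<open>
  A chart is a pair of a coordinate neighbourhood and a coordinate map; the values of the map
  outside the neighbourhood are irrelevant. A manifold is a subset \<open>M\<close> of a topological space with
  the subspace topology and an atlas \<open>A\<close>, which need not be maximal.  All charts take values in
  \<open>real^'n\<close>, so the dimension is \<open>CARD('n)\<close> and there is no boundary.
\<close>

type_synonym ('a, 'n) chart = "'a set \<times> ('a \<Rightarrow> real^'n)"

abbreviation chart_dom :: "('a, 'n::finite) chart \<Rightarrow> 'a set" where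
  "chart_dom c \<equiv> fst c"

abbreviation chart_map :: "('a, 'n::finite) chart \<Rightarrow> 'a \<Rightarrow> real^'n" where
  "chart_map c \<equiv> snd c"

abbreviation chart_img :: "('a, 'n::finite) chart \<Rightarrow> (real^'n) set" where
  "chart_img c \<equiv> chart_map c ` chart_dom c"

definition chart_inv :: "('a, 'n::finite) chart \<Rightarrow> real^'n \<Rightarrow> 'a" where
  "chart_inv c = inv_into (chart_dom c) (chart_map c)"

definition is_chart :: "'a::topological_space set \<Rightarrow> ('a, 'n::finite) chart \<Rightarrow> bool" where
  "is_chart M c \<longleftrightarrow>
     openin (top_of_set M) (chart_dom c) \<and> open (chart_img c) \<and>
     homeomorphism (chart_dom c) (chart_img c) (chart_map c) (chart_inv c)"

definition transition :: "('a, 'n::finite) chart \<Rightarrow> ('a, 'n) chart \<Rightarrow> real^'n \<Rightarrow> real^'n" where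
  "transition c d = chart_map d \<circ> chart_inv c"

definition smooth_atlas :: "'a::topological_space set \<Rightarrow> ('a, 'n::finite) chart set \<Rightarrow> bool" where
  "smooth_atlas M A \<longleftrightarrow>
     (\<forall>c\<in>A. is_chart M c) \<and> (\<Union>c\<in>A. chart_dom c) = M \<and>
     (\<forall>c\<in>A. \<forall>d\<in>A. smooth_on (chart_map c ` (chart_dom c \<inter> chart_dom d)) (transition c d))"

definition smooth_manifold :: "'a::topological_space set \<Rightarrow> ('a, 'n::finite) chart set \<Rightarrow> bool" where
  "smooth_manifold M A \<longleftrightarrow>
     M \<noteq> {} \<and> Hausdorff_space (top_of_set M) \<and> second_countable (top_of_set M) \<and> smooth_atlas M A"

definition smooth_function :: "('a, 'n::finite) chart set \<Rightarrow> ('a \<Rightarrow> real) \<Rightarrow> bool" where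
  "smooth_function A \<phi> \<longleftrightarrow> (\<forall>c\<in>A. smooth_on (chart_img c) (\<phi> \<circ> chart_inv c))"


section \<open>Riemannian metrics\<close>

text \<open>
  A metric is given by its component matrices: \<open>g c x $ i $ j\<close> is \<open>g(\<partial>\<^sub>i, \<partial>\<^sub>j)\<close> in the chart \<open>c\<close>, at the
  point with coordinates \<open>x \<in> chart_img c\<close>. The last condition is the transformation law of a
  covariant 2-tensor.
\<close>

type_synonym ('a, 'n) metric_field = "('a, 'n) chart \<Rightarrow> real^'n \<Rightarrow> real^'n^'n"

definition riemannian_metric :: "('a, 'n::finite) chart set \<Rightarrow> ('a, 'n) metric_field \<Rightarrow> bool" where
  "riemannian_metric A g \<longleftrightarrow>
     (\<forall>c\<in>A. smooth_on (chart_img c) (g c) \<and>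
        (\<forall>x\<in>chart_img c. transpose (g c x) = g c x \<and> (\<forall>v. v \<noteq> 0 \<longrightarrow> v \<bullet> (g c x *v v) > 0))) \<and>
     (\<forall>c\<in>A. \<forall>d\<in>A. \<forall>x\<in>chart_map c ` (chart_dom c \<inter> chart_dom d).
        g c x = transpose (jacobian (transition c d) (at x)) ** g d (transition c d x)
                  ** jacobian (transition c d) (at x))"

definition closed_riemannian_manifold ::
  "'a::topological_space set \<Rightarrow> ('a, 'n::finite) chart set \<Rightarrow> ('a, 'n) metric_field \<Rightarrow> bool" where
  "closed_riemannian_manifold M A g \<longleftrightarrow> smooth_manifold M A \<and> compact M \<and> riemannian_metric A g"

text \<open>
  Chart-independent quantities at a point \<open>p\<close> are computed in some chart around \<open>p\<close>.
\<close>

definition chart_at :: "('a, 'n::finite) chart set \<Rightarrow> 'a \<Rightarrow> ('a, 'n) chart" where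
  "chart_at A p = (SOME c. c \<in> A \<and> p \<in> chart_dom c)"


subsection \<open>Scalar curvature\<close>

text \<open>In the next definitions \<open>G\<close> is the component matrix of a metric in a fixed chart.\<close>

definition christoffel :: "(real^'n \<Rightarrow> real^'n^'n) \<Rightarrow> 'n::finite \<Rightarrow> 'n \<Rightarrow> 'n \<Rightarrow> real^'n \<Rightarrow> real" where
  "christoffel G k i j x =
     (1/2) * (\<Sum>l\<in>UNIV. matrix_inv (G x) $ k $ l *
        (pderiv_at i (\<lambda>y. G y $ j $ l) x + pderiv_at j (\<lambda>y. G y $ i $ l) x
          - pderiv_at l (\<lambda>y. G y $ i $ j) x))"

text \<open>\<open>riemann_tensor G l k i j\<close> is the \<open>\<partial>\<^sub>l\<close>-component of
  \<open>R(\<partial>\<^sub>i, \<partial>\<^sub>j) \<partial>\<^sub>k = \<nabla>\<^sub>i \<nabla>\<^sub>j \<partial>\<^sub>k - \<nabla>\<^sub>j \<nabla>\<^sub>i \<partial>\<^sub>k\<close>; with the trace below, round spheres have positive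
  curvature.\<close>

definition riemann_tensor ::
  "(real^'n \<Rightarrow> real^'n^'n) \<Rightarrow> 'n::finite \<Rightarrow> 'n \<Rightarrow> 'n \<Rightarrow> 'n \<Rightarrow> real^'n \<Rightarrow> real" where
  "riemann_tensor G l k i j x =
     pderiv_at i (christoffel G l j k) x - pderiv_at j (christoffel G l i k) x
     + (\<Sum>p\<in>UNIV. christoffel G l i p x * christoffel G p j k x
               - christoffel G l j p x * christoffel G p i k x)"

definition ricci_tensor :: "(real^'n \<Rightarrow> real^'n^'n) \<Rightarrow> 'n::finite \<Rightarrow> 'n \<Rightarrow> real^'n \<Rightarrow> real" where
  "ricci_tensor G j k x = (\<Sum>i\<in>UNIV. riemann_tensor G i k i j x)"

definition scalar_curvature ::
  "('a, 'n::finite) chart set \<Rightarrow> ('a, 'n) metric_field \<Rightarrow> 'a \<Rightarrow> real" where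
  "scalar_curvature A g p =
     (let c = chart_at A p; x = chart_map c p in
        \<Sum>j\<in>UNIV. \<Sum>k\<in>UNIV. matrix_inv (g c x) $ j $ k * ricci_tensor (g c) j k x)"


subsection \<open>Gradient\<close>

definition grad_norm_sq ::
  "('a, 'n::finite) chart set \<Rightarrow> ('a, 'n) metric_field \<Rightarrow> ('a \<Rightarrow> real) \<Rightarrow> 'a \<Rightarrow> real" where
  "grad_norm_sq A g \<phi> p =
     (let c = chart_at A p; x = chart_map c p;
          grad = matrix_inv (g c x) *v (\<chi> i. pderiv_at i (\<phi> \<circ> chart_inv c) x)
      in grad \<bullet> (g c x *v grad))"


subsection \<open>Riemannian volume\<close>

text \<open>
  The Riemannian volume is the unique Borel measure on \<open>M\<close> that is \<open>sqrt (det g\<^sub>i\<^sub>j) dx\<close> in each chart.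
\<close>

definition is_riemannian_volume ::
  "'a::topological_space set \<Rightarrow> ('a, 'n::finite) chart set \<Rightarrow> ('a, 'n) metric_field
     \<Rightarrow> 'a measure \<Rightarrow> bool" where
  "is_riemannian_volume M A g \<mu> \<longleftrightarrow>
     sets \<mu> = sets (restrict_space borel M) \<and>
     (\<forall>c\<in>A. \<forall>B\<in>sets \<mu>. B \<subseteq> chart_dom c \<longrightarrow>
        emeasure \<mu> B = (\<integral>\<^sup>+x\<in>chart_map c ` B. ennreal (sqrt (det (g c x))) \<partial>lborel))"

definition riemannian_volume ::
  "'a::topological_space set \<Rightarrow> ('a, 'n::finite) chart set \<Rightarrow> ('a, 'n) metric_field
     \<Rightarrow> 'a measure" where
  "riemannian_volume M A g = (THE \<mu>. is_riemannian_volume M A g \<mu>)"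


subsection \<open>Geodesic distance and diameter\<close>

definition C1_curve_on :: "('a, 'n::finite) chart set \<Rightarrow> (real \<Rightarrow> 'a) \<Rightarrow> real set \<Rightarrow> bool" where
  "C1_curve_on A \<gamma> I \<longleftrightarrow>
     (\<forall>c\<in>A. \<exists>D. continuous_on {t\<in>I. \<gamma> t \<in> chart_dom c} D \<and>
        (\<forall>t\<in>I. \<gamma> t \<in> chart_dom c \<longrightarrow>
           ((chart_map c \<circ> \<gamma>) has_vector_derivative D t) (at t within I)))"

text \<open>\<open>T\<close> is the set of subdivision points; consecutive ones bound a piece on which the curve is
  \<open>C\<^sup>1\<close> up to the end points.\<close>

definition piecewise_C1_curve ::
  "'a::topological_space set \<Rightarrow> ('a, 'n::finite) chart set \<Rightarrow> (real \<Rightarrow> 'a) \<Rightarrow> bool" where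
  "piecewise_C1_curve M A \<gamma> \<longleftrightarrow>
     path \<gamma> \<and> path_image \<gamma> \<subseteq> M \<and>
     (\<exists>T. finite T \<and> {0, 1} \<subseteq> T \<and> T \<subseteq> {0..1} \<and>
        (\<forall>a\<in>T. \<forall>b\<in>T. a < b \<and> T \<inter> {a<..<b} = {} \<longrightarrow> C1_curve_on A \<gamma> {a..b}))"

definition curve_speed ::
  "('a, 'n::finite) chart set \<Rightarrow> ('a, 'n) metric_field \<Rightarrow> (real \<Rightarrow> 'a) \<Rightarrow> real \<Rightarrow> real" where
  "curve_speed A g \<gamma> t =
     (let c = chart_at A (\<gamma> t); v = vector_derivative (chart_map c \<circ> \<gamma>) (at t within {0..1})
      in sqrt (v \<bullet> (g c (chart_map c (\<gamma> t)) *v v)))"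

definition curve_length ::
  "('a, 'n::finite) chart set \<Rightarrow> ('a, 'n) metric_field \<Rightarrow> (real \<Rightarrow> 'a) \<Rightarrow> real" where
  "curve_length A g \<gamma> = integral {0..1} (curve_speed A g \<gamma>)"

definition geodesic_dist ::
  "'a::topological_space set \<Rightarrow> ('a, 'n::finite) chart set \<Rightarrow> ('a, 'n) metric_field
     \<Rightarrow> 'a \<Rightarrow> 'a \<Rightarrow> real" where
  "geodesic_dist M A g x y =
     Inf {curve_length A g \<gamma> | \<gamma>. piecewise_C1_curve M A \<gamma> \<and> pathstart \<gamma> = x \<and> pathfinish \<gamma> = y}"

text \<open>On a compact connected manifold the supremum is attained.\<close>

definition riemannian_diameter ::
  "'a::topological_space set \<Rightarrow> ('a, 'n::finite) chart set \<Rightarrow> ('a, 'n) metric_field \<Rightarrow> real" where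
  "riemannian_diameter M A g = Sup {geodesic_dist M A g x y | x y. x \<in> M \<and> y \<in> M}"


section \<open>The Yamabe constant\<close>

definition yamabe_quotient ::
  "'a::topological_space set \<Rightarrow> ('a, 'n::finite) chart set \<Rightarrow> ('a, 'n) metric_field
     \<Rightarrow> ('a \<Rightarrow> real) \<Rightarrow> real" where
  "yamabe_quotient M A g \<phi> =
     (let n = real CARD('n); dv = riemannian_volume M A g in
        (4 * (n - 1) / (n - 2) * (\<integral>p. grad_norm_sq A g \<phi> p \<partial>dv)
           + (\<integral>p. scalar_curvature A g p * (\<phi> p)\<^sup>2 \<partial>dv))
        / (\<integral>p. \<phi> p powr (2 * n / (n - 2)) \<partial>dv) powr ((n - 2) / n))"

definition yamabe_constant ::
  "'a::topological_space set \<Rightarrow> ('a, 'n::finite) chart set \<Rightarrow> ('a, 'n) metric_field \<Rightarrow> real" where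
  "yamabe_constant M A g =
     Inf {yamabe_quotient M A g \<phi> | \<phi>. smooth_function A \<phi> \<and> (\<forall>p\<in>M. 0 < \<phi> p)}"


section \<open>The volume of the unit sphere\<close>

text \<open>
  Standard smooth structure and metric of an embedded submanifold \<open>S\<close> of a Euclidean space:
  the charts are the inverses of smooth immersive parametrizations, and the metric is the
  restriction of the inner product, \<open>g\<^sub>i\<^sub>j = \<partial>\<^sub>i \<psi> \<bullet> \<partial>\<^sub>j \<psi>\<close> for a parametrization \<open>\<psi>\<close>.
\<close>

definition submanifold_atlas :: "'e::euclidean_space set \<Rightarrow> ('e, 'n::finite) chart set" where
  "submanifold_atlas S =
     {c. is_chart S c \<and> smooth_on (chart_img c) (chart_inv c) \<and>
         (\<forall>x\<in>chart_img c. inj (frechet_derivative (chart_inv c) (at x)))}"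

definition induced_metric :: "('e::euclidean_space, 'n::finite) metric_field" where
  "induced_metric c x = (\<chi> i j. pderiv_at i (chart_inv c) x \<bullet> pderiv_at j (chart_inv c) x)"

text \<open>The ambient space of the \<open>CARD('n)\<close>-dimensional unit sphere is \<open>real^'n \<times> real\<close>,
  whose inner product is the Euclidean one.\<close>

definition unit_sphere_volume :: "'n::finite itself \<Rightarrow> real" where
  "unit_sphere_volume _ =
     (let S = sphere (0 :: (real^'n) \<times> real) 1 in
        measure (riemannian_volume S (submanifold_atlas S :: ((real^'n) \<times> real, 'n) chart set)
          induced_metric) S)"

end

theory Submission
  imports Defs
begin

text \<open>
  Mollifying the distance in charts gives a smooth \<open>f\<close> with \<open>\<bar>\<nabla>f\<bar> \<le> 1\<close> whose oscillation almost realizes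
  the diameter. Let \<open>V(s)\<close> be the volume of the slab \<open>{\<bar>f - t\<bar> < s}\<close>. Cutoff functions of \<open>f\<close>, made
  positive by adding \<open>\<epsilon>\<close>, are admissible in the Yamabe quotient and bound \<open>Y V(s/2)\<^bsup>(n-2)/n\<^esup>\<close> by
  \<open>Q s\<^bsup>-2\<^esup> V(s)\<close> plus the integral of \<open>R\<close> over the slab. If that integral were negligible at all scales,
  iterating \<open>s \<mapsto> s/2\<close> would contradict \<open>V(s) \<ge> c s\<^sup>n\<close> for small \<open>s\<close>. So every \<open>t\<close> in the range of \<open>f\<close> has a
  scale \<open>s\<close> for which the integral of \<open>R\<^bsup>(n-1)/2\<^esup>\<close> over the slab is at least \<open>\<delta> s\<close>, and a Vitali covering of
  the range of \<open>f\<close> by such intervals bounds its oscillation. The resulting constant is far below the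
  second term of the maximum in the theorem, so \<open>w\<^sub>n\<close> plays no role. That \<open>Y > 0\<close> follows from the
  Euclidean Sobolev inequality in finitely many charts.
\<close>

section \<open>Smooth functions on Euclidean spaces\<close>

text \<open>Scalar curvature, gradient and curve speed are each evaluated in an unspecified chart
  \<open>chart_at A p\<close>, and the volume is a definite description. Continuity and
  integrability therefore have to wait for chart independence, which is why the transformation laws,
  change of variables, and existence and uniqueness of the volume take up so much of the proof. The
  threshold \<delta> = (Y / (2^n Q))^(n/2) is the positive solution of Q \<delta> = 2^(-n) Y
  \<delta>^((n-2)/n): below it, if curvature is negligible, halving the scale at least halves the
  density V(s) / s^n. The exponent (n-1)/2 is the one for which the integral of the power of R has
  the dimension of a length, so that intervals of length comparable to s can pay for it. Young's
  inequality, with powers of s as weights, passes from R to this power. The constant obtained is 80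
  / \<delta>: 10 comes from the covering argument, 8 from replacing the distance by a smooth
  function. Q stays below 2^22 because every cutoff of f is made from one step function with
  derivative at most 200.\<close>

lemma frechet_derivative_cong_open:
  assumes "open S" "x \<in> S" "\<And>y. y \<in> S \<Longrightarrow> f y = g y"
  shows "frechet_derivative f (at x) = frechet_derivative g (at x)"
proof -
  have "(f has_derivative D) (at x) \<longleftrightarrow> (g has_derivative D) (at x)" for D
    using has_derivative_transform_within_open[of f D x UNIV S g]
      has_derivative_transform_within_open[of g D x UNIV S f] assms by auto
  then show ?thesis by (simp add: frechet_derivative_def)
qed

lemma differentiable_cong_open:
  assumes "open S" "x \<in> S" "\<And>y. y \<in> S \<Longrightarrow> f y = g y" "f differentiable (at x)"
  shows "g differentiable (at x)"
  using assms has_derivative_transform_within_open[of f _ x UNIV S g]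
  unfolding differentiable_def by blast

lemma frechet_derivative_eq:
  "(f has_derivative D) (at x) \<Longrightarrow> frechet_derivative f (at x) = D"
  using frechet_derivative_at by metis

lemma has_frechet_derivative:
  "f differentiable (at x) \<Longrightarrow> (f has_derivative frechet_derivative f (at x)) (at x)"
  by (simp add: frechet_derivative_works)

lemma frechet_derivative_bounded_linear:
  "f differentiable (at x) \<Longrightarrow> bounded_linear (frechet_derivative f (at x))"
  using has_frechet_derivative has_derivative_bounded_linear by blast

lemma frechet_derivative_basis_expand:
  fixes f :: "'e::euclidean_space \<Rightarrow> 'f::real_normed_vector"
  assumes "f differentiable (at x)"
  shows "frechet_derivative f (at x) w = (\<Sum>b\<in>Basis. (w \<bullet> b) *\<^sub>R frechet_derivative f (at x) b)"
proof -
  have l: "linear (frechet_derivative f (at x))"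
    using assms by (simp add: linear_frechet_derivative)
  have "frechet_derivative f (at x) w = frechet_derivative f (at x) (\<Sum>b\<in>Basis. (w \<bullet> b) *\<^sub>R b)"
    by (simp add: euclidean_representation)
  also have "\<dots> = (\<Sum>b\<in>Basis. (w \<bullet> b) *\<^sub>R frechet_derivative f (at x) b)"
    by (simp add: linear_sum[OF l] linear_scale[OF l])
  finally show ?thesis .
qed

section \<open>Closure properties of C^k functions on open sets\<close>

lemma Ck_on_cong:
  assumes "open S"
  shows "Ck_on k S f \<Longrightarrow> (\<And>y. y \<in> S \<Longrightarrow> f y = g y) \<Longrightarrow> Ck_on k S g"
proof (induction k arbitrary: f g)
  case 0
  then show ?case using continuous_on_cong by (metis Ck_on.simps(1))
next
  case (Suc k)
  have d: "f differentiable (at x)" if "x \<in> S" for x using Suc.prems that by simp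
  have "g differentiable (at x)" if "x \<in> S" for x
    using differentiable_cong_open[OF assms that _ d[OF that]] Suc.prems by blast
  moreover have "Ck_on k S (\<lambda>x. frechet_derivative g (at x) v)" for v
  proof (rule Suc.IH)
    show "Ck_on k S (\<lambda>x. frechet_derivative f (at x) v)" using Suc.prems by simp
    show "frechet_derivative f (at y) v = frechet_derivative g (at y) v" if "y \<in> S" for y
      using frechet_derivative_cong_open[OF assms that] Suc.prems by metis
  qed
  ultimately show ?case by simp
qed

lemma Ck_on_subset: "Ck_on k S f \<Longrightarrow> T \<subseteq> S \<Longrightarrow> Ck_on k T f"
  by (induction k arbitrary: f) (auto intro: continuous_on_subset)

lemma Ck_on_local:
  assumes "\<And>x. x \<in> S \<Longrightarrow> \<exists>T. open T \<and> x \<in> T \<and> Ck_on k T f"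
  shows "Ck_on k S f"
  using assms
proof (induction k arbitrary: f)
  case 0
  have "continuous (at x within S) f" if x: "x \<in> S" for x
  proof -
    obtain T where "open T" "x \<in> T" "continuous_on T f" using 0[OF x] by auto
    then have "isCont f x" by (simp add: continuous_on_eq_continuous_at)
    then show ?thesis using continuous_at_imp_continuous_at_within by blast
  qed
  then show ?case by (simp add: continuous_on_eq_continuous_within)
next
  case (Suc k)
  have "f differentiable (at x)" if "x \<in> S" for x
    using Suc.prems[OF that] by auto
  moreover have "Ck_on k S (\<lambda>x. frechet_derivative f (at x) v)" for v
    by (rule Suc.IH) (metis Suc.prems Ck_on.simps(2))
  ultimately show ?case by simp
qed

lemma Ck_on_continuous: "Ck_on k S f \<Longrightarrow> continuous_on S f"
  by (cases k) (auto intro!: continuous_at_imp_continuous_on differentiable_imp_continuous_within)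

lemma Ck_on_SucD: "Ck_on (Suc k) S f \<Longrightarrow> Ck_on k S f"
proof (induction k arbitrary: f)
  case 0
  then show ?case using Ck_on_continuous by (metis Ck_on.simps(1))
next
  case (Suc k)
  then show ?case by (metis Ck_on.simps(2))
qed

lemma Ck_on_const [simp]: "Ck_on k S (\<lambda>x. c)"
  by (induction k arbitrary: c) (auto simp: frechet_derivative_const)

text \<open>Any explicit formula D for the derivative on the open set will do, since
  \<open>frechet_derivative\<close> agrees with it there by uniqueness. The product, chain and
  convolution inductions below go through this rule.\<close>

lemma Ck_on_SucI:
  assumes "open S" "\<And>x. x \<in> S \<Longrightarrow> (f has_derivative D x) (at x)" "\<And>v. Ck_on k S (\<lambda>x. D x v)"
  shows "Ck_on (Suc k) S f"
proof -
  have "f differentiable (at x)" if "x \<in> S" for x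
    using assms(2)[OF that] by (auto simp: differentiable_def)
  moreover have "Ck_on k S (\<lambda>x. frechet_derivative f (at x) v)" for v
    by (rule Ck_on_cong[OF assms(1) assms(3)]) (use frechet_derivative_eq[OF assms(2)] in auto)
  ultimately show ?thesis by simp
qed

lemma Ck_on_SucE:
  assumes "Ck_on (Suc k) S f" "x \<in> S"
  shows "(f has_derivative frechet_derivative f (at x)) (at x)"
  using assms by (auto intro: has_frechet_derivative)

lemma Ck_on_bounded_linear:
  assumes "bounded_linear L" "open S" "Ck_on k S f"
  shows "Ck_on k S (\<lambda>x. L (f x))"
  using assms(3)
proof (induction k arbitrary: f)
  case 0
  then show ?case using bounded_linear.continuous_on[OF assms(1)] by auto
next
  case (Suc k)
  show ?case
  proof (rule Ck_on_SucI[OF assms(2)])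
    show "((\<lambda>x. L (f x)) has_derivative (\<lambda>v. L (frechet_derivative f (at x) v))) (at x)"
      if "x \<in> S" for x
      by (rule bounded_linear.has_derivative[OF assms(1)]) (use Ck_on_SucE[OF Suc.prems that] in simp)
    show "Ck_on k S (\<lambda>x. L (frechet_derivative f (at x) v))" for v
      using Suc by simp
  qed
qed

lemma Ck_on_id: "Ck_on k S (\<lambda>x. x)"
proof (cases k)
  case (Suc m)
  have "frechet_derivative (\<lambda>x::'a. x) (at x) v = v" for x v
    using frechet_derivative_eq[OF has_derivative_ident] by metis
  then show ?thesis by (simp add: Suc)
qed (simp add: continuous_on_id)

lemma Ck_on_add:
  assumes "open S" "Ck_on k S f" "Ck_on k S g"
  shows "Ck_on k S (\<lambda>x. f x + g x)"
  using assms(2,3)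
proof (induction k arbitrary: f g)
  case 0
  then show ?case by (auto intro: continuous_intros)
next
  case (Suc k)
  show ?case
  proof (rule Ck_on_SucI[OF assms(1)])
    show "((\<lambda>x. f x + g x) has_derivative
        (\<lambda>v. frechet_derivative f (at x) v + frechet_derivative g (at x) v)) (at x)" if "x \<in> S" for x
      by (intro has_derivative_add Ck_on_SucE[OF Suc.prems(1) that] Ck_on_SucE[OF Suc.prems(2) that])
    show "Ck_on k S (\<lambda>x. frechet_derivative f (at x) v + frechet_derivative g (at x) v)" for v
      by (rule Suc.IH) (use Suc.prems in simp_all)
  qed
qed

lemma Ck_on_bilinear:
  assumes "bounded_bilinear prd" "open S" "Ck_on k S f" "Ck_on k S g"
  shows "Ck_on k S (\<lambda>x. prd (f x) (g x))"
  using assms(3,4)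
proof (induction k arbitrary: f g)
  case 0
  then show ?case using bounded_bilinear.continuous_on[OF assms(1)] by auto
next
  case (Suc k)
  note k = Ck_on_SucD[OF Suc.prems(1)] Ck_on_SucD[OF Suc.prems(2)]
  show ?case
  proof (rule Ck_on_SucI[OF assms(2)])
    show "((\<lambda>x. prd (f x) (g x)) has_derivative
        (\<lambda>v. prd (f x) (frechet_derivative g (at x) v) + prd (frechet_derivative f (at x) v) (g x))) (at x)"
      if "x \<in> S" for x
      by (intro bounded_bilinear.FDERIV[OF assms(1)]
          Ck_on_SucE[OF Suc.prems(1) that] Ck_on_SucE[OF Suc.prems(2) that])
    show "Ck_on k S (\<lambda>x. prd (f x) (frechet_derivative g (at x) v) + prd (frechet_derivative f (at x) v) (g x))" for v
      by (intro Ck_on_add[OF assms(2)] Suc.IH k) (use Suc.prems in simp_all)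
  qed
qed

lemma Ck_on_sum:
  assumes "open S" "\<And>i. i \<in> I \<Longrightarrow> Ck_on k S (f i)"
  shows "Ck_on k S (\<lambda>x. \<Sum>i\<in>I. f i x)"
  using assms(2)
  by (induction I rule: infinite_finite_induct) (auto intro!: Ck_on_add[OF assms(1)])

text \<open>\<open>Ck_on\<close> speaks of derivatives in a fixed direction, whereas the chain rule
  differentiates h in a direction that moves with x. Expanding that direction in a basis gives a
  finite sum of fixed directional derivatives with C^k coefficients, to which the induction
  hypothesis and the product rule apply; hence the Euclidean middle space.\<close>

lemma Ck_on_compose:
  fixes f :: "'e::real_normed_vector \<Rightarrow> 'm::euclidean_space"
  assumes "open S" "open T" "f ` S \<subseteq> T" "Ck_on k S f" "Ck_on k T h"
  shows "Ck_on k S (\<lambda>x. h (f x))"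
  using assms(4,5)
proof (induction k arbitrary: h)
  case 0
  then show ?case using assms(3) continuous_on_compose2 by auto
next
  case (Suc k)
  show ?case
  proof (rule Ck_on_SucI[OF assms(1)])
    fix x assume x: "x \<in> S"
    then have fx: "f x \<in> T" using assms(3) by auto
    have "((\<lambda>x. h (f x)) has_derivative
        (\<lambda>v. frechet_derivative h (at (f x)) (frechet_derivative f (at x) v))) (at x)"
      using diff_chain_at[OF Ck_on_SucE[OF Suc.prems(1) x] Ck_on_SucE[OF Suc.prems(2) fx]]
      by (simp add: o_def)
    moreover have "(\<lambda>v. frechet_derivative h (at (f x)) (frechet_derivative f (at x) v)) =
       (\<lambda>v. \<Sum>b\<in>Basis. (frechet_derivative f (at x) v \<bullet> b) *\<^sub>R frechet_derivative h (at (f x)) b)"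
      by (rule ext, rule frechet_derivative_basis_expand) (use Suc.prems(2) fx in simp)
    ultimately show "((\<lambda>x. h (f x)) has_derivative
      (\<lambda>v. \<Sum>b\<in>Basis. (frechet_derivative f (at x) v \<bullet> b) *\<^sub>R frechet_derivative h (at (f x)) b)) (at x)"
      by (rule has_derivative_eq_rhs)
  next
    fix v
    have "Ck_on k S (\<lambda>x. frechet_derivative f (at x) v \<bullet> b)" for b
      by (rule Ck_on_bounded_linear[OF bounded_linear_inner_left assms(1)]) (use Suc.prems in simp)
    moreover have "Ck_on k S (\<lambda>x. frechet_derivative h (at (f x)) b)" for b
      by (rule Suc.IH) (use Suc.prems Ck_on_SucD in auto)
    ultimately show "Ck_on k S (\<lambda>x. \<Sum>b\<in>Basis. (frechet_derivative f (at x) v \<bullet> b) *\<^sub>R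
        frechet_derivative h (at (f x)) b)"
      by (intro Ck_on_sum[OF assms(1)] Ck_on_bilinear[OF bounded_bilinear_scaleR assms(1)])
  qed
qed

text \<open>The derivative is again a product of two inverses, so the bilinear rule closes the
  induction on k.\<close>

lemma Ck_on_inverse_real: "Ck_on k (- {0}) (inverse :: real \<Rightarrow> real)"
proof (induction k)
  case 0
  then show ?case by (auto intro!: continuous_on_inverse continuous_on_id)
next
  case (Suc k)
  have o: "open (- {0::real})" by auto
  show ?case
  proof (rule Ck_on_SucI[OF o])
    show "(inverse has_derivative (\<lambda>v. - (inverse x * inverse x) * v)) (at x)"
      if "x \<in> - {0::real}" for x
      using has_derivative_inverse'[of x UNIV] that
      by (auto elim!: has_derivative_eq_rhs simp: algebra_simps)
    show "Ck_on k (- {0}) (\<lambda>x::real. - (inverse x * inverse x) * v)" for v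
      using Ck_on_bounded_linear[OF bounded_linear_mult_left[of "- v"] o
          Ck_on_bilinear[OF bounded_bilinear_mult o Suc Suc]]
      by (simp add: algebra_simps)
  qed
qed

lemma smooth_on_cong:
  "open S \<Longrightarrow> smooth_on S f \<Longrightarrow> (\<And>y. y \<in> S \<Longrightarrow> f y = g y) \<Longrightarrow> smooth_on S g"
  unfolding smooth_on_def using Ck_on_cong by metis

lemma smooth_on_subset: "smooth_on S f \<Longrightarrow> T \<subseteq> S \<Longrightarrow> smooth_on T f"
  unfolding smooth_on_def using Ck_on_subset by metis

lemma smooth_on_local:
  "(\<And>x. x \<in> S \<Longrightarrow> \<exists>T. open T \<and> x \<in> T \<and> smooth_on T f) \<Longrightarrow> smooth_on S f"
  unfolding smooth_on_def by (meson Ck_on_local)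

lemma smooth_on_continuous: "smooth_on S f \<Longrightarrow> continuous_on S f"
  unfolding smooth_on_def using Ck_on_continuous by metis

lemma smooth_on_const [simp]: "smooth_on S (\<lambda>x. c)"
  by (simp add: smooth_on_def)

lemma smooth_on_id [simp]: "smooth_on S (\<lambda>x. x)"
  by (simp add: smooth_on_def Ck_on_id)

lemma smooth_on_bounded_linear:
  "bounded_linear L \<Longrightarrow> open S \<Longrightarrow> smooth_on S f \<Longrightarrow> smooth_on S (\<lambda>x. L (f x))"
  by (simp add: smooth_on_def Ck_on_bounded_linear)

lemma smooth_on_add:
  "open S \<Longrightarrow> smooth_on S f \<Longrightarrow> smooth_on S g \<Longrightarrow> smooth_on S (\<lambda>x. f x + g x)"
  by (simp add: smooth_on_def Ck_on_add)

lemma smooth_on_bilinear: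
  "bounded_bilinear prd \<Longrightarrow> open S \<Longrightarrow> smooth_on S f \<Longrightarrow> smooth_on S g \<Longrightarrow>
    smooth_on S (\<lambda>x. prd (f x) (g x))"
  by (simp add: smooth_on_def Ck_on_bilinear)

lemmas smooth_on_mult = smooth_on_bilinear[OF bounded_bilinear_mult]

lemma smooth_on_minus:
  "open S \<Longrightarrow> smooth_on S f \<Longrightarrow> smooth_on S (\<lambda>x. - f x)"
  by (rule smooth_on_bounded_linear[OF bounded_linear_minus[OF bounded_linear_ident]])

lemma smooth_on_diff:
  "open S \<Longrightarrow> smooth_on S f \<Longrightarrow> smooth_on S g \<Longrightarrow> smooth_on S (\<lambda>x. f x - g x)"
  using smooth_on_add[of S f "\<lambda>x. - g x"] smooth_on_minus[of S g] by simp

lemma smooth_on_sum: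
  "open S \<Longrightarrow> (\<And>i. i \<in> I \<Longrightarrow> smooth_on S (f i)) \<Longrightarrow> smooth_on S (\<lambda>x. \<Sum>i\<in>I. f i x)"
  by (simp add: smooth_on_def Ck_on_sum)

lemma smooth_on_prod:
  fixes f :: "'i \<Rightarrow> 'e::real_normed_vector \<Rightarrow> real"
  assumes "open S" "\<And>i. i \<in> I \<Longrightarrow> smooth_on S (f i)"
  shows "smooth_on S (\<lambda>x. \<Prod>i\<in>I. f i x)"
  using assms(2)
  by (induction I rule: infinite_finite_induct) (auto intro!: smooth_on_mult[OF assms(1)])

lemma smooth_on_compose:
  fixes f :: "'e::real_normed_vector \<Rightarrow> 'm::euclidean_space"
  shows "open S \<Longrightarrow> open T \<Longrightarrow> f ` S \<subseteq> T \<Longrightarrow> smooth_on S f \<Longrightarrow> smooth_on T h \<Longrightarrow>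
    smooth_on S (\<lambda>x. h (f x))"
  unfolding smooth_on_def using Ck_on_compose by metis

lemma smooth_on_inverse:
  fixes f :: "'e::real_normed_vector \<Rightarrow> real"
  assumes "open S" "smooth_on S f" "\<And>x. x \<in> S \<Longrightarrow> f x \<noteq> 0"
  shows "smooth_on S (\<lambda>x. inverse (f x))"
  by (rule smooth_on_compose[of S "- {0}" f inverse])
     (use assms in \<open>auto simp: smooth_on_def Ck_on_inverse_real\<close>)

lemma smooth_on_divide:
  fixes f g :: "'e::real_normed_vector \<Rightarrow> real"
  assumes "open S" "smooth_on S f" "smooth_on S g" "\<And>x. x \<in> S \<Longrightarrow> g x \<noteq> 0"
  shows "smooth_on S (\<lambda>x. f x / g x)"
  unfolding divide_inverse
  by (intro smooth_on_mult smooth_on_inverse assms)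

lemma smooth_on_differentiable: "smooth_on S f \<Longrightarrow> x \<in> S \<Longrightarrow> f differentiable (at x)"
  unfolding smooth_on_def by (metis Ck_on.simps(2))

lemma smooth_on_frechet_derivative:
  "smooth_on S f \<Longrightarrow> smooth_on S (\<lambda>x. frechet_derivative f (at x) v)"
  unfolding smooth_on_def by (metis Ck_on.simps(2))

lemma smooth_on_has_derivative:
  "smooth_on S f \<Longrightarrow> x \<in> S \<Longrightarrow> (f has_derivative frechet_derivative f (at x)) (at x)"
  using smooth_on_differentiable has_frechet_derivative by blast

lemma smooth_on_vec_nth:
  "open S \<Longrightarrow> smooth_on S f \<Longrightarrow> smooth_on S (\<lambda>x. f x $ i)"
  by (rule smooth_on_bounded_linear[OF bounded_linear_vec_nth])

lemma bounded_linear_axis: "bounded_linear (\<lambda>a::'a::real_normed_vector. axis i a :: 'a^'n::finite)"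
proof (rule bounded_linear_intro[where K=1])
  show "norm (axis i x :: 'a^'n) \<le> norm x * 1" for x :: 'a
  proof -
    have "norm (axis i x :: 'a^'n) = norm x"
      by (simp add: norm_vec_def axis_def L2_set_def if_distrib[of norm] power2_eq_square
          sum.delta if_distribR if_distrib cong: if_cong)
    then show ?thesis by simp
  qed
qed (auto simp: vec_eq_iff axis_def)

lemma smooth_on_vec_lambda:
  fixes f :: "'n::finite \<Rightarrow> 'e::real_normed_vector \<Rightarrow> 'f::real_normed_vector"
  assumes "open S" "\<And>i. smooth_on S (f i)"
  shows "smooth_on S (\<lambda>x. \<chi> i. f i x)"
proof -
  have "(\<chi> i. f i x) = (\<Sum>i\<in>UNIV. axis i (f i x))" for x
    by (simp add: vec_eq_iff axis_def sum.delta if_distrib cong: if_cong)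
  moreover have "smooth_on S (\<lambda>x. \<Sum>i\<in>UNIV. axis i (f i x) :: 'f^'n)"
    by (intro smooth_on_sum smooth_on_bounded_linear[OF bounded_linear_axis] assms)
  ultimately show ?thesis by simp
qed

lemma smooth_on_det:
  fixes A :: "'e::real_normed_vector \<Rightarrow> real^'n^'n"
  assumes "open S" "smooth_on S A"
  shows "smooth_on S (\<lambda>x. det (A x))"
  unfolding det_def
  by (intro smooth_on_sum smooth_on_mult smooth_on_prod smooth_on_const smooth_on_vec_nth assms)

section \<open>Symmetry of second derivatives\<close>

lemma second_difference_mvt:
  fixes f :: "'e::real_normed_vector \<Rightarrow> real"
  assumes f: "Ck_on 2 S f" and h: "h > 0"
    and S: "\<And>s t. s \<in> {0..h} \<Longrightarrow> t \<in> {0..h} \<Longrightarrow> x + s *\<^sub>R u + t *\<^sub>R v \<in> S"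
  obtains s t where "s \<in> {0..h}" "t \<in> {0..h}"
    "f (x + h *\<^sub>R u + h *\<^sub>R v) - f (x + h *\<^sub>R u) - f (x + h *\<^sub>R v) + f x =
      h\<^sup>2 * frechet_derivative (\<lambda>y. frechet_derivative f (at y) u) (at (x + s *\<^sub>R u + t *\<^sub>R v)) v"
proof -
  have f2: "Ck_on (Suc (Suc 0)) S f" using f by (simp add: numeral_2_eq_2)
  define Du where "Du = (\<lambda>y. frechet_derivative f (at y) u)"
  have Du: "Ck_on (Suc 0) S Du" using f2 unfolding Du_def by simp
  have fd: "((\<lambda>s. f (x + s *\<^sub>R u + t *\<^sub>R v)) has_real_derivative Du (x + s *\<^sub>R u + t *\<^sub>R v)) (at s)"
    if "s \<in> {0..h}" "t \<in> {0..h}" for s t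
  proof -
    have 1: "((\<lambda>s. x + s *\<^sub>R u + t *\<^sub>R v) has_derivative (\<lambda>r. r *\<^sub>R u)) (at s)"
      by (auto intro!: derivative_eq_intros)
    have D: "(f has_derivative frechet_derivative f (at (x + s *\<^sub>R u + t *\<^sub>R v))) (at (x + s *\<^sub>R u + t *\<^sub>R v))"
      by (rule Ck_on_SucE[OF f2 S[OF that]])
    from diff_chain_at[OF 1 D] show ?thesis
      unfolding has_field_derivative_def Du_def o_def
      by (rule has_derivative_eq_rhs)
        (simp add: linear_cmul[OF has_derivative_linear[OF D]] fun_eq_iff)
  qed
  \<comment> \<open>First mean value theorem, in the direction u, for the difference of f along two
    opposite sides of the parallelogram. The second one, in the direction v, then acts on the
    derivative \<open>Du\<close>.\<close>
  have "\<exists>s. s > 0 \<and> s < h \<and>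
      (f (x + h *\<^sub>R u + h *\<^sub>R v) - f (x + h *\<^sub>R u + 0 *\<^sub>R v)) - (f (x + 0 *\<^sub>R u + h *\<^sub>R v) - f (x + 0 *\<^sub>R u + 0 *\<^sub>R v))
      = (h - 0) * (Du (x + s *\<^sub>R u + h *\<^sub>R v) - Du (x + s *\<^sub>R u + 0 *\<^sub>R v))"
    by (rule MVT2[OF h, of "\<lambda>s. f (x + s *\<^sub>R u + h *\<^sub>R v) - f (x + s *\<^sub>R u + 0 *\<^sub>R v)"])
       (intro DERIV_diff fd; use h in auto)
  then obtain s where s0: "s > 0" "s < h"
    "f (x + h *\<^sub>R u + h *\<^sub>R v) - f (x + h *\<^sub>R u) - (f (x + h *\<^sub>R v) - f x)
      = h * (Du (x + s *\<^sub>R u + h *\<^sub>R v) - Du (x + s *\<^sub>R u))" by auto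
  then have s: "s \<in> {0..h}"
    "f (x + h *\<^sub>R u + h *\<^sub>R v) - f (x + h *\<^sub>R u) - f (x + h *\<^sub>R v) + f x
      = h * (Du (x + s *\<^sub>R u + h *\<^sub>R v) - Du (x + s *\<^sub>R u))"
    by simp_all
  have gd: "((\<lambda>t. Du (x + s *\<^sub>R u + t *\<^sub>R v)) has_real_derivative
      frechet_derivative Du (at (x + s *\<^sub>R u + t *\<^sub>R v)) v) (at t)" if "t \<in> {0..h}" for t
  proof -
    have 1: "((\<lambda>t. x + s *\<^sub>R u + t *\<^sub>R v) has_derivative (\<lambda>r. r *\<^sub>R v)) (at t)"
      by (auto intro!: derivative_eq_intros)
    have D: "(Du has_derivative frechet_derivative Du (at (x + s *\<^sub>R u + t *\<^sub>R v))) (at (x + s *\<^sub>R u + t *\<^sub>R v))"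
      by (rule Ck_on_SucE[OF Du S[OF s(1) that]])
    from diff_chain_at[OF 1 D] show ?thesis
      unfolding has_field_derivative_def o_def
      by (rule has_derivative_eq_rhs)
        (simp add: linear_cmul[OF has_derivative_linear[OF D]] fun_eq_iff)
  qed
  have "\<exists>t. t > 0 \<and> t < h \<and> Du (x + s *\<^sub>R u + h *\<^sub>R v) - Du (x + s *\<^sub>R u + 0 *\<^sub>R v)
      = (h - 0) * frechet_derivative Du (at (x + s *\<^sub>R u + t *\<^sub>R v)) v"
    by (rule MVT2[OF h, of "\<lambda>t. Du (x + s *\<^sub>R u + t *\<^sub>R v)"]) (rule gd; auto)
  then obtain t where t0: "t > 0" "t < h" "Du (x + s *\<^sub>R u + h *\<^sub>R v) - Du (x + s *\<^sub>R u)
      = h * frechet_derivative Du (at (x + s *\<^sub>R u + t *\<^sub>R v)) v" by auto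
  then have t: "t \<in> {0..h}" by simp
  note t = t t0(3)
  show ?thesis
    by (rule that[OF s(1) t(1)]) (simp add: s(2) t(2) power2_eq_square flip: Du_def)
qed

text \<open>The second difference over the parallelogram spanned by h u and h v is symmetric in u
  and v. So the two mixed derivatives agree when taken at two suitable points close to x, and
  continuity at x makes them equal up to any e.\<close>

lemma symmetric_second_derivative_real:
  fixes f :: "'e::real_normed_vector \<Rightarrow> real"
  assumes f: "Ck_on 2 S f" and S: "open S" "x \<in> S"
  shows "frechet_derivative (\<lambda>y. frechet_derivative f (at y) u) (at x) v =
    frechet_derivative (\<lambda>y. frechet_derivative f (at y) v) (at x) u"
proof -
  define A where "A = (\<lambda>u v x. frechet_derivative (\<lambda>y. frechet_derivative f (at y) u) (at x) v)"
  have cont: "continuous_on S (A u v)" for u v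
    using f unfolding A_def by (simp add: numeral_2_eq_2)
  have "\<bar>A u v x - A v u x\<bar> < e" if "e > 0" for e
  proof -
    have "\<exists>d>0. \<forall>y\<in>S. dist y x < d \<longrightarrow> dist (A u v y) (A u v x) < e/2" for u v
      using cont[of u v] S(2) that unfolding continuous_on_iff
      by (metis half_gt_zero)
    then obtain d1 d2 where d: "d1 > 0" "\<And>y. y\<in>S \<Longrightarrow> dist y x < d1 \<Longrightarrow> dist (A u v y) (A u v x) < e/2"
      "d2 > 0" "\<And>y. y\<in>S \<Longrightarrow> dist y x < d2 \<Longrightarrow> dist (A v u y) (A v u x) < e/2" by metis
    obtain d3 where d3: "d3 > 0" "ball x d3 \<subseteq> S" using S open_contains_ball by blast
    define d where "d = min d1 (min d2 d3)"
    \<comment> \<open>All points x + s u + t v with s and t in [0, h] then stay within d of x; the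
      summand 1 avoids division by zero.\<close>
    define h where "h = d / (norm u + norm v + 1)"
    have h: "h > 0" unfolding h_def d_def using d d3 by (intro divide_pos_pos) (auto simp: add_nonneg_pos)
    have close: "dist (x + s *\<^sub>R a + t *\<^sub>R b) x < d" if "s \<in> {0..h}" "t \<in> {0..h}" "norm a + norm b = norm u + norm v"
      for s t a b
    proof -
      have "dist (x + s *\<^sub>R a + t *\<^sub>R b) x = norm (s *\<^sub>R a + t *\<^sub>R b)"
        by (metis add.assoc add_diff_cancel_left' dist_norm)
      also have "\<dots> \<le> s * norm a + t * norm b"
        using norm_triangle_ineq[of "s *\<^sub>R a" "t *\<^sub>R b"] that by auto
      also have "\<dots> \<le> h * norm a + h * norm b"
        using that by (intro add_mono mult_right_mono) auto
      also have "\<dots> = h * (norm u + norm v)" using that by (simp add: distrib_left[symmetric])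
      also have "\<dots> < h * (norm u + norm v + 1)" using h by simp
      also have "\<dots> = d"
      proof -
        have "norm u + norm v + 1 > 0" by (simp add: add_nonneg_pos)
        then show ?thesis by (simp add: h_def)
      qed
      finally show ?thesis .
    qed
    have inS: "x + s *\<^sub>R a + t *\<^sub>R b \<in> S" if "s \<in> {0..h}" "t \<in> {0..h}" "norm a + norm b = norm u + norm v"
      for s t a b
      using close[OF that] d3 unfolding d_def by (auto simp: dist_commute)
    obtain s t where st: "s \<in> {0..h}" "t \<in> {0..h}"
      "f (x + h *\<^sub>R u + h *\<^sub>R v) - f (x + h *\<^sub>R u) - f (x + h *\<^sub>R v) + f x = h\<^sup>2 * A u v (x + s *\<^sub>R u + t *\<^sub>R v)"
      unfolding A_def using second_difference_mvt[OF f h, of x u v] inS by metis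
    obtain s' t' where st': "s' \<in> {0..h}" "t' \<in> {0..h}"
      "f (x + h *\<^sub>R v + h *\<^sub>R u) - f (x + h *\<^sub>R v) - f (x + h *\<^sub>R u) + f x = h\<^sup>2 * A v u (x + s' *\<^sub>R v + t' *\<^sub>R u)"
      unfolding A_def using second_difference_mvt[OF f h, of x v u] inS by (metis add.commute)
    have "x + h *\<^sub>R v + h *\<^sub>R u = x + h *\<^sub>R u + h *\<^sub>R v" by (simp add: algebra_simps)
    then have eq: "h\<^sup>2 * A u v (x + s *\<^sub>R u + t *\<^sub>R v) = h\<^sup>2 * A v u (x + s' *\<^sub>R v + t' *\<^sub>R u)"
      using st(3) st'(3) by (simp only: algebra_simps)
    then have eq: "A u v (x + s *\<^sub>R u + t *\<^sub>R v) = A v u (x + s' *\<^sub>R v + t' *\<^sub>R u)"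
      using h by simp
    have "dist (A u v (x + s *\<^sub>R u + t *\<^sub>R v)) (A u v x) < e/2"
      using d(2) inS[OF st(1,2)] close[OF st(1,2)] unfolding d_def by simp
    moreover have "dist (A v u (x + s' *\<^sub>R v + t' *\<^sub>R u)) (A v u x) < e/2"
      using d(4) inS[OF st'(1,2)] close[OF st'(1,2)] unfolding d_def by (simp add: add.commute)
    ultimately show ?thesis using eq unfolding dist_real_def by linarith
  qed
  then have "A u v x = A v u x"
    by (metis abs_ge_zero abs_le_zero_iff eq_iff_diff_eq_0 less_irrefl linorder_not_less zero_less_abs_iff)
  then show ?thesis by (simp add: A_def)
qed

lemma symmetric_second_derivative:
  fixes f :: "'e::real_normed_vector \<Rightarrow> 'f::euclidean_space"
  assumes f: "smooth_on S f" and S: "open S" "x \<in> S"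
  shows "frechet_derivative (\<lambda>y. frechet_derivative f (at y) u) (at x) v =
    frechet_derivative (\<lambda>y. frechet_derivative f (at y) v) (at x) u"
proof (rule euclidean_eqI)
  fix b :: 'f assume "b \<in> Basis"
  have L: "bounded_linear (\<lambda>z::'f. z \<bullet> b)" by (rule bounded_linear_inner_left)
  have sm: "smooth_on S (\<lambda>x. f x \<bullet> b)"
    by (rule smooth_on_bounded_linear[OF L S(1) f])
  have comp: "frechet_derivative (\<lambda>y. frechet_derivative (\<lambda>x. f x \<bullet> b) (at y) u) (at x) v =
    frechet_derivative (\<lambda>y. frechet_derivative f (at y) u) (at x) v \<bullet> b" for u v
  proof -
    have d1: "frechet_derivative (\<lambda>x. f x \<bullet> b) (at y) u = frechet_derivative f (at y) u \<bullet> b"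
      if "y \<in> S" for y
      using frechet_derivative_eq[OF bounded_linear.has_derivative[OF L smooth_on_has_derivative[OF f that]]]
      by (simp add: fun_eq_iff)
    have d2: "frechet_derivative (\<lambda>y. frechet_derivative f (at y) u \<bullet> b) (at x) v =
        frechet_derivative (\<lambda>y. frechet_derivative f (at y) u) (at x) v \<bullet> b"
      using frechet_derivative_eq[OF bounded_linear.has_derivative[OF L
          smooth_on_has_derivative[OF smooth_on_frechet_derivative[OF f] S(2)]]]
      by (simp add: fun_eq_iff)
    have "frechet_derivative (\<lambda>y. frechet_derivative (\<lambda>x. f x \<bullet> b) (at y) u) (at x) =
        frechet_derivative (\<lambda>y. frechet_derivative f (at y) u \<bullet> b) (at x)"
      by (rule frechet_derivative_cong_open[OF S d1])
    then show ?thesis by (simp only: d2)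
  qed
  have "Ck_on 2 S (\<lambda>x. f x \<bullet> b)" using sm by (simp add: smooth_on_def)
  from symmetric_second_derivative_real[OF this S] show
    "frechet_derivative (\<lambda>y. frechet_derivative f (at y) u) (at x) v \<bullet> b =
     frechet_derivative (\<lambda>y. frechet_derivative f (at y) v) (at x) u \<bullet> b"
    by (simp add: comp)
qed

section \<open>Smooth cutoff functions with numerical derivative bounds\<close>

definition flat_exp :: "nat \<Rightarrow> real \<Rightarrow> real" where
  "flat_exp k x = (if x > 0 then exp (- inverse x) * inverse x ^ k else 0)"

lemma flat_exp_tendsto_0: "((\<lambda>x. flat_exp k x) \<longlongrightarrow> 0) (at 0)"
proof -
  have "((\<lambda>y::real. y ^ k / exp y) \<longlongrightarrow> 0) at_top" by (rule tendsto_power_div_exp_0)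
  then have "((\<lambda>x::real. inverse x ^ k / exp (inverse x)) \<longlongrightarrow> 0) (at_right 0)"
    using filterlim_inverse_at_top_right by (rule filterlim_compose)
  moreover have "eventually (\<lambda>x::real. inverse x ^ k / exp (inverse x) = flat_exp k x) (at_right 0)"
    using eventually_at_right_less[of 0]
    by eventually_elim (simp add: flat_exp_def exp_minus divide_inverse)
  ultimately have r: "((\<lambda>x. flat_exp k x) \<longlongrightarrow> 0) (at_right 0)"
    using tendsto_cong by fastforce
  have "eventually (\<lambda>x::real. 0 = flat_exp k x) (at_left 0)"
    by (simp add: flat_exp_def eventually_at_filter)
  then have "((\<lambda>x. flat_exp k x) \<longlongrightarrow> 0) (at_left 0)"
    using tendsto_cong[of "\<lambda>_. 0"] by fastforce
  with r show ?thesis by (simp add: filterlim_split_at)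
qed

text \<open>The factor x^(-k) is carried along because the functions e^(-1/x) x^(-k), extended by 0,
  form a family that spans its own derivatives. Smoothness then follows by induction on the order,
  for all k at once.\<close>

lemma flat_exp_deriv:
  "(flat_exp k has_real_derivative (flat_exp (k + 2) x - real k * flat_exp (k + 1) x)) (at x)"
proof (cases x "0::real" rule: linorder_cases)
  case less
  have "(flat_exp k has_real_derivative 0) (at x)"
    by (rule has_field_derivative_transform_within_open[where S="{..<0}" and f="\<lambda>_. 0"])
       (use less in \<open>auto simp: flat_exp_def\<close>)
  then show ?thesis using less by (simp add: flat_exp_def)
next
  case greater
  have "((\<lambda>x. exp (- inverse x) * inverse x ^ k) has_real_derivative
     (flat_exp (k + 2) x - real k * flat_exp (k + 1) x)) (at x)"
    using greater
    by (auto intro!: derivative_eq_intros simp: flat_exp_def power2_eq_square)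
       (cases k; simp add: algebra_simps power2_eq_square)
  then show ?thesis
    by (rule has_field_derivative_transform_within_open[where S="{0<..}"])
       (use greater in \<open>auto simp: flat_exp_def\<close>)
next
  case equal
  \<comment> \<open>At 0 the difference quotient of \<open>flat_exp k\<close> is
    \<open>flat_exp (k + 1)\<close>.\<close>
  have "((\<lambda>y. flat_exp (k + 1) y) \<longlongrightarrow> 0) (at 0)" by (rule flat_exp_tendsto_0)
  moreover have "flat_exp (k + 1) y = (flat_exp k y - flat_exp k 0) / (y - 0)" for y
    by (simp add: flat_exp_def divide_inverse)
  ultimately have "(flat_exp k has_real_derivative 0) (at 0)"
    by (simp add: has_field_derivative_iff)
  then show ?thesis using equal by (simp add: flat_exp_def)
qed

lemma smooth_on_flat_exp: "smooth_on UNIV (flat_exp k)"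
proof -
  have "Ck_on m UNIV (flat_exp k)" for m
  proof (induction m arbitrary: k)
    case 0
    have "continuous_on UNIV (flat_exp k)"
      by (rule DERIV_continuous_on[OF flat_exp_deriv])
    then show ?case by simp
  next
    case (Suc m)
    show ?case
    proof (rule Ck_on_SucI)
      show "(flat_exp k has_derivative (\<lambda>v. v * flat_exp (k + 2) x + v * (- real k) * flat_exp (k + 1) x)) (at x)" for x
        using flat_exp_deriv[of k x] unfolding has_field_derivative_def
        by (rule has_derivative_eq_rhs) (simp add: algebra_simps fun_eq_iff)
      show "Ck_on m UNIV (\<lambda>x. v * flat_exp (k + 2) x + v * (- real k) * flat_exp (k + 1) x)" for v
        by (intro Ck_on_add Ck_on_bilinear[OF bounded_bilinear_mult] Ck_on_const Suc) auto
    qed simp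
  qed
  then show ?thesis by (simp add: smooth_on_def)
qed

lemma flat_exp_nonneg: "flat_exp k x \<ge> 0" by (simp add: flat_exp_def)
lemma flat_exp_0_le_1: "flat_exp 0 x \<le> 1"
  by (simp add: flat_exp_def)

text \<open>With y = 1/x the claim is y^2 <= e^y, which follows from y <= (1 + y/4)^2 <= e^(y/2);
  the first inequality is (y - 4)^2 >= 0. Since \<open>flat_exp 2\<close> is the derivative of
  \<open>flat_exp 0\<close>, this controls the numerator in
  \<open>smooth_step_deriv\<close>.\<close>

lemma flat_exp_2_le_1: "flat_exp 2 x \<le> 1"
proof (cases "x > 0")
  case True
  define y where "y = inverse x"
  have y: "y > 0" using True by (simp add: y_def)
  have "(1 + y / 2 / real 2) ^ 2 \<le> exp (y / 2)"
    by (rule exp_ge_one_plus_x_over_n_power_n) (use y in auto)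
  moreover have "y \<le> (1 + y / 2 / real 2) ^ 2"
    using zero_le_power2[of "y - 4"] by (simp add: power2_eq_square field_simps)
  ultimately have "y \<le> exp (y / 2)" by linarith
  then have "y ^ 2 \<le> exp (y / 2) ^ 2" using y by (intro power_mono) auto
  also have "\<dots> = exp y" by (simp add: power2_eq_square exp_add[symmetric])
  finally have "exp (- y) * y ^ 2 \<le> exp (- y) * exp y" by (intro mult_left_mono) auto
  then show ?thesis using True by (simp add: flat_exp_def y_def[symmetric] exp_minus)
qed (simp add: flat_exp_def)

definition smooth_step :: "real \<Rightarrow> real" where
  "smooth_step x = flat_exp 0 x / (flat_exp 0 x + flat_exp 0 (1 - x))"

text \<open>One of x and 1 - x is at least 1/2, and there e^(-1/x) is at least e^(-2).\<close>

lemma smooth_step_denom: "flat_exp 0 x + flat_exp 0 (1 - x) \<ge> exp (- 2)"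
proof -
  have a: "flat_exp 0 z \<ge> exp (-2)" if "z \<ge> 1/2" for z
  proof -
    have "inverse z \<le> 2" using that le_imp_inverse_le[of "1/2" z] by simp
    then show ?thesis using that by (simp add: flat_exp_def)
  qed
  show ?thesis
    using a[of x] a[of "1 - x"] flat_exp_nonneg[of 0 x] flat_exp_nonneg[of 0 "1 - x"]
    by (cases "x \<ge> 1/2") linarith+
qed

lemma smooth_step_denom_pos: "flat_exp 0 x + flat_exp 0 (1 - x) > 0"
  using smooth_step_denom[of x] exp_gt_zero[of "-2::real"] by linarith

lemma smooth_step_range: "0 \<le> smooth_step x" "smooth_step x \<le> 1"
  using smooth_step_denom_pos[of x] flat_exp_nonneg[of 0 x] flat_exp_nonneg[of 0 "1 - x"]
  by (auto simp: smooth_step_def divide_simps)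

lemma smooth_step_0: "x \<le> 0 \<Longrightarrow> smooth_step x = 0"
  by (simp add: smooth_step_def flat_exp_def)



lemma smooth_step_1: "x \<ge> 1 \<Longrightarrow> smooth_step x = 1"
  using smooth_step_denom_pos[of x] by (simp add: smooth_step_def flat_exp_def)

lemma smooth_on_smooth_step: "smooth_on UNIV smooth_step"
proof -
  have r: "smooth_on UNIV (\<lambda>x. flat_exp 0 (1 - x))"
    by (rule smooth_on_compose[OF _ _ _ _ smooth_on_flat_exp])
       (auto intro!: smooth_on_diff)
  have "smooth_on UNIV (\<lambda>x. flat_exp 0 x / (flat_exp 0 x + flat_exp 0 (1 - x)))"
    by (intro smooth_on_divide smooth_on_add smooth_on_flat_exp r)
       (auto simp: less_imp_neq[OF smooth_step_denom_pos, symmetric])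
  then show ?thesis unfolding smooth_step_def[abs_def] .
qed

text \<open>By the quotient rule the derivative is (a' b + a b') / (a + b)^2 with all four values in
  [0, 1]. As e^2 <= 10, the denominator is at least 1/100, which gives 2 * 100 = 200. This number
  enters the final constant through Q.\<close>

lemma smooth_step_deriv:
  obtains d where "(smooth_step has_real_derivative d) (at x)" "\<bar>d\<bar> \<le> 200"
proof
  define a b a' b' where ab: "a = flat_exp 0 x" "b = flat_exp 0 (1 - x)"
    "a' = flat_exp 2 x" "b' = flat_exp 2 (1 - x)"
  have pos: "a + b > 0" using smooth_step_denom_pos ab by simp
  have d1: "(flat_exp 0 has_real_derivative a') (at x)"
    using flat_exp_deriv[of 0 x] ab by (simp add: numeral_2_eq_2)
  have d2: "((\<lambda>x. flat_exp 0 (1 - x)) has_real_derivative (- b')) (at x)"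
  proof -
    have "((\<lambda>x::real. 1 - x) has_real_derivative - 1) (at x)"
      by (auto intro!: derivative_eq_intros)
    from DERIV_chain2[where f="flat_exp 0" and g="\<lambda>x. 1 - x" and x=x and s=UNIV and Db="-1", OF flat_exp_deriv[of 0 "1 - x"] this]
    show ?thesis using ab by (simp add: numeral_2_eq_2)
  qed
  show "(smooth_step has_real_derivative ((a' * (a + b) - a * (a' + - b')) / ((a + b) * (a + b)))) (at x)"
    unfolding smooth_step_def[abs_def]
    using DERIV_divide[OF d1 DERIV_add[OF d1 d2]] pos by (simp add: ab)
  have r: "0 \<le> a" "a \<le> 1" "0 \<le> b" "b \<le> 1" "0 \<le> a'" "a' \<le> 1" "0 \<le> b'" "b' \<le> 1"
    by (auto simp: ab flat_exp_nonneg flat_exp_0_le_1 flat_exp_2_le_1)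
  have num: "a' * (a + b) - a * (a' + - b') = a' * b + a * b'" by (simp add: algebra_simps)
  have "a' * b \<le> 1 * 1" "a * b' \<le> 1 * 1" by (intro mult_mono; use r in simp)+
  then have n2: "a' * b + a * b' \<le> 2" "0 \<le> a' * b + a * b'" using r by auto
  have "exp (-2) \<le> a + b" using smooth_step_denom[of x] ab by simp
  moreover have "exp (2::real) \<le> 10"
  proof -
    have "exp (2::real) = exp 1 * exp 1" by (simp add: exp_add[symmetric])
    also have "\<dots> \<le> 3 * 3" by (intro mult_mono) (use exp_le in auto)
    finally show ?thesis by simp
  qed
  then have "1/10 \<le> exp (-2::real)" by (simp add: exp_minus field_simps)
  ultimately have "1/10 \<le> a + b" by linarith
  then have "1/10 * (1/10) \<le> (a + b) * (a + b)" by (intro mult_mono) auto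
  then have "(a' * b + a * b') / ((a + b) * (a + b)) \<le> 2 / (1/100)"
    using n2 by (intro frac_le) auto
  moreover have "0 \<le> (a' * b + a * b') / ((a + b) * (a + b))"
    using n2 pos by (intro divide_nonneg_pos) auto
  ultimately show "\<bar>(a' * (a + b) - a * (a' + - b')) / ((a + b) * (a + b))\<bar> \<le> 200"
    unfolding num by simp
qed



text \<open>A function of the squared norm, hence smooth at the origin. The affine rescaling takes
  |x| = r to 1 and |x| = 2r to 0, so the bump is 1 on the ball of radius r and 0 outside that of
  radius 2r.\<close>

definition smooth_bump :: "real \<Rightarrow> 'e::euclidean_space \<Rightarrow> real" where
  "smooth_bump r x = smooth_step ((4 - (norm x / r)\<^sup>2) / 3)"

lemma smooth_on_bump: "smooth_on UNIV (smooth_bump r)"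
proof -
  have "smooth_on UNIV (\<lambda>x::'a. smooth_step ((4 - (inverse r * inverse r) * (x \<bullet> x)) * (1/3)))"
  proof (rule smooth_on_compose[OF _ _ _ _ smooth_on_smooth_step])
    show "smooth_on UNIV (\<lambda>x::'a. (4 - (inverse r * inverse r) * (x \<bullet> x)) * (1/3))"
      by (intro smooth_on_mult smooth_on_diff smooth_on_bilinear[OF bounded_bilinear_inner]
          smooth_on_const smooth_on_id open_UNIV)
  qed auto
  moreover have "smooth_bump r = (\<lambda>x::'a. smooth_step ((4 - (inverse r * inverse r) * (x \<bullet> x)) * (1/3)))"
  proof
    fix x :: 'a
    have "(norm x / r)\<^sup>2 = (inverse r * inverse r) * (x \<bullet> x)"
      by (simp only: divide_inverse power_mult_distrib power2_norm_eq_inner)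
        (simp only: power2_eq_square mult.commute)
    then show "smooth_bump r x = smooth_step ((4 - (inverse r * inverse r) * (x \<bullet> x)) * (1/3))"
      by (simp add: smooth_bump_def)
  qed
  ultimately show ?thesis by simp
qed

lemma smooth_bump_range: "0 \<le> smooth_bump r x" "smooth_bump r x \<le> 1"
  by (auto simp: smooth_bump_def smooth_step_range)

lemma smooth_bump_1: "r > 0 \<Longrightarrow> norm x \<le> r \<Longrightarrow> smooth_bump r x = 1"
  unfolding smooth_bump_def
  by (rule smooth_step_1) (auto simp: field_simps power_mono)

lemma smooth_bump_0: "r > 0 \<Longrightarrow> norm x \<ge> 2 * r \<Longrightarrow> smooth_bump r x = 0"
  unfolding smooth_bump_def
proof (rule smooth_step_0)
  assume a: "r > 0" "norm x \<ge> 2 * r"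
  then have "2 \<le> norm x / r" by (simp add: field_simps)
  then have "2\<^sup>2 \<le> (norm x / r)\<^sup>2" by (intro power_mono) auto
  then show "(4 - (norm x / r)\<^sup>2) / 3 \<le> 0" by simp
qed

section \<open>Invariance of the scalar curvature\<close>

lemma linear_axis_expand:
  fixes L :: "real^'n::finite \<Rightarrow> 'b::real_vector"
  assumes "linear L"
  shows "L w = (\<Sum>m\<in>UNIV. (w $ m) *\<^sub>R L (axis m 1))"
proof -
  have "w = (\<Sum>m\<in>UNIV. (w $ m) *\<^sub>R axis m 1)"
    using basis_expansion[of w] by (simp add: scalar_mult_eq_scaleR)
  then have "L w = L (\<Sum>m\<in>UNIV. (w $ m) *\<^sub>R axis m 1)" by simp
  then show ?thesis by (simp add: linear_sum[OF assms] linear_scale[OF assms])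
qed

lemma inner_axis_1: "axis j (1::real) \<bullet> v = v $ j" "v \<bullet> axis j (1::real) = v $ j"
  by (simp_all add: inner_axis inner_commute)

lemma matrix_vector_mult_axis: "((A::real^'n^'m) *v axis l 1) $ j = A $ j $ l"
  by (simp add: matrix_vector_mult_basis column_def)

lemma matrix_inv_mult:
  fixes A :: "real^'n^'n"
  assumes "invertible A"
  shows "A ** matrix_inv A = mat 1" "matrix_inv A ** A = mat 1"
  using assms unfolding invertible_def matrix_inv_def
  by (metis (mono_tags, lifting) someI_ex)+

lemma matrix_inv_eqI:
  fixes A :: "real^'n^'n"
  assumes "A ** B = mat 1"
  shows "matrix_inv A = B" "invertible A"
proof -
  show i: "invertible A" using assms matrix_left_right_inverse invertible_def by blast
  have "matrix_inv A = matrix_inv A ** (A ** B)" using assms by simp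
  also have "\<dots> = B" by (simp add: matrix_mul_assoc matrix_inv_mult[OF i])
  finally show "matrix_inv A = B" .
qed

lemma pos_def_invertible:
  fixes A :: "real^'n^'n"
  assumes "\<forall>v. v \<noteq> 0 \<longrightarrow> v \<bullet> (A *v v) > 0"
  shows "invertible A"
  unfolding invertible_left_inverse
  using matrix_left_invertible_ker assms by (metis inner_zero_right less_irrefl)

text \<open>Cramer's rule exhibits the entries of the inverse as quotients of polynomials in the
  entries of A, from which smoothness of the inverse metric follows.\<close>

lemma matrix_inv_cramer:
  fixes A :: "real^'n^'n"
  assumes "invertible A"
  shows "matrix_inv A $ k $ l = det (\<chi> i j. if j = k then (axis l 1 :: real^'n) $ i else A $ i $ j) / det A"
proof -
  have "A *v (matrix_inv A *v axis l 1) = axis l 1"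
    by (simp add: matrix_vector_mul_assoc matrix_inv_mult[OF assms])
  then have "matrix_inv A *v axis l 1 =
      (\<chi> k. det (\<chi> i j. if j = k then (axis l 1 :: real^'n) $ i else A $ i $ j) / det A)"
    using cramer[of A] assms by (simp add: invertible_det_nz)
  then show ?thesis by (metis (no_types, lifting) matrix_vector_mult_axis vec_lambda_beta)
qed

lemma smooth_on_matrix_inv:
  fixes A :: "'e::real_normed_vector \<Rightarrow> real^'n^'n"
  assumes "open S" "smooth_on S A" "\<And>x. x \<in> S \<Longrightarrow> invertible (A x)"
  shows "smooth_on S (\<lambda>x. matrix_inv (A x))"
proof -
  have "smooth_on S (\<lambda>x. matrix_inv (A x) $ k $ l)" for k l
  proof (rule smooth_on_cong[OF assms(1)])
    show "smooth_on S (\<lambda>x. det (\<chi> i j. if j = k then (axis l 1 :: real^'n) $ i else A x $ i $ j) / det (A x))"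
    proof (intro smooth_on_divide smooth_on_det assms smooth_on_vec_lambda)
      show "smooth_on S (\<lambda>x. if j = k then (axis l 1 :: real^'n) $ i else A x $ i $ j)" for i j
        by (cases "j = k") (auto intro!: smooth_on_vec_nth assms)
      show "det (A x) \<noteq> 0" if "x \<in> S" for x
        using assms(3)[OF that] by (simp add: invertible_det_nz)
    qed
  qed (simp add: matrix_inv_cramer assms(3))
  then have "smooth_on S (\<lambda>x. \<chi> k l. matrix_inv (A x) $ k $ l)"
    by (intro smooth_on_vec_lambda assms)
  then show ?thesis by simp
qed

lemma bounded_bilinear_matrix_vector: "bounded_bilinear (\<lambda>(A::real^'n^'m) v. A *v v)"
proof -
  have "bilinear (\<lambda>(A::real^'n^'m) v. A *v v)"
    unfolding bilinear_def
    by (auto intro!: linearI simp: matrix_vector_right_distrib matrix_vector_mult_add_rdistrib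
        vec_eq_iff matrix_vector_mult_def sum_distrib_left algebra_simps sum.distrib)
  then show ?thesis by (simp add: bilinear_conv_bounded_bilinear)
qed

text \<open>A product rule for the case where differentiability of L is known only at each fixed
  argument; linearity in the argument reduces it to finitely many basis vectors. It serves to
  differentiate Jacobians and Christoffel maps at moving arguments.\<close>

lemma has_derivative_linear_family:
  fixes L :: "'e::real_normed_vector \<Rightarrow> 'm::euclidean_space \<Rightarrow> 'f::real_normed_vector"
  assumes S: "open S" "x \<in> S" and lin: "\<And>y. y \<in> S \<Longrightarrow> linear (L y)"
    and d: "\<And>b. ((\<lambda>y. L y b) has_derivative L' b) (at x)"
    and h: "(h has_derivative h') (at x)"
  shows "((\<lambda>y. L y (h y)) has_derivative (\<lambda>z. L' (h x) z + L x (h' z))) (at x)"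
proof -
  have ex: "L y w = (\<Sum>b\<in>Basis. (w \<bullet> b) *\<^sub>R L y b)" if "y \<in> S" for y w
  proof -
    have "L y w = L y (\<Sum>b\<in>Basis. (w \<bullet> b) *\<^sub>R b)" by (simp add: euclidean_representation)
    then show ?thesis by (simp add: linear_sum[OF lin[OF that]] linear_scale[OF lin[OF that]])
  qed
  \<comment> \<open>The derivative inherits linearity in the fixed argument from L, by uniqueness of
    derivatives.\<close>
  have L': "L' w z = (\<Sum>b\<in>Basis. (w \<bullet> b) *\<^sub>R L' b z)" for w z
  proof -
    have "((\<lambda>y. \<Sum>b\<in>Basis. (w \<bullet> b) *\<^sub>R L y b) has_derivative (\<lambda>z. \<Sum>b\<in>Basis. (w \<bullet> b) *\<^sub>R L' b z)) (at x)"
      by (intro has_derivative_sum has_derivative_scaleR_right d)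
    then have "((\<lambda>y. L y w) has_derivative (\<lambda>z. \<Sum>b\<in>Basis. (w \<bullet> b) *\<^sub>R L' b z)) (at x)"
      by (rule has_derivative_transform_within_open[OF _ S]) (simp add: ex[symmetric])
    from has_derivative_unique[OF d[of w] this] show ?thesis by simp
  qed
  have "((\<lambda>y. \<Sum>b\<in>Basis. (h y \<bullet> b) *\<^sub>R L y b) has_derivative
      (\<lambda>z. \<Sum>b\<in>Basis. (h x \<bullet> b) *\<^sub>R L' b z + (h' z \<bullet> b) *\<^sub>R L x b)) (at x)"
    by (intro has_derivative_sum has_derivative_scaleR has_derivative_inner_left h d)
  then have "((\<lambda>y. L y (h y)) has_derivative
      (\<lambda>z. \<Sum>b\<in>Basis. (h x \<bullet> b) *\<^sub>R L' b z + (h' z \<bullet> b) *\<^sub>R L x b)) (at x)"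
    by (rule has_derivative_transform_within_open[OF _ S]) (simp add: ex[symmetric])
  then show ?thesis
    by (rule has_derivative_eq_rhs)
       (simp add: fun_eq_iff sum.distrib L'[of "h x"] ex[OF S(2), of "h' _"])
qed

section \<open>Connection and curvature of a metric in one chart, on arbitrary vectors\<close>

definition koszul :: "(real^'n::finite \<Rightarrow> real^'n^'n) \<Rightarrow> real^'n \<Rightarrow> real^'n \<Rightarrow> real^'n \<Rightarrow> real^'n \<Rightarrow> real" where
  "koszul G x u v w = (v \<bullet> (frechet_derivative G (at x) u *v w) + u \<bullet> (frechet_derivative G (at x) v *v w)
     - u \<bullet> (frechet_derivative G (at x) w *v v)) / 2"

text \<open>\<open>koszul\<close> is Koszul's formula for the inner product of nabla_u v with w, for
  constant vector fields; raising the index gives nabla_u v itself. Vectors instead of indices allow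
  arguments such as J u in the transformation laws.\<close>

definition chris :: "(real^'n::finite \<Rightarrow> real^'n^'n) \<Rightarrow> real^'n \<Rightarrow> real^'n \<Rightarrow> real^'n \<Rightarrow> real^'n" where
  "chris G x u v = matrix_inv (G x) *v (\<chi> m. koszul G x u v (axis m 1))"

text \<open>This is R(z, u) w for constant fields, whose brackets vanish.\<close>

definition curv :: "(real^'n::finite \<Rightarrow> real^'n^'n) \<Rightarrow> real^'n \<Rightarrow> real^'n \<Rightarrow> real^'n \<Rightarrow> real^'n \<Rightarrow> real^'n" where
  "curv G x z u w = frechet_derivative (\<lambda>y. chris G y u w) (at x) z
     - frechet_derivative (\<lambda>y. chris G y z w) (at x) u
     + chris G x z (chris G x u w) - chris G x u (chris G x z w)"

definition ric :: "(real^'n::finite \<Rightarrow> real^'n^'n) \<Rightarrow> real^'n \<Rightarrow> real^'n \<Rightarrow> real^'n \<Rightarrow> real" where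
  "ric G x u w = (\<Sum>i\<in>UNIV. curv G x (axis i 1) u w $ i)"

definition scal :: "(real^'n::finite \<Rightarrow> real^'n^'n) \<Rightarrow> real^'n \<Rightarrow> real" where
  "scal G x = (\<Sum>j\<in>UNIV. \<Sum>k\<in>UNIV. matrix_inv (G x) $ j $ k * ric G x (axis j 1) (axis k 1))"

definition metric_on :: "(real^'n) set \<Rightarrow> (real^'n::finite \<Rightarrow> real^'n^'n) \<Rightarrow> bool" where
  "metric_on S G \<longleftrightarrow> open S \<and> smooth_on S G \<and>
     (\<forall>x\<in>S. transpose (G x) = G x \<and> (\<forall>v. v \<noteq> 0 \<longrightarrow> v \<bullet> (G x *v v) > 0))"

lemma metric_onD:
  assumes "metric_on S G"
  shows "open S" "smooth_on S G" "x \<in> S \<Longrightarrow> invertible (G x)"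
    "x \<in> S \<Longrightarrow> v \<noteq> 0 \<Longrightarrow> v \<bullet> (G x *v v) > 0"
    "x \<in> S \<Longrightarrow> u \<bullet> (G x *v v) = v \<bullet> (G x *v u)"
    "x \<in> S \<Longrightarrow> G differentiable (at x)"
proof -
  show "x \<in> S \<Longrightarrow> invertible (G x)" using assms pos_def_invertible unfolding metric_on_def by blast
  show "u \<bullet> (G x *v v) = v \<bullet> (G x *v u)" if "x \<in> S"
  proof -
    have "transpose (G x) = G x" using assms that unfolding metric_on_def by blast
    then have "u \<bullet> (G x *v v) = (G x *v u) \<bullet> v" by (metis dot_lmul_matrix transpose_matrix_vector)
    then show ?thesis by (simp add: inner_commute)
  qed
qed (use assms in \<open>auto simp: metric_on_def intro: smooth_on_differentiable\<close>)

context
  fixes S :: "(real^'n::finite) set" and G :: "real^'n \<Rightarrow> real^'n^'n"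
  assumes met: "metric_on S G"
begin

private lemma lin_DG: "x \<in> S \<Longrightarrow> linear (frechet_derivative G (at x))"
  using metric_onD(6)[OF met] by (simp add: linear_frechet_derivative)

private lemmas lin_simps = matrix_vector_right_distrib matrix_vector_mult_add_rdistrib
  matrix_vector_mult_scaleR scaleR_matrix_vector_assoc[symmetric] inner_simps

lemma koszul_linear:
  assumes x: "x \<in> S"
  shows "linear (koszul G x u v)" "linear (\<lambda>u. koszul G x u v w)" "linear (\<lambda>v. koszul G x u v w)"
  using linear_add[OF lin_DG[OF x]] linear_cmul[OF lin_DG[OF x]]
  by (auto intro!: linearI simp: koszul_def lin_simps field_simps)

text \<open>Pairing with the metric characterizes \<open>chris\<close> without the inverse matrix;
  its transformation law is proved in this form.\<close>

lemma chris_koszul: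
  assumes x: "x \<in> S"
  shows "w \<bullet> (G x *v chris G x u v) = koszul G x u v w"
proof -
  have "G x *v chris G x u v = (\<chi> m. koszul G x u v (axis m 1))"
    by (simp add: chris_def matrix_vector_mul_assoc matrix_inv_mult[OF metric_onD(3)[OF met x]])
  then have "w \<bullet> (G x *v chris G x u v) = (\<Sum>m\<in>UNIV. w $ m * koszul G x u v (axis m 1))"
    by (simp add: inner_vec_def)
  then show ?thesis using linear_axis_expand[OF koszul_linear(1)[OF x], of u v w] by simp
qed

lemma chris_linear:
  assumes x: "x \<in> S"
  shows "linear (\<lambda>u. chris G x u v)" "linear (\<lambda>v. chris G x u v)"
proof -
  have "(\<lambda>u. \<chi> m. koszul G x u v (axis m 1)) = (\<lambda>u. (\<chi> m. koszul G x u v (axis m 1)))" by simp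
  have l1: "linear (\<lambda>u. (\<chi> m. koszul G x u v (axis m 1))::real^'n)"
    by (rule linearI) (simp_all add: vec_eq_iff linear_add[OF koszul_linear(2)[OF x]]
        linear_cmul[OF koszul_linear(2)[OF x]])
  have l2: "linear (\<lambda>v. (\<chi> m. koszul G x u v (axis m 1))::real^'n)"
    by (rule linearI) (simp_all add: vec_eq_iff linear_add[OF koszul_linear(3)[OF x]]
        linear_cmul[OF koszul_linear(3)[OF x]])
  show "linear (\<lambda>u. chris G x u v)"
    using linear_compose[OF l1 matrix_vector_mul_linear[of "matrix_inv (G x)"]]
    by (simp add: chris_def o_def)
  show "linear (\<lambda>v. chris G x u v)"
    using linear_compose[OF l2 matrix_vector_mul_linear[of "matrix_inv (G x)"]]
    by (simp add: chris_def o_def)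
qed

lemma christoffel_eq_chris:
  assumes x: "x \<in> S"
  shows "christoffel G k i j x = chris G x (axis i 1) (axis j 1) $ k"
proof -
  have p: "pderiv_at i (\<lambda>y. G y $ j $ l) x = frechet_derivative G (at x) (axis i 1) $ j $ l" for i j l
    unfolding pderiv_at_def
    using frechet_derivative_eq[OF bounded_linear.has_derivative[OF bounded_linear_vec_nth
        bounded_linear.has_derivative[OF bounded_linear_vec_nth
        has_frechet_derivative[OF metric_onD(6)[OF met x]]]], of j l]
    by (simp add: fun_eq_iff)
  show ?thesis
    unfolding christoffel_def chris_def matrix_vector_mult_def[of "matrix_inv _"] koszul_def
    by (simp add: p inner_axis_1 matrix_vector_mult_axis sum_distrib_left mult.assoc)
qed

lemma smooth_koszul: "smooth_on S (\<lambda>x. koszul G x u v w)"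
  unfolding koszul_def divide_inverse
  by (intro smooth_on_mult smooth_on_add smooth_on_diff smooth_on_const
      smooth_on_bilinear[OF bounded_bilinear_inner] smooth_on_bilinear[OF bounded_bilinear_matrix_vector]
      smooth_on_frechet_derivative metric_onD(1,2)[OF met])

lemma smooth_chris: "smooth_on S (\<lambda>x. chris G x u v)"
  unfolding chris_def
  by (intro smooth_on_bilinear[OF bounded_bilinear_matrix_vector] smooth_on_matrix_inv
      smooth_on_vec_lambda smooth_koszul metric_onD(1,2,3)[OF met])

lemma smooth_curv: "smooth_on S (\<lambda>x. curv G x z u w)"
proof -
  \<comment> \<open>Smoothness is known for fixed arguments, so the inner vector is expanded in the
    standard basis.\<close>
  have 1: "smooth_on S (\<lambda>x. chris G x a (chris G x b w))" for a b
  proof (rule smooth_on_cong[OF metric_onD(1)[OF met]])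
    show "smooth_on S (\<lambda>x. \<Sum>m\<in>UNIV. (chris G x b w $ m) *\<^sub>R chris G x a (axis m 1))"
      by (intro smooth_on_sum smooth_on_bilinear[OF bounded_bilinear_scaleR] smooth_on_vec_nth
          smooth_chris metric_onD(1)[OF met])
  qed (use linear_axis_expand[OF chris_linear(2)] in metis)
  show ?thesis unfolding curv_def
    by (intro smooth_on_add smooth_on_diff 1 smooth_on_frechet_derivative smooth_chris
        metric_onD(1)[OF met])
qed

lemma smooth_scal: "smooth_on S (scal G)"
  unfolding scal_def[abs_def] ric_def
  by (intro smooth_on_sum smooth_on_mult smooth_on_vec_nth smooth_on_matrix_inv smooth_curv
      metric_onD(1,2,3)[OF met])

lemma riemann_tensor_eq_curv:
  assumes x: "x \<in> S"
  shows "riemann_tensor G l k i j x = curv G x (axis i 1) (axis j 1) (axis k 1) $ l"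
proof -
  have d: "pderiv_at i (christoffel G l j k) x = frechet_derivative (\<lambda>y. chris G y (axis j 1) (axis k 1)) (at x) (axis i 1) $ l"
    for i j k l
  proof -
    have 1: "frechet_derivative (christoffel G l j k) (at x) = frechet_derivative (\<lambda>y. chris G y (axis j 1) (axis k 1) $ l) (at x)"
      by (rule frechet_derivative_cong_open[OF metric_onD(1)[OF met] x christoffel_eq_chris])
    have 2: "((\<lambda>y. chris G y (axis j 1) (axis k 1) $ l) has_derivative
        (\<lambda>z. frechet_derivative (\<lambda>y. chris G y (axis j 1) (axis k 1)) (at x) z $ l)) (at x)"
      by (rule bounded_linear.has_derivative[OF bounded_linear_vec_nth
            smooth_on_has_derivative[OF smooth_chris x]])
    show ?thesis unfolding pderiv_at_def 1 frechet_derivative_eq[OF 2] ..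
  qed
  have s: "(\<Sum>p\<in>UNIV. chris G x a (axis p 1) $ l * chris G x b c $ p) = chris G x a (chris G x b c) $ l" for a b c
    using linear_axis_expand[OF chris_linear(2)[OF x], of a "chris G x b c"]
    by (simp add: mult.commute)
  show ?thesis
    unfolding riemann_tensor_def curv_def
    by (simp add: d christoffel_eq_chris[OF x] sum_subtractf s)
qed

text \<open>The invariance of the traces below rests on a change of basis, for which linearity in
  every slot has to be available.\<close>

lemma curv_linear:
  assumes x: "x \<in> S"
  shows "linear (\<lambda>z. curv G x z u w)" "linear (\<lambda>u. curv G x z u w)" "linear (\<lambda>w. curv G x z u w)"
proof -
  note S = metric_onD(1)[OF met]
  note dc = smooth_on_has_derivative[OF smooth_chris x]
  have fd: "linear (frechet_derivative (\<lambda>y. chris G y u w) (at x))" for u w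
    using has_derivative_linear[OF dc] .
  have a1: "frechet_derivative (\<lambda>y. chris G y (a + b) w) (at x) z =
      frechet_derivative (\<lambda>y. chris G y a w) (at x) z + frechet_derivative (\<lambda>y. chris G y b w) (at x) z" for a b w z
  proof -
    have "frechet_derivative (\<lambda>y. chris G y (a + b) w) (at x) = frechet_derivative (\<lambda>y. chris G y a w + chris G y b w) (at x)"
      by (rule frechet_derivative_cong_open[OF S x]) (simp add: linear_add[OF chris_linear(1)])
    then show ?thesis using frechet_derivative_eq[OF has_derivative_add[OF dc dc], of a w b w] by (simp add: fun_eq_iff)
  qed
  have a2: "frechet_derivative (\<lambda>y. chris G y w (a + b)) (at x) z =
      frechet_derivative (\<lambda>y. chris G y w a) (at x) z + frechet_derivative (\<lambda>y. chris G y w b) (at x) z" for a b w z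
  proof -
    have "frechet_derivative (\<lambda>y. chris G y w (a + b)) (at x) = frechet_derivative (\<lambda>y. chris G y w a + chris G y w b) (at x)"
      by (rule frechet_derivative_cong_open[OF S x]) (simp add: linear_add[OF chris_linear(2)])
    then show ?thesis using frechet_derivative_eq[OF has_derivative_add[OF dc dc], of w a w b] by (simp add: fun_eq_iff)
  qed
  have s1: "frechet_derivative (\<lambda>y. chris G y (r *\<^sub>R a) w) (at x) z =
      r *\<^sub>R frechet_derivative (\<lambda>y. chris G y a w) (at x) z" for a r w z
  proof -
    have "frechet_derivative (\<lambda>y. chris G y (r *\<^sub>R a) w) (at x) = frechet_derivative (\<lambda>y. r *\<^sub>R chris G y a w) (at x)"
      by (rule frechet_derivative_cong_open[OF S x]) (simp add: linear_scale[OF chris_linear(1)])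
    then show ?thesis using frechet_derivative_eq[OF has_derivative_scaleR_right[OF dc], of r a w] by (simp add: fun_eq_iff)
  qed
  have s2: "frechet_derivative (\<lambda>y. chris G y w (r *\<^sub>R a)) (at x) z =
      r *\<^sub>R frechet_derivative (\<lambda>y. chris G y w a) (at x) z" for a r w z
  proof -
    have "frechet_derivative (\<lambda>y. chris G y w (r *\<^sub>R a)) (at x) = frechet_derivative (\<lambda>y. r *\<^sub>R chris G y w a) (at x)"
      by (rule frechet_derivative_cong_open[OF S x]) (simp add: linear_scale[OF chris_linear(2)])
    then show ?thesis using frechet_derivative_eq[OF has_derivative_scaleR_right[OF dc], of r w a] by (simp add: fun_eq_iff)
  qed
  note c = linear_add[OF chris_linear(1)[OF x]] linear_add[OF chris_linear(2)[OF x]]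
    linear_scale[OF chris_linear(1)[OF x]] linear_scale[OF chris_linear(2)[OF x]]
    linear_add[OF fd] linear_scale[OF fd]
  show "linear (\<lambda>z. curv G x z u w)" "linear (\<lambda>u. curv G x z u w)" "linear (\<lambda>w. curv G x z u w)"
    by (rule linearI; simp add: curv_def a1 a2 s1 s2 c algebra_simps)+
qed

lemma ric_linear:
  assumes x: "x \<in> S"
  shows "linear (\<lambda>u. ric G x u w)" "linear (\<lambda>w. ric G x u w)"
  unfolding ric_def
  by (rule linearI; simp add: linear_add[OF curv_linear(2)[OF x]] linear_scale[OF curv_linear(2)[OF x]]
      linear_add[OF curv_linear(3)[OF x]] linear_scale[OF curv_linear(3)[OF x]] sum.distrib sum_distrib_left)+

lemma scal_eq:
  assumes "x \<in> S"
  shows "(\<Sum>j\<in>UNIV. \<Sum>k\<in>UNIV. matrix_inv (G x) $ j $ k * ricci_tensor G j k x) = scal G x"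
  using assms by (simp add: scal_def ric_def ricci_tensor_def riemann_tensor_eq_curv)

end

lemma matrix_works_real:
  fixes f :: "real^'n \<Rightarrow> real^'m"
  shows "linear f \<Longrightarrow> matrix f *v x = f x"
  using matrix_vector_mul(2) by metis

section \<open>Transformation of connection and curvature under a local isometry\<close>

context
  fixes S S' :: "(real^'n::finite) set" and G G' :: "real^'n \<Rightarrow> real^'n^'n" and T :: "real^'n \<Rightarrow> real^'n"
  assumes met: "metric_on S G" and met': "metric_on S' G'"
    and T: "smooth_on S T" "T ` S \<subseteq> S'"
    and trans: "\<And>x. x \<in> S \<Longrightarrow> G x = transpose (jacobian T (at x)) ** G' (T x) ** jacobian T (at x)"
begin

private abbreviation "J x \<equiv> frechet_derivative T (at x)"
private abbreviation "H x u v \<equiv> frechet_derivative (\<lambda>y. frechet_derivative T (at y) v) (at x) u"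

private lemma S: "open S" "open S'" using met met' by (auto simp: metric_on_def)
private lemma TS: "x \<in> S \<Longrightarrow> T x \<in> S'" using T(2) by auto
private lemma dT: "x \<in> S \<Longrightarrow> (T has_derivative J x) (at x)"
  by (rule smooth_on_has_derivative[OF T(1)])
private lemma linJ: "x \<in> S \<Longrightarrow> linear (J x)"
  using dT has_derivative_linear by blast
private lemma dJ: "x \<in> S \<Longrightarrow> ((\<lambda>y. J y v) has_derivative (\<lambda>u. H x u v)) (at x)"
  using smooth_on_has_derivative[OF smooth_on_frechet_derivative[OF T(1)]] by blast

private lemma symH: "x \<in> S \<Longrightarrow> H x u v = H x v u"
  using symmetric_second_derivative[OF T(1) S(1)] by blast
private lemma dH: "x \<in> S \<Longrightarrow> ((\<lambda>y. H y u v) has_derivative frechet_derivative (\<lambda>y. H y u v) (at x)) (at x)"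
  by (rule smooth_on_has_derivative[OF smooth_on_frechet_derivative[OF smooth_on_frechet_derivative[OF T(1)]]])
private lemma symH3: "x \<in> S \<Longrightarrow> frechet_derivative (\<lambda>y. H y u v) (at x) z = frechet_derivative (\<lambda>y. H y z v) (at x) u"
  using symmetric_second_derivative[OF smooth_on_frechet_derivative[OF T(1)] S(1)] by blast

lemma metric_pullback: "x \<in> S \<Longrightarrow> u \<bullet> (G x *v v) = J x u \<bullet> (G' (T x) *v J x v)"
proof -
  assume x: "x \<in> S"
  have j: "jacobian T (at x) *v w = J x w" for w
    unfolding jacobian_def by (rule matrix_works_real[OF linJ[OF x]])
  have "u \<bullet> (G x *v v) = u \<bullet> (transpose (jacobian T (at x)) *v (G' (T x) *v (jacobian T (at x) *v v)))"
    by (simp add: trans[OF x] matrix_vector_mul_assoc matrix_mul_assoc)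
  also have "\<dots> = (jacobian T (at x) *v u) \<bullet> (G' (T x) *v (jacobian T (at x) *v v))"
    by (metis dot_lmul_matrix transpose_matrix_vector transpose_transpose)
  finally show ?thesis by (simp add: j)
qed

lemma pullback_inj: "x \<in> S \<Longrightarrow> inj (J x)"
proof -
  assume x: "x \<in> S"
  have "u = 0" if "J x u = 0" for u
    using metric_pullback[OF x, of u u] metric_onD(4)[OF met x, of u] that by fastforce
  then show ?thesis using linear_injective_0[OF linJ[OF x]] by blast
qed

lemma pullback_surj: "x \<in> S \<Longrightarrow> surj (J x)"
  using pullback_inj linJ linear_injective_imp_surjective by blast

text \<open>The pullback identity of the metrics, differentiated in the direction z. The terms with
  H, the second derivative of T, are what keeps Christoffel symbols from being tensors.\<close>

private lemma deriv_metric: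
  assumes x: "x \<in> S"
  shows "u \<bullet> (frechet_derivative G (at x) z *v v) =
    J x u \<bullet> (frechet_derivative G' (at (T x)) (J x z) *v J x v)
    + H x z u \<bullet> (G' (T x) *v J x v) + J x u \<bullet> (G' (T x) *v H x z v)"
proof -
  note bm = bounded_bilinear.FDERIV[OF bounded_bilinear_matrix_vector]
  have 1: "((\<lambda>y. u \<bullet> (G y *v v)) has_derivative (\<lambda>z. u \<bullet> (frechet_derivative G (at x) z *v v))) (at x)"
    by (rule has_derivative_inner_right, rule has_derivative_eq_rhs,
        rule bm[OF has_frechet_derivative[OF metric_onD(6)[OF met x]] has_derivative_const])
      (simp add: fun_eq_iff)
  have G': "((\<lambda>y. G' (T y)) has_derivative (\<lambda>z. frechet_derivative G' (at (T x)) (J x z))) (at x)"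
    using diff_chain_at[OF dT[OF x] has_frechet_derivative[OF metric_onD(6)[OF met' TS[OF x]]]]
    by (simp add: o_def)
  have "((\<lambda>y. J y u \<bullet> (G' (T y) *v J y v)) has_derivative
      (\<lambda>z. J x u \<bullet> (G' (T x) *v H x z v + frechet_derivative G' (at (T x)) (J x z) *v J x v)
          + H x z u \<bullet> (G' (T x) *v J x v))) (at x)"
    by (intro bounded_bilinear.FDERIV[OF bounded_bilinear_inner] bm dJ[OF x] G')
  then have 2: "((\<lambda>y. u \<bullet> (G y *v v)) has_derivative
      (\<lambda>z. J x u \<bullet> (G' (T x) *v H x z v + frechet_derivative G' (at (T x)) (J x z) *v J x v)
          + H x z u \<bullet> (G' (T x) *v J x v))) (at x)"
    by (rule has_derivative_transform_within_open[OF _ S(1) x]) (simp add: metric_pullback)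
  show ?thesis
    using has_derivative_unique[OF 1 2] by (simp add: fun_eq_iff inner_add_right)
qed

text \<open>Each of the three derivatives of the metric contributes two terms with H. By symmetry of
  H and of the metric, four of the six cancel and the remaining two are equal.\<close>

lemma koszul_pullback:
  assumes x: "x \<in> S"
  shows "koszul G x u v w = koszul G' (T x) (J x u) (J x v) (J x w) + J x w \<bullet> (G' (T x) *v H x u v)"
  unfolding koszul_def deriv_metric[OF x]
  using symH[OF x, of u w] symH[OF x, of v w] symH[OF x, of u v]
    metric_onD(5)[OF met' TS[OF x]]
  by (simp add: field_simps)

text \<open>Both sides have the same product with every J w, hence with every vector because J is
  onto, and the metric is nondegenerate.\<close>

lemma chris_pullback:
  assumes x: "x \<in> S"
  shows "J x (chris G x u v) = chris G' (T x) (J x u) (J x v) + H x u v"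
proof -
  define d where "d = J x (chris G x u v) - (chris G' (T x) (J x u) (J x v) + H x u v)"
  have "J x w \<bullet> (G' (T x) *v J x (chris G x u v)) =
      J x w \<bullet> (G' (T x) *v chris G' (T x) (J x u) (J x v)) + J x w \<bullet> (G' (T x) *v H x u v)" for w
    using chris_koszul[OF met x, of w u v] chris_koszul[OF met' TS[OF x], of "J x w" "J x u" "J x v"]
      koszul_pullback[OF x, of u v w] metric_pullback[OF x, of w] by simp
  then have "J x w \<bullet> (G' (T x) *v d) = 0" for w
    by (simp add: d_def matrix_vector_mult_diff_distrib matrix_vector_right_distrib inner_simps)
  then have "d \<bullet> (G' (T x) *v d) = 0" using pullback_surj[OF x] by (metis surjD)
  then have "d = 0" using metric_onD(4)[OF met' TS[OF x], of d] by fastforce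
  then show ?thesis by (simp add: d_def)
qed

private lemma deriv_chris_pullback:
  assumes x: "x \<in> S"
  shows "H x z (chris G x u v) + J x (frechet_derivative (\<lambda>y. chris G y u v) (at x) z) =
    frechet_derivative (\<lambda>y. chris G' y (J x u) (J x v)) (at (T x)) (J x z)
    + chris G' (T x) (H x z u) (J x v) + chris G' (T x) (J x u) (H x z v)
    + frechet_derivative (\<lambda>y. H y u v) (at x) z"
proof -
  have 1: "((\<lambda>y. J y (chris G y u v)) has_derivative
      (\<lambda>z. H x z (chris G x u v) + J x (frechet_derivative (\<lambda>y. chris G y u v) (at x) z))) (at x)"
    by (rule has_derivative_linear_family[OF S(1) x linJ dJ[OF x]
          smooth_on_has_derivative[OF smooth_chris[OF met] x]])
  have c: "((\<lambda>y. chris G' (T y) a b) has_derivative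
      (\<lambda>z. frechet_derivative (\<lambda>y. chris G' y a b) (at (T x)) (J x z))) (at x)" for a b
    using diff_chain_at[OF dT[OF x] smooth_on_has_derivative[OF smooth_chris[OF met'] TS[OF x]]]
    by (simp add: o_def)
  have c2: "((\<lambda>y. chris G' (T y) (J y u) b) has_derivative
      (\<lambda>z. frechet_derivative (\<lambda>y. chris G' y (J x u) b) (at (T x)) (J x z) + chris G' (T x) (H x z u) b)) (at x)" for b
    by (rule has_derivative_linear_family[OF S(1) x chris_linear(1)[OF met' TS] c dJ[OF x]])
  have "((\<lambda>y. chris G' (T y) (J y u) (J y v)) has_derivative
      (\<lambda>z. (frechet_derivative (\<lambda>y. chris G' y (J x u) (J x v)) (at (T x)) (J x z) + chris G' (T x) (H x z u) (J x v))
         + chris G' (T x) (J x u) (H x z v))) (at x)"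
    by (rule has_derivative_linear_family[OF S(1) x chris_linear(2)[OF met' TS] c2 dJ[OF x]])
  then have "((\<lambda>y. chris G' (T y) (J y u) (J y v) + H y u v) has_derivative
      (\<lambda>z. (frechet_derivative (\<lambda>y. chris G' y (J x u) (J x v)) (at (T x)) (J x z) + chris G' (T x) (H x z u) (J x v))
         + chris G' (T x) (J x u) (H x z v) + frechet_derivative (\<lambda>y. H y u v) (at x) z)) (at x)"
    by (intro has_derivative_add[OF _ dH[OF x]])
  then have 2: "((\<lambda>y. J y (chris G y u v)) has_derivative
      (\<lambda>z. (frechet_derivative (\<lambda>y. chris G' y (J x u) (J x v)) (at (T x)) (J x z) + chris G' (T x) (H x z u) (J x v))
         + chris G' (T x) (J x u) (H x z v) + frechet_derivative (\<lambda>y. H y u v) (at x) z)) (at x)"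
    by (rule has_derivative_transform_within_open[OF _ S(1) x]) (simp add: chris_pullback)
  show ?thesis using has_derivative_unique[OF 1 2] by (metis (no_types, lifting))
qed

text \<open>The terms with second or third derivatives of T are of two kinds: those symmetric in z
  and u drop out of the alternating difference, and the others cancel against the cross terms from
  the quadratic part of the curvature.\<close>

lemma curv_pullback:
  assumes x: "x \<in> S"
  shows "J x (curv G x z u w) = curv G' (T x) (J x z) (J x u) (J x w)"
proof -
  note c = chris_pullback[OF x]
  note l = linear_add[OF chris_linear(1)[OF met' TS[OF x]]] linear_add[OF chris_linear(2)[OF met' TS[OF x]]]
  have 1: "J x (chris G x a (chris G x b w)) =
      chris G' (T x) (J x a) (chris G' (T x) (J x b) (J x w)) + chris G' (T x) (J x a) (H x b w) + H x a (chris G x b w)" for a b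
    by (simp add: c l)
  have 2: "J x (frechet_derivative (\<lambda>y. chris G y b w) (at x) a) =
      frechet_derivative (\<lambda>y. chris G' y (J x b) (J x w)) (at (T x)) (J x a)
    + chris G' (T x) (H x a b) (J x w) + chris G' (T x) (J x b) (H x a w)
    + frechet_derivative (\<lambda>y. H y b w) (at x) a - H x a (chris G x b w)" for a b
    using deriv_chris_pullback[OF x, where z=a and u=b and v=w] by (simp add: algebra_simps)
  show ?thesis
    unfolding curv_def
    by (simp add: linear_add[OF linJ[OF x]] linear_diff[OF linJ[OF x]] 1 2 symH[OF x, of u z] symH3[OF x, where u=u and z=z and v=w])
qed

text \<open>The endomorphisms z -> R(z, u) w on both sides are conjugate by the Jacobian, so their
  traces agree.\<close>

lemma ric_pullback:
  assumes x: "x \<in> S"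
  shows "ric G x u w = ric G' (T x) (J x u) (J x w)"
proof -
  have tr: "(\<Sum>i\<in>UNIV. f (axis i 1) $ i) = trace (matrix f)" for f :: "real^'n \<Rightarrow> real^'n"
    by (simp add: trace_def matrix_def)
  define M where "M = matrix (\<lambda>z. curv G x z u w)"
  define M' where "M' = matrix (\<lambda>z. curv G' (T x) z (J x u) (J x w))"
  define A where "A = matrix (J x)"
  obtain B where B: "B ** A = mat 1" "A ** B = mat 1"
    using pullback_inj[OF x] matrix_left_invertible_injective[of A] matrix_left_right_inverse[of _ A]
      matrix_works_real[OF linJ[OF x]] unfolding A_def by (metis (no_types, lifting) ext)
  have m: "M *v z = curv G x z u w" "M' *v z = curv G' (T x) z (J x u) (J x w)" "A *v z = J x z" for z
    unfolding M_def M'_def A_def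
    using matrix_works_real[OF curv_linear(1)[OF met x]] matrix_works_real[OF curv_linear(1)[OF met' TS[OF x]]]
      matrix_works_real[OF linJ[OF x]] by blast+
  have "A ** M = M' ** A"
    unfolding matrix_eq by (simp add: matrix_vector_mul_assoc[symmetric] m curv_pullback[OF x])
  then have "M = B ** (M' ** A)" using B(1) by (metis matrix_mul_assoc matrix_mul_lid)
  then have "trace M = trace (M' ** A ** B)" by (metis trace_mul_sym)
  then have "trace M = trace M'" using B(2) by (simp add: matrix_mul_assoc[symmetric])
  then show ?thesis unfolding ric_def M_def M'_def
    using tr[of "\<lambda>z. curv G x z u w"] tr[of "\<lambda>z. curv G' (T x) z (J x u) (J x w)"] by simp
qed

text \<open>The Ricci matrix transforms by congruence with the Jacobian A, the inverse metric by
  congruence with its inverse B; the factors cancel under the cyclic trace.\<close>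

lemma scal_pullback:
  assumes x: "x \<in> S"
  shows "scal G x = scal G' (T x)"
proof -
  define R where "R = (\<chi> k j. ric G x (axis j 1) (axis k 1))"
  define R' where "R' = (\<chi> k j. ric G' (T x) (axis j 1) (axis k 1))"
  define A where "A = matrix (J x)"
  obtain B where B: "B ** A = mat 1" "A ** B = mat 1"
    using pullback_inj[OF x] matrix_left_invertible_injective[of A] matrix_left_right_inverse[of _ A]
      matrix_works_real[OF linJ[OF x]] unfolding A_def by (metis (no_types, lifting) ext)
  have A: "A *v z = J x z" for z unfolding A_def using matrix_works_real[OF linJ[OF x]] by blast
  have r: "w \<bullet> (R *v u) = ric G x u w" for u w
  proof -
    have "ric G x u w = (\<Sum>j\<in>UNIV. u $ j *\<^sub>R (\<Sum>k\<in>UNIV. w $ k *\<^sub>R ric G x (axis j 1) (axis k 1)))"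
      using linear_axis_expand[OF ric_linear(1)[OF met x], of u w]
        linear_axis_expand[OF ric_linear(2)[OF met x], of _ w] by simp
    also have "\<dots> = w \<bullet> (R *v u)"
      unfolding R_def inner_vec_def matrix_vector_mult_def
      by (simp add: sum_distrib_left) (subst sum.swap, simp add: algebra_simps)
    finally show ?thesis by simp
  qed
  have r': "w \<bullet> (R' *v u) = ric G' (T x) u w" for u w
  proof -
    have "ric G' (T x) u w = (\<Sum>j\<in>UNIV. u $ j *\<^sub>R (\<Sum>k\<in>UNIV. w $ k *\<^sub>R ric G' (T x) (axis j 1) (axis k 1)))"
      using linear_axis_expand[OF ric_linear(1)[OF met' TS[OF x]], of u w]
        linear_axis_expand[OF ric_linear(2)[OF met' TS[OF x]], of _ w] by simp
    also have "\<dots> = w \<bullet> (R' *v u)"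
      unfolding R'_def inner_vec_def matrix_vector_mult_def
      by (simp add: sum_distrib_left) (subst sum.swap, simp add: algebra_simps)
    finally show ?thesis by simp
  qed
  have "w \<bullet> (R *v u) = w \<bullet> ((transpose A ** R' ** A) *v u)" for u w
  proof -
    have "w \<bullet> (R *v u) = (A *v w) \<bullet> (R' *v (A *v u))"
      by (simp add: r r' A ric_pullback[OF x])
    also have "\<dots> = w \<bullet> (transpose A *v (R' *v (A *v u)))"
      by (metis dot_lmul_matrix transpose_matrix_vector transpose_transpose)
    finally show ?thesis by (simp add: matrix_vector_mul_assoc matrix_mul_assoc)
  qed
  then have R: "R = transpose A ** R' ** A" unfolding matrix_eq by (metis vector_eq_ldot)
  have G: "G x = transpose A ** G' (T x) ** A"
    using trans[OF x] by (simp add: A_def jacobian_def)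
  have tB: "transpose A ** transpose B = mat 1"
    using B(1) by (metis matrix_transpose_mul transpose_mat)
  have "G x ** (B ** matrix_inv (G' (T x)) ** transpose B) = transpose A ** (G' (T x) ** ((A ** B) ** matrix_inv (G' (T x)))) ** transpose B"
    by (simp add: G matrix_mul_assoc)
  also have "\<dots> = mat 1"
    by (simp add: B matrix_inv_mult[OF metric_onD(3)[OF met' TS[OF x]]] tB)
  finally have inv: "matrix_inv (G x) = B ** matrix_inv (G' (T x)) ** transpose B"
    by (rule matrix_inv_eqI)
  have sc: "scal G x = trace (matrix_inv (G x) ** R)" "scal G' (T x) = trace (matrix_inv (G' (T x)) ** R')"
    by (simp_all add: scal_def trace_def matrix_matrix_mult_def R_def R'_def)
  have tB': "transpose B ** transpose A = mat 1"
    using B(2) by (metis matrix_transpose_mul transpose_mat)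
  have "matrix_inv (G x) ** R = B ** ((matrix_inv (G' (T x)) ** ((transpose B ** transpose A) ** R')) ** A)"
    by (simp add: inv R matrix_mul_assoc)
  then have "trace (matrix_inv (G x) ** R) = trace ((matrix_inv (G' (T x)) ** R') ** A ** B)"
    by (simp add: tB' trace_mul_sym[of B])
  also have "\<dots> = trace (matrix_inv (G' (T x)) ** R')" by (simp add: matrix_mul_assoc[symmetric] B)
  finally show ?thesis by (simp add: sc)
qed

end

section \<open>Change of variables and the Riemannian volume\<close>

text \<open>The library proves change of variables for index types of class \<open>wellorder\<close> only; a copy of
  an arbitrary finite index type, ordered by some enumeration, removes this restriction.\<close>

typedef 'n windex = "UNIV :: 'n set" ..

lemma bij_Rep_windex: "bij Rep_windex"
  by (metis Abs_windex_inverse Rep_windex_inverse UNIV_I bij_betw_def injI surj_def)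

instance windex :: (finite) finite
proof
  show "finite (UNIV :: 'a windex set)"
    using finite_imageD[of Rep_windex UNIV] bij_Rep_windex
    by (metis bij_betw_def finite)
qed

definition windex_rank :: "'n::finite windex \<Rightarrow> nat" where
  "windex_rank = (SOME f. inj f)"

lemma inj_windex_rank: "inj (windex_rank :: 'n::finite windex \<Rightarrow> nat)"
proof -
  have "\<exists>f::'n windex \<Rightarrow> nat. inj f"
    using finite_imp_inj_to_nat_seg[of "UNIV :: 'n windex set"] by auto
  then show ?thesis unfolding windex_rank_def by (rule someI_ex)
qed

instantiation windex :: (finite) wellorder
begin
definition less_eq_windex :: "'a windex \<Rightarrow> 'a windex \<Rightarrow> bool" where
  "less_eq_windex a b \<longleftrightarrow> windex_rank a \<le> windex_rank b"
definition less_windex :: "'a windex \<Rightarrow> 'a windex \<Rightarrow> bool" where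
  "less_windex a b \<longleftrightarrow> windex_rank a < windex_rank b"
instance
proof
  fix P :: "'a windex \<Rightarrow> bool" and a
  assume step: "\<And>x. (\<And>y. y < x \<Longrightarrow> P y) \<Longrightarrow> P x"
  show "P a"
    by (induction a rule: measure_induct_rule[of windex_rank]) (use step less_windex_def in blast)
qed (auto simp: less_eq_windex_def less_windex_def dest: injD[OF inj_windex_rank])
end

definition to_windex :: "real^'n::finite \<Rightarrow> real^'n windex" where
  "to_windex x = (\<chi> i. x $ Rep_windex i)"

definition of_windex :: "real^'n windex \<Rightarrow> real^'n::finite" where
  "of_windex y = (\<chi> i. y $ Abs_windex i)"

lemma of_to_windex [simp]: "of_windex (to_windex x) = x"
  by (simp add: of_windex_def to_windex_def Abs_windex_inverse)

lemma to_of_windex [simp]: "to_windex (of_windex y) = y"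
  by (simp add: of_windex_def to_windex_def Rep_windex_inverse)

lemma linear_to_windex: "linear to_windex" and linear_of_windex: "linear of_windex"
  by (auto intro!: linearI simp: to_windex_def of_windex_def vec_eq_iff)

lemma bl_to_windex: "bounded_linear to_windex" and bl_of_windex: "bounded_linear of_windex"
  using linear_to_windex linear_of_windex by (simp_all add: linear_conv_bounded_linear)

lemma borel_measurable_windex [measurable]:
  "to_windex \<in> borel_measurable borel" "of_windex \<in> borel_measurable borel"
  using linear_continuous_on[OF bl_to_windex] linear_continuous_on[OF bl_of_windex]
  by (auto intro: borel_measurable_continuous_onI)

text \<open>Conjugation by the bijection of the index types matches the permutations in the Leibniz
  sum and preserves their signs.\<close>

lemma det_reindex:
  fixes A :: "real^'n::finite^'n"
  shows "det (\<chi> i j. A $ Rep_windex i $ Rep_windex j) = det A"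
proof -
  have inj: "inj (Rep_windex :: 'n windex \<Rightarrow> 'n)" "inj (Abs_windex :: 'n \<Rightarrow> 'n windex)"
    by (metis Rep_windex_inverse injI, metis Abs_windex_inverse UNIV_I injI)
  have invs: "inv (Rep_windex :: 'n windex \<Rightarrow> 'n) = Abs_windex" "inv (Abs_windex :: 'n \<Rightarrow> 'n windex) = Rep_windex"
    by (rule inv_unique_comp; simp add: fun_eq_iff Rep_windex_inverse Abs_windex_inverse)+
  have surj: "range (Rep_windex :: 'n windex \<Rightarrow> 'n) = UNIV" "range (Abs_windex :: 'n \<Rightarrow> 'n windex) = UNIV"
    by (metis Abs_windex_inverse UNIV_I surj_def, metis Rep_windex_inverse surj_def)
  have m1: "map_permutation UNIV Rep_windex p = Rep_windex \<circ> p \<circ> Abs_windex" for p :: "'n windex \<Rightarrow> 'n windex"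
    by (simp add: map_permutation_def invs surj restrict_id_def fun_eq_iff)
  have prm1: "Rep_windex \<circ> p \<circ> Abs_windex permutes UNIV" if "p permutes UNIV" for p :: "'n windex \<Rightarrow> 'n windex"
    using that inj surj by (simp add: permutes_univ bij_def inj_compose surj_def)
      (metis Abs_windex_inverse Rep_windex_inverse UNIV_I)
  have prm2: "Abs_windex \<circ> p \<circ> Rep_windex permutes UNIV" if "p permutes UNIV" for p :: "'n \<Rightarrow> 'n"
    using that inj surj by (simp add: permutes_univ bij_def inj_compose surj_def)
      (metis Abs_windex_inverse Rep_windex_inverse UNIV_I)
  have sg: "sign (Rep_windex \<circ> p \<circ> Abs_windex) = sign p" if "p permutes UNIV" for p :: "'n windex \<Rightarrow> 'n windex"
    using sign_map_permutation[OF inj(1) that] by (simp add: m1)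
  have pr: "(\<Prod>i\<in>UNIV. A $ i $ Rep_windex (p (Abs_windex i))) = (\<Prod>i\<in>UNIV. A $ Rep_windex i $ Rep_windex (p i))"
    for p :: "'n windex \<Rightarrow> 'n windex"
    by (rule prod.reindex_bij_witness[of _ Rep_windex Abs_windex])
       (auto simp: Rep_windex_inverse Abs_windex_inverse)
  show ?thesis
    unfolding det_def
    by (rule sum.reindex_bij_witness[where i="\<lambda>p. Abs_windex \<circ> p \<circ> Rep_windex" and j="\<lambda>p. Rep_windex \<circ> p \<circ> Abs_windex"])
       (auto simp: fun_eq_iff Rep_windex_inverse Abs_windex_inverse prm1 prm2 sg pr)
qed

lemma prod_Basis_vec: "(\<Prod>b\<in>Basis. (u::real^'n) \<bullet> b) = (\<Prod>i\<in>UNIV. u $ i)"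
proof -
  have B: "(Basis :: (real^'n) set) = (\<lambda>i. axis i 1) ` UNIV"
    by (auto simp: Basis_vec_def)
  have "inj (\<lambda>i. axis i 1 :: real^'n)" by (auto simp: inj_on_def axis_eq_axis)
  then show ?thesis unfolding B by (subst prod.reindex) (auto simp: inner_axis)
qed

text \<open>Boxes go to boxes with the same side lengths, and these values determine Lebesgue
  measure.\<close>

lemma lborel_windex: "distr lborel borel (to_windex :: real^'n::finite \<Rightarrow> _) = lborel"
proof (rule lborel_eqI[symmetric])
  fix l u :: "real^'n windex" assume lu: "\<And>b. b \<in> Basis \<Longrightarrow> l \<bullet> b \<le> u \<bullet> b"
  have lu': "l $ i \<le> u $ i" for i using lu[of "axis i 1"] by (simp add: inner_axis axis_in_Basis_iff)
  have "to_windex -` box l u = box (of_windex l) (of_windex u)"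
    by (auto simp: mem_box_cart to_windex_def of_windex_def)
       (metis Abs_windex_inverse UNIV_I Rep_windex_inverse)+
  then have "emeasure (distr lborel borel to_windex) (box l u) = emeasure lborel (box (of_windex l) (of_windex u))"
    by (simp add: emeasure_distr)
  also have "\<dots> = ennreal (\<Prod>b\<in>Basis. (of_windex u - of_windex l) \<bullet> b)"
    by (rule emeasure_lborel_box) (auto simp: Basis_vec_def inner_axis of_windex_def lu')
  also have "(\<Prod>b\<in>Basis. (of_windex u - of_windex l) \<bullet> b) = (\<Prod>b\<in>Basis. (u - l) \<bullet> b)"
    unfolding prod_Basis_vec of_windex_def
    by (rule prod.reindex_bij_witness[of _ Rep_windex Abs_windex])
       (auto simp: Rep_windex_inverse Abs_windex_inverse)
  finally show "emeasure (distr lborel borel to_windex) (box l u) = ennreal (\<Prod>b\<in>Basis. (u - l) \<bullet> b)" .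
qed simp

text \<open>\<open>has_measure_differentiable_image\<close> is an equivalence about finite values.
  If either side is finite it yields equality; otherwise both sides are infinite.\<close>

lemma emeasure_differentiable_image_wellorder:
  fixes g :: "real^'n::{finite,wellorder} \<Rightarrow> real^'n::_"
  assumes B: "B \<in> sets borel" "g ` B \<in> sets borel"
    and d: "\<And>x. x \<in> B \<Longrightarrow> (g has_derivative g' x) (at x within B)" and inj: "inj_on g B"
    and m: "(\<lambda>x. indicator B x * \<bar>det (matrix (g' x))\<bar>) \<in> borel_measurable borel"
  shows "emeasure lborel (g ` B) = (\<integral>\<^sup>+x. ennreal (indicator B x * \<bar>det (matrix (g' x))\<bar>) \<partial>lborel)"
proof -
  let ?h = "\<lambda>x. \<bar>det (matrix (g' x))\<bar>"
  have Bl: "B \<in> sets lebesgue" using B by simp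
  note cv = has_measure_differentiable_image[OF Bl d inj]
  have eqI: ?thesis if "(?h has_integral r) B" for r
  proof -
    have "g ` B \<in> lmeasurable" "measure lebesgue (g ` B) = r" using cv[of r] that by auto
    then have "emeasure lborel (g ` B) = ennreal r"
      using B(2) emeasure_eq_measure2[of "g ` B" lebesgue] by simp
    moreover have "(\<integral>\<^sup>+x. ennreal (indicator B x * ?h x) \<partial>lborel) = ennreal r"
      by (rule nn_integral_has_integral_lebesgue[OF _ that]) simp
    ultimately show ?thesis by simp
  qed
  show ?thesis
  proof (cases "(\<integral>\<^sup>+x. ennreal (indicator B x * ?h x) \<partial>lborel) < \<infinity>")
    case True
    have "(\<lambda>x. indicator B x * ?h x) integrable_on UNIV"
      by (rule nn_integral_integrable_on[OF m _ True]) simp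
    then obtain r where "((\<lambda>x. indicator B x * ?h x) has_integral r) UNIV" by auto
    moreover have "(\<lambda>x. indicator B x * ?h x) = (\<lambda>x. if x \<in> B then ?h x else 0)"
      by (auto simp: fun_eq_iff)
    ultimately have "(?h has_integral r) B" by (simp only: has_integral_restrict_UNIV)
    then show ?thesis by (rule eqI)
  next
    case False
    show ?thesis
    proof (cases "emeasure lborel (g ` B) < \<infinity>")
      case True
      then have "g ` B \<in> lmeasurable"
        using B(2) by (simp add: fmeasurable_def)
      then have "(?h has_integral measure lebesgue (g ` B)) B" using cv by blast
      then show ?thesis by (rule eqI)
    qed (use False in \<open>simp add: not_less top.extremum_unique\<close>)
  qed
qed

lemma emeasure_differentiable_image:
  fixes g :: "real^'n::finite \<Rightarrow> real^'n"
  assumes B: "B \<in> sets borel" "g ` B \<in> sets borel"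
    and d: "\<And>x. x \<in> B \<Longrightarrow> (g has_derivative g' x) (at x within B)" and inj: "inj_on g B"
    and m: "(\<lambda>x. indicator B x * \<bar>det (matrix (g' x))\<bar>) \<in> borel_measurable borel"
  shows "emeasure lborel (g ` B) = (\<integral>\<^sup>+x. ennreal (indicator B x * \<bar>det (matrix (g' x))\<bar>) \<partial>lborel)"
proof -
  define f where "f = to_windex \<circ> g \<circ> of_windex"
  define f' where "f' y = to_windex \<circ> g' (of_windex y) \<circ> of_windex" for y
  define C where "C = of_windex -` B"
  have im: "to_windex ` X = of_windex -` X" for X :: "(real^'n) set"
    by (auto simp: image_iff) (metis to_of_windex)
  have C: "C \<in> sets borel" unfolding C_def
    using measurable_sets[OF borel_measurable_windex(2) B(1)] by simp
  have fC: "f ` C = of_windex -` (g ` B)" unfolding f_def C_def im[symmetric] by (auto simp: image_iff)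
  then have fCb: "f ` C \<in> sets borel"
    using measurable_sets[OF borel_measurable_windex(2) B(2)] by simp
  have det: "det (matrix (f' y)) = det (matrix (g' (of_windex y)))" for y
  proof -
    have "matrix (f' y) = (\<chi> i j. matrix (g' (of_windex y)) $ Rep_windex i $ Rep_windex j)"
    proof -
      have "of_windex (axis j 1) = (axis (Rep_windex j) 1 :: real^'n)" for j
        by (auto simp: of_windex_def axis_def vec_eq_iff Rep_windex_inverse Abs_windex_inverse)
      then show ?thesis by (simp add: matrix_def f'_def to_windex_def)
    qed
    then show ?thesis by (simp add: det_reindex)
  qed
  have ind: "indicator C y = (indicator B (of_windex y) :: real)" for y by (simp add: C_def indicator_def)
  have m': "(\<lambda>x. indicator C x * \<bar>det (matrix (f' x))\<bar>) \<in> borel_measurable borel"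
    unfolding det ind using measurable_compose[OF borel_measurable_windex(2) m] by simp
  have "emeasure lborel (f ` C) = (\<integral>\<^sup>+x. ennreal (indicator C x * \<bar>det (matrix (f' x))\<bar>) \<partial>lborel)"
  proof (rule emeasure_differentiable_image_wellorder[OF C fCb _ _ m'])
    fix y assume y: "y \<in> C"
    have 1: "(of_windex has_derivative of_windex) (at y within C)"
      by (rule bounded_linear_imp_has_derivative[OF bl_of_windex])
    have iC: "of_windex ` C = B" by (auto simp: C_def image_iff) (metis of_to_windex)
    have 2: "(g has_derivative g' (of_windex y)) (at (of_windex y) within of_windex ` C)"
      unfolding iC using d[of "of_windex y"] y by (simp add: C_def)
    show "(f has_derivative f' y) (at y within C)"
      using bounded_linear.has_derivative[OF bl_to_windex diff_chain_within[OF 1 2]]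
      by (simp add: f_def f'_def o_def)
  next
    have "inj_on of_windex C" "of_windex ` C = B" "inj to_windex"
      by (metis inj_on_def to_of_windex, auto simp: C_def image_iff inj_def) (metis of_to_windex)+
    then show "inj_on f C" unfolding f_def using inj
      by (intro comp_inj_on) (auto intro: inj_on_subset)
  qed
  also have "\<dots> = (\<integral>\<^sup>+x. ennreal (indicator C x * \<bar>det (matrix (f' x))\<bar>) \<partial>distr lborel borel to_windex)"
    by (simp add: lborel_windex)
  also have "\<dots> = (\<integral>\<^sup>+x. ennreal (indicator B x * \<bar>det (matrix (g' x))\<bar>) \<partial>lborel)"
    using m' by (subst nn_integral_distr) (auto simp: det ind)
  finally show ?thesis
  proof -
    assume a: "emeasure lborel (f ` C) = (\<integral>\<^sup>+x. ennreal (indicator B x * \<bar>det (matrix (g' x))\<bar>) \<partial>lborel)"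
    have "emeasure lborel (f ` C) = emeasure (distr lborel borel to_windex) (f ` C)" by (simp add: lborel_windex)
    also have "\<dots> = emeasure lborel (g ` B)"
    proof -
      have "to_windex -` (f ` C) = g ` B" unfolding fC by auto
      then show ?thesis using fCb by (subst emeasure_distr) simp_all
    qed
    finally show ?thesis using a by simp
  qed
qed

text \<open>The area formula above says that two measures agree: the push-forward of |det DT| dx
  under T, and Lebesgue measure on the image. Integrating f against both gives the claim.\<close>

lemma nn_integral_change_of_variables:
  fixes T :: "real^'n::finite \<Rightarrow> real^'n"
  assumes S: "open S" and T: "smooth_on S T" and inj: "inj_on T S" and TS: "T ` S \<in> sets borel"
    and f[measurable]: "f \<in> borel_measurable borel"
  shows "(\<integral>\<^sup>+x\<in>T ` S. f x \<partial>lborel) =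
    (\<integral>\<^sup>+x\<in>S. ennreal \<bar>det (matrix (frechet_derivative T (at x)))\<bar> * f (T x) \<partial>lborel)"
proof -
  let ?J = "\<lambda>x. \<bar>det (matrix (frechet_derivative T (at x)))\<bar>"
  have [measurable]: "S \<in> sets borel" using S by simp
  \<comment> \<open>T is continuous on S; extended by 0 it becomes measurable on the whole space, as
    the push-forward requires.\<close>
  define T' where "T' x = indicator S x *\<^sub>R T x" for x
  have T'[measurable]: "T' \<in> borel_measurable borel" unfolding T'_def
    by (rule borel_measurable_continuous_on_indicator) (use smooth_on_continuous[OF T] in auto)
  have "smooth_on S (\<lambda>x. matrix (frechet_derivative T (at x)))"
    unfolding matrix_def
    by (intro smooth_on_vec_lambda smooth_on_vec_nth S smooth_on_frechet_derivative T)
  then have "continuous_on S (\<lambda>x. det (matrix (frechet_derivative T (at x))))"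
    by (intro smooth_on_continuous smooth_on_det S)
  then have J: "(\<lambda>x. indicator S x *\<^sub>R ?J x) \<in> borel_measurable borel"
    by (intro borel_measurable_continuous_on_indicator continuous_on_rabs) auto
  then have [measurable]: "(\<lambda>x. indicator S x * ?J x) \<in> borel_measurable borel" by simp
  define N1 where "N1 = distr (density lborel (\<lambda>x. ennreal (indicator S x * ?J x))) borel T'"
  define N2 where "N2 = density lborel (indicator (T ` S))"
  have "N1 = N2"
  proof (rule measure_eqI)
    fix X assume "X \<in> sets N1"
    then have X[measurable]: "X \<in> sets borel" by (simp add: N1_def)
    define B where "B = S \<inter> T' -` X"
    have B: "B \<in> sets borel" unfolding B_def using measurable_sets[OF T' X] by simp
    have TB: "T ` B = X \<inter> T ` S" unfolding B_def T'_def by auto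
    have BS: "B \<subseteq> S" by (auto simp: B_def)
    have "emeasure lborel (T ` B) = (\<integral>\<^sup>+x. ennreal (indicator B x * ?J x) \<partial>lborel)"
    proof (rule emeasure_differentiable_image[OF B])
      show "T ` B \<in> sets borel" unfolding TB using TS by simp
      show "(T has_derivative frechet_derivative T (at x)) (at x within B)" if "x \<in> B" for x
        using smooth_on_has_derivative[OF T] that BS has_derivative_at_withinI by blast
      show "inj_on T B" using inj BS inj_on_subset by blast
      have "(\<lambda>x. indicator B x * ?J x) = (\<lambda>x. indicator B x * (indicator S x * ?J x))"
        using BS by (auto simp: fun_eq_iff indicator_def)
      then show "(\<lambda>x. indicator B x * ?J x) \<in> borel_measurable borel" using B by simp
    qed
    moreover have "emeasure N2 X = emeasure lborel (T ` B)"
      unfolding N2_def TB using TS by (simp add: emeasure_density indicator_inter_arith[symmetric] Int_commute)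
    moreover have "emeasure N1 X = (\<integral>\<^sup>+x. ennreal (indicator B x * ?J x) \<partial>lborel)"
    proof -
      have X': "T' -` X \<in> sets borel" using measurable_sets[OF T' X] by simp
      have "emeasure N1 X = emeasure (density lborel (\<lambda>x. ennreal (indicator S x * ?J x))) (T' -` X)"
        unfolding N1_def by (subst emeasure_distr) simp_all
      also have "\<dots> = (\<integral>\<^sup>+x\<in>T' -` X. ennreal (indicator S x * ?J x) \<partial>lborel)"
        by (rule emeasure_density) (use X' in simp_all)
      also have "\<dots> = (\<integral>\<^sup>+x. ennreal (indicator B x * ?J x) \<partial>lborel)"
        by (intro nn_integral_cong) (auto simp: B_def indicator_def)
      finally show ?thesis .
    qed
    ultimately show "emeasure N1 X = emeasure N2 X" by simp
  qed (simp add: N1_def N2_def)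
  then have "(\<integral>\<^sup>+x. f x \<partial>N1) = (\<integral>\<^sup>+x. f x \<partial>N2)" by simp
  moreover have "(\<integral>\<^sup>+x. f x \<partial>N2) = (\<integral>\<^sup>+x\<in>T ` S. f x \<partial>lborel)"
    unfolding N2_def using TS by (simp add: nn_integral_density mult.commute)
  moreover have "(\<integral>\<^sup>+x. f x \<partial>N1) = (\<integral>\<^sup>+x\<in>S. ennreal (?J x) * f (T x) \<partial>lborel)"
    unfolding N1_def
    by (simp add: nn_integral_distr nn_integral_density)
       (auto intro!: nn_integral_cong simp: T'_def indicator_def)
  ultimately show ?thesis by simp
qed

text \<open>The segment from the identity to G consists of positive definite matrices, so the
  determinant has no zero on it and keeps the sign it has at the identity.\<close>

lemma pos_def_det_pos:
  fixes G :: "real^'n::finite^'n"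
  assumes "\<forall>v. v \<noteq> 0 \<longrightarrow> v \<bullet> (G *v v) > 0"
  shows "det G > 0"
proof -
  define H where "H = (\<lambda>t::real. (1 - t) *\<^sub>R mat 1 + t *\<^sub>R G)"
  have mv: "H t *v v = (1 - t) *\<^sub>R v + t *\<^sub>R (G *v v)" for t v
    by (simp add: H_def matrix_vector_mult_add_rdistrib scaleR_matrix_vector_assoc[symmetric])
  have pd: "v \<bullet> (H t *v v) > 0" if "v \<noteq> 0" "0 \<le> t" "t \<le> 1" for t v
  proof (cases "t = 0")
    case False
    have "v \<bullet> (G *v v) > 0" "v \<bullet> v > 0" using assms that by auto
    then have "t * (v \<bullet> (G *v v)) > 0" "(1 - t) * (v \<bullet> v) \<ge> 0" using that False by auto
    then show ?thesis by (simp add: mv inner_simps)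
  qed (use that in \<open>simp add: mv inner_simps\<close>)
  then have nz: "det (H t) \<noteq> 0" if "0 \<le> t" "t \<le> 1" for t
    using pos_def_invertible[of "H t"] that by (simp add: invertible_det_nz)
  have "continuous_on {0..1} (\<lambda>t. det (H t))" unfolding det_def H_def
    by (intro continuous_intros)
  then have "\<not> det (H 1) < 0"
    using IVT2'[of "\<lambda>t. det (H t)" 1 0 0] nz by (force simp: H_def det_I)
  moreover have "det (H 1) \<noteq> 0" using nz by auto
  ultimately show ?thesis by (simp add: H_def)
qed

section \<open>Charts and transition maps of a closed Riemannian manifold\<close>

locale closed_riemannian =
  fixes M :: "'a::topological_space set" and A :: "('a, 'n::finite) chart set" and g :: "('a, 'n) metric_field"
  assumes closed_riem: "closed_riemannian_manifold M A g"
begin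

abbreviation "R \<equiv> scalar_curvature A g"
abbreviation "vol \<equiv> riemannian_volume M A g"
abbreviation "cat p \<equiv> chart_at A p"

lemma compact_M: "compact M" and Hausdorff_M: "Hausdorff_space (top_of_set M)" and M_nonempty: "M \<noteq> {}"
  using closed_riem by (auto simp: closed_riemannian_manifold_def smooth_manifold_def)

lemma smooth_atlas_A: "smooth_atlas M A"
  using closed_riem by (auto simp: closed_riemannian_manifold_def smooth_manifold_def)

lemma chartD:
  assumes "c \<in> A"
  shows "openin (top_of_set M) (chart_dom c)" "open (chart_img c)"
    "continuous_on (chart_dom c) (chart_map c)" "continuous_on (chart_img c) (chart_inv c)"
    "p \<in> chart_dom c \<Longrightarrow> chart_inv c (chart_map c p) = p"
    "x \<in> chart_img c \<Longrightarrow> chart_inv c x \<in> chart_dom c"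
    "x \<in> chart_img c \<Longrightarrow> chart_map c (chart_inv c x) = x"
    "chart_dom c \<subseteq> M"
proof -
  have c: "is_chart M c" using assms smooth_atlas_A by (auto simp: smooth_atlas_def)
  then have h: "homeomorphism (chart_dom c) (chart_img c) (chart_map c) (chart_inv c)"
    by (simp add: is_chart_def)
  show "openin (top_of_set M) (chart_dom c)" "open (chart_img c)" using c by (auto simp: is_chart_def)
  then show "chart_dom c \<subseteq> M" using openin_imp_subset by blast
  show "continuous_on (chart_dom c) (chart_map c)" "continuous_on (chart_img c) (chart_inv c)"
    using h by (auto simp: homeomorphism_def)
  show "p \<in> chart_dom c \<Longrightarrow> chart_inv c (chart_map c p) = p"
    "x \<in> chart_img c \<Longrightarrow> chart_inv c x \<in> chart_dom c"
    "x \<in> chart_img c \<Longrightarrow> chart_map c (chart_inv c x) = x"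
    using h by (auto simp: homeomorphism_def)
qed

lemma metric_chart: "c \<in> A \<Longrightarrow> metric_on (chart_img c) (g c)"
  using closed_riem chartD(2)
  by (auto simp: closed_riemannian_manifold_def riemannian_metric_def metric_on_def)

lemma chart_at: "p \<in> M \<Longrightarrow> cat p \<in> A" "p \<in> M \<Longrightarrow> p \<in> chart_dom (cat p)"
proof -
  assume "p \<in> M"
  then have "\<exists>c. c \<in> A \<and> p \<in> chart_dom c" using smooth_atlas_A by (auto simp: smooth_atlas_def)
  then have "cat p \<in> A \<and> p \<in> chart_dom (cat p)" unfolding chart_at_def by (rule someI_ex)
  then show "cat p \<in> A" "p \<in> chart_dom (cat p)" by auto
qed

definition overlap where "overlap c d = chart_map c ` (chart_dom c \<inter> chart_dom d)"

lemma overlap: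
  assumes "c \<in> A" "d \<in> A"
  shows "open (overlap c d)" "overlap c d \<subseteq> chart_img c" "smooth_on (overlap c d) (transition c d)"
    "transition c d ` overlap c d = overlap d c" "inj_on (transition c d) (overlap c d)"
    "p \<in> chart_dom c \<Longrightarrow> p \<in> chart_dom d \<Longrightarrow> chart_map c p \<in> overlap c d"
    "p \<in> chart_dom c \<Longrightarrow> p \<in> chart_dom d \<Longrightarrow> transition c d (chart_map c p) = chart_map d p"
    "x \<in> overlap c d \<Longrightarrow> chart_inv d (transition c d x) = chart_inv c x"
    "x \<in> overlap c d \<Longrightarrow> chart_inv c x \<in> chart_dom c \<inter> chart_dom d"
proof -
  show sub: "overlap c d \<subseteq> chart_img c" by (auto simp: overlap_def)
  show "smooth_on (overlap c d) (transition c d)"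
    using smooth_atlas_A assms by (auto simp: smooth_atlas_def overlap_def)
  have eq: "overlap c d = chart_img c \<inter> chart_inv c -` (chart_dom c \<inter> chart_dom d)"
    using chartD(5-7)[OF assms(1)] by (force simp: overlap_def)
  have "openin (top_of_set (chart_dom c)) (chart_dom c \<inter> chart_dom d)"
    using chartD(1,8)[OF assms(1)] chartD(1)[OF assms(2)]
    by (metis openin_Int openin_subset_trans inf_le1)
  then have "openin (top_of_set (chart_img c)) (overlap c d)"
    unfolding eq using chartD(4,6)[OF assms(1)]
    by (intro continuous_on_open_gen[THEN iffD1, rule_format, of "chart_inv c"]) auto
  then show "open (overlap c d)" using chartD(2)[OF assms(1)] openin_open_eq by blast
  show t: "p \<in> chart_dom c \<Longrightarrow> p \<in> chart_dom d \<Longrightarrow> transition c d (chart_map c p) = chart_map d p" for p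
    using chartD(5)[OF assms(1)] by (simp add: transition_def)
  show "p \<in> chart_dom c \<Longrightarrow> p \<in> chart_dom d \<Longrightarrow> chart_map c p \<in> overlap c d"
    by (auto simp: overlap_def)
  show "transition c d ` overlap c d = overlap d c"
    unfolding overlap_def by (auto simp: t image_iff)
  show "x \<in> overlap c d \<Longrightarrow> chart_inv d (transition c d x) = chart_inv c x"
    using chartD(5)[OF assms(1)] chartD(5)[OF assms(2)] by (auto simp: overlap_def t)
  show "x \<in> overlap c d \<Longrightarrow> chart_inv c x \<in> chart_dom c \<inter> chart_dom d"
    using chartD(5)[OF assms(1)] chartD(5)[OF assms(2)] by (auto simp: overlap_def)
  show "inj_on (transition c d) (overlap c d)"
    using chartD(5)[OF assms(1)] chartD(5)[OF assms(2)] by (auto simp: inj_on_def overlap_def t) metis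
qed

lemma metric_overlap:
  assumes "c \<in> A" "d \<in> A"
  shows "metric_on (overlap c d) (g c)"
    "\<And>x. x \<in> overlap c d \<Longrightarrow> g c x = transpose (jacobian (transition c d) (at x)) ** g d (transition c d x)
                  ** jacobian (transition c d) (at x)"
proof -
  show "metric_on (overlap c d) (g c)"
    using metric_chart[OF assms(1)] overlap(1,2)[OF assms] unfolding metric_on_def
    by (auto intro: smooth_on_subset)
  show "\<And>x. x \<in> overlap c d \<Longrightarrow> g c x = transpose (jacobian (transition c d) (at x)) ** g d (transition c d x)
                  ** jacobian (transition c d) (at x)"
    using closed_riem assms unfolding closed_riemannian_manifold_def riemannian_metric_def overlap_def
    by blast
qed

lemma transition_subset: "c \<in> A \<Longrightarrow> d \<in> A \<Longrightarrow> transition c d ` overlap c d \<subseteq> chart_img d"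
  using overlap(4)[of c d] overlap(2)[of d c] by simp

text \<open>\<open>scal_pullback\<close> along the transition from the chosen chart to c. From here
  on R can be computed in any chart, which is what its continuity needs.\<close>

lemma scalar_curvature_chart:
  assumes "c \<in> A" "p \<in> chart_dom c"
  shows "R p = scal (g c) (chart_map c p)"
proof -
  define d where "d = cat p"
  have p: "p \<in> M" using assms chartD(8) by blast
  have d: "d \<in> A" "p \<in> chart_dom d" using chart_at p by (auto simp: d_def)
  have "R p = scal (g d) (chart_map d p)"
    unfolding scalar_curvature_def Let_def d_def[symmetric]
    by (rule scal_eq[OF metric_chart[OF d(1)]]) (use d in auto)
  also have "\<dots> = scal (g c) (transition d c (chart_map d p))"
    by (rule scal_pullback[OF metric_overlap(1)[OF d(1) assms(1)] metric_chart[OF assms(1)]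
          overlap(3)[OF d(1) assms(1)] transition_subset[OF d(1) assms(1)] metric_overlap(2)[OF d(1) assms(1)]])
       (use overlap(6) d assms in auto)
  finally show ?thesis using overlap(7) d assms by simp
qed

lemma continuous_on_manifoldI:
  assumes "\<And>c. c \<in> A \<Longrightarrow> continuous_on (chart_img c) (f \<circ> chart_inv c)"
  shows "continuous_on M f"
  unfolding continuous_on_def
proof
  fix p assume p: "p \<in> M"
  define c where "c = cat p"
  have c: "c \<in> A" "p \<in> chart_dom c" using chart_at p by (auto simp: c_def)
  obtain T where T: "open T" "chart_dom c = M \<inter> T" using chartD(1)[OF c(1)] by (auto simp: openin_open)
  have "continuous_on (chart_dom c) (\<lambda>p. (f \<circ> chart_inv c) (chart_map c p))"
    by (rule continuous_on_compose2[OF assms[OF c(1)] chartD(3)[OF c(1)]]) auto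
  then have "continuous_on (chart_dom c) f"
    by (rule continuous_on_eq) (simp add: chartD(5)[OF c(1)])
  then have "(f \<longlongrightarrow> f p) (at p within chart_dom c)" using c by (simp add: continuous_on_def)
  moreover have "at p within M = at p within chart_dom c"
    by (rule at_within_nhd[of p T]) (use T c in auto)
  ultimately show "(f \<longlongrightarrow> f p) (at p within M)" by simp
qed

lemma continuous_on_R: "continuous_on M R"
proof (rule continuous_on_manifoldI)
  fix c assume c: "c \<in> A"
  have "continuous_on (chart_img c) (scal (g c))"
    by (rule smooth_on_continuous[OF smooth_scal[OF metric_chart[OF c]]])
  then show "continuous_on (chart_img c) (R \<circ> chart_inv c)"
    by (rule continuous_on_eq) (simp add: scalar_curvature_chart[OF c] chartD(6,7)[OF c])
qed

section \<open>Existence and uniqueness of the Riemannian volume\<close>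

abbreviation "msets \<equiv> sets (restrict_space borel M)"
abbreviation "vden c x \<equiv> sqrt (det (g c x))"

lemma openin_msets:
  assumes "openin (top_of_set M) U"
  shows "U \<in> msets"
proof -
  obtain T where "open T" "U = M \<inter> T" using assms unfolding openin_open by blast
  then show ?thesis unfolding sets_restrict_space by (intro image_eqI[of _ _ T]) simp_all
qed

lemma dom_msets: "c \<in> A \<Longrightarrow> chart_dom c \<in> msets"
  using openin_msets chartD(1) by blast

lemma continuous_vden: "c \<in> A \<Longrightarrow> continuous_on (chart_img c) (vden c)"
  by (intro continuous_on_real_sqrt smooth_on_continuous smooth_on_det metric_onD(1,2)[OF metric_chart])

lemma vden_pos: "c \<in> A \<Longrightarrow> x \<in> chart_img c \<Longrightarrow> vden c x > 0"
  using pos_def_det_pos[of "g c x"] metric_onD(4)[OF metric_chart, of c x] by simp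

text \<open>The push-forward of sqrt(det g) dx as a measure on all of M that gives no mass to the
  complement of the chart domain. It can thus be evaluated on every measurable set.\<close>

definition chart_measure :: "('a, 'n) chart \<Rightarrow> 'a measure" where
  "chart_measure c = distr (density (restrict_space lborel (chart_img c)) (\<lambda>x. ennreal (vden c x)))
     (restrict_space borel M) (chart_inv c)"

lemma measurable_chart_inv:
  assumes "c \<in> A"
  shows "chart_inv c \<in> measurable (restrict_space borel (chart_img c)) (restrict_space borel M)"
  by (rule measurable_restrict_space2)
     (use chartD(6,8)[OF assms] borel_measurable_continuous_on_restrict[OF chartD(4)[OF assms]]
       in \<open>auto simp: space_restrict_space\<close>)

lemma nn_integral_chart_measure:
  assumes c: "c \<in> A" and f: "f \<in> borel_measurable (restrict_space borel M)"
  shows "(\<integral>\<^sup>+p. f p \<partial>chart_measure c) = (\<integral>\<^sup>+x\<in>chart_img c. ennreal (vden c x) * f (chart_inv c x) \<partial>lborel)"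
proof -
  have o: "chart_img c \<in> sets borel" using chartD(2)[OF c] by simp
  have s: "sets (restrict_space lborel (chart_img c)) = sets (restrict_space borel (chart_img c))"
    by (rule sets_restrict_space_cong) simp
  have m: "chart_inv c \<in> measurable (restrict_space lborel (chart_img c)) (restrict_space borel M)"
    using measurable_chart_inv[OF c] measurable_cong_sets[OF s refl] by auto
  have v: "(\<lambda>x. ennreal (vden c x)) \<in> borel_measurable (restrict_space lborel (chart_img c))"
    using borel_measurable_continuous_on_restrict[OF continuous_vden[OF c]] measurable_cong_sets[OF s refl]
    by (intro measurable_compose[OF _ measurable_ennreal]) auto
  have "(\<integral>\<^sup>+p. f p \<partial>chart_measure c) = (\<integral>\<^sup>+x. f (chart_inv c x) \<partial>density (restrict_space lborel (chart_img c)) (\<lambda>x. ennreal (vden c x)))"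
    unfolding chart_measure_def
    by (rule nn_integral_distr) (use m f in auto)
  also have "\<dots> = (\<integral>\<^sup>+x. ennreal (vden c x) * f (chart_inv c x) \<partial>restrict_space lborel (chart_img c))"
    by (rule nn_integral_density[OF v measurable_compose[OF m f]])
  also have "\<dots> = (\<integral>\<^sup>+x\<in>chart_img c. ennreal (vden c x) * f (chart_inv c x) \<partial>lborel)"
    by (rule nn_integral_restrict_space) (use o in simp)
  finally show ?thesis .
qed

lemma emeasure_chart_measure:
  assumes c: "c \<in> A" and B: "B \<in> msets"
  shows "emeasure (chart_measure c) B = (\<integral>\<^sup>+x\<in>chart_map c ` (B \<inter> chart_dom c). ennreal (vden c x) \<partial>lborel)"
proof -
  have "emeasure (chart_measure c) B = (\<integral>\<^sup>+p. indicator B p \<partial>chart_measure c)"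
    by (rule nn_integral_indicator[symmetric]) (use B in \<open>simp add: chart_measure_def\<close>)
  also have "\<dots> = (\<integral>\<^sup>+x\<in>chart_img c. ennreal (vden c x) * indicator B (chart_inv c x) \<partial>lborel)"
    by (rule nn_integral_chart_measure[OF c]) (use B in simp)
  also have "\<dots> = (\<integral>\<^sup>+x\<in>chart_map c ` (B \<inter> chart_dom c). ennreal (vden c x) \<partial>lborel)"
  proof (rule nn_integral_cong)
    fix x
    have "x \<in> chart_map c ` (B \<inter> chart_dom c) \<longleftrightarrow> x \<in> chart_img c \<and> chart_inv c x \<in> B"
      using chartD(5-7)[OF c] by force
    then show "ennreal (vden c x) * indicator B (chart_inv c x) * indicator (chart_img c) x
      = ennreal (vden c x) * indicator (chart_map c ` (B \<inter> chart_dom c)) x"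
      by (auto simp: indicator_def)
  qed
  finally show ?thesis .
qed

lemma sets_chart_measure [simp]: "sets (chart_measure c) = msets"
  by (simp add: chart_measure_def)

lemma measurable_chart_image:
  assumes c: "c \<in> A" and B: "B \<in> msets" "B \<subseteq> chart_dom c"
  shows "chart_map c ` B \<in> sets borel"
proof -
  have "chart_map c ` B = chart_inv c -` B \<inter> chart_img c"
    using chartD(5-7)[OF c] B(2) by force
  moreover have "chart_inv c -` B \<inter> space (restrict_space borel (chart_img c)) \<in> sets (restrict_space borel (chart_img c))"
    by (rule measurable_sets[OF measurable_chart_inv[OF c] B(1)])
  ultimately have "chart_map c ` B \<in> sets (restrict_space borel (chart_img c))"
    by (simp add: space_restrict_space)
  then show ?thesis using chartD(2)[OF c] by (subst (asm) sets_restrict_space_iff) auto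
qed

lemma vden_transition:
  assumes "c \<in> A" "d \<in> A" "x \<in> overlap c d"
  shows "vden c x = \<bar>det (matrix (frechet_derivative (transition c d) (at x)))\<bar> * vden d (transition c d x)"
proof -
  have "det (g c x) = (det (jacobian (transition c d) (at x)))\<^sup>2 * det (g d (transition c d x))"
    using metric_overlap(2)[OF assms] by (simp add: det_mul det_transpose power2_eq_square)
  then show ?thesis by (simp add: real_sqrt_mult jacobian_def)
qed

text \<open>Change of variables for the transition map, whose Jacobian factor is absorbed by the two
  densities according to \<open>vden_transition\<close>.\<close>

lemma chart_measure_compat:
  assumes cd: "c \<in> A" "d \<in> A" and B: "B \<in> msets" "B \<subseteq> chart_dom c" "B \<subseteq> chart_dom d"
  shows "emeasure (chart_measure c) B = emeasure (chart_measure d) B"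
proof -
  let ?T = "transition c d"
  let ?J = "\<lambda>x. \<bar>det (matrix (frechet_derivative ?T (at x)))\<bar>"
  note ov = overlap[OF cd]
  have img: "chart_map d ` B \<in> sets borel" by (rule measurable_chart_image[OF cd(2) B(1,3)])
  have Bd: "B \<inter> chart_dom d = B" "B \<inter> chart_dom c = B" using B by auto
  \<comment> \<open>The density is cut off outside the chart image, where nothing is known about it,
    so that it is Borel on the whole space.\<close>
  define f where "f y = ennreal (indicator (chart_img d) y *\<^sub>R vden d y) * indicator (chart_map d ` B) y" for y
  have "(\<lambda>y. indicator (chart_img d) y *\<^sub>R vden d y) \<in> borel_measurable borel"
    by (rule borel_measurable_continuous_on_indicator) (use chartD(2)[OF cd(2)] continuous_vden[OF cd(2)] in auto)
  then have f: "f \<in> borel_measurable borel" unfolding f_def using img by measurable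
  have "emeasure (chart_measure d) B = (\<integral>\<^sup>+x\<in>chart_map d ` B. ennreal (vden d x) \<partial>lborel)"
    using emeasure_chart_measure[OF cd(2) B(1)] Bd by simp
  also have "\<dots> = (\<integral>\<^sup>+y\<in>?T ` overlap c d. f y \<partial>lborel)"
    unfolding ov(4) using B(2,3)
    by (intro nn_integral_cong) (auto simp: f_def indicator_def overlap_def)
  also have "\<dots> = (\<integral>\<^sup>+x\<in>overlap c d. ennreal (?J x) * f (?T x) \<partial>lborel)"
    by (rule nn_integral_change_of_variables[OF ov(1,3,5) _ f]) (use overlap(1)[OF cd(2,1)] ov(4) in simp)
  also have "\<dots> = (\<integral>\<^sup>+x\<in>chart_map c ` B. ennreal (vden c x) \<partial>lborel)"
  proof (rule nn_integral_cong)
    fix x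
    show "ennreal (?J x) * f (?T x) * indicator (overlap c d) x = ennreal (vden c x) * indicator (chart_map c ` B) x"
    proof (cases "x \<in> overlap c d")
      case True
      have "?T x \<in> chart_img d" using transition_subset[OF cd] True by blast
      moreover have "?T x \<in> chart_map d ` B \<longleftrightarrow> x \<in> chart_map c ` B"
      proof
        assume "?T x \<in> chart_map d ` B"
        then obtain p where p: "p \<in> B" "?T x = chart_map d p" by blast
        then have pcd: "p \<in> chart_dom c" "p \<in> chart_dom d" using B by auto
        have "?T x = ?T (chart_map c p)" using ov(7)[OF pcd] p by simp
        then have "x = chart_map c p" by (rule inj_onD[OF ov(5) _ True ov(6)[OF pcd]])
        then show "x \<in> chart_map c ` B" using p by blast
      next
        assume "x \<in> chart_map c ` B"
        then obtain p where p: "p \<in> B" "x = chart_map c p" by blast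
        then have "?T x = chart_map d p" using ov(7)[of p] B by auto
        then show "?T x \<in> chart_map d ` B" using p by blast
      qed
      ultimately show ?thesis using True vden_transition[OF cd True]
        by (auto simp: f_def indicator_def ennreal_mult')
    next
      case False
      then have "x \<notin> chart_map c ` B" using ov(6) B by auto
      then show ?thesis using False by simp
    qed
  qed
  also have "\<dots> = emeasure (chart_measure c) B"
    using emeasure_chart_measure[OF cd(1) B(1)] Bd by simp
  finally show ?thesis by simp
qed

lemma finite_subatlas: obtains F where "finite F" "F \<subseteq> A" "M = (\<Union>c\<in>F. chart_dom c)"
proof -
  have "\<forall>U\<in>chart_dom ` A. openin (top_of_set M) U" using chartD(1) by auto
  moreover have "M \<subseteq> \<Union>(chart_dom ` A)" using smooth_atlas_A by (auto simp: smooth_atlas_def)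
  ultimately obtain D where D: "D \<subseteq> chart_dom ` A" "finite D" "M \<subseteq> \<Union>D"
    using compact_M unfolding compact_eq_openin_cover by metis
  obtain F where F: "F \<subseteq> A" "finite F" "D = chart_dom ` F"
    using finite_subset_image[OF D(2,1)] by metis
  have "(\<Union>c\<in>F. chart_dom c) \<subseteq> M" using F(1) chartD(8) by (intro UN_least) auto
  then have "M = (\<Union>c\<in>F. chart_dom c)" using D(3) F by auto
  then show ?thesis using that F by blast
qed

lemma is_riemannian_volume_iff:
  "is_riemannian_volume M A g \<mu> \<longleftrightarrow> sets \<mu> = msets \<and>
    (\<forall>c\<in>A. \<forall>B\<in>msets. B \<subseteq> chart_dom c \<longrightarrow> emeasure \<mu> B = emeasure (chart_measure c) B)"
proof -
  have "B \<inter> chart_dom c = B" if "B \<subseteq> chart_dom c" for B and c :: "('a, 'n) chart" using that by auto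
  then show ?thesis unfolding is_riemannian_volume_def
    by (auto simp: emeasure_chart_measure)
qed

text \<open>A definite description calls for existence and uniqueness. A finite subatlas is made
  disjoint by subtracting earlier domains, and the volume is the sum of the chart measures on the
  pieces \<open>D k\<close>. It satisfies the condition in every chart by
  \<open>chart_measure_compat\<close>, and it is unique because any solution is prescribed on each
  piece.\<close>

lemma riemannian_volume: "is_riemannian_volume M A g vol"
proof -
  obtain F where F: "finite F" "F \<subseteq> A" "M = (\<Union>c\<in>F. chart_dom c)" by (rule finite_subatlas)
  obtain cs where cs: "set cs = F" using finite_list[OF F(1)] by auto
  have csA: "k < length cs \<Longrightarrow> cs ! k \<in> A" for k using cs F(2) nth_mem by blast
  define D where "D k = chart_dom (cs ! k) - (\<Union>j<k. chart_dom (cs ! j))" for k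
  have Dm: "D k \<in> msets" if "k < length cs" for k
    unfolding D_def using that by (intro sets.Diff sets.countable_UN'' dom_msets csA) auto
  have Ddom: "D k \<subseteq> chart_dom (cs ! k)" for k by (auto simp: D_def)
  have disj: "D j \<inter> D k = {}" if "j < k" for j k using that by (auto simp: D_def)
  have disjf: "disjoint_family_on (\<lambda>k. B \<inter> D k) {..<length cs}" for B
    unfolding disjoint_family_on_def by (metis disj inf.commute inf_assoc inf_bot_right linorder_neqE_nat inf_left_commute)
  have UD: "(\<Union>k<length cs. D k) = M"
  proof
    show "(\<Union>k<length cs. D k) \<subseteq> M" using Ddom chartD(8) csA by blast
    show "M \<subseteq> (\<Union>k<length cs. D k)"
    proof
      fix p assume "p \<in> M"
      then obtain k where k: "k < length cs \<and> p \<in> chart_dom (cs ! k)"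
        using F(3) cs by (metis UN_E in_set_conv_nth)
      define m where "m = (LEAST k. k < length cs \<and> p \<in> chart_dom (cs ! k))"
      have "m < length cs \<and> p \<in> chart_dom (cs ! m)" unfolding m_def by (rule LeastI[of "\<lambda>k. k < length cs \<and> p \<in> chart_dom (cs ! k)" k, OF k])
      moreover have "p \<notin> chart_dom (cs ! j)" if "j < m" for j
        using not_less_Least[of j "\<lambda>k. k < length cs \<and> p \<in> chart_dom (cs ! k)"] that calculation
        unfolding m_def[symmetric] by auto
      ultimately show "p \<in> (\<Union>k<length cs. D k)" by (auto simp: D_def)
    qed
  qed
  have BM: "B \<subseteq> M" if "B \<in> msets" for B using that by (auto simp: sets_restrict_space)
  have split: "emeasure \<nu> B = (\<Sum>k<length cs. emeasure \<nu> (B \<inter> D k))"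
    if "sets \<nu> = msets" "B \<in> msets" for \<nu> B
  proof -
    have "(\<Sum>k<length cs. emeasure \<nu> (B \<inter> D k)) = emeasure \<nu> (\<Union>k<length cs. B \<inter> D k)"
      by (rule sum_emeasure[OF _ disjf]) (use that Dm in auto)
    also have "(\<Union>k<length cs. B \<inter> D k) = B" using UD BM[OF that(2)] by auto
    finally show ?thesis by simp
  qed
  define m where "m B = (\<Sum>k<length cs. emeasure (chart_measure (cs ! k)) (B \<inter> D k))" for B
  define \<mu> where "\<mu> = measure_of M msets m"
  have sp: "space (restrict_space borel M) = M" by (simp add: space_restrict_space)
  have sa: "sigma_algebra M msets" using sets.sigma_algebra_axioms[of "restrict_space borel M"] sp by simp
  have s\<mu>: "sets \<mu> = msets" unfolding \<mu>_def using sa sigma_algebra.sets_measure_of_eq by blast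
  have e\<mu>: "emeasure \<mu> B = m B" if "B \<in> msets" for B
    unfolding \<mu>_def
  proof (rule emeasure_measure_of_sigma[OF sa _ _ that])
    show "positive msets m" by (simp add: positive_def m_def)
    show "countably_additive msets m"
    proof (rule countably_additiveI)
      fix E :: "nat \<Rightarrow> 'a set" assume E: "range E \<subseteq> msets" "disjoint_family E" "(\<Union>i. E i) \<in> msets"
      have "(\<Sum>i. emeasure (chart_measure (cs ! k)) (E i \<inter> D k)) = emeasure (chart_measure (cs ! k)) ((\<Union>i. E i) \<inter> D k)"
        if "k < length cs" for k
      proof -
        have "disjoint_family (\<lambda>i. E i \<inter> D k)" using E(2) by (auto simp: disjoint_family_on_def)
        then have "(\<Sum>i. emeasure (chart_measure (cs ! k)) (E i \<inter> D k)) = emeasure (chart_measure (cs ! k)) (\<Union>i. E i \<inter> D k)"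
          by (intro suminf_emeasure) (use E Dm[OF that] in auto)
        then show ?thesis by simp
      qed
      then show "(\<Sum>i. m (E i)) = m (\<Union>i. E i)"
        unfolding m_def by (subst suminf_sum) auto
    qed
  qed
  have "is_riemannian_volume M A g \<mu>"
    unfolding is_riemannian_volume_iff
  proof (intro conjI ballI impI s\<mu>)
    fix c B assume c: "c \<in> A" and B: "B \<in> msets" "B \<subseteq> chart_dom c"
    have "m B = (\<Sum>k<length cs. emeasure (chart_measure c) (B \<inter> D k))"
      unfolding m_def
      by (intro sum.cong refl chart_measure_compat csA c) (use B Dm Ddom in auto)
    also have "\<dots> = emeasure (chart_measure c) B" by (rule split[symmetric]) (use B in auto)
    finally show "emeasure \<mu> B = emeasure (chart_measure c) B" using e\<mu>[OF B(1)] by simp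
  qed
  moreover have "\<nu> = \<mu>" if "is_riemannian_volume M A g \<nu>" for \<nu>
  proof (rule measure_eqI)
    note v = that[unfolded is_riemannian_volume_iff]
    show "sets \<nu> = sets \<mu>" using v s\<mu> by simp
    fix B assume "B \<in> sets \<nu>"
    then have B: "B \<in> msets" using v by simp
    have "emeasure \<nu> B = (\<Sum>k<length cs. emeasure \<nu> (B \<inter> D k))" by (rule split) (use v B in auto)
    also have "\<dots> = m B" unfolding m_def
    proof (intro sum.cong refl)
      fix k assume "k \<in> {..<length cs}"
      then have k: "k < length cs" by simp
      have "B \<inter> D k \<in> msets" "B \<inter> D k \<subseteq> chart_dom (cs ! k)" using B Dm[OF k] Ddom[of k] by auto
      then show "emeasure \<nu> (B \<inter> D k) = emeasure (chart_measure (cs ! k)) (B \<inter> D k)"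
        using v csA[OF k] by blast
    qed
    finally show "emeasure \<nu> B = emeasure \<mu> B" using e\<mu>[OF B] by simp
  qed
  ultimately show ?thesis unfolding riemannian_volume_def by (rule theI)
qed

lemma sets_vol [simp]: "sets vol = msets" and space_vol [simp]: "space vol = M"
proof -
  show s: "sets vol = msets" using riemannian_volume is_riemannian_volume_iff by blast
  show "space vol = M" using sets_eq_imp_space_eq[OF s] by (simp add: space_restrict_space)
qed

text \<open>Restricted to the chart domain, the volume agrees with the chart measure on all sets,
  and this passes to integrals of nonnegative functions.\<close>

lemma nn_integral_vol_chart:
  assumes c: "c \<in> A" and f: "f \<in> borel_measurable vol"
  shows "(\<integral>\<^sup>+p\<in>chart_dom c. f p \<partial>vol) = (\<integral>\<^sup>+x\<in>chart_img c. ennreal (vden c x) * f (chart_inv c x) \<partial>lborel)"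
proof -
  have f': "f \<in> borel_measurable (restrict_space borel M)"
    using f measurable_cong_sets[OF sets_vol refl] by blast
  have ind: "indicator (chart_dom c) \<in> borel_measurable vol"
    by (rule borel_measurable_indicator) (use dom_msets[OF c] in simp)
  have "density vol (indicator (chart_dom c)) = chart_measure c"
  proof (rule measure_eqI)
    show "sets (density vol (indicator (chart_dom c))) = sets (chart_measure c)" by simp
    fix B assume "B \<in> sets (density vol (indicator (chart_dom c)))"
    then have B: "B \<in> msets" by simp
    have "emeasure (density vol (indicator (chart_dom c))) B = emeasure vol (B \<inter> chart_dom c)"
      using B dom_msets[OF c] by (subst emeasure_density[OF ind]) (auto simp: indicator_inter_arith[symmetric] Int_commute)
    also have "\<dots> = emeasure (chart_measure c) (B \<inter> chart_dom c)"
      using riemannian_volume c B dom_msets[OF c] unfolding is_riemannian_volume_iff by auto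
    also have "\<dots> = emeasure (chart_measure c) B"
      using emeasure_chart_measure[OF c] B dom_msets[OF c] by simp
    finally show "emeasure (density vol (indicator (chart_dom c))) B = emeasure (chart_measure c) B" .
  qed
  then have "(\<integral>\<^sup>+p. f p \<partial>chart_measure c) = (\<integral>\<^sup>+p. indicator (chart_dom c) p * f p \<partial>vol)"
    using nn_integral_density[OF ind f] by simp
  then show ?thesis using nn_integral_chart_measure[OF c f'] by (simp add: mult.commute)
qed

end

section \<open>Functions on a closed Riemannian manifold\<close>

text \<open>Nonnegativity of the quadratic form at u - t v, with the t that minimizes it.\<close>

lemma pos_def_cauchy_schwarz:
  fixes G :: "real^'n::finite^'n"
  assumes pos: "\<And>v. v \<noteq> 0 \<Longrightarrow> v \<bullet> (G *v v) > 0" and sym: "\<And>u v. u \<bullet> (G *v v) = v \<bullet> (G *v u)"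
  shows "\<bar>u \<bullet> (G *v v)\<bar> \<le> sqrt (u \<bullet> (G *v u)) * sqrt (v \<bullet> (G *v v))"
proof (cases "v = 0")
  case False
  define b where "b = v \<bullet> (G *v v)"
  define t where "t = (u \<bullet> (G *v v)) / b"
  have b: "b > 0" using pos False by (simp add: b_def)
  have "0 \<le> (u - t *\<^sub>R v) \<bullet> (G *v (u - t *\<^sub>R v))"
    using pos[of "u - t *\<^sub>R v"] by (cases "u - t *\<^sub>R v = 0") auto
  also have "\<dots> = u \<bullet> (G *v u) - 2 * t * (u \<bullet> (G *v v)) + t\<^sup>2 * b"
    using sym[of v u]
    by (simp add: matrix_vector_mult_diff_distrib matrix_vector_mult_scaleR inner_simps b_def
        power2_eq_square algebra_simps)
  also have "\<dots> = u \<bullet> (G *v u) - (u \<bullet> (G *v v))\<^sup>2 / b"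
    using b by (simp add: t_def power2_eq_square field_simps)
  finally have "(u \<bullet> (G *v v))\<^sup>2 \<le> (u \<bullet> (G *v u)) * b" using b by (simp add: field_simps)
  then have "sqrt ((u \<bullet> (G *v v))\<^sup>2) \<le> sqrt ((u \<bullet> (G *v u)) * b)" by (rule real_sqrt_le_mono)
  then show ?thesis by (simp add: real_sqrt_mult b_def)
qed simp

section \<open>Smooth functions and their extension from a chart\<close>

context closed_riemannian
begin

lemma open_chart_preimage:
  assumes "d \<in> A" "openin (top_of_set M) U"
  shows "open {x \<in> chart_img d. chart_inv d x \<in> U}"
proof -
  have "openin (top_of_set (chart_dom d)) (chart_dom d \<inter> U)"
  proof -
    obtain T where T: "open T" "U = M \<inter> T" using assms(2) unfolding openin_open by blast
    then have "chart_dom d \<inter> U = chart_dom d \<inter> T" using chartD(8)[OF assms(1)] by auto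
    then show ?thesis using T(1) unfolding openin_open by blast
  qed
  then have "openin (top_of_set (chart_img d)) (chart_img d \<inter> chart_inv d -` (chart_dom d \<inter> U))"
    using chartD(4,6)[OF assms(1)]
    by (intro continuous_on_open_gen[THEN iffD1, rule_format, of "chart_inv d"]) auto
  moreover have "chart_img d \<inter> chart_inv d -` (chart_dom d \<inter> U) = {x \<in> chart_img d. chart_inv d x \<in> U}"
    using chartD(6)[OF assms(1)] by auto
  ultimately show ?thesis using openin_open_trans[OF _ chartD(2)[OF assms(1)]] by simp
qed

lemma open_chart_image:
  assumes c: "c \<in> A" and W: "open W" "W \<subseteq> chart_img c"
  shows "openin (top_of_set M) (chart_inv c ` W)"
proof -
  have eq: "chart_inv c ` W = chart_dom c \<inter> chart_map c -` W"
    using chartD(5-7)[OF c] W(2) by force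
  have "openin (top_of_set (chart_dom c)) (chart_inv c ` W)"
    unfolding eq using chartD(3)[OF c] W(1) by (rule continuous_openin_preimage_gen)
  then show ?thesis using chartD(1)[OF c] openin_trans by blast
qed

lemma smooth_functionD:
  assumes "smooth_function A \<phi>" "c \<in> A"
  shows "smooth_on (chart_img c) (\<phi> \<circ> chart_inv c)"
    "x \<in> chart_img c \<Longrightarrow> ((\<phi> \<circ> chart_inv c) has_derivative frechet_derivative (\<phi> \<circ> chart_inv c) (at x)) (at x)"
  using assms smooth_on_has_derivative unfolding smooth_function_def by blast+

lemma smooth_function_continuous: "smooth_function A \<phi> \<Longrightarrow> continuous_on M \<phi>"
  by (rule continuous_on_manifoldI) (rule smooth_on_continuous[OF smooth_functionD(1)])

lemma smooth_function_const [simp]: "smooth_function A (\<lambda>p. k)"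
  by (simp add: smooth_function_def o_def)

lemma smooth_function_add:
  "smooth_function A \<phi> \<Longrightarrow> smooth_function A \<psi> \<Longrightarrow> smooth_function A (\<lambda>p. \<phi> p + \<psi> p)"
  using smooth_on_add chartD(2) unfolding smooth_function_def o_def by blast

lemma smooth_function_mult:
  "smooth_function A \<phi> \<Longrightarrow> smooth_function A \<psi> \<Longrightarrow> smooth_function A (\<lambda>p. \<phi> p * \<psi> p)"
  using smooth_on_mult chartD(2) unfolding smooth_function_def o_def by blast

lemma smooth_function_sum:
  "(\<And>i. i \<in> I \<Longrightarrow> smooth_function A (f i)) \<Longrightarrow> smooth_function A (\<lambda>p. \<Sum>i\<in>I. f i p)"
  by (induction I rule: infinite_finite_induct) (auto intro: smooth_function_add)

lemma smooth_function_compose: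
  fixes h :: "real \<Rightarrow> real"
  assumes "smooth_function A \<phi>" "smooth_on UNIV h"
  shows "smooth_function A (\<lambda>p. h (\<phi> p))"
  unfolding smooth_function_def o_def
proof
  fix c assume c: "c \<in> A"
  show "smooth_on (chart_img c) (\<lambda>x. h (\<phi> (chart_inv c x)))"
    using smooth_on_compose[OF chartD(2)[OF c] open_UNIV _ smooth_functionD(1)[OF assms(1) c] assms(2)]
    by simp
qed

lemma smooth_function_divide:
  assumes "smooth_function A \<phi>" "smooth_function A \<psi>" "\<And>p. p \<in> M \<Longrightarrow> \<psi> p \<noteq> 0"
  shows "smooth_function A (\<lambda>p. \<phi> p / \<psi> p)"
  unfolding smooth_function_def o_def
proof
  fix c assume c: "c \<in> A"
  have "\<psi> (chart_inv c x) \<noteq> 0" if "x \<in> chart_img c" for x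
    using assms(3) chartD(6,8)[OF c] that by blast
  then show "smooth_on (chart_img c) (\<lambda>x. \<phi> (chart_inv c x) / \<psi> (chart_inv c x))"
    using smooth_functionD(1)[OF assms(1) c] smooth_functionD(1)[OF assms(2) c]
    by (intro smooth_on_divide chartD(2)[OF c]) (auto simp: o_def)
qed

definition ext :: "('a, 'n) chart \<Rightarrow> (real^'n \<Rightarrow> real) \<Rightarrow> 'a \<Rightarrow> real" where
  "ext c h p = (if p \<in> chart_dom c then h (chart_map c p) else 0)"

lemma closedin_chart_compact:
  assumes c: "c \<in> A" and K: "compact K" "K \<subseteq> chart_img c"
  shows "closedin (top_of_set M) (chart_inv c ` K)"
proof (rule compactin_imp_closedin[OF Hausdorff_M])
  have "compact (chart_inv c ` K)"
    using K chartD(4)[OF c] by (intro compact_continuous_image continuous_on_subset[OF chartD(4)[OF c]]) auto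
  moreover have "chart_inv c ` K \<subseteq> M" using K chartD(6,8)[OF c] by blast
  ultimately show "compactin (top_of_set M) (chart_inv c ` K)"
    by (simp add: compactin_subtopology compactin_euclidean_iff)
qed

text \<open>The image of K is compact, hence closed because M is Hausdorff. So every point outside
  the chart domain has a neighbourhood on which the extension is 0.\<close>

lemma smooth_ext:
  assumes c: "c \<in> A" and h: "smooth_on (chart_img c) h"
    and K: "compact K" "K \<subseteq> chart_img c" "\<And>x. x \<in> chart_img c \<Longrightarrow> x \<notin> K \<Longrightarrow> h x = 0"
  shows "smooth_function A (ext c h)"
  unfolding smooth_function_def
proof
  fix d assume d: "d \<in> A"
  show "smooth_on (chart_img d) (ext c h \<circ> chart_inv d)"
  proof (rule smooth_on_local)
    fix x assume x: "x \<in> chart_img d"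
    let ?p = "chart_inv d x"
    have p: "?p \<in> chart_dom d" "chart_map d ?p = x" using chartD(6,7)[OF d] x by auto
    show "\<exists>T. open T \<and> x \<in> T \<and> smooth_on T (ext c h \<circ> chart_inv d)"
    proof (cases "?p \<in> chart_dom c")
      case True
      have "smooth_on (overlap d c) (\<lambda>y. h (transition d c y))"
        by (rule smooth_on_compose[OF overlap(1)[OF d c] chartD(2)[OF c] transition_subset[OF d c] overlap(3)[OF d c] h])
      then have "smooth_on (overlap d c) (ext c h \<circ> chart_inv d)"
        by (rule smooth_on_cong[OF overlap(1)[OF d c]])
           (use overlap(9)[OF d c] in \<open>auto simp: ext_def transition_def\<close>)
      moreover have "x \<in> overlap d c" using overlap(6)[OF d c p(1) True] p(2) by simp
      ultimately show ?thesis using overlap(1)[OF d c] by blast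
    next
      case False
      define U where "U = M - chart_inv c ` K"
      have U: "openin (top_of_set M) U" unfolding U_def
        using closedin_chart_compact[OF c K(1,2)] by (metis closedin_def topspace_euclidean_subtopology)
      define T where "T = {y \<in> chart_img d. chart_inv d y \<in> U}"
      have T: "open T" unfolding T_def by (rule open_chart_preimage[OF d U])
      have "?p \<notin> chart_inv c ` K"
      proof
        assume "?p \<in> chart_inv c ` K"
        then obtain z where z: "z \<in> K" "?p = chart_inv c z" by (rule imageE)
        then have "z \<in> chart_img c" using K(2) by (rule_tac subsetD)
        then show False using False chartD(6)[OF c] z(2) by simp
      qed
      then have "x \<in> T" using x p chartD(8)[OF d] by (auto simp: T_def U_def)
      moreover have "smooth_on T (ext c h \<circ> chart_inv d)"
      proof (rule smooth_on_cong[OF T smooth_on_const[of _ 0]])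
        fix y assume "y \<in> T"
        then have "chart_inv d y \<notin> chart_inv c ` K" by (simp add: T_def U_def)
        then have "chart_map c (chart_inv d y) \<notin> K" if "chart_inv d y \<in> chart_dom c"
          using chartD(5)[OF c that] by (metis image_eqI)
        then show "0 = (ext c h \<circ> chart_inv d) y" using K(3) by (auto simp: ext_def)
      qed
      ultimately show ?thesis using T by blast
    qed
  qed
qed

section \<open>Pointwise gradient bounds\<close>

definition gnorm :: "('a, 'n) chart \<Rightarrow> real^'n \<Rightarrow> real^'n \<Rightarrow> real" where
  "gnorm c x v = sqrt (v \<bullet> (g c x *v v))"

abbreviation dchart :: "('a \<Rightarrow> real) \<Rightarrow> ('a, 'n) chart \<Rightarrow> real^'n \<Rightarrow> real^'n \<Rightarrow> real" where
  "dchart \<phi> c x \<equiv> frechet_derivative (\<phi> \<circ> chart_inv c) (at x)"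

text \<open>The bound |grad \<phi>| <= K at p, tested on tangent vectors. As no inverse matrix
  occurs, chart independence and the rules for sums, products and compositions are short.\<close>

definition gbound :: "('a \<Rightarrow> real) \<Rightarrow> real \<Rightarrow> 'a \<Rightarrow> bool" where
  "gbound \<phi> K p \<longleftrightarrow> (\<forall>v. \<bar>dchart \<phi> (cat p) (chart_map (cat p) p) v\<bar> \<le> K * gnorm (cat p) (chart_map (cat p) p) v)"

lemma gnorm_nonneg: "c \<in> A \<Longrightarrow> x \<in> chart_img c \<Longrightarrow> gnorm c x v \<ge> 0"
  using metric_onD(4)[OF metric_chart, of c x v] by (cases "v = 0") (auto simp: gnorm_def)



lemma dchart_change:
  assumes \<phi>: "smooth_function A \<phi>" and cd: "c \<in> A" "d \<in> A" and x: "x \<in> overlap c d"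
  shows "dchart \<phi> c x v = dchart \<phi> d (transition c d x) (frechet_derivative (transition c d) (at x) v)"
    "gnorm c x v = gnorm d (transition c d x) (frechet_derivative (transition c d) (at x) v)"
proof -
  note ov = overlap[OF cd]
  have Tx: "transition c d x \<in> chart_img d" using transition_subset[OF cd] x by blast
  have "((\<phi> \<circ> chart_inv d \<circ> transition c d) has_derivative
     (dchart \<phi> d (transition c d x) \<circ> frechet_derivative (transition c d) (at x))) (at x)"
    by (rule diff_chain_at[OF smooth_on_has_derivative[OF ov(3) x] smooth_functionD(2)[OF \<phi> cd(2) Tx]])
  then have "((\<phi> \<circ> chart_inv c) has_derivative
     (dchart \<phi> d (transition c d x) \<circ> frechet_derivative (transition c d) (at x))) (at x)"
    by (rule has_derivative_transform_within_open[OF _ ov(1) x]) (simp add: ov(8))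
  then show "dchart \<phi> c x v = dchart \<phi> d (transition c d x) (frechet_derivative (transition c d) (at x) v)"
    using frechet_derivative_eq by (metis comp_apply)
  show "gnorm c x v = gnorm d (transition c d x) (frechet_derivative (transition c d) (at x) v)"
    unfolding gnorm_def
    using metric_pullback[OF metric_overlap(1)[OF cd] metric_chart[OF cd(2)] ov(3)
        transition_subset[OF cd] metric_overlap(2)[OF cd] x, of v v] by simp
qed

lemma gbound_transfer:
  assumes \<phi>: "smooth_function A \<phi>" and cd: "c \<in> A" "d \<in> A" and p: "p \<in> chart_dom c" "p \<in> chart_dom d"
    and b: "\<And>v. \<bar>dchart \<phi> d (chart_map d p) v\<bar> \<le> K * gnorm d (chart_map d p) v"
  shows "\<bar>dchart \<phi> c (chart_map c p) v\<bar> \<le> K * gnorm c (chart_map c p) v"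
  using dchart_change[OF \<phi> cd overlap(6)[OF cd p]] overlap(7)[OF cd p] b by simp

lemma gbound_chart:
  assumes \<phi>: "smooth_function A \<phi>" and d: "d \<in> A" "p \<in> chart_dom d"
  shows "gbound \<phi> K p \<longleftrightarrow> (\<forall>v. \<bar>dchart \<phi> d (chart_map d p) v\<bar> \<le> K * gnorm d (chart_map d p) v)"
proof -
  have "p \<in> M" using chartD(8) d by blast
  note c = chart_at[OF this]
  show ?thesis unfolding gbound_def
    using gbound_transfer[OF \<phi> c(1) d(1) c(2) d(2)] gbound_transfer[OF \<phi> d(1) c(1) d(2) c(2)] by blast
qed

definition gns :: "('a, 'n) chart \<Rightarrow> ('a \<Rightarrow> real) \<Rightarrow> real^'n \<Rightarrow> real" where
  "gns c \<phi> x = (let grad = matrix_inv (g c x) *v (\<chi> i. pderiv_at i (\<phi> \<circ> chart_inv c) x)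
      in grad \<bullet> (g c x *v grad))"

text \<open>The gradient represents the differential. By Cauchy-Schwarz its norm is an admissible
  bound, and testing the differential on the gradient itself shows that no smaller bound is.\<close>

lemma gns_bound:
  assumes \<phi>: "smooth_function A \<phi>" and c: "c \<in> A" and x: "x \<in> chart_img c"
  shows "gns c \<phi> x \<ge> 0" "\<bar>dchart \<phi> c x v\<bar> \<le> sqrt (gns c \<phi> x) * gnorm c x v"
    "(\<And>v. \<bar>dchart \<phi> c x v\<bar> \<le> K * gnorm c x v) \<Longrightarrow> gns c \<phi> x \<le> K\<^sup>2"
proof -
  define dv :: "real^'n" where "dv = (\<chi> i. pderiv_at i (\<phi> \<circ> chart_inv c) x)"
  define grad where "grad = matrix_inv (g c x) *v dv"
  have gn: "gns c \<phi> x = grad \<bullet> (g c x *v grad)" by (simp add: gns_def grad_def dv_def Let_def)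
  note met = metric_chart[OF c]
  have G: "g c x *v grad = dv"
    by (simp add: grad_def matrix_vector_mul_assoc matrix_inv_mult[OF metric_onD(3)[OF met x]])
  have dphi: "dchart \<phi> c x w = w \<bullet> dv" for w
    using linear_axis_expand[OF has_derivative_linear[OF smooth_functionD(2)[OF \<phi> c x]], of w]
    by (simp add: inner_vec_def dv_def pderiv_at_def)
  show 0: "gns c \<phi> x \<ge> 0"
    using metric_onD(4)[OF met x, of grad] by (cases "grad = 0") (auto simp: gn)
  show "\<bar>dchart \<phi> c x v\<bar> \<le> sqrt (gns c \<phi> x) * gnorm c x v" for v
    using pos_def_cauchy_schwarz[OF metric_onD(4)[OF met x] metric_onD(5)[OF met x], of v grad]
    by (simp add: dphi gn gnorm_def G mult.commute)
  assume b: "\<And>v. \<bar>dchart \<phi> c x v\<bar> \<le> K * gnorm c x v"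
  have "gns c \<phi> x \<le> K * sqrt (gns c \<phi> x)"
    using b[of grad] by (simp add: dphi gn gnorm_def G)
  then have "sqrt (gns c \<phi> x) * sqrt (gns c \<phi> x) \<le> K * sqrt (gns c \<phi> x)" using 0 by simp
  then have "sqrt (gns c \<phi> x) \<le> K" if "gns c \<phi> x > 0"
    using that by (metis mult_le_cancel_right not_less real_sqrt_gt_zero less_le_not_le)
  then have "(sqrt (gns c \<phi> x))\<^sup>2 \<le> K\<^sup>2" if "gns c \<phi> x > 0" using that 0 by (intro power_mono) auto
  then show "gns c \<phi> x \<le> K\<^sup>2" using 0 by (cases "gns c \<phi> x > 0") auto
qed

lemma grad_norm_sq_gns: "grad_norm_sq A g \<phi> p = gns (cat p) \<phi> (chart_map (cat p) p)"
  by (simp add: grad_norm_sq_def gns_def Let_def)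

text \<open>The norm of the gradient is the least bound on the differential, and such bounds carry
  over from chart to chart; hence two inequalities.\<close>

lemma grad_norm_sq_chart:
  assumes \<phi>: "smooth_function A \<phi>" and c: "c \<in> A" "p \<in> chart_dom c"
  shows "grad_norm_sq A g \<phi> p = gns c \<phi> (chart_map c p)"
proof -
  have "p \<in> M" using chartD(8) c by blast
  note d = chart_at[OF this]
  have *: "gns d \<phi> (chart_map d p) \<le> gns c \<phi> (chart_map c p)"
    if "c \<in> A" "p \<in> chart_dom c" "d \<in> A" "p \<in> chart_dom d" for c d
  proof -
    have x: "chart_map c p \<in> chart_img c" "chart_map d p \<in> chart_img d" using that by auto
    have "gns d \<phi> (chart_map d p) \<le> (sqrt (gns c \<phi> (chart_map c p)))\<^sup>2"
      by (rule gns_bound(3)[OF \<phi> that(3) x(2) gbound_transfer[OF \<phi> that(3,1,4,2) gns_bound(2)[OF \<phi> that(1) x(1)]]])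
    then show ?thesis using gns_bound(1)[OF \<phi> that(1) x(1)] by simp
  qed
  show ?thesis unfolding grad_norm_sq_gns using *[OF c d] *[OF d c] by simp
qed

lemma gbound_grad_norm_sq:
  assumes \<phi>: "smooth_function A \<phi>" and p: "p \<in> M"
  shows "grad_norm_sq A g \<phi> p \<ge> 0" "gbound \<phi> (sqrt (grad_norm_sq A g \<phi> p)) p"
    "gbound \<phi> K p \<Longrightarrow> grad_norm_sq A g \<phi> p \<le> K\<^sup>2"
proof -
  note c = chart_at[OF p]
  then have x: "chart_map (cat p) p \<in> chart_img (cat p)" by auto
  note b = gns_bound[OF \<phi> c(1) x]
  show "grad_norm_sq A g \<phi> p \<ge> 0" "gbound \<phi> (sqrt (grad_norm_sq A g \<phi> p)) p"
    "gbound \<phi> K p \<Longrightarrow> grad_norm_sq A g \<phi> p \<le> K\<^sup>2"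
    using b unfolding gbound_def grad_norm_sq_gns by blast+
qed

lemma continuous_on_grad_norm_sq:
  assumes \<phi>: "smooth_function A \<phi>"
  shows "continuous_on M (grad_norm_sq A g \<phi>)"
proof (rule continuous_on_manifoldI)
  fix c assume c: "c \<in> A"
  note met = metric_onD[OF metric_chart[OF c]]
  have "smooth_on (chart_img c) (\<lambda>x. gns c \<phi> x)"
    unfolding gns_def Let_def pderiv_at_def
    by (intro smooth_on_bilinear[OF bounded_bilinear_inner] smooth_on_bilinear[OF bounded_bilinear_matrix_vector]
        smooth_on_matrix_inv smooth_on_vec_lambda smooth_on_frechet_derivative smooth_functionD(1)[OF \<phi> c] met)
  then have "continuous_on (chart_img c) (gns c \<phi>)" by (rule smooth_on_continuous)
  then show "continuous_on (chart_img c) (grad_norm_sq A g \<phi> \<circ> chart_inv c)"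
    by (rule continuous_on_eq) (simp add: grad_norm_sq_chart[OF \<phi> c] chartD(6,7)[OF c])
qed

lemma gbound_uniform:
  assumes \<phi>: "smooth_function A \<phi>"
  obtains K where "K \<ge> 0" "\<And>p. p \<in> M \<Longrightarrow> gbound \<phi> K p"
proof -
  obtain q where q: "q \<in> M" "\<And>p. p \<in> M \<Longrightarrow> grad_norm_sq A g \<phi> p \<le> grad_norm_sq A g \<phi> q"
    using continuous_attains_sup[OF compact_M M_nonempty continuous_on_grad_norm_sq[OF \<phi>]] by blast
  show thesis
  proof (rule that[of "sqrt (grad_norm_sq A g \<phi> q)"])
    show "gbound \<phi> (sqrt (grad_norm_sq A g \<phi> q)) p" if p: "p \<in> M" for p
      unfolding gbound_def
    proof
      fix v
      note c = chart_at[OF p]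
      have "\<bar>dchart \<phi> (cat p) (chart_map (cat p) p) v\<bar> \<le> sqrt (grad_norm_sq A g \<phi> p) * gnorm (cat p) (chart_map (cat p) p) v"
        using gbound_grad_norm_sq(2)[OF \<phi> p] unfolding gbound_def by blast
      also have "\<dots> \<le> sqrt (grad_norm_sq A g \<phi> q) * gnorm (cat p) (chart_map (cat p) p) v"
        by (intro mult_right_mono real_sqrt_le_mono q(2) p gnorm_nonneg c(1)) (use c in auto)
      finally show "\<bar>dchart \<phi> (cat p) (chart_map (cat p) p) v\<bar> \<le> sqrt (grad_norm_sq A g \<phi> q) * gnorm (cat p) (chart_map (cat p) p) v" .
    qed
  qed (use gbound_grad_norm_sq(1)[OF \<phi> q(1)] in simp)
qed

text \<open>The radii leave room: the balls of radius r cover M, the cutoffs live on radius 2r, and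
  mollification reaches out to 3r.\<close>

lemma good_cover:
  obtains P where "finite P"
    "\<forall>(c, a, r)\<in>P. c \<in> A \<and> r > 0 \<and> cball a (3 * r) \<subseteq> chart_img c"
    "M = (\<Union>(c, a, r)\<in>P. chart_inv c ` ball a r)"
proof -
  have "\<exists>r>0. cball (chart_map (cat p) p) (3 * r) \<subseteq> chart_img (cat p)" if p: "p \<in> M" for p
  proof -
    obtain e where "e > 0" "cball (chart_map (cat p) p) e \<subseteq> chart_img (cat p)"
      using chartD(2)[OF chart_at(1)[OF p]] chart_at(2)[OF p] by (metis image_eqI open_contains_cball)
    then show ?thesis by (intro exI[of _ "e / 3"]) auto
  qed
  then obtain r where r: "\<And>p. p \<in> M \<Longrightarrow> r p > 0" "\<And>p. p \<in> M \<Longrightarrow> cball (chart_map (cat p) p) (3 * r p) \<subseteq> chart_img (cat p)"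
    by metis
  define t where "t p = (cat p, chart_map (cat p) p, r p)" for p
  define N where "N = (\<lambda>(c :: ('a, 'n) chart, a, r). chart_inv c ` ball a r :: 'a set)"
  have sub: "ball (chart_map (cat p) p) (r p) \<subseteq> chart_img (cat p)" if "p \<in> M" for p
  proof -
    have "ball (chart_map (cat p) p) (r p) \<subseteq> cball (chart_map (cat p) p) (3 * r p)"
      using r(1)[OF that] by auto
    then show ?thesis using r(2)[OF that] by (rule order_trans)
  qed
  have "\<forall>U\<in>N ` t ` M. openin (top_of_set M) U"
    using open_chart_image[OF chart_at(1) open_ball sub] by (auto simp: N_def t_def)
  moreover have "M \<subseteq> \<Union>(N ` t ` M)"
  proof
    fix p assume p: "p \<in> M"
    have "p = chart_inv (cat p) (chart_map (cat p) p)" using chartD(5)[OF chart_at(1)] chart_at(2) p by simp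
    then have "p \<in> N (t p)" using r(1)[OF p] unfolding N_def t_def by auto
    then show "p \<in> \<Union>(N ` t ` M)" using p by blast
  qed
  ultimately obtain D where D: "D \<subseteq> N ` t ` M" "finite D" "M \<subseteq> \<Union>D"
    using compact_M unfolding compact_eq_openin_cover by metis
  obtain P where P: "P \<subseteq> t ` M" "finite P" "D = N ` P"
    using finite_subset_image[OF D(2,1)] by metis
  show thesis
  proof (rule that[OF P(2)])
    have "c \<in> A \<and> s > 0 \<and> cball a (3 * s) \<subseteq> chart_img c" if cas: "(c, a, s) \<in> P" for c a s
    proof -
      obtain p where p: "p \<in> M" "(c, a, s) = t p" using P(1) cas by blast
      then show ?thesis using r[OF p(1)] chart_at[OF p(1)] by (simp add: t_def)
    qed
    then show "\<forall>(c, a, r)\<in>P. c \<in> A \<and> r > 0 \<and> cball a (3 * r) \<subseteq> chart_img c" by blast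
    have "N x \<subseteq> M" if xP: "x \<in> P" for x
    proof -
      obtain p where p: "p \<in> M" "x = t p" using P(1) xP by blast
      have "chart_inv (cat p) ` ball (chart_map (cat p) p) (r p) \<subseteq> chart_dom (cat p)"
        using chartD(6)[OF chart_at(1)[OF p(1)]] sub[OF p(1)] by blast
      then show ?thesis using chartD(8)[OF chart_at(1)[OF p(1)]] by (auto simp: p N_def t_def)
    qed
    then have "M = (\<Union>x\<in>P. N x)" using D(3) P(3) by blast
    then show "M = (\<Union>(c, a, r)\<in>P. chart_inv c ` ball a r)" by (simp add: N_def)
  qed
qed

section \<open>Finiteness of the volume and integrability of continuous functions\<close>

lemma measurable_vol: "continuous_on M f \<Longrightarrow> f \<in> borel_measurable vol"
  using borel_measurable_continuous_on_restrict measurable_cong_sets[OF sets_vol refl] by blast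

lemma emeasure_chart_compact:
  assumes c: "c \<in> A" and K: "compact K" "K \<subseteq> chart_img c"
  shows "emeasure vol (chart_inv c ` K) < \<infinity>" "chart_inv c ` K \<in> msets"
proof -
  have "M - chart_inv c ` K \<in> msets"
    by (rule openin_msets) (use closedin_chart_compact[OF c K] in \<open>metis closedin_def topspace_euclidean_subtopology\<close>)
  then have "M - (M - chart_inv c ` K) \<in> msets"
    by (metis sets.compl_sets space_vol sets_vol)
  moreover have dom: "chart_inv c ` K \<subseteq> chart_dom c" using chartD(6)[OF c] K(2) by blast
  ultimately show m: "chart_inv c ` K \<in> msets" using chartD(8)[OF c] by (simp add: double_diff)
  have "bounded (vden c ` K)"
    using continuous_vden[OF c] K by (meson compact_continuous_image compact_imp_bounded continuous_on_subset)
  then obtain b where b: "\<And>x. x \<in> K \<Longrightarrow> \<bar>vden c x\<bar> \<le> b" by (auto simp: bounded_iff)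
  have "emeasure vol (chart_inv c ` K) = (\<integral>\<^sup>+x\<in>chart_map c ` chart_inv c ` K. ennreal (vden c x) \<partial>lborel)"
    using riemannian_volume c m dom unfolding is_riemannian_volume_def by auto
  also have "chart_map c ` chart_inv c ` K = K"
    using chartD(7)[OF c] K(2) by (force simp: image_image)
  also have "(\<integral>\<^sup>+x\<in>K. ennreal (vden c x) \<partial>lborel) \<le> (\<integral>\<^sup>+x\<in>K. ennreal b \<partial>lborel)"
    by (intro nn_integral_mono) (auto simp: indicator_def intro!: ennreal_leI order_trans[OF abs_ge_self b])
  also have "\<dots> = ennreal b * emeasure lborel K"
    using K(1) by (simp add: nn_integral_cmult_indicator compact_imp_closed)
  also have "\<dots> < \<infinity>" using emeasure_compact_finite[OF K(1)] by (simp add: ennreal_mult_less_top)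
  finally show "emeasure vol (chart_inv c ` K) < \<infinity>" .
qed

sublocale finite_measure vol
proof
  obtain P where P: "finite P"
    "\<forall>(c, a, r)\<in>P. c \<in> A \<and> r > 0 \<and> cball a (3 * r) \<subseteq> chart_img c"
    "M = (\<Union>(c, a, r)\<in>P. chart_inv c ` ball a r)" by (rule good_cover)
  define N where "N = (\<lambda>(c :: ('a, 'n) chart, a, r). chart_inv c ` cball a r :: 'a set)"
  have e: "emeasure vol (N x) < \<infinity> \<and> N x \<in> msets" if x: "x \<in> P" for x
  proof -
    obtain c a r where [simp]: "x = (c, a, r)" by (cases x)
    have c: "c \<in> A" "r > 0" "cball a (3 * r) \<subseteq> chart_img c" using P(2) x by auto
    have "cball a r \<subseteq> cball a (3 * r)" using c by (intro subset_cball) simp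
    then have "cball a r \<subseteq> chart_img c" using c by blast
    then show ?thesis unfolding N_def using emeasure_chart_compact[OF c(1)] by simp
  qed
  have "(case x of (c, a, r) \<Rightarrow> chart_inv c ` ball a r) \<subseteq> N x" for x :: "('a, 'n) chart \<times> (real^'n) \<times> real"
    by (auto simp: N_def split: prod.splits)
  then have "(\<Union>x\<in>P. case x of (c, a, r) \<Rightarrow> chart_inv c ` ball a r) \<subseteq> (\<Union>x\<in>P. N x)"
    by (intro UN_mono) auto
  then have "M \<subseteq> (\<Union>x\<in>P. N x)" using P(3) by simp
  then have "emeasure vol M \<le> emeasure vol (\<Union>x\<in>P. N x)"
    by (rule emeasure_mono) (use e P(1) in auto)
  also have "\<dots> \<le> (\<Sum>x\<in>P. emeasure vol (N x))"
    by (rule emeasure_subadditive_finite) (use e P(1) in auto)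
  also have "\<dots> < \<infinity>" using e P(1) by simp
  finally show "emeasure vol (space vol) \<noteq> \<infinity>" by simp
qed

lemma integrable_vol:
  fixes f :: "'a \<Rightarrow> real"
  assumes f: "continuous_on M f"
  shows "integrable vol f"
proof -
  have "bounded (f ` M)" using compact_continuous_image[OF f compact_M] compact_imp_bounded by blast
  then obtain b where "\<And>x. x \<in> M \<Longrightarrow> norm (f x) \<le> b" by (auto simp: bounded_iff)
  then show ?thesis by (intro integrable_const_bound[where B=b] measurable_vol f) (auto intro!: AE_I2)
qed

end

section \<open>The geodesic distance\<close>

text \<open>The constant loops at two points are homotopic through loops, and the track of the
  parameter 0 under the homotopy is a path between the points.\<close>

lemma simply_connected_connected:
  fixes S :: "'a::topological_space set"
  assumes S: "simply_connected S"
  shows "connected S"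
proof (rule path_connected_imp_connected, unfold path_connected_def, intro ballI)
  fix x y assume xy: "x \<in> S" "y \<in> S"
  have l: "path (\<lambda>_. z) \<and> pathfinish (\<lambda>_. z) = pathstart (\<lambda>_. z) \<and> path_image (\<lambda>_. z) \<subseteq> S" if "z \<in> S" for z
    using that by (auto simp: path_def pathstart_def pathfinish_def path_image_def)
  have "homotopic_loops S (\<lambda>_::real. x) (\<lambda>_. y)"
    using S l[OF xy(1)] l[OF xy(2)] unfolding simply_connected_def by blast
  then obtain h :: "real \<times> real \<Rightarrow> 'a" where h: "continuous_on ({0..1} \<times> {0..1}) h" "h ` ({0..1} \<times> {0..1}) \<subseteq> S"
    "\<forall>t\<in>{0..1}. h (0, t) = x" "\<forall>t\<in>{0..1}. h (1, t) = y"
    unfolding homotopic_loops by blast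
  have "continuous_on {0..1} (\<lambda>s. h (s, 0))"
    by (rule continuous_on_compose2[OF h(1)]) (auto intro!: continuous_intros)
  then show "\<exists>f. path f \<and> path_image f \<subseteq> S \<and> pathstart f = x \<and> pathfinish f = y"
    using h(2-4) by (intro exI[of _ "\<lambda>s. h (s, 0)"])
      (auto simp: path_def path_image_def pathstart_def pathfinish_def)
qed

section \<open>Curves: concatenation, coordinate segments, and the resulting distance\<close>

context closed_riemannian
begin

text \<open>Slope 2 with shift 0 or -1 describes the two halves of a joined path.\<close>

lemma C1_curve_on_affine:
  assumes "C1_curve_on A \<sigma> {2 * a + k..2 * b + k}" "\<And>t. t \<in> {a..b} \<Longrightarrow> \<gamma> t = \<sigma> (2 * t + k)"
  shows "C1_curve_on A \<gamma> {a..b}"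
  unfolding C1_curve_on_def
proof
  fix c assume c: "c \<in> A"
  obtain D where D: "continuous_on {t \<in> {2 * a + k..2 * b + k}. \<sigma> t \<in> chart_dom c} D"
    "\<forall>t\<in>{2 * a + k..2 * b + k}. \<sigma> t \<in> chart_dom c \<longrightarrow>
      ((chart_map c \<circ> \<sigma>) has_vector_derivative D t) (at t within {2 * a + k..2 * b + k})"
    using bspec[OF assms(1)[unfolded C1_curve_on_def] c] by blast
  have "continuous_on {t \<in> {a..b}. \<gamma> t \<in> chart_dom c} (\<lambda>t. 2 *\<^sub>R D (2 * t + k))"
    by (intro continuous_intros continuous_on_compose2[OF D(1)]) (auto simp: assms(2))
  moreover have "((chart_map c \<circ> \<gamma>) has_vector_derivative 2 *\<^sub>R D (2 * t + k)) (at t within {a..b})"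
    if t: "t \<in> {a..b}" "\<gamma> t \<in> chart_dom c" for t
  proof -
    have im: "(\<lambda>t. 2 * t + k) ` {a..b} \<subseteq> {2 * a + k..2 * b + k}" by auto
    have "((\<lambda>t. 2 * t + k) has_vector_derivative 2) (at t within {a..b})"
      by (auto intro!: derivative_eq_intros simp: has_real_derivative_iff_has_vector_derivative[symmetric])
    moreover have "((chart_map c \<circ> \<sigma>) has_vector_derivative D (2 * t + k)) (at (2 * t + k) within (\<lambda>t. 2 * t + k) ` {a..b})"
      by (rule has_vector_derivative_within_subset[OF D(2)[rule_format] im]) (use t assms(2) in auto)
    ultimately have "(((chart_map c \<circ> \<sigma>) \<circ> (\<lambda>t. 2 * t + k)) has_vector_derivative 2 *\<^sub>R D (2 * t + k)) (at t within {a..b})"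
      by (rule vector_diff_chain_within)
    then show ?thesis
      by (rule has_vector_derivative_transform[OF t(1), rotated]) (simp add: assms(2))
  qed
  ultimately show "\<exists>D. continuous_on {t \<in> {a..b}. \<gamma> t \<in> chart_dom c} D \<and>
     (\<forall>t\<in>{a..b}. \<gamma> t \<in> chart_dom c \<longrightarrow> ((chart_map c \<circ> \<gamma>) has_vector_derivative D t) (at t within {a..b}))"
    by blast
qed

text \<open>Speed is computed from the derivative within [0, 1]. At interior points this is the
  two-sided derivative, to which the chain rule applies.\<close>

lemma curve_speed_affine:
  assumes I: "open I" "t \<in> I" "\<And>s. s \<in> I \<Longrightarrow> \<gamma> s = \<sigma> (2 * s + k)"
    and t: "0 < t" "t < 1" "0 < 2 * t + k" "2 * t + k < 1"
    and d: "((chart_map (cat (\<gamma> t)) \<circ> \<sigma>) has_vector_derivative v) (at (2 * t + k))"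
  shows "curve_speed A g \<gamma> t = 2 * curve_speed A g \<sigma> (2 * t + k)"
proof -
  have int: "at t within {0..1} = at t" "at (2 * t + k) within {0..1} = at (2 * t + k)"
    using t by (auto intro!: at_within_interior)
  have eq: "\<gamma> t = \<sigma> (2 * t + k)" using I by simp
  have "((\<lambda>t. 2 * t + k) has_vector_derivative 2) (at t)"
    by (auto intro!: derivative_eq_intros simp: has_real_derivative_iff_has_vector_derivative[symmetric])
  from vector_diff_chain_at[OF this d]
  have "((chart_map (cat (\<gamma> t)) \<circ> \<sigma> \<circ> (\<lambda>t. 2 * t + k)) has_vector_derivative 2 *\<^sub>R v) (at t)" .
  then have "((chart_map (cat (\<gamma> t)) \<circ> \<gamma>) has_vector_derivative 2 *\<^sub>R v) (at t)"
    by (rule has_vector_derivative_transform_within_open[OF _ I(1,2)]) (simp add: I(3))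
  then have "vector_derivative (chart_map (cat (\<gamma> t)) \<circ> \<gamma>) (at t) = 2 *\<^sub>R v"
    by (rule vector_derivative_at)
  moreover have "vector_derivative (chart_map (cat (\<gamma> t)) \<circ> \<sigma>) (at (2 * t + k)) = v"
    using d by (rule vector_derivative_at)
  ultimately show ?thesis
    unfolding curve_speed_def Let_def int using eq
    by (simp add: matrix_vector_mult_scaleR real_sqrt_mult)
qed

lemma piece_around:
  fixes T :: "real set"
  assumes T: "finite T" "{0, 1} \<subseteq> T" and t: "t \<in> {0..1} - T"
  obtains a b where "a \<in> T" "b \<in> T" "a < t" "t < b" "T \<inter> {a<..<b} = {}"
proof
  define a where "a = Max {s \<in> T. s < t}"
  define b where "b = Min {s \<in> T. s > t}"
  have f: "finite {s \<in> T. s < t}" "finite {s \<in> T. s > t}" using T by auto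
  have "0 < t" "t < 1" using t T(2) by (force simp: less_le)+
  then have ne: "{s \<in> T. s < t} \<noteq> {}" "{s \<in> T. s > t} \<noteq> {}" using T(2) by blast+
  have "a \<in> {s \<in> T. s < t}" "b \<in> {s \<in> T. s > t}"
    unfolding a_def b_def using Max_in[OF f(1) ne(1)] Min_in[OF f(2) ne(2)] by auto
  then show "a \<in> T" "b \<in> T" "a < t" "t < b" by auto
  have "s \<le> a" if "s \<in> T" "s < t" for s unfolding a_def using Max_ge[OF f(1)] that by blast
  moreover have "b \<le> s" if "s \<in> T" "t < s" for s unfolding b_def using Min_le[OF f(2)] that by blast
  ultimately show "T \<inter> {a<..<b} = {}" using t by (fastforce simp: not_less)
qed

lemma curve_differentiable:
  assumes T: "finite T" "{0, 1} \<subseteq> T"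
    and C: "\<forall>a\<in>T. \<forall>b\<in>T. a < b \<and> T \<inter> {a<..<b} = {} \<longrightarrow> C1_curve_on A \<gamma> {a..b}"
    and t: "t \<in> {0..1} - T" and c: "c \<in> A" "\<gamma> t \<in> chart_dom c"
  obtains v where "((chart_map c \<circ> \<gamma>) has_vector_derivative v) (at t)"
proof -
  obtain a b where ab: "a \<in> T" "b \<in> T" "a < t" "t < b" "T \<inter> {a<..<b} = {}" by (rule piece_around[OF T t])
  then have "C1_curve_on A \<gamma> {a..b}" using C by (meson less_trans)
  from bspec[OF this[unfolded C1_curve_on_def] c(1)]
  obtain D where "\<forall>t\<in>{a..b}. \<gamma> t \<in> chart_dom c \<longrightarrow>
      ((chart_map c \<circ> \<gamma>) has_vector_derivative D t) (at t within {a..b})" by blast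
  then have "((chart_map c \<circ> \<gamma>) has_vector_derivative D t) (at t within {a..b})"
    using c(2) ab by simp
  moreover have "at t within {a..b} = at t" using ab by (auto intro!: at_within_interior)
  ultimately show ?thesis using that by metis
qed

definition reach :: "'a \<Rightarrow> 'a \<Rightarrow> real \<Rightarrow> bool" where
  "reach x y L \<longleftrightarrow> (\<exists>\<gamma> l. piecewise_C1_curve M A \<gamma> \<and> pathstart \<gamma> = x \<and> pathfinish \<gamma> = y \<and>
     (curve_speed A g \<gamma> has_integral l) {0..1} \<and> l \<le> L)"

lemma reach_trans:
  assumes "reach x y L1" "reach y z L2"
  shows "reach x z (L1 + L2)"
proof -
  obtain \<gamma>1 l1 T1 where 1: "path \<gamma>1" "path_image \<gamma>1 \<subseteq> M" "pathstart \<gamma>1 = x" "pathfinish \<gamma>1 = y"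
    "(curve_speed A g \<gamma>1 has_integral l1) {0..1}" "l1 \<le> L1" "finite T1" "{0, 1} \<subseteq> T1" "T1 \<subseteq> {0..1}"
    "\<forall>a\<in>T1. \<forall>b\<in>T1. a < b \<and> T1 \<inter> {a<..<b} = {} \<longrightarrow> C1_curve_on A \<gamma>1 {a..b}"
    using assms(1) unfolding reach_def piecewise_C1_curve_def by blast
  obtain \<gamma>2 l2 T2 where 2: "path \<gamma>2" "path_image \<gamma>2 \<subseteq> M" "pathstart \<gamma>2 = y" "pathfinish \<gamma>2 = z"
    "(curve_speed A g \<gamma>2 has_integral l2) {0..1}" "l2 \<le> L2" "finite T2" "{0, 1} \<subseteq> T2" "T2 \<subseteq> {0..1}"
    "\<forall>a\<in>T2. \<forall>b\<in>T2. a < b \<and> T2 \<inter> {a<..<b} = {} \<longrightarrow> C1_curve_on A \<gamma>2 {a..b}"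
    using assms(2) unfolding reach_def piecewise_C1_curve_def by blast
  define \<gamma> where "\<gamma> = \<gamma>1 +++ \<gamma>2"
  define h1 h2 :: "real \<Rightarrow> real" where "h1 = (\<lambda>t. t / 2)" and "h2 = (\<lambda>t. t / 2 + 1 / 2)"
  define T where "T = h1 ` T1 \<union> h2 ` T2"
  have g1: "\<gamma> t = \<gamma>1 (2 * t + 0)" if "t \<le> 1/2" for t using that by (simp add: \<gamma>_def joinpaths_def)
  have g2: "\<gamma> t = \<gamma>2 (2 * t + (-1))" if "1/2 \<le> t" for t
  proof (cases "t = 1/2")
    case True
    show ?thesis unfolding True using 1(4) 2(3)
      by (simp add: \<gamma>_def joinpaths_def pathfinish_def pathstart_def)
  qed (use that in \<open>simp add: \<gamma>_def joinpaths_def\<close>)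
  \<comment> \<open>The junction is a subdivision point, so no piece of the joined curve straddles
    it.\<close>
  have half: "1/2 \<in> T" using 1(8) unfolding T_def h1_def by auto
  have "h1 0 = 0" "h2 1 = 1" by (simp_all add: h1_def h2_def)
  then have "0 \<in> h1 ` T1" "1 \<in> h2 ` T2" using 1(8) 2(8) by (metis image_eqI insert_subset)+
  then have T: "finite T" "{0, 1} \<subseteq> T" "T \<subseteq> {0..1}"
    using 1(7,9) 2(7,9) by (auto simp: T_def h1_def h2_def)
  have inT1: "2 * a \<in> T1" if aT: "a \<in> T" "a \<le> 1/2" for a
  proof -
    consider s where "s \<in> T1" "a = s / 2" | s where "s \<in> T2" "a = s / 2 + 1 / 2"
      using aT(1) by (auto simp: T_def h1_def h2_def)
    then show ?thesis
    proof cases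
      case 2
      then have "s \<ge> 0" using \<open>T2 \<subseteq> {0..1}\<close> by auto
      then have "a = 1/2" using 2 aT(2) by auto
      then have "2 * a = 1" by simp
      then show ?thesis using 1(8) by (simp only: insert_subset)
    next
      case c: 1
      then have "2 * a = s" by simp
      then show ?thesis using c(1) by simp
    qed
  qed
  have inT2: "2 * a + (-1) \<in> T2" if aT: "a \<in> T" "1/2 \<le> a" for a
  proof -
    consider s where "s \<in> T2" "a = s / 2 + 1 / 2" | s where "s \<in> T1" "a = s / 2"
      using aT(1) by (auto simp: T_def h1_def h2_def)
    then show ?thesis
    proof cases
      case 2
      then have "s \<le> 1" using \<open>T1 \<subseteq> {0..1}\<close> by auto
      then have "a = 1/2" using 2 aT(2) by auto
      then have "2 * a + (-1) = 0" by simp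
      then show ?thesis using \<open>{0, 1} \<subseteq> T2\<close> by (simp only: insert_subset)
    next
      case c: 1
      then have "2 * a + (-1) = s" by simp
      then show ?thesis using c(1) by simp
    qed
  qed
  have C: "C1_curve_on A \<gamma> {a..b}" if ab: "a \<in> T" "b \<in> T" "a < b" "T \<inter> {a<..<b} = {}" for a b
  proof -
    consider "b \<le> 1/2" | "1/2 \<le> a" using half ab(4) by fastforce
    then show ?thesis
    proof cases
      case b: 1
      have "T1 \<inter> {2 * a + 0<..<2 * b + 0} = {}"
      proof (rule ccontr)
        assume "\<not> ?thesis"
        then obtain s where "s \<in> T1" "2 * a < s" "s < 2 * b" by auto
        then have "s / 2 \<in> T \<inter> {a<..<b}" by (auto simp: T_def h1_def)
        then show False using ab(4) by blast
      qed
      moreover have "2 * a + 0 \<in> T1" "2 * b + 0 \<in> T1" using inT1 ab b by auto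
      ultimately have "C1_curve_on A \<gamma>1 {2 * a + 0..2 * b + 0}" using 1(10) ab(3) by auto
      then show ?thesis by (rule C1_curve_on_affine) (use g1 b in auto)
    next
      case a: 2
      have "T2 \<inter> {2 * a + (-1)<..<2 * b + (-1)} = {}"
      proof (rule ccontr)
        assume "\<not> ?thesis"
        then obtain s where "s \<in> T2" "2 * a + (-1) < s" "s < 2 * b + (-1)" by auto
        then have "s / 2 + 1/2 \<in> T \<inter> {a<..<b}" by (auto simp: T_def h2_def)
        then show False using ab(4) by blast
      qed
      moreover have "2 * a + (-1) \<in> T2" "2 * b + (-1) \<in> T2" using inT2 ab a by auto
      ultimately have "C1_curve_on A \<gamma>2 {2 * a + (-1)..2 * b + (-1)}" using 2(10) ab(3) by auto
      then show ?thesis by (rule C1_curve_on_affine) (use g2 a in auto)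
    qed
  qed
  have pimg: "path_image \<gamma> \<subseteq> M" unfolding \<gamma>_def using path_image_join_subset 1(2) 2(2) by blast
  have pw: "piecewise_C1_curve M A \<gamma>"
    unfolding piecewise_C1_curve_def using T C pimg 1 2 by (auto simp: \<gamma>_def intro!: exI[of _ T])
  have inM: "\<gamma> t \<in> M" if "t \<in> {0..1}" for t using pimg that by (auto simp: path_image_def)
  \<comment> \<open>Subdivision points are left out because the curve may fail to be differentiable
    there; being finite in number, they do not affect the integral.\<close>
  have s1: "curve_speed A g \<gamma> t = 2 * curve_speed A g \<gamma>1 (2 * t + 0)" if t: "t \<in> {0..1/2} - T" for t
  proof -
    have "t \<noteq> 0" "t \<noteq> 1/2" using t T(2) half by blast+
    then have t': "0 < t" "t < 1/2" using t by auto
    have "2 * t \<in> {0..1} - T1"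
    proof -
      have "h1 (2 * t) = t" by (simp add: h1_def)
      then have "2 * t \<notin> T1" using t unfolding T_def by (metis DiffD2 UnI1 image_eqI)
      then show ?thesis using t' by auto
    qed
    then have nT: "2 * t \<in> {0..1} - T1" .
    have dm: "\<gamma>1 (2 * t) \<in> chart_dom (cat (\<gamma> t))" using chart_at(2)[OF inM[of t]] t' g1[of t] by simp
    have cA: "cat (\<gamma> t) \<in> A" using chart_at(1)[OF inM[of t]] t' by simp
    obtain v where "((chart_map (cat (\<gamma> t)) \<circ> \<gamma>1) has_vector_derivative v) (at (2 * t))"
      by (rule curve_differentiable[OF 1(7,8,10) nT cA dm])
    then show ?thesis
      by (intro curve_speed_affine[of "{..<1/2}" t \<gamma> \<gamma>1 0]) (use t' g1 in auto)
  qed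
  have s2: "curve_speed A g \<gamma> t = 2 * curve_speed A g \<gamma>2 (2 * t + (-1))" if t: "t \<in> {1/2..1} - T" for t
  proof -
    have "t \<noteq> 1" "t \<noteq> 1/2" using t T(2) half by blast+
    then have t': "1/2 < t" "t < 1" using t by auto
    have "2 * t + (-1) \<in> {0..1} - T2"
    proof -
      have "h2 (2 * t + (-1)) = t" by (simp add: h2_def field_simps)
      then have "2 * t + (-1) \<notin> T2" using t unfolding T_def by (metis DiffD2 UnI2 image_eqI)
      then show ?thesis using t' by auto
    qed
    then have nT: "2 * t + (-1) \<in> {0..1} - T2" .
    have dm: "\<gamma>2 (2 * t + (-1)) \<in> chart_dom (cat (\<gamma> t))" using chart_at(2)[OF inM[of t]] t' g2[of t] by simp
    have cA: "cat (\<gamma> t) \<in> A" using chart_at(1)[OF inM[of t]] t' by simp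
    obtain v where "((chart_map (cat (\<gamma> t)) \<circ> \<gamma>2) has_vector_derivative v) (at (2 * t + (-1)))"
      by (rule curve_differentiable[OF 2(7,8,10) nT cA dm])
    then show ?thesis
      by (intro curve_speed_affine[of "{1/2<..}" t \<gamma> \<gamma>2 "-1"]) (use t' g2 in auto)
  qed
  have i1: "((\<lambda>t. 2 * curve_speed A g \<gamma>1 (2 * t + 0)) has_integral l1) {0..1/2}"
    using has_integral_mult_right[OF has_integral_affinity01[OF 1(5), of 2 0], of 2] by (simp add: mult.commute)
  have im2: "(\<lambda>x::real. x / 2 + 1 / 2) ` {0..1} = {1/2..1}"
    using image_affinity_atLeastAtMost[of "1/2" "1/2" "0::real" 1] by simp
  have i2: "((\<lambda>t. 2 * curve_speed A g \<gamma>2 (2 * t + (-1))) has_integral l2) {1/2..1}"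
    using has_integral_mult_right[OF has_integral_affinity01[OF 2(5), of 2 "-1"], of 2] im2 by simp
  have "(curve_speed A g \<gamma> has_integral l1) {0..1/2}"
    by (rule has_integral_spike_finite[OF T(1) s1 i1])
  moreover have "(curve_speed A g \<gamma> has_integral l2) {1/2..1}"
    by (rule has_integral_spike_finite[OF T(1) s2 i2])
  ultimately have "(curve_speed A g \<gamma> has_integral (l1 + l2)) {0..1}"
    by (intro has_integral_combine) auto
  then show ?thesis unfolding reach_def
    using pw 1 2 by (auto simp: \<gamma>_def intro!: exI[of _ "\<gamma>1 +++ \<gamma>2"])
qed

text \<open>The segment is run through over [0, 1] with constant coordinate velocity y - x, so a
  bound on its speed is a bound on its length.\<close>

lemma reach_segment:
  assumes c: "c \<in> A" and seg: "closed_segment x y \<subseteq> chart_img c"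
    and L: "\<And>z. z \<in> closed_segment x y \<Longrightarrow> gnorm c z (y - x) \<le> L"
  shows "reach (chart_inv c x) (chart_inv c y) L"
proof -
  define \<gamma> where "\<gamma> = chart_inv c \<circ> linepath x y"
  have lp: "linepath x y t \<in> chart_img c" if "t \<in> {0..1}" for t
    using seg that linepath_in_path[of t x y] by auto
  have "continuous_on {0..1} \<gamma>" unfolding \<gamma>_def
    by (intro continuous_on_compose continuous_on_linepath continuous_on_subset[OF chartD(4)[OF c]]) (use lp in auto)
  then have path: "path \<gamma>" by (simp add: path_def)
  have dom: "\<gamma> t \<in> chart_dom c" if "t \<in> {0..1}" for t using lp[OF that] chartD(6)[OF c] by (simp add: \<gamma>_def)
  have pimg: "path_image \<gamma> \<subseteq> M" using dom chartD(8)[OF c] by (auto simp: path_image_def)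
  define D where "D d t = frechet_derivative (transition c d) (at (linepath x y t)) (y - x)" for d t
  have ov: "linepath x y t \<in> overlap c d" if "t \<in> {0..1}" "\<gamma> t \<in> chart_dom d" "d \<in> A" for d t
    using overlap(6)[OF c that(3) dom[OF that(1)] that(2)] chartD(7)[OF c lp[OF that(1)]] by (simp add: \<gamma>_def)
  have deriv: "((chart_map d \<circ> \<gamma>) has_vector_derivative D d t) (at t within {0..1})"
    if d: "d \<in> A" and t: "t \<in> {0..1}" "\<gamma> t \<in> chart_dom d" for d t
  proof -
    have "(linepath x y has_derivative (\<lambda>s. s *\<^sub>R (y - x))) (at t)"
      using has_vector_derivative_linepath_within[of x y t UNIV] by (simp add: has_vector_derivative_def)
    then have "((transition c d \<circ> linepath x y) has_derivative
        (frechet_derivative (transition c d) (at (linepath x y t)) \<circ> (\<lambda>s. s *\<^sub>R (y - x)))) (at t)"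
      by (rule diff_chain_at) (rule smooth_on_has_derivative[OF overlap(3)[OF c d] ov[OF t d]])
    moreover have "transition c d \<circ> linepath x y = chart_map d \<circ> \<gamma>"
      by (simp add: transition_def \<gamma>_def o_assoc)
    moreover have "linear (frechet_derivative (transition c d) (at (linepath x y t)))"
      by (rule has_derivative_linear[OF smooth_on_has_derivative[OF overlap(3)[OF c d] ov[OF t d]]])
    ultimately have "((chart_map d \<circ> \<gamma>) has_vector_derivative D d t) (at t)"
      unfolding has_vector_derivative_def by (auto elim!: has_derivative_eq_rhs simp: D_def linear_scale fun_eq_iff)
    then show ?thesis by (rule has_vector_derivative_at_within)
  qed
  have "C1_curve_on A \<gamma> {0..1}"
    unfolding C1_curve_on_def
  proof
    fix d assume d: "d \<in> A"
    have "continuous_on {t \<in> {0..1}. \<gamma> t \<in> chart_dom d} (D d)"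
      unfolding D_def
      by (rule continuous_on_compose2[OF smooth_on_continuous[OF smooth_on_frechet_derivative[OF overlap(3)[OF c d]]]
            continuous_on_linepath]) (use ov[OF _ _ d] in auto)
    then show "\<exists>D. continuous_on {t \<in> {0..1}. \<gamma> t \<in> chart_dom d} D \<and>
       (\<forall>t\<in>{0..1}. \<gamma> t \<in> chart_dom d \<longrightarrow> ((chart_map d \<circ> \<gamma>) has_vector_derivative D t) (at t within {0..1}))"
      using deriv[OF d] by blast
  qed
  then have pw: "piecewise_C1_curve M A \<gamma>"
    unfolding piecewise_C1_curve_def using path pimg by (auto intro!: exI[of _ "{0, 1}"])
  have speed: "curve_speed A g \<gamma> t = gnorm c (linepath x y t) (y - x)" if t: "t \<in> {0..1}" for t
  proof -
    define d where "d = cat (\<gamma> t)"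
    have "\<gamma> t \<in> M" using dom[OF t] chartD(8)[OF c] by blast
    then have d: "d \<in> A" "\<gamma> t \<in> chart_dom d" using chart_at by (auto simp: d_def)
    have v: "vector_derivative (chart_map d \<circ> \<gamma>) (at t within {0..1}) = D d t"
      by (rule vector_derivative_within_closed_interval[OF _ _ deriv[OF d(1) t d(2)]]) (use t in auto)
    have x: "transition c d (linepath x y t) = chart_map d (\<gamma> t)" by (simp add: transition_def \<gamma>_def)
    have "curve_speed A g \<gamma> t = gnorm d (chart_map d (\<gamma> t)) (D d t)"
      unfolding curve_speed_def Let_def d_def[symmetric] v gnorm_def ..
    also have "\<dots> = gnorm c (linepath x y t) (y - x)"
      using dchart_change(2)[OF smooth_function_const c d(1) ov[OF t d(2,1)], of "y - x"]
      by (simp add: x D_def)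
    finally show ?thesis .
  qed
  have "continuous_on {0..1} (\<lambda>t. gnorm c (linepath x y t) (y - x))"
    unfolding gnorm_def
    by (intro continuous_intros bounded_bilinear.continuous_on[OF bounded_bilinear_matrix_vector]
        continuous_on_compose2[OF smooth_on_continuous[OF metric_onD(2)[OF metric_chart[OF c]]] continuous_on_linepath])
       (use lp in auto)
  then have cont: "continuous_on {0..1} (curve_speed A g \<gamma>)"
    by (rule continuous_on_eq) (simp add: speed)
  define l where "l = integral {0..1} (curve_speed A g \<gamma>)"
  have l: "(curve_speed A g \<gamma> has_integral l) {0..1}"
    unfolding l_def using integrable_continuous_real[OF cont] by (rule integrable_integral)
  have "l \<le> L"
  proof (rule has_integral_le[OF l])
    show "((\<lambda>_::real. L) has_integral L) {0..1}" using has_integral_const_real[of L 0 1] by simp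
    show "curve_speed A g \<gamma> t \<le> L" if "t \<in> {0..1}" for t
      using L linepath_in_path[OF that, of x y] by (simp add: speed[OF that])
  qed
  then show ?thesis unfolding reach_def using pw l
    by (intro exI[of _ \<gamma>] exI[of _ l]) (simp add: \<gamma>_def pathstart_def pathfinish_def linepath_def)
qed

lemma curve_speed_nonneg: "\<gamma> t \<in> M \<Longrightarrow> curve_speed A g \<gamma> t \<ge> 0"
  using gnorm_nonneg[OF chart_at(1)] chart_at(2) unfolding curve_speed_def Let_def gnorm_def by blast

lemma reach_nonneg: "reach x y L \<Longrightarrow> L \<ge> 0"
proof -
  assume "reach x y L"
  then obtain \<gamma> l where "piecewise_C1_curve M A \<gamma>" and l: "(curve_speed A g \<gamma> has_integral l) {0..1}" "l \<le> L"
    unfolding reach_def by blast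
  then have "\<gamma> t \<in> M" if "t \<in> {0..1}" for t
    using that by (auto simp: piecewise_C1_curve_def path_image_def)
  then have "0 \<le> l" using has_integral_nonneg[OF l(1)] curve_speed_nonneg by blast
  then show ?thesis using l(2) by simp
qed

lemma geodesic_dist_le_reach:
  assumes "reach x y L"
  shows "geodesic_dist M A g x y \<le> L"
proof -
  obtain \<gamma> l where \<gamma>: "piecewise_C1_curve M A \<gamma>" "pathstart \<gamma> = x" "pathfinish \<gamma> = y"
    "(curve_speed A g \<gamma> has_integral l) {0..1}" "l \<le> L" using assms unfolding reach_def by blast
  \<comment> \<open>The infimum needs a lower bound over all competing curves; those with
    nonintegrable speed have length 0 by default and do no harm.\<close>
  have "curve_length A g \<sigma> \<ge> 0" if "piecewise_C1_curve M A \<sigma>" for \<sigma>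
    unfolding curve_length_def
  proof (cases "curve_speed A g \<sigma> integrable_on {0..1}")
    case True
    have "\<sigma> t \<in> M" if "t \<in> {0..1}" for t
      using that \<open>piecewise_C1_curve M A \<sigma>\<close> by (auto simp: piecewise_C1_curve_def path_image_def)
    then show "0 \<le> integral {0..1} (curve_speed A g \<sigma>)"
      using True curve_speed_nonneg by (intro Henstock_Kurzweil_Integration.integral_nonneg) auto
  qed (simp add: not_integrable_integral)
  then have "bdd_below {curve_length A g \<gamma> | \<gamma>. piecewise_C1_curve M A \<gamma> \<and> pathstart \<gamma> = x \<and> pathfinish \<gamma> = y}"
    by (auto simp: bdd_below_def)
  then have "geodesic_dist M A g x y \<le> curve_length A g \<gamma>"
    unfolding geodesic_dist_def using \<gamma>(1-3) by (intro cInf_lower) auto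
  also have "\<dots> = l" unfolding curve_length_def using \<gamma>(4) by (rule integral_unique)
  finally show ?thesis using \<gamma>(5) by simp
qed

lemma reach_refl: "x \<in> M \<Longrightarrow> reach x x 0"
  using reach_segment[OF chart_at(1), of x "chart_map (cat x) x" "chart_map (cat x) x" 0]
    chartD(5)[OF chart_at(1) chart_at(2)] chart_at(2)[of x]
  by (simp add: gnorm_def)

lemma gnorm_bound_compact:
  assumes c: "c \<in> A" and K: "compact K" "K \<subseteq> chart_img c"
  obtains b where "b > 0" "\<And>x v. x \<in> K \<Longrightarrow> gnorm c x v \<le> b * norm v"
proof -
  have "bounded (g c ` K)"
    using K smooth_on_continuous[OF metric_onD(2)[OF metric_chart[OF c]]]
    by (meson compact_continuous_image compact_imp_bounded continuous_on_subset)
  then obtain k where k: "\<And>x. x \<in> K \<Longrightarrow> norm (g c x) \<le> k" by (auto simp: bounded_iff)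
  obtain B where B: "B > 0" "\<And>(G::real^'n^'n) v. norm (G *v v) \<le> norm G * norm v * B"
    using bounded_bilinear.pos_bounded[OF bounded_bilinear_matrix_vector] by metis
  define m where "m = max k 1"
  show thesis
  proof (rule that[of "sqrt (m * B)"])
    show "sqrt (m * B) > 0" using B by (simp add: m_def)
    fix x v assume x: "x \<in> K"
    have "v \<bullet> (g c x *v v) \<le> norm v * norm (g c x *v v)" by (rule norm_cauchy_schwarz)
    also have "\<dots> \<le> norm v * (norm (g c x) * norm v * B)" by (intro mult_left_mono B) auto
    also have "\<dots> \<le> norm v * (m * norm v * B)"
      using k[OF x] B(1) by (intro mult_left_mono mult_right_mono) (auto simp: m_def)
    also have "\<dots> = (m * B) * (norm v)\<^sup>2" by (simp add: power2_eq_square)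
    finally have "gnorm c x v \<le> sqrt ((m * B) * (norm v)\<^sup>2)" unfolding gnorm_def by (rule real_sqrt_le_mono)
    then show "gnorm c x v \<le> sqrt (m * B) * norm v" by (simp add: real_sqrt_mult)
  qed
qed

text \<open>Mutual reachability is an equivalence relation, and its classes are open because a
  coordinate ball is joined to its centre by segments.\<close>

lemma reach_exists:
  assumes conn: "connected M" and xy: "x \<in> M" "y \<in> M"
  shows "\<exists>L. reach x y L"
proof -
  have "(\<exists>L. reach x y L) \<and> (\<exists>L. reach y x L)"
  proof (rule connected_equivalence_relation[OF conn xy])
    fix p assume p: "p \<in> M"
    define c a where "c = cat p" and "a = chart_map c p"
    have c: "c \<in> A" "p \<in> chart_dom c" using chart_at p by (auto simp: c_def)
    have pa: "chart_inv c a = p" using chartD(5)[OF c] by (simp add: a_def)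
    obtain r where r: "r > 0" "cball a r \<subseteq> chart_img c"
      using chartD(2)[OF c(1)] c(2) unfolding a_def by (metis image_eqI open_contains_cball)
    obtain b where b: "b > 0" "\<And>x v. x \<in> cball a r \<Longrightarrow> gnorm c x v \<le> b * norm v"
      using gnorm_bound_compact[OF c(1) compact_cball r(2)] by blast
    have R: "reach (chart_inv c x) (chart_inv c y) (b * norm (y - x))" if "x \<in> ball a r" "y \<in> ball a r" for x y
    proof (rule reach_segment[OF c(1)])
      have "closed_segment x y \<subseteq> cball a r"
        using that by (intro closed_segment_subset convex_cball) auto
      then show "closed_segment x y \<subseteq> chart_img c" "\<And>z. z \<in> closed_segment x y \<Longrightarrow> gnorm c z (y - x) \<le> b * norm (y - x)"
        using r b by blast+
    qed
    show "\<exists>T. openin (top_of_set M) T \<and> p \<in> T \<and> (\<forall>x\<in>T. (\<exists>L. reach p x L) \<and> (\<exists>L. reach x p L))"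
    proof (intro exI[of _ "chart_inv c ` ball a r"] conjI ballI)
      show "openin (top_of_set M) (chart_inv c ` ball a r)"
        by (rule open_chart_image[OF c(1)]) (use r ball_subset_cball in auto)
      show "p \<in> chart_inv c ` ball a r" using pa r by (metis centre_in_ball image_eqI)
      fix q assume "q \<in> chart_inv c ` ball a r"
      then obtain z where z: "z \<in> ball a r" "q = chart_inv c z" by auto
      have "a \<in> ball a r" using r by simp
      from R[OF this z(1)] R[OF z(1) this]
      show "\<exists>L. reach p q L" "\<exists>L. reach q p L" using pa z by auto
    qed
  qed (use reach_trans in blast)+
  then show ?thesis by blast
qed

text \<open>A substitute for \<open>geodesic_dist\<close> built on \<open>reach\<close>, whose
  triangle inequality comes from \<open>reach_trans\<close>. It dominates
  \<open>geodesic_dist\<close>, so an upper bound on it bounds the diameter.\<close>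

definition du :: "'a \<Rightarrow> 'a \<Rightarrow> real" where
  "du x p = Inf {L. reach x p L}"

lemma
  assumes conn: "connected M" and x: "x \<in> M"
  shows du_self: "du x x = 0"
    and geodesic_dist_le_du: "y \<in> M \<Longrightarrow> geodesic_dist M A g x y \<le> du x y"
    and du_Lipschitz: "p \<in> M \<Longrightarrow> q \<in> M \<Longrightarrow> reach p q m \<Longrightarrow> reach q p m \<Longrightarrow> \<bar>du x p - du x q\<bar> \<le> m"
proof -
  have bdd: "bdd_below {L. reach x p L}" for p using reach_nonneg by (auto simp: bdd_below_def)
  have ne: "{L. reach x p L} \<noteq> {}" if "p \<in> M" for p using reach_exists[OF conn x that] by auto
  have "du x x \<le> 0" unfolding du_def by (rule cInf_lower[OF _ bdd]) (use reach_refl[OF x] in simp)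
  moreover have "0 \<le> du x x" unfolding du_def by (rule cInf_greatest[OF ne[OF x]]) (use reach_nonneg in auto)
  ultimately show "du x x = 0" by simp
  show "geodesic_dist M A g x y \<le> du x y" if "y \<in> M"
    unfolding du_def by (rule cInf_greatest[OF ne[OF that]]) (use geodesic_dist_le_reach in auto)
  have one: "du x q \<le> du x p + m" if "p \<in> M" "reach p q m" for p q m
  proof -
    have "du x q - m \<le> du x p"
    proof (subst (2) du_def, rule cInf_greatest[OF ne[OF that(1)]])
      fix L assume "L \<in> {L. reach x p L}"
      then have "du x q \<le> L + m"
        unfolding du_def using reach_trans[OF _ that(2)] by (intro cInf_lower[OF _ bdd]) auto
      then show "du x q - m \<le> L" by simp
    qed
    then show ?thesis by simp
  qed
  show "\<bar>du x p - du x q\<bar> \<le> m" if "p \<in> M" "q \<in> M" "reach p q m" "reach q p m"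
    using one[OF that(1,3)] one[OF that(2,4)] by simp
qed

lemma du_segment:
  assumes conn: "connected M" and x: "x \<in> M" and c: "c \<in> A" and seg: "closed_segment a b \<subseteq> chart_img c"
    and m: "\<And>z. z \<in> closed_segment a b \<Longrightarrow> gnorm c z (b - a) \<le> m"
  shows "\<bar>du x (chart_inv c a) - du x (chart_inv c b)\<bar> \<le> m"
proof (rule du_Lipschitz[OF conn x])
  show "chart_inv c a \<in> M" "chart_inv c b \<in> M" using seg chartD(6,8)[OF c] by blast+
  show "reach (chart_inv c a) (chart_inv c b) m" by (rule reach_segment[OF c seg m])
  have "gnorm c z (a - b) = gnorm c z (b - a)" for z
    unfolding gnorm_def by (simp add: matrix_vector_mult_diff_distrib inner_simps)
  then show "reach (chart_inv c b) (chart_inv c a) m"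
    using seg m by (intro reach_segment[OF c]) (auto simp: closed_segment_commute)
qed

end

section \<open>Smooth approximation of the distance\<close>

text \<open>All derivatives fall on the kernel, so continuity of U suffices. Integrating over a
  fixed box, with z in the kernel only, brings the integral into the form of
  \<open>leibniz_rule\<close>.\<close>

lemma has_derivative_convolution:
  fixes U \<rho> :: "'e::euclidean_space \<Rightarrow> real"
  assumes U: "continuous_on (cbox l u) U" and \<rho>: "smooth_on UNIV \<rho>"
  shows "((\<lambda>z. integral (cbox l u) (\<lambda>y. U y * \<rho> (y - z))) has_derivative
    (\<lambda>v. integral (cbox l u) (\<lambda>y. U y * (- frechet_derivative \<rho> (at (y - z)) v)))) (at z)"
proof -
  \<comment> \<open>\<open>leibniz_rule\<close> takes the derivative as a continuous family of
    bounded linear maps.\<close>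
  define E where "E x = Blinfun (frechet_derivative \<rho> (at x))" for x
  have bl: "bounded_linear (frechet_derivative \<rho> (at x))" for x
    by (rule frechet_derivative_bounded_linear) (use smooth_on_differentiable[OF \<rho>] in simp)
  have E: "blinfun_apply (E x) = frechet_derivative \<rho> (at x)" for x
    unfolding E_def by (rule bounded_linear_Blinfun_apply[OF bl])
  have contE: "continuous_on UNIV E"
    by (rule continuous_on_blinfun_componentwise)
       (simp add: E smooth_on_continuous[OF smooth_on_frechet_derivative[OF \<rho>]])
  define fx where "fx z y = (- U y) *\<^sub>R E (y - z)" for z y
  have cont: "continuous_on (UNIV \<times> cbox l u) (\<lambda>(z, y). fx z y)"
    unfolding fx_def split_beta
    by (intro continuous_intros continuous_on_compose2[OF U] continuous_on_compose2[OF contE]) auto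
  have cont\<rho>: "continuous_on UNIV \<rho>" by (rule smooth_on_continuous[OF \<rho>])
  have lr: "((\<lambda>z. integral (cbox l u) (\<lambda>y. U y * \<rho> (y - z))) has_derivative
      blinfun_apply (integral (cbox l u) (fx z))) (at z within UNIV)"
  proof (rule leibniz_rule[OF _ _ cont])
    fix z y :: 'e
    have "((\<lambda>z. y - z) has_derivative (\<lambda>v. - v)) (at z)" by (auto intro!: derivative_eq_intros)
    moreover have "(\<rho> has_derivative frechet_derivative \<rho> (at (y - z))) (at (y - z))"
      by (rule smooth_on_has_derivative[OF \<rho>]) simp
    ultimately have "((\<lambda>z. \<rho> (y - z)) has_derivative (\<lambda>v. frechet_derivative \<rho> (at (y - z)) (- v))) (at z)"
      using diff_chain_at[of "\<lambda>z. y - z" "\<lambda>v. - v" z \<rho>] by (simp add: o_def)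
    then have "((\<lambda>z. U y * \<rho> (y - z)) has_derivative (\<lambda>v. U y * frechet_derivative \<rho> (at (y - z)) (- v))) (at z)"
      by (rule has_derivative_mult_right)
    moreover have "blinfun_apply (fx z y) = (\<lambda>v. U y * frechet_derivative \<rho> (at (y - z)) (- v))"
      by (simp add: fx_def fun_eq_iff blinfun.scaleR_left blinfun.minus_left E
          linear_neg[OF bounded_linear.linear[OF bl]])
    ultimately show "((\<lambda>z. U y * \<rho> (y - z)) has_derivative blinfun_apply (fx z y)) (at z within UNIV)"
      by simp
  next
    show "(\<lambda>y. U y * \<rho> (y - z)) integrable_on cbox l u" for z
      by (intro integrable_continuous continuous_intros U continuous_on_compose2[OF cont\<rho>]) auto
  qed auto
  have bv: "blinfun_apply (integral (cbox l u) (fx z)) v = integral (cbox l u) (\<lambda>y. U y * (- frechet_derivative \<rho> (at (y - z)) v))" for v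
  proof -
    have "fx z integrable_on cbox l u"
      unfolding fx_def
      by (intro integrable_continuous continuous_intros U continuous_on_compose2[OF contE]) auto
    from integral_linear[OF this blinfun.bounded_linear_left[of v]]
    show ?thesis by (simp add: o_def fx_def blinfun.scaleR_left blinfun.minus_left E)
  qed
  from bv have "blinfun_apply (integral (cbox l u) (fx z)) = (\<lambda>v. integral (cbox l u) (\<lambda>y. U y * (- frechet_derivative \<rho> (at (y - z)) v)))"
    by (rule ext)
  then show ?thesis using lr by simp
qed

text \<open>A directional derivative of the integral is again such an integral, with the negative
  directional derivative of \<rho> as kernel; hence induction over all smooth kernels.\<close>

lemma smooth_on_convolution:
  fixes U \<rho> :: "'e::euclidean_space \<Rightarrow> real"
  assumes U: "continuous_on (cbox l u) U" and \<rho>: "smooth_on UNIV \<rho>"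
  shows "smooth_on UNIV (\<lambda>z. integral (cbox l u) (\<lambda>y. U y * \<rho> (y - z)))"
proof -
  have "Ck_on k UNIV (\<lambda>z. integral (cbox l u) (\<lambda>y. U y * \<rho> (y - z)))" for k
    using \<rho>
  proof (induction k arbitrary: \<rho>)
    case 0
    then show ?case
      using has_derivative_continuous[OF has_derivative_convolution[OF U 0]]
      by (simp add: continuous_at_imp_continuous_on)
  next
    case (Suc k)
    show ?case
    proof (rule Ck_on_SucI[OF open_UNIV has_derivative_convolution[OF U Suc.prems]])
      show "Ck_on k UNIV (\<lambda>z. integral (cbox l u) (\<lambda>y. U y * (- frechet_derivative \<rho> (at (y - z)) v)))" for v
        by (rule Suc.IH) (intro smooth_on_minus smooth_on_frechet_derivative Suc.prems open_UNIV)
    qed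
  qed
  then show ?thesis by (simp add: smooth_on_def)
qed

lemma has_derivative_dir_bound:
  fixes S :: "'e::real_normed_vector \<Rightarrow> real"
  assumes d: "(S has_derivative D) (at z)" and e: "e > 0"
    and b: "\<And>h. 0 < h \<Longrightarrow> h < e \<Longrightarrow> \<bar>S (z + h *\<^sub>R v) - S z\<bar> \<le> h * m"
  shows "\<bar>D v\<bar> \<le> m"
proof -
  have 1: "((\<lambda>h. z + h *\<^sub>R v) has_derivative (\<lambda>h. h *\<^sub>R v)) (at 0)"
    by (auto intro!: derivative_eq_intros)
  have "((\<lambda>h. S (z + h *\<^sub>R v)) has_derivative (\<lambda>h. D (h *\<^sub>R v))) (at 0)"
    using diff_chain_at[OF 1, of S D] d by (simp add: o_def)
  then have "((\<lambda>h. S (z + h *\<^sub>R v)) has_real_derivative D v) (at 0)"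
    unfolding has_field_derivative_def
    by (rule has_derivative_eq_rhs) (simp add: linear_scale[OF has_derivative_linear[OF d]] fun_eq_iff)
  then have "((\<lambda>h. (S (z + h *\<^sub>R v) - S z) / h) \<longlongrightarrow> D v) (at 0)"
    by (simp add: has_field_derivative_iff)
  then have "((\<lambda>h. (S (z + h *\<^sub>R v) - S z) / h) \<longlongrightarrow> D v) (at_right 0)"
    by (rule filterlim_mono) (auto simp: at_within_le_at)
  then have "((\<lambda>h. \<bar>(S (z + h *\<^sub>R v) - S z) / h\<bar>) \<longlongrightarrow> \<bar>D v\<bar>) (at_right 0)"
    by (rule tendsto_rabs)
  moreover have "eventually (\<lambda>h. \<bar>(S (z + h *\<^sub>R v) - S z) / h\<bar> \<le> m) (at_right 0)"
  proof (rule eventually_at_rightI[of 0 e])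
    show "\<bar>(S (z + h *\<^sub>R v) - S z) / h\<bar> \<le> m" if "h \<in> {0<..<e}" for h
      using b[of h] that by (simp add: abs_divide field_simps)
  qed (use e in simp)
  ultimately show ?thesis by (intro tendsto_upperbound[of _ _ "at_right (0::real)"]) auto
qed

section \<open>Uniform control of the metric in a chart, and mollification\<close>

context closed_riemannian
begin

lemma gnorm_scale: "gnorm c x (k *\<^sub>R v) = \<bar>k\<bar> * gnorm c x v"
  unfolding gnorm_def by (simp add: matrix_vector_mult_scaleR real_sqrt_mult mult.assoc[symmetric])

text \<open>The quadratic form attains a positive minimum on the compact product of K with the unit
  sphere, and homogeneity does the rest.\<close>

lemma gnorm_lower_compact:
  assumes c: "c \<in> A" and K: "compact K" "K \<subseteq> chart_img c"
  obtains m where "m > 0" "\<And>x v. x \<in> K \<Longrightarrow> m * (norm v)\<^sup>2 \<le> v \<bullet> (g c x *v v)"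
proof -
  define Q where "Q = (\<lambda>(x, v). v \<bullet> (g c x *v v))"
  have cont: "continuous_on (K \<times> sphere 0 1) Q" unfolding Q_def split_beta
    by (intro continuous_intros bounded_bilinear.continuous_on[OF bounded_bilinear_matrix_vector]
        continuous_on_compose2[OF smooth_on_continuous[OF metric_onD(2)[OF metric_chart[OF c]]]])
       (use K in auto)
  show thesis
  proof (cases "K \<times> sphere (0::real^'n) 1 = {}")
    case True
    have "sphere (0::real^'n) 1 \<noteq> {}" by (simp add: sphere_empty)
    then have "K = {}" using True by auto
    then show thesis by (intro that[of 1]) auto
  next
    case False
    have "compact (K \<times> sphere (0::real^'n) 1)" using K by (intro compact_Times) auto
    from continuous_attains_inf[OF this False cont]
    obtain xv where xv: "xv \<in> K \<times> sphere 0 1" "\<And>z. z \<in> K \<times> sphere 0 1 \<Longrightarrow> Q xv \<le> Q z" by blast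
    then have pos: "Q xv > 0" unfolding Q_def
      using metric_onD(4)[OF metric_chart[OF c], of "fst xv" "snd xv"] K by (cases xv) force
    show thesis
    proof (rule that[OF pos])
      fix x v assume x: "x \<in> K"
      show "Q xv * (norm v)\<^sup>2 \<le> v \<bullet> (g c x *v v)"
      proof (cases "v = 0")
        case False
        define w where "w = (1 / norm v) *\<^sub>R v"
        have "Q xv \<le> w \<bullet> (g c x *v w)" using xv(2)[of "(x, w)"] x False by (simp add: Q_def w_def)
        also have "\<dots> = (v \<bullet> (g c x *v v)) / (norm v)\<^sup>2"
          by (simp add: w_def matrix_vector_mult_scaleR power2_eq_square)
        finally show ?thesis using False by (simp add: field_simps)
      qed simp
    qed
  qed
qed

text \<open>On K the form is at least m |v|^2. If two points are so close that the matrices differ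
  by less than m / B, the form changes by at most m |v|^2, hence at most doubles, and the norm grows
  at most by a factor 2.\<close>

lemma gnorm_almost_constant:
  assumes c: "c \<in> A" and K: "compact K" "K \<subseteq> chart_img c"
  obtains e where "e > 0" "\<And>x y v. x \<in> K \<Longrightarrow> y \<in> K \<Longrightarrow> dist x y < e \<Longrightarrow> gnorm c y v \<le> 2 * gnorm c x v"
proof -
  obtain m where m: "m > 0" "\<And>x v. x \<in> K \<Longrightarrow> m * (norm v)\<^sup>2 \<le> v \<bullet> (g c x *v v)"
    by (rule gnorm_lower_compact[OF c K]) blast
  obtain B where B: "B > 0" "\<And>(G::real^'n^'n) v. norm (G *v v) \<le> norm G * norm v * B"
    using bounded_bilinear.pos_bounded[OF bounded_bilinear_matrix_vector] by metis
  have "uniformly_continuous_on K (g c)"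
    using K smooth_on_continuous[OF metric_onD(2)[OF metric_chart[OF c]]]
    by (intro compact_uniformly_continuous) (auto intro: continuous_on_subset)
  then obtain e where e: "e > 0" "\<And>x y. x \<in> K \<Longrightarrow> y \<in> K \<Longrightarrow> dist y x < e \<Longrightarrow> dist (g c y) (g c x) < m / B"
    unfolding uniformly_continuous_on_def using m B by (metis divide_pos_pos)
  show thesis
  proof (rule that[OF e(1)])
    fix x y v assume x: "x \<in> K" and y: "y \<in> K" and d: "dist x y < e"
    have "v \<bullet> (g c y *v v) - v \<bullet> (g c x *v v) = v \<bullet> ((g c y - g c x) *v v)"
      by (simp add: matrix_vector_mult_diff_rdistrib inner_simps)
    also have "\<dots> \<le> norm v * norm ((g c y - g c x) *v v)" by (rule norm_cauchy_schwarz)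
    also have "\<dots> \<le> norm v * (norm (g c y - g c x) * norm v * B)" by (intro mult_left_mono B) auto
    also have "\<dots> \<le> norm v * (m / B * norm v * B)"
      using e(2)[OF x y] d B(1) by (intro mult_left_mono mult_right_mono) (auto simp: dist_norm norm_minus_commute)
    also have "\<dots> = m * (norm v)\<^sup>2" using B by (simp add: power2_eq_square)
    also have "\<dots> \<le> v \<bullet> (g c x *v v)" by (rule m(2)[OF x])
    finally have "v \<bullet> (g c y *v v) \<le> 4 * (v \<bullet> (g c x *v v))"
      using order_trans[OF mult_nonneg_nonneg[OF less_imp_le[OF m(1)] zero_le_power2] m(2)[OF x, of v]] by linarith
    then have "gnorm c y v \<le> sqrt (4 * (v \<bullet> (g c x *v v)))" unfolding gnorm_def by (rule real_sqrt_le_mono)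
    also have "\<dots> = 2 * gnorm c x v" unfolding gnorm_def by (simp add: real_sqrt_mult)
    finally show "gnorm c y v \<le> 2 * gnorm c x v" .
  qed
qed

text \<open>Translates of the distance are averaged against a bump of radius \<epsilon>. A
  difference of the average is an average of differences along short parallel segments, on which the
  metric norm of v is at most twice its value at z; this is the origin of the factor 2.\<close>

lemma local_smoothing:
  assumes conn: "connected M" and x0: "x0 \<in> M" and c: "c \<in> A" and r: "r > 0" "cball a (3 * r) \<subseteq> chart_img c"
    and \<tau>: "\<tau> > 0"
  obtains S where "smooth_on UNIV S"
    "\<And>z. z \<in> cball a (2 * r) \<Longrightarrow> \<bar>S z - du x0 (chart_inv c z)\<bar> \<le> \<tau>"
    "\<And>z v. z \<in> cball a (2 * r) \<Longrightarrow> \<bar>frechet_derivative S (at z) v\<bar> \<le> 2 * gnorm c z v"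
proof -
  let ?K = "cball a (3 * r)"
  define u where "u z = du x0 (chart_inv c z)" for z
  \<comment> \<open>\<open>closest_point\<close> extends u continuously to the whole space, as the
    convolution over a box requires.\<close>
  define U where "U z = u (closest_point ?K z)" for z
  have KU: "U z = u z" if "z \<in> ?K" for z unfolding U_def using closest_point_self[OF that] by simp
  obtain b where b: "b > 0" "\<And>x v. x \<in> ?K \<Longrightarrow> gnorm c x v \<le> b * norm v"
    by (rule gnorm_bound_compact[OF c compact_cball r(2)]) blast
  obtain e0 where e0: "e0 > 0" "\<And>x y v. x \<in> ?K \<Longrightarrow> y \<in> ?K \<Longrightarrow> dist x y < e0 \<Longrightarrow> gnorm c y v \<le> 2 * gnorm c x v"
    by (rule gnorm_almost_constant[OF c compact_cball r(2)]) blast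
  have seg: "closed_segment y z \<subseteq> ?K" if "y \<in> ?K" "z \<in> ?K" for y z
    using that by (intro closed_segment_subset convex_cball)
  have lip: "\<bar>u y - u z\<bar> \<le> b * norm (z - y)" if "y \<in> ?K" "z \<in> ?K" for y z
    unfolding u_def
    by (rule du_segment[OF conn x0 c]) (use seg[OF that] r(2) b(2) in blast)+
  have "continuous_on ?K u"
  proof (rule continuous_onI)
    fix y e assume y: "y \<in> ?K" and e: "e > (0::real)"
    show "\<exists>d>0. \<forall>z\<in>?K. dist z y < d \<longrightarrow> dist (u z) (u y) \<le> e"
    proof (intro exI[of _ "e / b"] conjI ballI impI)
      fix z assume z: "z \<in> ?K" "dist z y < e / b"
      then have "b * norm (y - z) \<le> e" using b(1) by (simp add: dist_norm field_simps norm_minus_commute)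
      then show "dist (u z) (u y) \<le> e" using lip[OF z(1) y] by (simp add: dist_real_def)
    qed (use e b in simp)
  qed
  then have contU: "continuous_on UNIV U" unfolding U_def
    by (rule continuous_on_compose2[OF _ continuous_on_closest_point])
       (use closest_point_in_set[of ?K] r(1) in \<open>auto simp: less_imp_le\<close>)
  \<comment> \<open>The bound r / 2 keeps translated points inside the ball, e0 / 2 keeps the metric
    comparable, and \<tau> / b makes the average \<tau>-close by the Lipschitz constant b.\<close>
  define \<epsilon> where "\<epsilon> = min (r / 2) (min (e0 / 2) (\<tau> / b))"
  have "\<epsilon> > 0" using r(1) e0(1) \<tau> b(1) by (simp add: \<epsilon>_def)
  moreover have "\<epsilon> \<le> r / 2" "\<epsilon> \<le> e0 / 2" "\<epsilon> \<le> \<tau> / b"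
    unfolding \<epsilon>_def min_le_iff_disj by blast+
  ultimately have \<epsilon>: "\<epsilon> > 0" "\<epsilon> \<le> r / 2" "\<epsilon> \<le> e0 / 2" "b * \<epsilon> \<le> \<tau>"
    using b(1) by (auto simp: field_simps)
  define \<rho> :: "real^'n \<Rightarrow> real" where "\<rho> = smooth_bump (\<epsilon> / 2)"
  have \<rho>s: "smooth_on UNIV \<rho>" unfolding \<rho>_def by (rule smooth_on_bump)
  have \<rho>c: "continuous_on UNIV \<rho>" by (rule smooth_on_continuous[OF \<rho>s])
  have \<rho>0: "\<rho> w = 0" if "norm w \<ge> \<epsilon>" for w using smooth_bump_0[of "\<epsilon> / 2" w] that \<epsilon>(1) by (simp add: \<rho>_def)
  have \<rho>nn: "\<rho> w \<ge> 0" for w by (simp add: \<rho>_def smooth_bump_range)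
  define E :: "real^'n" where "E = \<epsilon> *\<^sub>R One"
  have inE: "w \<in> cbox (- E) E" if "norm w \<le> \<epsilon>" for w
    unfolding mem_box
  proof
    fix i :: "real^'n" assume i: "i \<in> Basis"
    have "\<bar>w \<bullet> i\<bar> \<le> \<epsilon>" using Basis_le_norm[OF i, of w] that by linarith
    then show "- E \<bullet> i \<le> w \<bullet> i \<and> w \<bullet> i \<le> E \<bullet> i" using i by (simp add: E_def abs_le_iff)
  qed
  \<comment> \<open>The mass of the kernel, by which S is normalized. It is positive because a
    nonnegative continuous kernel with integral 0 would vanish at the origin.\<close>
  define I where "I = integral (cbox (- E) E) \<rho>"
  have Ipos: "I > 0"
  proof -
    have int: "(\<rho> has_integral I) (cbox (- E) E)" unfolding I_def
      by (intro integrable_integral integrable_continuous continuous_on_subset[OF \<rho>c]) auto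
    have "I \<ge> 0" by (rule has_integral_nonneg[OF int \<rho>nn])
    moreover have "I \<noteq> 0"
    proof
      assume "I = 0"
      have "box (- E) E \<noteq> {}" using \<epsilon>(1) by (simp add: E_def box_ne_empty)
      then have "\<rho> 0 = 0"
        using has_integral_0_cbox_imp_0[of "- E" E \<rho> 0] int \<open>I = 0\<close> \<rho>nn inE[of 0] \<epsilon>(1)
          continuous_on_subset[OF \<rho>c] by auto
      then show False using smooth_bump_1[of "\<epsilon> / 2" "0::real^'n"] \<epsilon>(1) by (simp add: \<rho>_def)
    qed
    ultimately show ?thesis by simp
  qed
  \<comment> \<open>The box with corners l and h contains the support of the kernel translated by
    any z considered below.\<close>
  define l where "l = a - (4 * r) *\<^sub>R One"
  define h where "h = a + (4 * r) *\<^sub>R One"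
  define S0 where "S0 z = integral (cbox l h) (\<lambda>y. U y * \<rho> (y - z))" for z
  define S where "S z = inverse I * S0 z" for z
  have S0s: "smooth_on UNIV S0" unfolding S0_def
    by (rule smooth_on_convolution[OF continuous_on_subset[OF contU] \<rho>s]) simp
  then have Ss: "smooth_on UNIV S" unfolding S_def by (intro smooth_on_mult) auto
  \<comment> \<open>After the substitution y = z + w the kernel no longer depends on z, and
    differences can be estimated for each w. The radius 5/2 r lets a point of the ball of radius 2r
    move by r / 2.\<close>
  have S0_eq: "((\<lambda>w. U (z + w) * \<rho> w) has_integral S0 z) (cbox (- E) E)" if z: "norm (z - a) \<le> 5 / 2 * r" for z
  proof -
    let ?F = "\<lambda>y. U y * \<rho> (y - z)"
    have sub: "cbox (- E + z) (E + z) \<subseteq> cbox l h"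
    proof -
      have "\<bar>(z - a) \<bullet> i\<bar> \<le> 5 / 2 * r" if "i \<in> Basis" for i using Basis_le_norm[OF that, of "z - a"] z by linarith
      then show ?thesis unfolding subset_box l_def h_def E_def
        using \<epsilon>(2) by (auto simp: inner_simps abs_le_iff) (smt (verit))+
    qed
    have int: "(\<lambda>w. U (z + w) * \<rho> w) integrable_on cbox (- E) E"
      by (intro integrable_continuous continuous_intros continuous_on_compose2[OF contU]
          continuous_on_subset[OF \<rho>c]) auto
    define J where "J = integral (cbox (- E) E) (\<lambda>w. U (z + w) * \<rho> w)"
    have J: "((\<lambda>w. U (z + w) * \<rho> w) has_integral J) (cbox (- E) E)" unfolding J_def using int by (rule integrable_integral)
    then have "((?F \<circ> (+) z) has_integral J) (cbox (- E) E)" by (simp add: o_def)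
    then have "(?F has_integral J) (cbox (- E + z) (E + z))" by (simp add: has_integral_shift_cbox_iff)
    moreover have "?F y = 0" if "y \<notin> cbox (- E + z) (E + z)" for y
    proof -
      have "y - z \<notin> cbox (- E) E" using that by (auto simp: mem_box inner_simps algebra_simps)
      then show ?thesis using inE[of "y - z"] \<rho>0[of "y - z"] by force
    qed
    ultimately have "(?F has_integral J) (cbox l h)" by (rule has_integral_on_superset[OF _ _ sub])
    then have "S0 z = J" unfolding S0_def by (rule integral_unique)
    then show ?thesis using J by simp
  qed
  have I_int: "((\<lambda>w. k * \<rho> w) has_integral (k * I)) (cbox (- E) E)" for k
    unfolding I_def
    by (intro has_integral_mult_right integrable_integral integrable_continuous continuous_on_subset[OF \<rho>c]) auto
  have approx: "\<bar>S z - u z\<bar> \<le> \<tau>" if z: "z \<in> cball a (2 * r)" for z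
  proof -
    have nz: "norm (z - a) \<le> 2 * r" using z by (simp add: dist_norm norm_minus_commute)
    then have zK: "z \<in> ?K" using r(1) by (simp add: dist_norm norm_minus_commute)
    have *: "\<bar>U (z + w) * \<rho> w - u z * \<rho> w\<bar> \<le> \<tau> * \<rho> w" for w
    proof (cases "norm w \<ge> \<epsilon>")
      case False
      have "norm (z + w - a) \<le> norm (z - a) + norm w" using norm_triangle_ineq[of "z - a" w] by (simp add: algebra_simps)
      then have wK: "z + w \<in> ?K" using False nz \<epsilon>(2) r(1) by (simp add: dist_norm norm_minus_commute)
      have "\<bar>U (z + w) - u z\<bar> \<le> b * norm (z - (z + w))" using lip[OF wK zK] by (simp add: KU[OF wK])
      also have "\<dots> \<le> b * \<epsilon>" using False b(1) by simp
      also have "\<dots> \<le> \<tau>" by (rule \<epsilon>(4))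
      finally have "\<bar>U (z + w) - u z\<bar> * \<rho> w \<le> \<tau> * \<rho> w" using \<rho>nn by (rule mult_right_mono)
      then show ?thesis using \<rho>nn[of w] by (simp add: abs_mult left_diff_distrib[symmetric])
    qed (simp add: \<rho>0)
    have i1: "((\<lambda>w. U (z + w) * \<rho> w - u z * \<rho> w) has_integral (S0 z - u z * I)) (cbox (- E) E)"
      by (intro has_integral_diff S0_eq I_int) (use nz r(1) in simp)
    have "norm (integral (cbox (- E) E) (\<lambda>w. U (z + w) * \<rho> w - u z * \<rho> w)) \<le> integral (cbox (- E) E) (\<lambda>w. \<tau> * \<rho> w)"
      by (rule integral_norm_bound_integral) (use * i1 I_int[of \<tau>] in auto)
    then have "\<bar>S0 z - u z * I\<bar> \<le> \<tau> * I" by (simp only: integral_unique[OF i1] integral_unique[OF I_int[of \<tau>]] real_norm_def)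
    moreover have "S z - u z = (S0 z - u z * I) / I" using Ipos by (simp add: S_def field_simps)
    ultimately show ?thesis using Ipos by (simp only: abs_divide) (simp add: pos_divide_le_eq)
  qed
  have deriv: "\<bar>frechet_derivative S (at z) v\<bar> \<le> 2 * gnorm c z v" if z: "z \<in> cball a (2 * r)" for z v
  proof -
    have nz: "norm (z - a) \<le> 2 * r" using z by (simp add: dist_norm norm_minus_commute)
    then have zK: "z \<in> ?K" using r(1) by (simp add: dist_norm norm_minus_commute)
    \<comment> \<open>Displacements t v with t < t0 have length at most r / 2 and at most e0 /
      2.\<close>
    define t0 where "t0 = min (r / 2) (e0 / 2) / (norm v + 1)"
    have nv: "norm v + 1 > 0" by (simp add: add_nonneg_pos)
    have t0: "t0 > 0" unfolding t0_def using r(1) e0(1) nv by simp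
    show ?thesis
    proof (rule has_derivative_dir_bound[where D="frechet_derivative S (at z)" and S=S and z=z and v=v, OF _ t0])
      show "(S has_derivative frechet_derivative S (at z)) (at z)"
        by (rule smooth_on_has_derivative[OF Ss]) simp
      fix t :: real assume t: "0 < t" "t < t0"
      have "t * norm v \<le> t * (norm v + 1)" using t by simp
      also have "\<dots> \<le> min (r / 2) (e0 / 2)" using t nv unfolding t0_def by (simp add: pos_less_divide_eq)
      finally have tv: "t * norm v \<le> r / 2" "t * norm v \<le> e0 / 2" by auto
      let ?z = "z + t *\<^sub>R v"
      have nz': "norm (?z - a) \<le> norm (z - a) + t * norm v"
        using norm_triangle_ineq[of "z - a" "t *\<^sub>R v"] t by (simp add: algebra_simps)
      have *: "\<bar>U (?z + w) * \<rho> w - U (z + w) * \<rho> w\<bar> \<le> (t * (2 * gnorm c z v)) * \<rho> w" for w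
      proof (cases "norm w \<ge> \<epsilon>")
        case False
        have "norm (z + w - a) \<le> norm (z - a) + norm w" using norm_triangle_ineq[of "z - a" w] by (simp add: algebra_simps)
        then have wK: "z + w \<in> ?K" using False nz \<epsilon>(2) r(1) by (simp add: dist_norm norm_minus_commute)
        have "norm (?z + w - a) \<le> norm (?z - a) + norm w" using norm_triangle_ineq[of "?z - a" w] by (simp add: algebra_simps)
        then have wK': "?z + w \<in> ?K" using False nz nz' tv \<epsilon>(2) r(1) by (simp add: dist_norm norm_minus_commute)
        have "\<bar>u (z + w) - u (?z + w)\<bar> \<le> t * (2 * gnorm c z v)"
          unfolding u_def
        proof (rule du_segment[OF conn x0 c])
          show "closed_segment (z + w) (?z + w) \<subseteq> chart_img c" using seg[OF wK wK'] r(2) by blast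
          fix y assume y: "y \<in> closed_segment (z + w) (?z + w)"
          have yK: "y \<in> ?K" using seg[OF wK wK'] y by blast
          have "dist z y \<le> dist z (z + w) + dist (z + w) y" by (rule dist_triangle)
          also have "dist (z + w) y \<le> t * norm v"
            using segment_bound(1)[OF y] t by (simp add: dist_norm norm_minus_commute)
          finally have "dist z y < e0" using False \<epsilon>(3) tv(2) by (simp add: dist_norm)
          then have "gnorm c y v \<le> 2 * gnorm c z v" using e0(2)[OF zK yK] by blast
          moreover have "?z + w - (z + w) = t *\<^sub>R v" by simp
          ultimately show "gnorm c y (?z + w - (z + w)) \<le> t * (2 * gnorm c z v)"
            using t by (simp only: gnorm_scale) simp
        qed
        then have "\<bar>U (?z + w) - U (z + w)\<bar> \<le> t * (2 * gnorm c z v)" by (simp add: KU[OF wK] KU[OF wK'] abs_minus_commute)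
        then have "\<bar>U (?z + w) - U (z + w)\<bar> * \<rho> w \<le> (t * (2 * gnorm c z v)) * \<rho> w" using \<rho>nn by (rule mult_right_mono)
        then show ?thesis using \<rho>nn[of w] by (simp add: abs_mult left_diff_distrib[symmetric])
      qed (simp add: \<rho>0)
      have i1: "((\<lambda>w. U (?z + w) * \<rho> w - U (z + w) * \<rho> w) has_integral (S0 ?z - S0 z)) (cbox (- E) E)"
        by (intro has_integral_diff S0_eq) (use nz nz' tv r(1) in auto)
      have "norm (integral (cbox (- E) E) (\<lambda>w. U (?z + w) * \<rho> w - U (z + w) * \<rho> w))
          \<le> integral (cbox (- E) E) (\<lambda>w. (t * (2 * gnorm c z v)) * \<rho> w)"
        by (rule integral_norm_bound_integral) (use * i1 I_int[of "t * (2 * gnorm c z v)"] in auto)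
      then have "\<bar>S0 ?z - S0 z\<bar> \<le> (t * (2 * gnorm c z v)) * I"
        by (simp only: integral_unique[OF i1] integral_unique[OF I_int[of "t * (2 * gnorm c z v)"]] real_norm_def)
      moreover have "S ?z - S z = (S0 ?z - S0 z) / I" using Ipos by (simp add: S_def field_simps)
      ultimately show "\<bar>S ?z - S z\<bar> \<le> t * (2 * gnorm c z v)"
        using Ipos by (simp only: abs_divide) (simp add: pos_divide_le_eq)
    qed
  qed
  show thesis by (rule that[OF Ss]) (use approx deriv u_def in auto)
qed

section \<open>Sum, product and chain rules for gradient bounds\<close>

lemma smooth_function_at:
  assumes "smooth_function A \<phi>" "p \<in> M"
  shows "((\<phi> \<circ> chart_inv (cat p)) has_derivative dchart \<phi> (cat p) (chart_map (cat p) p)) (at (chart_map (cat p) p))"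
    "(\<phi> \<circ> chart_inv (cat p)) (chart_map (cat p) p) = \<phi> p"
  using smooth_functionD(2)[OF assms(1) chart_at(1)[OF assms(2)]] chart_at(2)[OF assms(2)]
    chartD(5)[OF chart_at(1)[OF assms(2)] chart_at(2)[OF assms(2)]] by auto

lemma gnorm_cat_nonneg: "p \<in> M \<Longrightarrow> gnorm (cat p) (chart_map (cat p) p) v \<ge> 0"
  using gnorm_nonneg[OF chart_at(1)] chart_at(2) by blast

lemma gbound_mono: "p \<in> M \<Longrightarrow> gbound \<phi> a p \<Longrightarrow> a \<le> b \<Longrightarrow> gbound \<phi> b p"
  unfolding gbound_def using gnorm_cat_nonneg by (meson mult_right_mono order_trans)

lemma gbound_cong:
  assumes "p \<in> M" "\<And>q. q \<in> M \<Longrightarrow> \<phi> q = \<psi> q" "gbound \<phi> a p"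
  shows "gbound \<psi> a p"
proof -
  note c = chart_at[OF assms(1)]
  have "dchart \<phi> (cat p) (chart_map (cat p) p) = dchart \<psi> (cat p) (chart_map (cat p) p)"
  proof (rule frechet_derivative_cong_open[OF chartD(2)[OF c(1)]])
    fix y assume "y \<in> chart_img (cat p)"
    then have "chart_inv (cat p) y \<in> M" using chartD(6,8)[OF c(1)] by blast
    then show "(\<phi> \<circ> chart_inv (cat p)) y = (\<psi> \<circ> chart_inv (cat p)) y" using assms(2) by simp
  qed (use c in simp)
  then show ?thesis using assms(3) unfolding gbound_def by simp
qed

lemma gbound_add:
  assumes "smooth_function A \<phi>" "smooth_function A \<psi>" "p \<in> M" "gbound \<phi> a p" "gbound \<psi> b p"
  shows "gbound (\<lambda>q. \<phi> q + \<psi> q) (a + b) p"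
  unfolding gbound_def
proof
  fix v
  let ?c = "cat p" and ?x = "chart_map (cat p) p"
  have "dchart (\<lambda>q. \<phi> q + \<psi> q) ?c ?x = (\<lambda>v. dchart \<phi> ?c ?x v + dchart \<psi> ?c ?x v)"
    using has_derivative_add[OF smooth_function_at(1)[OF assms(1,3)] smooth_function_at(1)[OF assms(2,3)]]
    by (intro frechet_derivative_eq) (simp add: o_def)
  then have "\<bar>dchart (\<lambda>q. \<phi> q + \<psi> q) ?c ?x v\<bar> \<le> \<bar>dchart \<phi> ?c ?x v\<bar> + \<bar>dchart \<psi> ?c ?x v\<bar>"
    by (simp add: abs_triangle_ineq)
  also have "\<dots> \<le> a * gnorm ?c ?x v + b * gnorm ?c ?x v"
    using assms(4,5) unfolding gbound_def by (intro add_mono) auto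
  finally show "\<bar>dchart (\<lambda>q. \<phi> q + \<psi> q) ?c ?x v\<bar> \<le> (a + b) * gnorm ?c ?x v" by (simp add: distrib_right)
qed

lemma gbound_mult:
  assumes "smooth_function A \<phi>" "smooth_function A \<psi>" "p \<in> M" "gbound \<phi> a p" "gbound \<psi> b p"
  shows "gbound (\<lambda>q. \<phi> q * \<psi> q) (\<bar>\<phi> p\<bar> * b + a * \<bar>\<psi> p\<bar>) p"
  unfolding gbound_def
proof
  fix v
  let ?c = "cat p" and ?x = "chart_map (cat p) p"
  have "dchart (\<lambda>q. \<phi> q * \<psi> q) ?c ?x = (\<lambda>v. \<phi> p * dchart \<psi> ?c ?x v + dchart \<phi> ?c ?x v * \<psi> p)"
    using has_derivative_mult[OF smooth_function_at(1)[OF assms(1,3)] smooth_function_at(1)[OF assms(2,3)]]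
      smooth_function_at(2)[OF assms(1,3)] smooth_function_at(2)[OF assms(2,3)]
    by (intro frechet_derivative_eq) (simp add: o_def)
  then have "\<bar>dchart (\<lambda>q. \<phi> q * \<psi> q) ?c ?x v\<bar> \<le> \<bar>\<phi> p\<bar> * \<bar>dchart \<psi> ?c ?x v\<bar> + \<bar>dchart \<phi> ?c ?x v\<bar> * \<bar>\<psi> p\<bar>"
    using abs_triangle_ineq[of "\<phi> p * dchart \<psi> ?c ?x v" "dchart \<phi> ?c ?x v * \<psi> p"] by (simp add: abs_mult)
  also have "\<dots> \<le> \<bar>\<phi> p\<bar> * (b * gnorm ?c ?x v) + a * gnorm ?c ?x v * \<bar>\<psi> p\<bar>"
    using assms(4,5) unfolding gbound_def by (intro add_mono mult_left_mono mult_right_mono) auto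
  finally show "\<bar>dchart (\<lambda>q. \<phi> q * \<psi> q) ?c ?x v\<bar> \<le> (\<bar>\<phi> p\<bar> * b + a * \<bar>\<psi> p\<bar>) * gnorm ?c ?x v"
    by (simp add: algebra_simps)
qed

lemma gbound_compose:
  fixes h :: "real \<Rightarrow> real"
  assumes "smooth_function A \<phi>" "p \<in> M" "(h has_real_derivative d) (at (\<phi> p))" "gbound \<phi> a p"
  shows "gbound (\<lambda>q. h (\<phi> q)) (\<bar>d\<bar> * a) p"
  unfolding gbound_def
proof
  fix v
  let ?c = "cat p" and ?x = "chart_map (cat p) p"
  have "(h has_derivative (*) d) (at ((\<phi> \<circ> chart_inv ?c) ?x))"
    using assms(3) smooth_function_at(2)[OF assms(1,2)] by (simp add: has_field_derivative_def)
  from diff_chain_at[OF smooth_function_at(1)[OF assms(1,2)] this]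
  have "dchart (\<lambda>q. h (\<phi> q)) ?c ?x = (\<lambda>v. d * dchart \<phi> ?c ?x v)"
    by (intro frechet_derivative_eq) (simp add: o_def)
  then have "\<bar>dchart (\<lambda>q. h (\<phi> q)) ?c ?x v\<bar> = \<bar>d\<bar> * \<bar>dchart \<phi> ?c ?x v\<bar>" by (simp add: abs_mult)
  also have "\<dots> \<le> \<bar>d\<bar> * (a * gnorm ?c ?x v)"
    using assms(4) unfolding gbound_def by (intro mult_left_mono) auto
  finally show "\<bar>dchart (\<lambda>q. h (\<phi> q)) ?c ?x v\<bar> \<le> \<bar>d\<bar> * a * gnorm ?c ?x v" by simp
qed

lemma gbound_const: "p \<in> M \<Longrightarrow> gbound (\<lambda>q. k) 0 p"
  unfolding gbound_def by (simp add: o_def frechet_derivative_const)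

lemma gbound_sum:
  assumes "finite I" "\<And>i. i \<in> I \<Longrightarrow> smooth_function A (f i)" "p \<in> M" "\<And>i. i \<in> I \<Longrightarrow> gbound (f i) (a i) p"
  shows "gbound (\<lambda>q. \<Sum>i\<in>I. f i q) (\<Sum>i\<in>I. a i) p"
  using assms
proof (induction I)
  case (insert i I)
  then show ?case
    using gbound_add[of "f i" "\<lambda>q. \<Sum>i\<in>I. f i q" p "a i" "\<Sum>i\<in>I. a i"] smooth_function_sum[of I f]
    by simp
qed (simp add: gbound_const)

lemma gbound_zero_near:
  assumes "openin (top_of_set M) U" "p \<in> U" "\<And>q. q \<in> U \<Longrightarrow> \<phi> q = 0"
  shows "gbound \<phi> 0 p"
proof -
  have p: "p \<in> M" using assms(1,2) openin_imp_subset by blast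
  note c = chart_at[OF p]
  define T where "T = {x \<in> chart_img (cat p). chart_inv (cat p) x \<in> U}"
  have T: "open T" unfolding T_def by (rule open_chart_preimage[OF c(1) assms(1)])
  have "chart_map (cat p) p \<in> T" using c chartD(5)[OF c] assms(2) by (simp add: T_def)
  then have "dchart \<phi> (cat p) (chart_map (cat p) p) = frechet_derivative (\<lambda>_. 0) (at (chart_map (cat p) p))"
    by (rule frechet_derivative_cong_open[OF T]) (simp add: T_def assms(3))
  then show ?thesis unfolding gbound_def by (simp add: frechet_derivative_const)
qed

lemma ext_chart:
  assumes c: "c \<in> A" and x: "x \<in> chart_img c"
  shows "ext c h (chart_inv c x) = h x" "dchart (ext c h) c x = frechet_derivative h (at x)"
proof -
  have *: "ext c h (chart_inv c y) = h y" if "y \<in> chart_img c" for y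
    using chartD(6,7)[OF c that] by (simp add: ext_def)
  then show "ext c h (chart_inv c x) = h x" using x .
  show "dchart (ext c h) c x = frechet_derivative h (at x)"
    by (rule frechet_derivative_cong_open[OF chartD(2)[OF c] x]) (simp add: *)
qed

text \<open>The charts' mollifications of the distance are glued by a partition of unity; the derivatives of
  the partition functions are harmless since the mollifications are uniformly \<open>\<tau>\<close>-close to the distance.\<close>

lemma smooth_distance:
  assumes conn: "connected M" and xy: "x \<in> M" "y \<in> M" and D: "du x y > 0"
  obtains f where "smooth_function A f" "\<And>p. p \<in> M \<Longrightarrow> gbound f 1 p" "f y - f x \<ge> du x y / 8"
proof -
  obtain P where P: "finite P"
    "\<forall>(c, a, r)\<in>P. c \<in> A \<and> r > 0 \<and> cball a (3 * r) \<subseteq> chart_img c"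
    "M = (\<Union>(c, a, r)\<in>P. chart_inv c ` ball a r)" by (rule good_cover)
  define ch where "ch i = fst i" for i :: "('a, 'n) chart \<times> (real^'n) \<times> real"
  define ce where "ce i = fst (snd i)" for i :: "('a, 'n) chart \<times> (real^'n) \<times> real"
  define ra where "ra i = snd (snd i)" for i :: "('a, 'n) chart \<times> (real^'n) \<times> real"
  have piece: "ch i \<in> A" "ra i > 0" "cball (ce i) (3 * ra i) \<subseteq> chart_img (ch i)" if "i \<in> P" for i
    using bspec[OF P(2) that] unfolding ch_def ce_def ra_def split_beta by blast+
  have cover: "\<exists>i\<in>P. \<exists>z\<in>ball (ce i) (ra i). p = chart_inv (ch i) z" if "p \<in> M" for p
  proof -
    have "p \<in> (\<Union>i\<in>P. chart_inv (ch i) ` ball (ce i) (ra i))"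
      using that unfolding P(3) ch_def ce_def ra_def split_beta .
    then show ?thesis by blast
  qed
  have sub2: "cball (ce i) (2 * ra i) \<subseteq> chart_img (ch i)" if "i \<in> P" for i
  proof -
    have "cball (ce i) (2 * ra i) \<subseteq> cball (ce i) (3 * ra i)" using piece(2)[OF that] by (intro subset_cball) simp
    then show ?thesis using piece(3)[OF that] by blast
  qed
  define bu where "bu i z = smooth_bump (ra i) (z - ce i)" for i and z :: "real^'n"
  have bus: "smooth_on UNIV (bu i)" for i unfolding bu_def
    by (rule smooth_on_compose[OF open_UNIV open_UNIV _ _ smooth_on_bump]) (auto intro!: smooth_on_diff)
  have bu0: "bu i z = 0" if "i \<in> P" "z \<notin> cball (ce i) (2 * ra i)" for i z
    unfolding bu_def using that piece(2) by (intro smooth_bump_0) (auto simp: dist_norm norm_minus_commute)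
  have bu1: "bu i z = 1" if "i \<in> P" "z \<in> ball (ce i) (ra i)" for i z
    unfolding bu_def using that piece(2) by (intro smooth_bump_1) (auto simp: dist_norm norm_minus_commute)
  have bur: "0 \<le> bu i z" "bu i z \<le> 1" for i z unfolding bu_def by (rule smooth_bump_range)+
  have ext_smooth: "smooth_function A (ext (ch i) (\<lambda>z. bu i z * h z))"
    if "i \<in> P" "smooth_on UNIV h" for i h
  proof (rule smooth_ext[OF piece(1)[OF that(1)] _ compact_cball sub2[OF that(1)]])
    show "smooth_on (chart_img (ch i)) (\<lambda>z. bu i z * h z)"
      using smooth_on_mult[OF open_UNIV bus that(2)] by (rule smooth_on_subset) simp
  qed (simp add: bu0 that)
  define be where "be i = ext (ch i) (\<lambda>z. bu i z * 1)" for i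
  have bes: "smooth_function A (be i)" if "i \<in> P" for i unfolding be_def by (rule ext_smooth[OF that]) simp
  have be_nn: "be i p \<ge> 0" for i p by (simp add: be_def ext_def bur)
  define B where "B p = (\<Sum>i\<in>P. be i p)" for p
  have Bs: "smooth_function A B" unfolding B_def by (rule smooth_function_sum[OF bes])
  have B1: "B p \<ge> 1" if p: "p \<in> M" for p
  proof -
    obtain i z where i: "i \<in> P" "z \<in> ball (ce i) (ra i)" "p = chart_inv (ch i) z" using cover[OF p] by blast
    have "z \<in> chart_img (ch i)" using sub2[OF i(1)] i(2) piece(2)[OF i(1)] by auto
    then have "be i p = 1" using ext_chart(1)[OF piece(1)[OF i(1)]] bu1[OF i(1,2)] i(3) by (simp add: be_def)
    moreover have "be i p \<le> B p" unfolding B_def by (rule member_le_sum[OF i(1)]) (use be_nn P(1) in auto)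
    ultimately show ?thesis by simp
  qed
  have "\<exists>K\<ge>0. \<forall>p\<in>M. gbound (be i) K p" if "i \<in> P" for i
    using gbound_uniform[OF bes[OF that]] by metis
  then obtain Kf where Kf: "\<And>i. i \<in> P \<Longrightarrow> Kf i \<ge> 0" "\<And>i p. i \<in> P \<Longrightarrow> p \<in> M \<Longrightarrow> gbound (be i) (Kf i) p" by metis
  define K where "K = (\<Sum>i\<in>P. Kf i)"
  have K0: "K \<ge> 0" unfolding K_def by (rule sum_nonneg) (rule Kf(1))
  have KB: "gbound B K p" if "p \<in> M" for p
    unfolding B_def K_def by (rule gbound_sum[OF P(1) bes that Kf(2)[OF _ that]])
  \<comment> \<open>The first entry leaves at least half of du after an error \<tau> at both ends.
    The second makes \<tau> K at most 1/2, where K bounds the gradient of the sum B of the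
    bumps.\<close>
  define \<tau> where "\<tau> = min (du x y / 4) (1 / (2 * (K + 1)))"
  have \<tau>: "\<tau> > 0" "\<tau> \<le> du x y / 4" unfolding \<tau>_def using D K0 by auto
  have "\<tau> * K \<le> \<tau> * (K + 1)" using \<tau>(1) by simp
  also have "\<dots> \<le> 1 / (2 * (K + 1)) * (K + 1)" unfolding \<tau>_def using K0 by (intro mult_right_mono) auto
  also have "\<dots> = 1 / 2" using K0 by (simp add: field_simps)
  finally have \<tau>K: "\<tau> * K \<le> 1 / 2" .
  have "\<exists>S. smooth_on UNIV S \<and> (\<forall>z\<in>cball (ce i) (2 * ra i). \<bar>S z - du x (chart_inv (ch i) z)\<bar> \<le> \<tau> \<and>
      (\<forall>v. \<bar>frechet_derivative S (at z) v\<bar> \<le> 2 * gnorm (ch i) z v))" if "i \<in> P" for i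
    using local_smoothing[OF conn xy(1) piece[OF that] \<tau>(1)] by metis
  then obtain S where S: "\<And>i. i \<in> P \<Longrightarrow> smooth_on UNIV (S i)"
    "\<And>i z. i \<in> P \<Longrightarrow> z \<in> cball (ce i) (2 * ra i) \<Longrightarrow> \<bar>S i z - du x (chart_inv (ch i) z)\<bar> \<le> \<tau>"
    "\<And>i z v. i \<in> P \<Longrightarrow> z \<in> cball (ce i) (2 * ra i) \<Longrightarrow> \<bar>frechet_derivative (S i) (at z) v\<bar> \<le> 2 * gnorm (ch i) z v"
    by metis
  \<comment> \<open>The numerator of the glued function, with a constant k subtracted from every
    local approximation. For estimates at p, k is the distance of p: the factors S i - k are then at
    most \<tau> at p, so terms in which a bump is differentiated are small.\<close>
  define N where "N k p = (\<Sum>i\<in>P. ext (ch i) (\<lambda>z. bu i z * (S i z - k)) p)" for k p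
  have es: "smooth_function A (ext (ch i) (\<lambda>z. bu i z * (S i z - k)))" if "i \<in> P" for i k
    by (rule ext_smooth[OF that smooth_on_diff[OF open_UNIV S(1)[OF that] smooth_on_const]])
  have Ns: "smooth_function A (N k)" for k
    unfolding N_def by (rule smooth_function_sum[OF es])
  have Nk: "N k p = N 0 p - k * B p" for k p
    unfolding N_def B_def be_def ext_def
    by (simp add: sum_distrib_left sum_subtractf[symmetric]) (intro sum.cong refl, simp add: algebra_simps)
  define f0 where "f0 p = N 0 p * inverse (B p)" for p
  have Bnz: "B p \<noteq> 0" if "p \<in> M" for p using B1[OF that] by simp
  have f0s: "smooth_function A f0"
    unfolding f0_def divide_inverse[symmetric] by (rule smooth_function_divide[OF Ns Bs Bnz])
  have local: "\<bar>ext (ch i) (\<lambda>z. bu i z * (S i z - du x p)) p\<bar> \<le> \<tau> * be i p \<and>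
      gbound (ext (ch i) (\<lambda>z. bu i z * (S i z - du x p))) (2 * be i p + \<tau> * Kf i) p"
    if i: "i \<in> P" and p: "p \<in> M" for i p
  proof (cases "p \<in> chart_inv (ch i) ` cball (ce i) (2 * ra i)")
    case True
    then obtain z where z: "z \<in> cball (ce i) (2 * ra i)" "p = chart_inv (ch i) z" by blast
    have zi: "z \<in> chart_img (ch i)" using sub2[OF i] z(1) by blast
    note c = piece(1)[OF i]
    have pd: "p \<in> chart_dom (ch i)" "chart_map (ch i) p = z" using chartD(6,7)[OF c zi] z(2) by auto
    have bep: "be i p = bu i z" using ext_chart(1)[OF c zi] z(2) by (simp add: be_def)
    have st: "\<bar>S i z - du x p\<bar> \<le> \<tau>" using S(2)[OF i z(1)] z(2) by simp
    have 1: "\<bar>ext (ch i) (\<lambda>z. bu i z * (S i z - du x p)) p\<bar> \<le> \<tau> * be i p"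
      using ext_chart(1)[OF c zi, of "\<lambda>z. bu i z * (S i z - du x p)"] z(2) bep
        mult_left_mono[OF st bur(1)[of i z]] by (simp add: abs_mult bur(1) mult.commute)
    have "gbound (ext (ch i) (\<lambda>z. bu i z * (S i z - du x p))) (2 * be i p + \<tau> * Kf i) p"
      unfolding gbound_chart[OF es[OF i] c pd(1)] pd(2) ext_chart(2)[OF c zi]
    proof
      fix v
      have gn: "gnorm (ch i) z v \<ge> 0" by (rule gnorm_nonneg[OF c zi])
      have db: "(bu i has_derivative frechet_derivative (bu i) (at z)) (at z)"
        by (rule smooth_on_has_derivative[OF bus]) simp
      have dS: "((\<lambda>z. S i z - du x p) has_derivative frechet_derivative (S i) (at z)) (at z)"
        using has_derivative_diff[OF smooth_on_has_derivative[OF S(1)[OF i] UNIV_I] has_derivative_const] by simp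
      have "frechet_derivative (\<lambda>z. bu i z * (S i z - du x p)) (at z) v =
          bu i z * frechet_derivative (S i) (at z) v + frechet_derivative (bu i) (at z) v * (S i z - du x p)"
        using frechet_derivative_eq[OF has_derivative_mult[OF db dS]] by simp
      also have "\<bar>\<dots>\<bar> \<le> bu i z * \<bar>frechet_derivative (S i) (at z) v\<bar> + \<bar>frechet_derivative (bu i) (at z) v\<bar> * \<bar>S i z - du x p\<bar>"
        using abs_triangle_ineq[of "bu i z * frechet_derivative (S i) (at z) v"
            "frechet_derivative (bu i) (at z) v * (S i z - du x p)"] bur(1)[of i z] by (simp add: abs_mult)
      also have "\<dots> \<le> bu i z * (2 * gnorm (ch i) z v) + (Kf i * gnorm (ch i) z v) * \<tau>"
      proof (intro add_mono mult_mono mult_left_mono S(3) i z(1) bur st)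
        have "\<bar>dchart (be i) (ch i) (chart_map (ch i) p) v\<bar> \<le> Kf i * gnorm (ch i) (chart_map (ch i) p) v"
          using Kf(2)[OF i p] unfolding gbound_chart[OF bes[OF i] c pd(1)] by blast
        then show "\<bar>frechet_derivative (bu i) (at z) v\<bar> \<le> Kf i * gnorm (ch i) z v"
          using ext_chart(2)[OF c zi, of "\<lambda>z. bu i z * 1"] by (simp add: pd(2) be_def)
      qed (use gn Kf(1)[OF i] in auto)
      finally show "\<bar>frechet_derivative (\<lambda>z. bu i z * (S i z - du x p)) (at z) v\<bar> \<le> (2 * be i p + \<tau> * Kf i) * gnorm (ch i) z v"
        by (simp add: bep algebra_simps)
    qed
    with 1 show ?thesis by simp
  next
    case False
    define U where "U = M - chart_inv (ch i) ` cball (ce i) (2 * ra i)"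
    have U: "openin (top_of_set M) U" unfolding U_def
      using closedin_chart_compact[OF piece(1)[OF i] compact_cball sub2[OF i]]
      by (metis closedin_def topspace_euclidean_subtopology)
    have pU: "p \<in> U" using p False by (simp add: U_def)
    have z: "ext (ch i) (\<lambda>z. bu i z * h z) q = 0" if q: "q \<in> U" for q h
    proof (cases "q \<in> chart_dom (ch i)")
      case True
      then have "chart_map (ch i) q \<notin> cball (ce i) (2 * ra i)"
        using q chartD(5)[OF piece(1)[OF i] True] unfolding U_def by (metis DiffD2 image_eqI)
      then show ?thesis using bu0[OF i] by (simp add: ext_def)
    qed (simp add: ext_def)
    have "gbound (ext (ch i) (\<lambda>z. bu i z * (S i z - du x p))) 0 p"
      by (rule gbound_zero_near[OF U pU z])
    then have "gbound (ext (ch i) (\<lambda>z. bu i z * (S i z - du x p))) (2 * be i p + \<tau> * Kf i) p"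
      by (rule gbound_mono[OF p]) (use be_nn[of i p] \<tau>(1) Kf(1)[OF i] in simp)
    then show ?thesis using z[OF pU, of "\<lambda>z. S i z - du x p"] \<tau>(1) be_nn[of i p] by simp
  qed
  have close: "\<bar>N (du x p) p\<bar> \<le> \<tau> * B p" if p: "p \<in> M" for p
    unfolding N_def B_def sum_distrib_left
    by (rule order_trans[OF sum_abs sum_mono]) (use local p in blast)
  have Ngb: "gbound (N (du x p)) (2 * B p + \<tau> * K) p" if p: "p \<in> M" for p
  proof -
    have "gbound (N (du x p)) (\<Sum>i\<in>P. 2 * be i p + \<tau> * Kf i) p"
      unfolding N_def by (rule gbound_sum[OF P(1) es p]) (use local p in blast)+
    then show ?thesis by (simp add: B_def K_def sum.distrib sum_distrib_left)
  qed
  \<comment> \<open>A change of k shifts the quotient by a constant, so the gradient at p may be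
    computed with the k adapted to p.\<close>
  have f0_eq: "f0 p = N k p * inverse (B p) + k" if "p \<in> M" for p k
    using Bnz[OF that] unfolding f0_def Nk[of k] by (simp add: field_simps)
  have f0_close: "\<bar>f0 p - du x p\<bar> \<le> \<tau>" if p: "p \<in> M" for p
    using close[OF p] B1[OF p] unfolding f0_eq[OF p, of "du x p"]
    by (simp add: divide_inverse[symmetric] abs_divide pos_divide_le_eq)
  \<comment> \<open>The bound 3 is 2 from the local approximations, plus 1/2 from the derivatives of
    the bumps in the numerator and 1/2 from that of the denominator.\<close>
  have f0_gb: "gbound f0 3 p" if p: "p \<in> M" for p
  proof -
    note b = B1[OF p]
    define k where "k = du x p"
    have invs: "smooth_function A (\<lambda>q. inverse (B q))"
      using smooth_function_divide[OF smooth_function_const Bs Bnz, of 1] by (simp add: divide_inverse)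
    have "(inverse has_real_derivative - (inverse (B p) ^ Suc (Suc 0))) (at (B p))"
      by (rule DERIV_inverse) (use b in simp)
    from gbound_compose[OF Bs p this KB[OF p]]
    have gi: "gbound (\<lambda>q. inverse (B q)) (inverse (B p) ^ 2 * K) p"
      using b by (simp add: numeral_2_eq_2 abs_mult)
    have "gbound (\<lambda>q. N k q * inverse (B q)) (\<bar>N k p\<bar> * (inverse (B p) ^ 2 * K) + (2 * B p + \<tau> * K) * \<bar>inverse (B p)\<bar>) p"
      unfolding k_def by (rule gbound_mult[OF Ns invs p Ngb[OF p] gi])
    then have g1: "gbound (\<lambda>q. N k q * inverse (B q) + k) (\<bar>N k p\<bar> * (inverse (B p) ^ 2 * K) + (2 * B p + \<tau> * K) * \<bar>inverse (B p)\<bar> + 0) p"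
      by (rule gbound_add[OF smooth_function_mult[OF Ns invs] smooth_function_const p _ gbound_const[OF p]])
    have ib: "inverse (B p) \<le> 1" "0 < inverse (B p)" "inverse (B p) * B p = 1" using b by (auto simp: field_simps)
    have "\<bar>N k p\<bar> * (inverse (B p) ^ 2 * K) \<le> (\<tau> * B p) * (inverse (B p) ^ 2 * K)"
      unfolding k_def by (intro mult_right_mono close[OF p]) (use K0 in auto)
    also have "\<dots> = (inverse (B p) * B p) * inverse (B p) * (\<tau> * K)" by (simp add: power2_eq_square)
    also have "\<dots> = inverse (B p) * (\<tau> * K)" by (simp only: ib(3) mult_1_left)
    also have "\<dots> \<le> 1 * (1/2)"
      by (intro mult_mono ib \<tau>K) (use \<tau>(1) K0 in auto)
    finally have 1: "\<bar>N k p\<bar> * (inverse (B p) ^ 2 * K) \<le> 1/2" by simp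
    have "(2 * B p + \<tau> * K) * \<bar>inverse (B p)\<bar> = 2 * (inverse (B p) * B p) + (\<tau> * K) * inverse (B p)"
      using ib by (simp add: algebra_simps)
    also have "\<dots> \<le> 2 + 1/2 * 1"
    proof (intro add_mono)
      show "2 * (inverse (B p) * B p) \<le> 2" by (simp only: ib(3))
      show "\<tau> * K * inverse (B p) \<le> 1/2 * 1" by (intro mult_mono ib \<tau>K) (use ib in auto)
    qed
    finally have "\<bar>N k p\<bar> * (inverse (B p) ^ 2 * K) + (2 * B p + \<tau> * K) * \<bar>inverse (B p)\<bar> + 0 \<le> 3" using 1 by simp
    from gbound_mono[OF p g1 this] have "gbound (\<lambda>q. N k q * inverse (B q) + k) 3 p" .
    then show ?thesis
      by (rule gbound_cong[OF p f0_eq[symmetric], rotated])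
  qed
  show thesis
  proof (rule that[of "\<lambda>p. 1/3 * f0 p"])
    show "smooth_function A (\<lambda>p. 1/3 * f0 p)"
      by (intro smooth_function_mult smooth_function_const f0s)
    show "gbound (\<lambda>p. 1/3 * f0 p) 1 p" if p: "p \<in> M" for p
      using gbound_mult[OF smooth_function_const[of "1/3"] f0s p gbound_const[OF p] f0_gb[OF p]] by simp
    \<comment> \<open>From x to y, \<open>f0\<close> grows by at least du - 2 \<tau> >= du / 2, and
      a third of this is more than du / 8.\<close>
    have "du x x = 0" by (rule du_self[OF conn xy(1)])
    then show "du x y / 8 \<le> 1/3 * f0 y - 1/3 * f0 x"
      using f0_close[OF xy(1)] f0_close[OF xy(2)] \<tau>(2) D by (simp add: abs_le_iff)
  qed
qed

end

section \<open>The diameter bound\<close>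

lemma young_one:
  fixes x p :: real
  assumes "x > 0" "p \<ge> 1"
  shows "x \<le> x powr p / p + (1 - 1 / p)"
proof -
  have "exp ((1 - 1 / p) *\<^sub>R 0 + (1 / p) *\<^sub>R (p * ln x)) \<le> (1 - 1 / p) * exp 0 + (1 / p) * exp (p * ln x)"
    by (rule convex_onD[OF exp_convex]) (use assms in auto)
  then show ?thesis using assms by (simp add: powr_def)
qed

text \<open>A finite subcover is thinned to disjoint intervals whose fivefold enlargements still
  cover. Each enlargement has length 10 s, and by disjointness the measures of the intervals add up
  to at most I.\<close>

lemma finite_interval_covering:
  fixes a b \<delta> I :: real and \<nu> :: "real measure"
  assumes \<nu>: "finite_measure \<nu>" "sets \<nu> = sets borel" and I: "measure \<nu> UNIV \<le> I"
    and cov: "\<And>t. t \<in> {a..b} \<Longrightarrow> \<exists>s>0. measure \<nu> {t - s<..<t + s} \<ge> \<delta> * s" and \<delta>: "\<delta> > 0" and ab: "a \<le> b"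
  shows "b - a \<le> 10 * I / \<delta>"
proof -
  interpret finite_measure \<nu> by (rule \<nu>(1))
  obtain s where s: "\<And>t. t \<in> {a..b} \<Longrightarrow> s t > 0" "\<And>t. t \<in> {a..b} \<Longrightarrow> measure \<nu> {t - s t<..<t + s t} \<ge> \<delta> * s t"
    using cov by metis
  have bs: "ball t r = {t - r<..<t + r}" for t r :: real by (auto simp: dist_real_def)
  obtain F where F: "F \<subseteq> {a..b}" "finite F" "{a..b} \<subseteq> (\<Union>t\<in>F. ball t (s t))"
  proof (rule compactE_image[of "{a..b}" "{a..b}" "\<lambda>t. ball t (s t)"])
    show "{a..b} \<subseteq> (\<Union>t\<in>{a..b}. ball t (s t))" using s(1) by force
  qed auto
  have "\<exists>B. \<forall>t\<in>F. s t \<le> B" using F(2) by (metis Max_ge finite_imageI imageI)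
  then obtain B where B: "\<And>t. t \<in> F \<Longrightarrow> 0 < s t \<and> s t \<le> B" using s(1) F(1) by (metis subsetD)
  obtain C where C: "countable C" "C \<subseteq> F" "pairwise (\<lambda>i j. disjnt (ball i (s i)) (ball j (s j))) C"
    "{a..b} \<subseteq> (\<Union>i\<in>C. ball i (5 * s i))"
    by (rule Vitali_covering_lemma_balls[OF F(3) B]) auto
  have fC: "finite C" using C(2) F(2) finite_subset by blast
  have sC: "s i > 0" if "i \<in> C" for i using B C(2) that by blast
  have "ennreal (b - a) = emeasure lborel {a..b}" using ab by simp
  also have "\<dots> \<le> emeasure lborel (\<Union>i\<in>C. ball i (5 * s i))"
    by (rule emeasure_mono[OF C(4)]) (use fC in auto)
  also have "\<dots> \<le> (\<Sum>i\<in>C. emeasure lborel (ball i (5 * s i)))"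
    by (rule emeasure_subadditive_finite[OF fC]) auto
  also have "\<dots> = (\<Sum>i\<in>C. ennreal (10 * s i))"
    using sC by (intro sum.cong refl) (simp add: bs less_imp_le)
  also have "\<dots> = ennreal (\<Sum>i\<in>C. 10 * s i)" using sC by (intro sum_ennreal) (auto simp: less_imp_le)
  finally have 1: "b - a \<le> (\<Sum>i\<in>C. 10 * s i)"
    using sC by (subst (asm) ennreal_le_iff) (auto intro!: sum_nonneg simp: less_imp_le)
  have "\<delta> * (\<Sum>i\<in>C. s i) \<le> (\<Sum>i\<in>C. measure \<nu> (ball i (s i)))"
    unfolding sum_distrib_left bs using s(2) C(2) F(1) by (intro sum_mono) blast
  also have "\<dots> = measure \<nu> (\<Union>i\<in>C. ball i (s i))"
    using C(3) \<nu>(2) by (intro measure_finite_Union[symmetric] fC)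
      (auto simp: disjoint_family_on_def pairwise_def disjnt_def)
  also have "\<dots> \<le> measure \<nu> UNIV" using \<nu>(2) by (intro finite_measure_mono) auto
  also have "\<dots> \<le> I" by (rule I)
  finally have "(\<Sum>i\<in>C. s i) \<le> I / \<delta>" using \<delta> by (simp add: field_simps)
  then show ?thesis using 1 by (simp add: sum_distrib_left[symmetric])
qed

text \<open>If the density \<open>V s / s^n\<close> stayed below \<open>\<delta>\<close> at all scales, it would decay geometrically,
  against the lower bound at small scales. At a scale where it crosses \<open>\<delta>\<close>, the curvature term
  must dominate.\<close>

lemma critical_scale:
  fixes V W J :: "real \<Rightarrow> real" and n :: nat and Y Q c s0 Rm Vt \<delta> :: real
  assumes n: "n \<ge> 3" and Y: "Y > 0" and Q: "Q \<ge> 1"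
    and \<delta>: "\<delta> = (Y / (2 ^ n * Q)) powr (n / 2)"
    and V: "\<And>s. s > 0 \<Longrightarrow> 0 \<le> V s" "\<And>s. s > 0 \<Longrightarrow> V s \<le> Vt"
    and yam: "\<And>s. s > 0 \<Longrightarrow> Y * V (s / 2) powr ((real n - 2) / n) \<le> Q / s\<^sup>2 * V s + W s"
    and hold: "\<And>s. s > 0 \<Longrightarrow> W s \<le> (2 / (real n - 1)) * s ^ (n - 3) * J s + (1 - 2 / (real n - 1)) * (V s / s\<^sup>2)"
    and Rm: "\<And>s. s > 0 \<Longrightarrow> W s \<le> Rm * V s"
    and low: "c > 0" "s0 > 0" "\<And>s. 0 < s \<Longrightarrow> s < s0 \<Longrightarrow> c * s ^ n \<le> V s"
  shows "\<exists>s>0. J s \<ge> \<delta> * s"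
proof -
  define q where "q = (real n - 2) / n"
  have q: "0 < q" "q \<le> 1" "q = 1 - 2 / n" using n by (auto simp: q_def field_simps)
  have \<delta>0: "\<delta> > 0" unfolding \<delta> using Y Q by simp
  have \<delta>2: "\<delta> powr (2 / n) = Y / (2 ^ n * Q)"
    unfolding \<delta> powr_powr using n Y Q by simp
  \<comment> \<open>This identity is the reason for the choice of \<delta>. At density \<delta> on
    both scales the term Q v is a quarter of the left side of \<open>yv\<close>, which leaves room
    for the curvature term and for the halving.\<close>
  have \<delta>q: "Q * \<delta> = Y / 2 ^ n * \<delta> powr q"
  proof -
    have "\<delta> = \<delta> powr (2 / n) * \<delta> powr q" using \<delta>0 by (simp add: powr_add[symmetric] q(3))
    then show ?thesis using \<delta>2 Q by (simp add: field_simps)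
  qed
  define v where "v s = V s / s ^ n" for s
  have v0: "v s \<ge> 0" if "s > 0" for s using V(1)[OF that] that by (simp add: v_def)
  have Vv: "V s = v s * s ^ n" if "s > 0" for s using that by (simp add: v_def)
  have "n = (n - 2) + 2" using n by simp
  then have sn: "s ^ n = s ^ (n - 2) * s\<^sup>2" for s :: real using power_add[of s "n - 2" 2] by simp
  \<comment> \<open>Since n q = n - 2, dividing by s^(n-2) turns the hypothesis into a recursion for
    the density v in which no power of s is left beside Q and Y.\<close>
  have yv: "Y / 2 ^ (n - 2) * v (s / 2) powr q \<le> Q * v s + W s / s ^ (n - 2)" if s: "s > 0" for s
  proof -
    have "((s / 2) ^ n) powr q = (s / 2) ^ (n - 2)"
    proof -
      have "((s / 2) ^ n) powr q = (s / 2) powr (real n * q)"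
        using s by (simp add: powr_realpow[symmetric] powr_powr)
      also have "real n * q = real (n - 2)" using n by (simp add: q_def of_nat_diff)
      finally show ?thesis using s by (simp add: powr_realpow)
    qed
    then have "V (s / 2) powr q = v (s / 2) powr q * (s / 2) ^ (n - 2)"
      using Vv[of "s / 2"] s v0[of "s / 2"] by (simp add: powr_mult)
    then have "Y * (v (s / 2) powr q * (s / 2) ^ (n - 2)) \<le> Q / s\<^sup>2 * (v s * s ^ n) + W s"
      using yam[OF s] Vv[OF s] by (simp add: q_def)
    also have "Q / s\<^sup>2 * (v s * s ^ n) = Q * v s * s ^ (n - 2)" using s by (simp add: sn)
    finally have "(Y / 2 ^ (n - 2) * v (s / 2) powr q) * s ^ (n - 2) \<le> (Q * v s + W s / s ^ (n - 2)) * s ^ (n - 2)"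
    proof -
      assume a: "Y * (v (s / 2) powr q * (s / 2) ^ (n - 2)) \<le> Q * v s * s ^ (n - 2) + W s"
      have "(Y / 2 ^ (n - 2) * v (s / 2) powr q) * s ^ (n - 2) = Y * (v (s / 2) powr q * (s / 2) ^ (n - 2))"
        by (simp add: power_divide)
      moreover have "(Q * v s + W s / s ^ (n - 2)) * s ^ (n - 2) = Q * v s * s ^ (n - 2) + W s"
        using s by (simp add: distrib_right)
      ultimately show ?thesis using a by simp
    qed
    then show ?thesis by (rule mult_right_le_imp_le) (use s in simp)
  qed
  \<comment> \<open>At this scale the total volume alone forces v <= \<delta>, since V <= Vt <=
    \<delta> S <= \<delta> S^n.\<close>
  define S where "S = max 1 (Vt / \<delta>)"
  have S: "S \<ge> 1" "Vt \<le> \<delta> * S" using \<delta>0 by (auto simp: S_def max_def field_simps)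
  define sk where "sk k = S / 2 ^ k" for k :: nat
  have sk0: "sk k > 0" for k using S by (simp add: sk_def)
  have skS: "sk (Suc k) = sk k / 2" for k by (simp add: sk_def)
  have start: "v (sk 0) \<le> \<delta>"
  proof -
    have "V S \<le> \<delta> * S" using V(2)[of S] S by simp
    also have "\<dots> \<le> \<delta> * S ^ n" using self_le_power[of S n] S n \<delta>0 by simp
    finally show ?thesis using S by (simp add: v_def sk_def field_simps)
  qed
  have "\<exists>k. v (sk k) > \<delta>"
  proof (rule ccontr)
    assume "\<not> ?thesis"
    then have all: "v (sk k) \<le> \<delta>" for k by (simp add: not_less)
    have lim: "(\<lambda>k. sk k) \<longlonglongrightarrow> 0"
      unfolding sk_def using tendsto_mult_right_zero[OF LIMSEQ_power_zero[of "1/2::real"], of S]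
      by (simp add: power_divide)
    \<comment> \<open>Below e the curvature term is at most Q v, because Rm s^2 <= Q, and the lower
      volume bound is available.\<close>
    define e where "e = min s0 (sqrt (Q / (\<bar>Rm\<bar> + 1)))"
    have e: "e > 0" using low(2) Q by (simp add: e_def)
    obtain k0 where k0: "\<And>k. k \<ge> k0 \<Longrightarrow> sk k < e"
      using lim e sk0 unfolding LIMSEQ_iff by (metis abs_of_pos diff_zero real_norm_def)
    \<comment> \<open>With the curvature term absorbed, x = v(s/2) / \<delta> satisfies x^q <= v(s)
      / (2 \<delta>). Moreover x <= x^q, because x <= 1 and q <= 1.\<close>
    have step: "v (sk (Suc k)) / \<delta> \<le> v (sk k) / \<delta> / 2" if k: "k \<ge> k0" for k
    proof -
      let ?s = "sk k"
      have s: "?s > 0" "?s < s0" "?s < sqrt (Q / (\<bar>Rm\<bar> + 1))" using sk0 k0[OF k] by (auto simp: e_def)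
      have "?s\<^sup>2 < Q / (\<bar>Rm\<bar> + 1)" using s(1,3) Q by (metis real_sqrt_less_iff real_sqrt_unique less_imp_le real_sqrt_abs abs_of_pos)
      then have "(\<bar>Rm\<bar> + 1) * ?s\<^sup>2 < Q" by (simp add: field_simps)
      moreover have "Rm * ?s\<^sup>2 \<le> (\<bar>Rm\<bar> + 1) * ?s\<^sup>2"
        by (rule mult_right_mono) auto
      ultimately have "Rm * ?s\<^sup>2 \<le> Q" by linarith
      have "W ?s \<le> Rm * (v ?s * ?s ^ n)" using Rm[OF s(1)] Vv[OF s(1)] by simp
      also have "\<dots> = (Rm * ?s\<^sup>2) * (v ?s * ?s ^ (n - 2))" by (simp add: sn)
      also have "\<dots> \<le> Q * (v ?s * ?s ^ (n - 2))"
        using v0[OF s(1)] s(1) by (intro mult_right_mono \<open>Rm * ?s\<^sup>2 \<le> Q\<close>) auto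
      finally have "W ?s / ?s ^ (n - 2) \<le> Q * v ?s" using s(1) by (simp add: field_simps)
      then have "Y / 2 ^ (n - 2) * v (sk (Suc k)) powr q \<le> 2 * Q * v ?s" using yv[OF s(1)] unfolding skS by linarith
      also have "2 * Q * v ?s = 2 * (Y / 2 ^ n * \<delta> powr q) * (v ?s / \<delta>)" using \<delta>q[symmetric] \<delta>0 by simp
      also have "\<dots> = (Y / 2 ^ (n - 2)) * (\<delta> powr q * (v ?s / \<delta> / 2))"
      proof -
        have "(2::real) ^ n = 2 ^ (n - 2) * 4" using sn[of 2] by simp
        then show ?thesis by (simp add: field_simps)
      qed
      finally have "v (sk (Suc k)) powr q \<le> \<delta> powr q * (v ?s / \<delta> / 2)"
        by (rule mult_left_le_imp_le) (use Y in simp)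
      then have "(v (sk (Suc k)) / \<delta>) powr q \<le> v ?s / \<delta> / 2"
        using \<delta>0 v0[OF sk0[of "Suc k"]] by (simp add: powr_divide field_simps)
      moreover have x1: "v (sk (Suc k)) / \<delta> \<le> 1" "0 \<le> v (sk (Suc k)) / \<delta>"
        using all[of "Suc k"] \<delta>0 v0[OF sk0[of "Suc k"]] by auto
      moreover have "v (sk (Suc k)) / \<delta> \<le> (v (sk (Suc k)) / \<delta>) powr q"
      proof -
        have "(v (sk (Suc k)) / \<delta>) powr 1 \<le> (v (sk (Suc k)) / \<delta>) powr q"
          by (rule powr_mono') (use x1 q(2) in auto)
        then show ?thesis using x1(2) by (simp only: powr_one)
      qed
      ultimately show ?thesis by linarith
    qed
    have dec: "v (sk (k0 + j)) / \<delta> \<le> 1 / 2 ^ j" for j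
    proof (induction j)
      case 0
      then show ?case using all[of k0] \<delta>0 by simp
    next
      case (Suc j)
      then show ?case using step[of "k0 + j"] by simp
    qed
    \<comment> \<open>The densities at these scales are at least c, against the geometric decay
      \<open>dec\<close>.\<close>
    have cl: "c / \<delta> \<le> 1 / 2 ^ j" for j
    proof -
      have "sk (k0 + j) < s0" using k0[of "k0 + j"] by (simp add: e_def)
      then have "c \<le> v (sk (k0 + j))" using low(3)[OF sk0] sk0[of "k0 + j"] by (simp add: v_def field_simps)
      then show ?thesis using dec[of j] \<delta>0 divide_right_mono[of c "v (sk (k0 + j))" \<delta>] by linarith
    qed
    have "(\<lambda>j. 1 / 2 ^ j :: real) \<longlonglongrightarrow> 0"
      using LIMSEQ_power_zero[of "1/2::real"] by (simp add: power_divide)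
    then have "c / \<delta> \<le> 0" by (rule LIMSEQ_le_const) (use cl in blast)
    then show False using low(1) \<delta>0 by (simp add: divide_le_0_iff)
  qed
  then obtain k where "v (sk k) > \<delta>" by blast
  \<comment> \<open>The first scale with density above \<delta>. At its predecessor s, which exists
    by \<open>start\<close>, the density is still at most \<delta>.\<close>
  define m where "m = (LEAST k. v (sk k) > \<delta>)"
  have m: "v (sk m) > \<delta>" unfolding m_def by (rule LeastI) (rule \<open>v (sk k) > \<delta>\<close>)
  then obtain j where j: "m = Suc j" using start by (cases m) auto
  have vj: "v (sk j) \<le> \<delta>" using not_less_Least[of j "\<lambda>k. v (sk k) > \<delta>"] j unfolding m_def[symmetric] by simp
  let ?s = "sk j"
  have s: "?s > 0" by (rule sk0)
  have vs2: "v (?s / 2) > \<delta>" using m skS[of j] j by simp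
  \<comment> \<open>Otherwise Young's inequality bounds W / s^(n-2) by an average of two quantities
    at most \<delta>, so by Q \<delta>. The right side of \<open>yv\<close> is then at most 2 Q
    \<delta>, whereas density above \<delta> at s/2 makes the left side exceed 4 Q \<delta>.\<close>
  have "J ?s \<ge> \<delta> * ?s"
  proof (rule ccontr)
    assume "\<not> ?thesis"
    then have J: "J ?s < \<delta> * ?s" by simp
    define p where "p = 2 / (real n - 1)"
    have p: "0 < p" "p \<le> 1" using n by (auto simp: p_def)
    have "W ?s \<le> p * ?s ^ (n - 3) * J ?s + (1 - p) * (V ?s / ?s\<^sup>2)"
      using hold[OF s] by (simp add: p_def)
    also have "\<dots> \<le> p * ?s ^ (n - 3) * (\<delta> * ?s) + (1 - p) * (\<delta> * ?s ^ (n - 2))"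
    proof (intro add_mono mult_left_mono)
      have "V ?s / ?s\<^sup>2 = v ?s * ?s ^ (n - 2)" using Vv[OF s] s by (simp add: sn)
      then show "V ?s / ?s\<^sup>2 \<le> \<delta> * ?s ^ (n - 2)" using vj s by simp
    qed (use J p s in auto)
    also have "p * ?s ^ (n - 3) * (\<delta> * ?s) = p * (\<delta> * ?s ^ (n - 2))"
    proof -
      have "n - 2 = Suc (n - 3)" using n by simp
      then show ?thesis by simp
    qed
    also have "p * (\<delta> * ?s ^ (n - 2)) + (1 - p) * (\<delta> * ?s ^ (n - 2)) = \<delta> * ?s ^ (n - 2)" by (simp add: algebra_simps)
    finally have "W ?s / ?s ^ (n - 2) \<le> \<delta>" using s by (simp add: field_simps)
    moreover have "\<delta> \<le> Q * \<delta>" using Q \<delta>0 by simp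
    moreover have "Q * v ?s \<le> Q * \<delta>" using vj Q by simp
    ultimately have "Y / 2 ^ (n - 2) * v (?s / 2) powr q \<le> 2 * (Q * \<delta>)" using yv[OF s] by linarith
    moreover have "\<delta> powr q < v (?s / 2) powr q" using vs2 \<delta>0 q by (intro powr_less_mono2) auto
    then have "Y / 2 ^ (n - 2) * \<delta> powr q < Y / 2 ^ (n - 2) * v (?s / 2) powr q"
      by (rule mult_strict_left_mono) (use Y in simp)
    ultimately have "Y / 2 ^ (n - 2) * \<delta> powr q < 2 * (Y / 2 ^ n * \<delta> powr q)" using \<delta>q by linarith
    moreover have "(2::real) ^ n = 2 ^ (n - 2) * 4" using sn[of 2] by simp
    ultimately show False using Y \<delta>0 by (simp add: field_simps)
  qed
  then show ?thesis using s by blast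
qed

text \<open>Write 80 = 4 * 20 with 20 <= 2^5, and E = 2e/n <= 2. As Q <= 2^22, the left side is at
  most 4 (E Y)^(-n/2) times the power of 2 with exponent n (n + 23) / 2 + 5. By n^2 <= 2 * 2^n and n
  <= 2^n this exponent is at most 17 * 2^n, and finally 2 <= e and 17 <= (17n - 18) / (n -
  2).\<close>

lemma constant_comparison:
  fixes Y :: real and n :: nat
  assumes n: "n \<ge> 3" and Y: "Y > 0" and Q: "0 < Q" "Q \<le> 2 ^ 22"
  shows "80 * (Y / (2 ^ n * Q)) powr (- (n / 2)) \<le>
    4 * ((2 * exp 1 / n * Y) powr (- real n / 2) * exp ((17 * real n - 18) / (real n - 2) * 2 ^ n))"
proof -
  define E :: real where "E = 2 * exp 1 / n"
  have E: "0 < E" "E \<le> 2" unfolding E_def using n exp_le by (auto simp: field_simps)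
  have "Y / (2 ^ n * Q) = (E * Y) / (E * 2 ^ n * Q)" using E by simp
  then have 1: "(Y / (2 ^ n * Q)) powr (- (n / 2)) = (E * Y) powr (- (n / 2)) * (E * 2 ^ n * Q) powr (n / 2)"
    using powr_divide[of "E * Y" "E * 2 ^ n * Q" "- (n / 2)"] powr_minus[of "E * 2 ^ n * Q" "n / 2"] E Y Q
    by (simp only: inverse_inverse_eq divide_inverse)
  have "E * 2 ^ n * Q \<le> 2 * 2 ^ n * 2 ^ 22" using E Q by (intro mult_mono) auto
  also have "\<dots> = 2 ^ (n + 23)" by (simp add: power_add)
  finally have "(E * 2 ^ n * Q) powr (n / 2) \<le> (2 ^ (n + 23)) powr (n / 2)"
    using E Q by (intro powr_mono2) auto
  also have "\<dots> = 2 powr (real (n + 23) * (n / 2))" by (simp add: powr_realpow[symmetric] powr_powr)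
  finally have 2: "(E * 2 ^ n * Q) powr (n / 2) \<le> 2 powr (real (n + 23) * (n / 2))" .
  have n2: "n * n \<le> 2 * 2 ^ n"
    using n
  proof (induction n rule: nat_induct_at_least)
    case (Suc n)
    have "2 * n + 1 \<le> 3 * n" "3 * n \<le> n * n" using Suc.hyps by auto
    then have "2 * n + 1 \<le> n * n" by linarith
    then show ?case using Suc.IH unfolding mult_Suc mult_Suc_right power_Suc by linarith
  qed simp
  have "real (n * n) \<le> real (2 * 2 ^ n)" using n2 by (rule of_nat_mono)
  then have n2r: "real n * real n \<le> 2 * 2 ^ n" by simp
  have n1: "real n \<le> 2 ^ n" using less_exp[of n] by (metis less_imp_le of_nat_le_iff of_nat_numeral of_nat_power)
  have n8: "(8::real) \<le> 2 ^ n" using power_increasing[OF n, of "2::real"] by simp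
  have "real (n + 23) * (n / 2) = real n * real n / 2 + 23 / 2 * real n" by (simp add: algebra_simps)
  then have ex: "real (n + 23) * (n / 2) + 5 \<le> 17 * 2 ^ n" using n2r n1 n8 by linarith
  have "20 * (E * 2 ^ n * Q) powr (n / 2) \<le> 2 powr 5 * 2 powr (real (n + 23) * (n / 2))"
    using 2 by (intro mult_mono) auto
  also have "\<dots> = 2 powr (real (n + 23) * (n / 2) + 5)" by (simp add: powr_add)
  also have "\<dots> \<le> 2 powr (17 * 2 ^ n)" using ex by (intro powr_mono) auto
  also have "\<dots> \<le> exp 1 powr (17 * 2 ^ n)"
    using exp_ge_add_one_self[of 1] by (intro powr_mono2) auto
  also have "\<dots> = exp (17 * 2 ^ n)" by (simp add: powr_def)
  also have "\<dots> \<le> exp ((17 * real n - 18) / (real n - 2) * 2 ^ n)"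
  proof -
    have "17 \<le> (17 * real n - 18) / (real n - 2)" using n by (simp add: field_simps)
    then show ?thesis by (subst exp_le_cancel_iff) (rule mult_right_mono, auto)
  qed
  finally have 3: "20 * (E * 2 ^ n * Q) powr (n / 2) \<le> exp ((17 * real n - 18) / (real n - 2) * 2 ^ n)" .
  have "80 * (Y / (2 ^ n * Q)) powr (- (n / 2)) = 4 * ((E * Y) powr (- (n / 2)) * (20 * (E * 2 ^ n * Q) powr (n / 2)))"
    unfolding 1 by simp
  also have "\<dots> \<le> 4 * ((E * Y) powr (- (n / 2)) * exp ((17 * real n - 18) / (real n - 2) * 2 ^ n))"
    using 3 by (intro mult_left_mono) auto
  finally show ?thesis by (simp add: E_def)
qed

text \<open>On the support the inner quadratic has slope at most (8/3) / s <= 3 / s, whence 600 =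
  200 * 3. Elsewhere the bump vanishes, so it is at its minimum and d = 0.\<close>

lemma smooth_bump_deriv:
  fixes t s \<tau> :: real
  assumes s: "s > 0"
  obtains d where "((\<lambda>\<tau>. smooth_bump (s / 2) (\<tau> - t)) has_real_derivative d) (at \<tau>)"
    "\<bar>d\<bar> \<le> 600 / s" "\<bar>\<tau> - t\<bar> \<ge> s \<Longrightarrow> d = 0"
proof -
  define u where "u = (\<lambda>\<tau>. (4 - ((\<tau> - t) / (s / 2))\<^sup>2) / 3)"
  have eq: "smooth_bump (s / 2) (\<tau> - t) = smooth_step (u \<tau>)" for \<tau>
  proof -
    have "(norm (\<tau> - t) / (s / 2))\<^sup>2 = ((\<tau> - t) / (s / 2))\<^sup>2"
      by (simp only: real_norm_def power_divide power2_abs)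
    then show ?thesis by (simp only: smooth_bump_def u_def)
  qed
  obtain e where e: "(smooth_step has_real_derivative e) (at (u \<tau>))" "\<bar>e\<bar> \<le> 200"
    by (rule smooth_step_deriv)
  define u' where "u' = - (8 / 3) * ((\<tau> - t) / s\<^sup>2)"
  have "(u has_real_derivative u') (at \<tau>)"
    unfolding u_def u'_def using s
    by (auto intro!: derivative_eq_intros simp: field_simps power2_eq_square)
  from DERIV_chain2[OF e(1) this]
  have d: "((\<lambda>\<tau>. smooth_bump (s / 2) (\<tau> - t)) has_real_derivative e * u') (at \<tau>)"
    by (simp add: eq)
  have z: "e * u' = 0" if "\<bar>\<tau> - t\<bar> \<ge> s"
  proof (rule DERIV_local_min[OF d, of 1])
    have "smooth_bump (s / 2) (\<tau> - t) = 0" using that s by (intro smooth_bump_0) auto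
    then show "\<forall>y. \<bar>\<tau> - y\<bar> < 1 \<longrightarrow> smooth_bump (s / 2) (\<tau> - t) \<le> smooth_bump (s / 2) (y - t)"
      by (simp add: smooth_bump_range)
  qed simp
  have "\<bar>e * u'\<bar> \<le> 600 / s"
  proof (cases "\<bar>\<tau> - t\<bar> \<ge> s")
    case False
    have "\<bar>u'\<bar> = 8 / 3 * (\<bar>\<tau> - t\<bar> / s\<^sup>2)" unfolding u'_def abs_mult abs_divide by simp
    also have "\<dots> \<le> 8 / 3 * (s / s\<^sup>2)" using False by (intro mult_left_mono divide_right_mono) auto
    also have "\<dots> \<le> 3 / s" using s by (simp add: power2_eq_square field_simps)
    finally have "\<bar>e\<bar> * \<bar>u'\<bar> \<le> 200 * (3 / s)" using e(2) by (intro mult_mono) auto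
    then show ?thesis by (simp add: abs_mult)
  next
    case True
    show ?thesis unfolding z[OF True] using s by simp
  qed
  then show thesis using that d z by blast
qed

section \<open>Slabs of a function with gradient at most one\<close>

context closed_riemannian
begin

lemma R_bounds:
  assumes "\<forall>p\<in>M. R p > 0"
  obtains R0 R1 where "R0 > 0" "\<And>p. p \<in> M \<Longrightarrow> R0 \<le> R p" "\<And>p. p \<in> M \<Longrightarrow> R p \<le> R1"
  using continuous_attains_inf[OF compact_M M_nonempty continuous_on_R]
    continuous_attains_sup[OF compact_M M_nonempty continuous_on_R] assms by metis

lemma integral_vol_nonneg: "(\<And>p. p \<in> M \<Longrightarrow> 0 \<le> f p) \<Longrightarrow> 0 \<le> (\<integral>p. f p \<partial>vol)" for f :: "'a \<Rightarrow> real"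
  by (rule Bochner_Integration.integral_nonneg_AE) (auto intro!: AE_I2)

text \<open>Provides the lower bound that allows the real infimum \<open>yamabe_constant\<close> to
  be compared with individual quotients.\<close>

lemma yamabe_quotient_nonneg:
  assumes "\<forall>p\<in>M. R p > 0" "CARD('n) \<ge> 3" "smooth_function A \<phi>"
  shows "yamabe_quotient M A g \<phi> \<ge> 0"
proof -
  have "0 \<le> (\<integral>p. grad_norm_sq A g \<phi> p \<partial>vol)" "0 \<le> (\<integral>p. R p * (\<phi> p)\<^sup>2 \<partial>vol)"
    using gbound_grad_norm_sq(1)[OF assms(3)] assms(1) by (auto intro!: integral_vol_nonneg simp: less_imp_le)
  then show ?thesis unfolding yamabe_quotient_def Let_def using assms(2)
    by (intro divide_nonneg_nonneg add_nonneg_nonneg mult_nonneg_nonneg) auto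
qed

lemma yamabe_constant_le:
  assumes "\<forall>p\<in>M. R p > 0" "CARD('n) \<ge> 3" "smooth_function A \<phi>" "\<And>p. p \<in> M \<Longrightarrow> \<phi> p > 0"
  shows "yamabe_constant M A g \<le> yamabe_quotient M A g \<phi>"
  unfolding yamabe_constant_def
proof (rule cInf_lower)
  show "bdd_below {yamabe_quotient M A g \<phi> |\<phi>. smooth_function A \<phi> \<and> (\<forall>p\<in>M. 0 < \<phi> p)}"
    using yamabe_quotient_nonneg[OF assms(1,2)] by (auto simp: bdd_below_def)
qed (use assms in blast)

definition slab :: "('a \<Rightarrow> real) \<Rightarrow> real \<Rightarrow> real \<Rightarrow> 'a set" where
  "slab f t s = {p \<in> M. \<bar>f p - t\<bar> < s}"

lemma slab_msets:
  assumes "continuous_on M f"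
  shows "slab f t s \<in> msets"
proof -
  have "slab f t s = f -` {t - s<..<t + s} \<inter> space vol" by (auto simp: slab_def)
  moreover have "f -` {t - s<..<t + s} \<inter> space vol \<in> sets vol"
    by (rule measurable_sets[OF measurable_vol[OF assms]]) simp
  ultimately show ?thesis by simp
qed

lemma integrable_slab:
  fixes h :: "'a \<Rightarrow> real"
  assumes "continuous_on M f" "continuous_on M h"
  shows "integrable vol (\<lambda>p. indicator (slab f t s) p * h p)"
  using integrable_mult_indicator[OF _ integrable_vol[OF assms(2)], of "slab f t s"] slab_msets[OF assms(1)] by simp

lemma slab_measure: "continuous_on M f \<Longrightarrow> (\<integral>p. indicator (slab f t s) p \<partial>vol) = measure vol (slab f t s)"
  by (simp add: slab_def Int_def conj_commute)

text \<open>The test function is \<psi>(f) + \<epsilon>, where \<psi> is 1 up to distance s/2 from t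
  and 0 from distance s on. Its gradient is at most 600 / s and vanishes off the larger slab, and
  the integral in the denominator is at least the volume of the smaller slab.\<close>

lemma slab_yamabe:
  fixes f :: "'a \<Rightarrow> real"
  assumes Rpos: "\<forall>p\<in>M. R p > 0" and n3: "CARD('n) \<ge> 3" and f: "smooth_function A f" "\<And>p. p \<in> M \<Longrightarrow> gbound f 1 p"
    and Y: "yamabe_constant M A g > 0" and s: "s > 0"
  shows "yamabe_constant M A g * measure vol (slab f t (s / 2)) powr ((real CARD('n) - 2) / CARD('n))
    \<le> (4 * (real CARD('n) - 1) / (real CARD('n) - 2) * 600\<^sup>2) / s\<^sup>2 * measure vol (slab f t s)
      + (\<integral>p. indicator (slab f t s) p * R p \<partial>vol)"
proof (rule field_le_epsilon)
  fix e :: real assume e: "e > 0"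
  define n where "n = real CARD('n)"
  have n: "n \<ge> 3" using n3 by (simp add: n_def)
  note cf = smooth_function_continuous[OF f(1)]
  define IR where "IR = (\<integral>p. R p \<partial>vol)"
  have IR: "IR \<ge> 0" unfolding IR_def using Rpos by (intro integral_vol_nonneg) (auto simp: less_imp_le)
  \<comment> \<open>The square of \<psi> + \<epsilon> exceeds the indicator of the slab by at most 3
    \<epsilon>. This choice keeps the resulting error below e; the summand 1 avoids division by
    zero.\<close>
  define \<epsilon> where "\<epsilon> = min 1 (e / (3 * IR + 1))"
  have \<epsilon>: "0 < \<epsilon>" "\<epsilon> \<le> 1" using e IR by (auto simp: \<epsilon>_def)
  have "3 * \<epsilon> * IR \<le> \<epsilon> * (3 * IR + 1)" using \<epsilon> by (simp add: algebra_simps)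
  also have "\<dots> \<le> e / (3 * IR + 1) * (3 * IR + 1)" using IR by (intro mult_right_mono) (auto simp: \<epsilon>_def)
  finally have \<epsilon>e: "3 * \<epsilon> * IR \<le> e" using IR by simp
  define \<psi> where "\<psi> \<tau> = smooth_bump (s / 2) (\<tau> - t)" for \<tau> :: real
  define \<phi> where "\<phi> p = \<psi> (f p) + \<epsilon>" for p
  have \<psi>r: "0 \<le> \<psi> \<tau>" "\<psi> \<tau> \<le> 1" for \<tau> by (auto simp: \<psi>_def smooth_bump_range)
  have \<psi>s: "smooth_on UNIV \<psi>" unfolding \<psi>_def
    by (rule smooth_on_compose[OF open_UNIV open_UNIV _ _ smooth_on_bump]) (auto intro!: smooth_on_diff)
  have \<phi>s: "smooth_function A \<phi>" unfolding \<phi>_def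
    by (intro smooth_function_add smooth_function_const smooth_function_compose[OF f(1) \<psi>s])
  have \<phi>pos: "\<phi> p > 0" for p using \<psi>r(1)[of "f p"] \<epsilon> by (simp add: \<phi>_def)
  let ?V = "\<lambda>s. measure vol (slab f t s)"
  let ?ind = "\<lambda>p. indicator (slab f t s) p :: real"
  define a where "a = 4 * (n - 1) / (n - 2)"
  have a: "a \<ge> 0" using n by (simp add: a_def)
  have "(\<integral>p. grad_norm_sq A g \<phi> p \<partial>vol) \<le> (\<integral>p. (600 / s)\<^sup>2 * ?ind p \<partial>vol)"
  proof (rule integral_mono)
    show "integrable vol (grad_norm_sq A g \<phi>)" by (rule integrable_vol[OF continuous_on_grad_norm_sq[OF \<phi>s]])
    show "integrable vol (\<lambda>p. (600 / s)\<^sup>2 * ?ind p)"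
      using integrable_slab[OF cf continuous_on_const[of M "(600 / s)\<^sup>2"], of t s] by (simp add: mult.commute)
    fix p assume "p \<in> space vol"
    then have p: "p \<in> M" by simp
    obtain d where d: "(\<psi> has_real_derivative d) (at (f p))" "\<bar>d\<bar> \<le> 600 / s" "\<bar>f p - t\<bar> \<ge> s \<Longrightarrow> d = 0"
      using smooth_bump_deriv[OF s, of t "f p"] unfolding \<psi>_def by metis
    have "gbound \<phi> (\<bar>d\<bar> * 1 + 0) p" unfolding \<phi>_def
      by (rule gbound_add[OF smooth_function_compose[OF f(1) \<psi>s] smooth_function_const p
            gbound_compose[OF f(1) p d(1) f(2)[OF p]] gbound_const[OF p]])
    then have "grad_norm_sq A g \<phi> p \<le> \<bar>d\<bar>\<^sup>2" using gbound_grad_norm_sq(3)[OF \<phi>s p, of "\<bar>d\<bar>"] by simp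
    also have "\<dots> \<le> (600 / s)\<^sup>2 * ?ind p"
    proof (cases "p \<in> slab f t s")
      case True
      then show ?thesis using power_mono[OF d(2), of 2] by simp
    next
      case False
      then show ?thesis using d(3) p by (simp add: slab_def)
    qed
    finally show "grad_norm_sq A g \<phi> p \<le> (600 / s)\<^sup>2 * ?ind p" .
  qed
  also have "\<dots> = (600 / s)\<^sup>2 * ?V s" using slab_measure[OF cf] by simp
  finally have G: "(\<integral>p. grad_norm_sq A g \<phi> p \<partial>vol) \<le> (600 / s)\<^sup>2 * ?V s" .
  have "(\<integral>p. R p * (\<phi> p)\<^sup>2 \<partial>vol) \<le> (\<integral>p. ?ind p * R p + 3 * \<epsilon> * R p \<partial>vol)"
  proof (rule integral_mono)
    show "integrable vol (\<lambda>p. R p * (\<phi> p)\<^sup>2)"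
      by (intro integrable_vol continuous_intros continuous_on_R smooth_function_continuous[OF \<phi>s])
    show "integrable vol (\<lambda>p. ?ind p * R p + 3 * \<epsilon> * R p)"
      by (intro Bochner_Integration.integrable_add integrable_slab[OF cf continuous_on_R]
          integrable_mult_right integrable_vol continuous_on_R)
    fix p assume "p \<in> space vol"
    then have p: "p \<in> M" by simp
    have b0: "\<psi> (f p) = 0" if "p \<notin> slab f t s"
      using that p s unfolding \<psi>_def slab_def by (intro smooth_bump_0) auto
    have "(\<psi> (f p))\<^sup>2 \<le> ?ind p"
      using b0 \<psi>r[of "f p"] power_le_one[of "\<psi> (f p)" 2] by (cases "p \<in> slab f t s") auto
    moreover have "2 * \<epsilon> * \<psi> (f p) \<le> 2 * \<epsilon> * 1" using \<psi>r[of "f p"] \<epsilon> by (intro mult_left_mono) auto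
    moreover have "\<epsilon>\<^sup>2 \<le> \<epsilon>" using \<epsilon> by (simp add: power2_eq_square mult_left_le)
    moreover have "(\<phi> p)\<^sup>2 = (\<psi> (f p))\<^sup>2 + 2 * \<epsilon> * \<psi> (f p) + \<epsilon>\<^sup>2" by (simp add: \<phi>_def power2_sum)
    ultimately have "(\<phi> p)\<^sup>2 \<le> ?ind p + 3 * \<epsilon>" by linarith
    then have "R p * (\<phi> p)\<^sup>2 \<le> R p * (?ind p + 3 * \<epsilon>)" using Rpos p by (intro mult_left_mono) (auto simp: less_imp_le)
    then show "R p * (\<phi> p)\<^sup>2 \<le> ?ind p * R p + 3 * \<epsilon> * R p" by (simp add: algebra_simps)
  qed
  also have "\<dots> = (\<integral>p. ?ind p * R p \<partial>vol) + 3 * \<epsilon> * IR"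
    unfolding IR_def
    by (subst Bochner_Integration.integral_add)
       (auto intro!: integrable_slab[OF cf continuous_on_R] integrable_mult_right integrable_vol continuous_on_R)
  finally have RI: "(\<integral>p. R p * (\<phi> p)\<^sup>2 \<partial>vol) \<le> (\<integral>p. ?ind p * R p \<partial>vol) + e" using \<epsilon>e by linarith
  define den where "den = (\<integral>p. \<phi> p powr (2 * n / (n - 2)) \<partial>vol)"
  have "measure vol (slab f t (s / 2)) = (\<integral>p. indicator (slab f t (s / 2)) p \<partial>vol)" using slab_measure[OF cf] by simp
  also have "\<dots> \<le> den" unfolding den_def
  proof (rule integral_mono)
    show "integrable vol (indicator (slab f t (s / 2)) :: 'a \<Rightarrow> real)"
      using integrable_slab[OF cf continuous_on_const[of M 1], of t "s / 2"] by simp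
    show "integrable vol (\<lambda>p. \<phi> p powr (2 * n / (n - 2)))"
      by (intro integrable_vol continuous_on_powr smooth_function_continuous[OF \<phi>s] continuous_on_const)
        (use \<phi>pos less_imp_neq in \<open>metis\<close>)
    fix p assume "p \<in> space vol"
    show "indicator (slab f t (s / 2)) p \<le> \<phi> p powr (2 * n / (n - 2))"
    proof (cases "p \<in> slab f t (s / 2)")
      case True
      then have "\<psi> (f p) = 1" unfolding \<psi>_def slab_def using s by (intro smooth_bump_1) auto
      then show ?thesis using True \<epsilon> n by (auto simp: \<phi>_def intro!: ge_one_powr_ge_zero)
    qed simp
  qed
  finally have Vd: "?V (s / 2) \<le> den" .
  define q where "q = (n - 2) / n"
  have q: "q > 0" using n by (simp add: q_def)
  have Vq: "?V (s / 2) powr q \<le> den powr q" using Vd q by (intro powr_mono2) auto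
  define num where "num = a * (\<integral>p. grad_norm_sq A g \<phi> p \<partial>vol) + (\<integral>p. R p * (\<phi> p)\<^sup>2 \<partial>vol)"
  have num: "num \<le> a * ((600 / s)\<^sup>2 * ?V s) + ((\<integral>p. ?ind p * R p \<partial>vol) + e)"
    unfolding num_def by (intro add_mono mult_left_mono G RI a)
  have num0: "num \<ge> 0" unfolding num_def
    using gbound_grad_norm_sq(1)[OF \<phi>s] Rpos
    by (intro add_nonneg_nonneg mult_nonneg_nonneg a integral_vol_nonneg) (auto simp: less_imp_le)
  have Yq: "yamabe_constant M A g \<le> num / den powr q"
    using yamabe_constant_le[OF Rpos n3 \<phi>s \<phi>pos]
    by (simp add: yamabe_quotient_def Let_def num_def den_def q_def a_def n_def)
  have "yamabe_constant M A g * ?V (s / 2) powr q \<le> num"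
  \<comment> \<open>A quotient with denominator 0 has the value 0, so multiplying out requires this
    case to be treated apart.\<close>
  proof (cases "den powr q = 0")
    case True
    then have "?V (s / 2) powr q = 0" using Vq powr_ge_zero by (metis order_antisym)
    then show ?thesis using num0 by simp
  next
    case False
    then have "den powr q > 0" using powr_ge_zero[of den q] by linarith
    then have "yamabe_constant M A g * den powr q \<le> num" using Yq by (simp add: pos_le_divide_eq)
    moreover have "yamabe_constant M A g * ?V (s / 2) powr q \<le> yamabe_constant M A g * den powr q"
      using Vq Y by (intro mult_left_mono) auto
    ultimately show ?thesis by linarith
  qed
  also note num
  also have "a * ((600 / s)\<^sup>2 * ?V s) = (a * 600\<^sup>2) / s\<^sup>2 * ?V s" by (simp add: power_divide)
  finally show "yamabe_constant M A g * measure vol (slab f t (s / 2)) powr ((real CARD('n) - 2) / CARD('n))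
    \<le> (4 * (real CARD('n) - 1) / (real CARD('n) - 2) * 600\<^sup>2) / s\<^sup>2 * ?V s + (\<integral>p. ?ind p * R p \<partial>vol) + e"
    by (simp add: q_def a_def n_def)
qed

text \<open>Young's inequality with exponent P = (n-1)/2, applied pointwise to R s^2 and divided by
  s^2; the scaling produces the weight s^(2P-2) = s^(n-3).\<close>

lemma slab_holder:
  assumes Rpos: "\<forall>p\<in>M. R p > 0" and n3: "CARD('n) \<ge> 3" and cf: "continuous_on M f" and s: "s > 0"
  shows "(\<integral>p. indicator (slab f t s) p * R p \<partial>vol) \<le>
    (2 / (real CARD('n) - 1)) * s ^ (CARD('n) - 3) * (\<integral>p. indicator (slab f t s) p * R p powr ((real CARD('n) - 1) / 2) \<partial>vol)
    + (1 - 2 / (real CARD('n) - 1)) * (measure vol (slab f t s) / s\<^sup>2)"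
proof -
  define P where "P = (real CARD('n) - 1) / 2"
  have P: "P \<ge> 1" "2 / (real CARD('n) - 1) = 1 / P" using n3 by (auto simp: P_def)
  have cR: "continuous_on M (\<lambda>p. R p powr P)"
    using Rpos by (intro continuous_on_powr continuous_on_R continuous_on_const) (metis less_irrefl)
  have pt: "indicator (slab f t s) p * R p \<le>
      (1 / P * s ^ (CARD('n) - 3)) * (indicator (slab f t s) p * R p powr P) + ((1 - 1 / P) / s\<^sup>2) * indicator (slab f t s) p"
    if p: "p \<in> M" for p
  proof -
    have "R p * s\<^sup>2 \<le> (R p * s\<^sup>2) powr P / P + (1 - 1 / P)" by (rule young_one) (use Rpos p s P in auto)
    also have "(R p * s\<^sup>2) powr P = R p powr P * s powr (2 * P)"
      using Rpos p s by (simp add: powr_mult less_imp_le powr_powr powr_numeral[symmetric] del: powr_numeral)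
    also have "2 * P = real (CARD('n) - 1)" using n3 by (simp add: P_def of_nat_diff)
    also have "s powr real (CARD('n) - 1) = s ^ (CARD('n) - 3) * s\<^sup>2"
    proof -
      have "CARD('n) - 1 = (CARD('n) - 3) + 2" using n3 by simp
      then show ?thesis using s by (simp only: powr_realpow power_add)
    qed
    also have "R p powr P * (s ^ (CARD('n) - 3) * s\<^sup>2) / P + (1 - 1 / P) =
        (1 / P * s ^ (CARD('n) - 3) * R p powr P + ((1 - 1 / P) / s\<^sup>2)) * s\<^sup>2"
      using s by (simp add: distrib_right)
    finally have "R p \<le> 1 / P * s ^ (CARD('n) - 3) * R p powr P + ((1 - 1 / P) / s\<^sup>2)"
      by (rule mult_right_le_imp_le) (use s in simp)
    then show ?thesis by (cases "p \<in> slab f t s") auto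
  qed
  have i1: "integrable vol (\<lambda>p. (1 / P * s ^ (CARD('n) - 3)) * (indicator (slab f t s) p * R p powr P))"
    by (intro integrable_mult_right integrable_slab[OF cf cR])
  have i2: "integrable vol (\<lambda>p. ((1 - 1 / P) / s\<^sup>2) * indicator (slab f t s) p)"
    using integrable_slab[OF cf continuous_on_const[of M "(1 - 1 / P) / s\<^sup>2"], of t s] by (simp add: mult.commute)
  have "(\<integral>p. indicator (slab f t s) p * R p \<partial>vol) \<le> (\<integral>p. (1 / P * s ^ (CARD('n) - 3)) * (indicator (slab f t s) p * R p powr P) + ((1 - 1 / P) / s\<^sup>2) * indicator (slab f t s) p \<partial>vol)"
    by (rule integral_mono[OF integrable_slab[OF cf continuous_on_R] Bochner_Integration.integrable_add[OF i1 i2] pt]) simp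
  also have "\<dots> = (1 / P * s ^ (CARD('n) - 3)) * (\<integral>p. indicator (slab f t s) p * R p powr P \<partial>vol) + ((1 - 1 / P) / s\<^sup>2) * measure vol (slab f t s)"
    using slab_measure[OF cf, of t s] by (subst Bochner_Integration.integral_add[OF i1 i2]) simp
  finally show ?thesis unfolding P(2) P_def[symmetric] by simp
qed

text \<open>In a chart around z the function f is Lipschitz with constant b. So the slab contains
  the coordinate ball of radius s / b, on which the volume density is at least m.\<close>

lemma slab_lower:
  assumes f: "smooth_function A f" and gb: "\<And>p. p \<in> M \<Longrightarrow> gbound f 1 p" and z: "z \<in> M"
  obtains c s0 where "c > 0" "s0 > 0" "\<And>s. 0 < s \<Longrightarrow> s < s0 \<Longrightarrow> c * s ^ CARD('n) \<le> measure vol (slab f (f z) s)"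
proof -
  define h where "h = cat z"
  define a where "a = chart_map h z"
  have h: "h \<in> A" "z \<in> chart_dom h" using chart_at z by (auto simp: h_def)
  have za: "chart_inv h a = z" using chartD(5)[OF h] by (simp add: a_def)
  obtain r where r: "r > 0" "cball a r \<subseteq> chart_img h"
    using chartD(2)[OF h(1)] h(2) unfolding a_def by (metis image_eqI open_contains_cball)
  obtain b where b: "b > 0" "\<And>x v. x \<in> cball a r \<Longrightarrow> gnorm h x v \<le> b * norm v"
    by (rule gnorm_bound_compact[OF h(1) compact_cball r(2)]) blast
  have "continuous_on (cball a r) (vden h)" using continuous_vden[OF h(1)] r(2) by (rule continuous_on_subset)
  from continuous_attains_inf[OF compact_cball _ this]
  obtain y where y: "y \<in> cball a r" "\<And>x. x \<in> cball a r \<Longrightarrow> vden h y \<le> vden h x" using r(1) by fastforce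
  define m where "m = vden h y"
  have m: "m > 0" using vden_pos[OF h(1)] y(1) r(2) by (auto simp: m_def)
  let ?F = "f \<circ> chart_inv h"
  have lip: "\<bar>?F x - ?F a\<bar> \<le> b * norm (x - a)" if x: "x \<in> cball a r" for x
  proof -
    have "norm (?F x - ?F a) \<le> b * norm (x - a)"
    proof (rule differentiable_bound[of "cball a r" ?F "dchart f h"])
      fix w assume w: "w \<in> cball a r"
      then have wi: "w \<in> chart_img h" using r by blast
      show "(?F has_derivative dchart f h w) (at w within cball a r)"
        using smooth_functionD(2)[OF f h(1) wi] has_derivative_at_withinI by blast
      have p: "chart_inv h w \<in> chart_dom h" "chart_map h (chart_inv h w) = w" using chartD(6,7)[OF h(1) wi] by auto
      then have pM: "chart_inv h w \<in> M" using chartD(8)[OF h(1)] by blast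
      show "onorm (dchart f h w) \<le> b"
      proof (rule onorm_le)
        fix v
        have "\<bar>dchart f h w v\<bar> \<le> 1 * gnorm h w v"
          using gb[OF pM] unfolding gbound_chart[OF f h(1) p(1)] p(2) by blast
        then show "norm (dchart f h w v) \<le> b * norm v" using b(2)[OF w, of v] by simp
      qed
    qed (use x r(1) in auto)
    then show ?thesis by simp
  qed
  show thesis
  proof (rule that[of "m * measure lborel (ball (0::real^'n) 1) / b ^ CARD('n)" "b * r"])
    show "m * measure lborel (ball (0::real^'n) 1) / b ^ CARD('n) > 0" using m b(1) by simp
    show "b * r > 0" using b r by simp
    fix s assume s: "0 < s" "s < b * r"
    define u where "u = s / b"
    have u: "0 < u" "u < r" using s b(1) by (auto simp: u_def field_simps)
    have ub: "ball a u \<subseteq> cball a r" using u by auto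
    define B where "B = chart_inv h ` ball a u"
    have Bo: "openin (top_of_set M) B" unfolding B_def
      by (rule open_chart_image[OF h(1)]) (use ub r in auto)
    then have Bm: "B \<in> msets" by (rule openin_msets)
    have Bd: "B \<subseteq> chart_dom h" unfolding B_def using ub r(2) chartD(6)[OF h(1)] by blast
    have hB: "chart_map h ` B = ball a u"
      unfolding B_def image_image using ub r(2) chartD(7)[OF h(1)] by (force simp: image_iff)
    have "B \<subseteq> slab f (f z) s"
    proof
      fix p assume "p \<in> B"
      then obtain x where x: "x \<in> ball a u" "p = chart_inv h x" by (auto simp: B_def)
      have xc: "x \<in> cball a r" using x(1) ub by blast
      have "b * norm (x - a) < b * u" using x(1) b(1) by (simp add: dist_norm norm_minus_commute)
      also have "\<dots> = s" using b(1) by (simp add: u_def)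
      finally have "\<bar>f p - f z\<bar> < s" using lip[OF xc] x(2) za by simp
      moreover have "p \<in> M" using \<open>p \<in> B\<close> Bd chartD(8)[OF h(1)] by blast
      ultimately show "p \<in> slab f (f z) s" by (simp add: slab_def)
    qed
    then have mB: "measure vol B \<le> measure vol (slab f (f z) s)"
      using slab_msets[OF smooth_function_continuous[OF f]] by (intro finite_measure_mono) auto
    have "ennreal (m * measure lborel (ball a u)) = (\<integral>\<^sup>+x\<in>ball a u. ennreal m \<partial>lborel)"
    proof -
      have "emeasure lborel (ball a u) = ennreal (measure lborel (ball a u))"
        by (rule emeasure_eq_ennreal_measure) (use emeasure_lborel_ball_finite[of a u] in simp)
      then show ?thesis using m by (simp add: nn_integral_cmult_indicator ennreal_mult less_imp_le)
    qed
    also have "\<dots> \<le> (\<integral>\<^sup>+x\<in>ball a u. ennreal (vden h x) \<partial>lborel)"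
      using ub y(2) by (intro nn_integral_mono) (auto simp: indicator_def m_def intro!: ennreal_leI)
    also have "\<dots> = emeasure vol B"
      using riemannian_volume h(1) Bm Bd hB unfolding is_riemannian_volume_def by auto
    finally have "m * measure lborel (ball a u) \<le> measure vol B" by (simp add: emeasure_eq_measure)
    moreover have "measure lborel (ball a u) = u ^ CARD('n) * measure lborel (ball (0::real^'n) 1)"
      using content_ball_conv_unit_ball[of u a] u by simp
    ultimately have "m * measure lborel (ball (0::real^'n) 1) / b ^ CARD('n) * s ^ CARD('n) \<le> measure vol B"
      by (simp add: u_def power_divide mult_ac)
    then show "m * measure lborel (ball (0::real^'n) 1) / b ^ CARD('n) * s ^ CARD('n) \<le> measure vol (slab f (f z) s)"
      using mB by linarith
  qed
qed

text \<open>The covering lemma is applied to the push-forward \<nu> of R^((n-1)/2) dv under f, for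
  which the measure of an interval is an integral over a slab; \<open>critical_scale\<close>
  supplies the intervals.\<close>

lemma oscillation_bound:
  assumes Rpos: "\<forall>p\<in>M. R p > 0" and n3: "CARD('n) \<ge> 3" and f: "smooth_function A f" "\<And>p. p \<in> M \<Longrightarrow> gbound f 1 p"
    and Y: "yamabe_constant M A g > 0" and conn: "connected M" and xy: "x \<in> M" "y \<in> M" "f x \<le> f y"
    and Q: "Q = 4 * (real CARD('n) - 1) / (real CARD('n) - 2) * 600\<^sup>2"
    and \<delta>: "\<delta> = (yamabe_constant M A g / (2 ^ CARD('n) * Q)) powr (CARD('n) / 2)"
  shows "f y - f x \<le> 10 * (\<integral>p. R p powr ((real CARD('n) - 1) / 2) \<partial>vol) / \<delta>"
proof -
  define P where "P = (real CARD('n) - 1) / 2"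
  define I where "I = (\<integral>p. R p powr P \<partial>vol)"
  note cf = smooth_function_continuous[OF f(1)]
  have cR: "continuous_on M (\<lambda>p. R p powr P)"
    using Rpos by (intro continuous_on_powr continuous_on_R continuous_on_const) (metis less_irrefl)
  have Q1: "Q \<ge> 1" unfolding Q using n3 by (simp add: field_simps)
  obtain R0 R1 where R1: "\<And>p. p \<in> M \<Longrightarrow> R p \<le> R1" using R_bounds[OF Rpos] by metis
  define \<nu> where "\<nu> = distr (density vol (\<lambda>p. ennreal (R p powr P))) borel f"
  have m1: "(\<lambda>p. ennreal (R p powr P)) \<in> borel_measurable vol"
    using measurable_vol[OF cR] by measurable
  have mf: "f \<in> borel_measurable (density vol (\<lambda>p. ennreal (R p powr P)))"
    using measurable_vol[OF cf] by simp
  have e\<nu>: "emeasure \<nu> B = ennreal (\<integral>p. indicator (f -` B \<inter> M) p * R p powr P \<partial>vol)"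
    if B: "B \<in> sets borel" for B
  proof -
    have fB: "f -` B \<inter> M \<in> sets vol" using measurable_sets[OF measurable_vol[OF cf] B] by simp
    have "emeasure \<nu> B = emeasure (density vol (\<lambda>p. ennreal (R p powr P))) (f -` B \<inter> M)"
      unfolding \<nu>_def using emeasure_distr[OF mf B] by simp
    also have "\<dots> = (\<integral>\<^sup>+p. ennreal (R p powr P) * indicator (f -` B \<inter> M) p \<partial>vol)"
      by (rule emeasure_density[OF m1 fB])
    also have "\<dots> = (\<integral>\<^sup>+p. ennreal (indicator (f -` B \<inter> M) p * R p powr P) \<partial>vol)"
      by (intro nn_integral_cong) (simp add: indicator_def)
    also have "\<dots> = ennreal (\<integral>p. indicator (f -` B \<inter> M) p * R p powr P \<partial>vol)"
      using integrable_mult_indicator[OF fB integrable_vol[OF cR]]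
      by (intro nn_integral_eq_integral) auto
    finally show ?thesis .
  qed
  have m\<nu>: "measure \<nu> B = (\<integral>p. indicator (f -` B \<inter> M) p * R p powr P \<partial>vol)" if "B \<in> sets borel" for B
    using e\<nu>[OF that] by (simp add: measure_def integral_vol_nonneg)
  have "f y - f x \<le> 10 * I / \<delta>"
  proof (rule finite_interval_covering[of \<nu>])
    have "space \<nu> = UNIV" by (simp add: \<nu>_def)
    then show "finite_measure \<nu>" using e\<nu>[of UNIV] by (intro finite_measureI) simp
    show "sets \<nu> = sets borel" by (simp add: \<nu>_def)
    have "measure \<nu> UNIV = I" unfolding I_def m\<nu>[of UNIV, simplified]
      by (rule Bochner_Integration.integral_cong) (auto simp: indicator_def)
    then show "measure \<nu> UNIV \<le> I" by simp
    show "\<delta> > 0" unfolding \<delta> using Y Q1 by simp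
    show "f x \<le> f y" by (rule xy(3))
    fix t assume t: "t \<in> {f x..f y}"
    \<comment> \<open>Connectedness makes every t in the interval a value of f, so that there is a
      point at the centre of the slab for \<open>slab_lower\<close>.\<close>
    have "connected (f ` M)" using connected_continuous_image[OF cf conn] .
    then have "t \<in> f ` M" using connectedD_interval[of "f ` M" "f x" "f y" t] xy t by auto
    then obtain z where z: "z \<in> M" "f z = t" by blast
    obtain c s0 where low: "c > 0" "s0 > 0" "\<And>s. 0 < s \<Longrightarrow> s < s0 \<Longrightarrow> c * s ^ CARD('n) \<le> measure vol (slab f t s)"
      using slab_lower[OF f z(1)] unfolding z(2) by metis
    have "\<exists>s>0. (\<integral>p. indicator (slab f t s) p * R p powr P \<partial>vol) \<ge> \<delta> * s"
    proof (rule critical_scale[OF n3 Y Q1 \<delta>, where c=c and ?s0.0=s0])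
      show "0 \<le> measure vol (slab f t s)" for s by simp
      show "measure vol (slab f t s) \<le> measure vol M" for s
        using bounded_measure[of "slab f t s"] by simp
      show "yamabe_constant M A g * measure vol (slab f t (s / 2)) powr ((real CARD('n) - 2) / real CARD('n)) \<le>
          Q / s\<^sup>2 * measure vol (slab f t s) + (\<integral>p. indicator (slab f t s) p * R p \<partial>vol)" if "s > 0" for s
        unfolding Q by (rule slab_yamabe[OF Rpos n3 f Y that])
      show "(\<integral>p. indicator (slab f t s) p * R p \<partial>vol) \<le> 2 / (real CARD('n) - 1) * s ^ (CARD('n) - 3) *
          (\<integral>p. indicator (slab f t s) p * R p powr P \<partial>vol) + (1 - 2 / (real CARD('n) - 1)) * (measure vol (slab f t s) / s\<^sup>2)"
        if "s > 0" for s
        unfolding P_def by (rule slab_holder[OF Rpos n3 cf that])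
      show "(\<integral>p. indicator (slab f t s) p * R p \<partial>vol) \<le> R1 * measure vol (slab f t s)" for s
      proof -
        have "(\<integral>p. indicator (slab f t s) p * R p \<partial>vol) \<le> (\<integral>p. indicator (slab f t s) p * R1 \<partial>vol)"
          by (intro integral_mono integrable_slab[OF cf] continuous_on_R continuous_on_const mult_left_mono) (auto simp: R1)
        then show ?thesis using slab_measure[OF cf, of t s] by (simp add: mult.commute)
      qed
    qed (use low in auto)
    moreover have "f -` {t - s<..<t + s} \<inter> M = slab f t s" for s by (auto simp: slab_def)
    ultimately show "\<exists>s>0. \<delta> * s \<le> measure \<nu> {t - s<..<t + s}" by (simp add: m\<nu>)
  qed
  then show ?thesis by (simp add: I_def P_def)
qed

text \<open>The smooth function gains at least an eighth of the distance, while its oscillation is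
  at most 10 / \<delta> times the curvature integral; together this is 80 / \<delta>.\<close>

theorem diameter_bound:
  assumes Rpos: "\<forall>p\<in>M. R p > 0" and n3: "CARD('n) \<ge> 3"
    and Y: "yamabe_constant M A g > 0" and conn: "connected M"
  shows "riemannian_diameter M A g \<le>
    4 * ((2 * exp 1 / real CARD('n) * yamabe_constant M A g) powr (- real CARD('n) / 2) *
        exp ((17 * real CARD('n) - 18) / (real CARD('n) - 2) * 2 ^ CARD('n))) *
    (\<integral>p. R p powr ((real CARD('n) - 1) / 2) \<partial>vol)" (is "_ \<le> ?C * ?I")
proof -
  define Q where "Q = 4 * (real CARD('n) - 1) / (real CARD('n) - 2) * 600\<^sup>2"
  define \<delta> where "\<delta> = (yamabe_constant M A g / (2 ^ CARD('n) * Q)) powr (CARD('n) / 2)"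
  \<comment> \<open>For n >= 3 the ratio w is at most 2, so Q = 1440000 w <= 2880000 < 2^22.\<close>
  define w where "w = (real CARD('n) - 1) / (real CARD('n) - 2)"
  have "w \<le> 2" "w > 0" using n3 by (auto simp: w_def field_simps)
  moreover have "Q = 1440000 * w" by (simp add: Q_def w_def)
  ultimately have Q: "0 < Q" "Q \<le> 2 ^ 22" by simp_all
  have I: "?I \<ge> 0" by (rule integral_vol_nonneg) simp
  have "80 / \<delta> = 80 * (yamabe_constant M A g / (2 ^ CARD('n) * Q)) powr (- (CARD('n) / 2))"
    unfolding \<delta>_def powr_minus by (rule divide_inverse)
  then have inv\<delta>: "80 / \<delta> \<le> ?C"
    using constant_comparison[OF n3 Y Q] by (simp only:)
  have \<delta>0: "\<delta> > 0" unfolding \<delta>_def using Y Q by simp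
  have D: "geodesic_dist M A g x y \<le> ?C * ?I" if xy: "x \<in> M" "y \<in> M" for x y
  proof (cases "du x y > 0")
    case True
    obtain f where f: "smooth_function A f" "\<And>p. p \<in> M \<Longrightarrow> gbound f 1 p" "f y - f x \<ge> du x y / 8"
      by (rule smooth_distance[OF conn xy True]) blast
    then have "f x \<le> f y" using True by simp
    from oscillation_bound[OF Rpos n3 f(1,2) Y conn xy this Q_def \<delta>_def]
    have "du x y \<le> 80 / \<delta> * ?I" using f(3) by simp
    also have "\<dots> \<le> ?C * ?I" by (rule mult_right_mono[OF inv\<delta> I])
    finally show ?thesis using geodesic_dist_le_du[OF conn xy(1,2)] by linarith
  next
    case False
    have "0 \<le> ?C * ?I" using I by (intro mult_nonneg_nonneg) auto
    then show ?thesis using geodesic_dist_le_du[OF conn xy(1,2)] False by linarith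
  qed
  show ?thesis unfolding riemannian_diameter_def
  proof (rule cSup_least)
    show "{geodesic_dist M A g x y |x y. x \<in> M \<and> y \<in> M} \<noteq> {}" using M_nonempty by blast
  qed (use D in blast)
qed

end

section \<open>The Euclidean Sobolev inequality\<close>

text \<open>Powers with exponents \<open>\<ge> 0\<close> of extended nonnegative reals; unlike for \<open>powr\<close>, \<open>epow 0 0 = 1\<close>.\<close>

definition epow :: "ennreal \<Rightarrow> real \<Rightarrow> ennreal" where
  "epow x p = (if p = 0 then 1 else if x = \<infinity> then \<infinity> else ennreal (enn2real x powr p))"

lemma epow_0 [simp]: "epow x 0 = 1" by (simp add: epow_def)

lemma epow_ennreal: "p > 0 \<Longrightarrow> a \<ge> 0 \<Longrightarrow> epow (ennreal a) p = ennreal (a powr p)"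
  by (simp add: epow_def)

lemma epow_zero: "p > 0 \<Longrightarrow> epow 0 p = 0" by (simp add: epow_def)



lemma epow_add: "a \<ge> 0 \<Longrightarrow> b \<ge> 0 \<Longrightarrow> epow x (a + b) = epow x a * epow x b"
  by (cases x) (auto simp: epow_def powr_add ennreal_mult ennreal_mult_top)

lemma epow_ne_0: "x \<noteq> 0 \<Longrightarrow> epow x p \<noteq> 0"
  by (cases x) (auto simp: epow_def)

lemma epow_mult:
  assumes "a > 0" "p \<ge> 0"
  shows "epow (ennreal a * y) p = epow (ennreal a) p * epow y p"
proof (cases y)
  case (real r)
  then show ?thesis using assms by (cases "p = 0") (auto simp: epow_ennreal powr_mult ennreal_mult[symmetric])
next
  case top
  then show ?thesis using assms by (cases "p = 0") (auto simp: epow_def ennreal_mult_top)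
qed

lemma epow_mono: "x \<le> y \<Longrightarrow> p \<ge> 0 \<Longrightarrow> epow x p \<le> epow y p"
proof (cases "y = \<infinity> \<or> p = 0")
  case False
  assume "x \<le> y" "p \<ge> 0"
  then obtain a b where "x = ennreal a" "y = ennreal b" "0 \<le> a" "a \<le> b"
    using False by (cases x; cases y) (auto simp: top_unique)
  then show ?thesis using False \<open>p \<ge> 0\<close> by (auto simp: epow_ennreal intro!: ennreal_leI powr_mono2)
qed (auto simp: epow_def)

lemma measurable_epow [measurable]:
  assumes [measurable]: "f \<in> borel_measurable M"
  shows "(\<lambda>x. epow (f x) p) \<in> borel_measurable M"
  unfolding epow_def by measurable

text \<open>Weighted AM-GM by convexity of exp, after factors with exponent 0 are dropped and the
  values 0 and \<infinity> are treated separately.\<close>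

lemma epow_amgm:
  assumes I: "finite I" and p: "\<And>i. i \<in> I \<Longrightarrow> p i \<ge> 0" "sum p I = 1"
  shows "(\<Prod>i\<in>I. epow (x i) (p i)) \<le> (\<Sum>i\<in>I. ennreal (p i) * x i)"
proof -
  define J where "J = {i \<in> I. p i > 0}"
  have J: "finite J" "J \<subseteq> I" using I by (auto simp: J_def)
  have z: "p i = 0" if "i \<in> I - J" for i using p(1)[of i] that by (auto simp: J_def)
  have pJ: "sum p J = 1" using p(2) sum.mono_neutral_right[OF I J(2), of p] z by simp
  have L: "(\<Prod>i\<in>I. epow (x i) (p i)) = (\<Prod>i\<in>J. epow (x i) (p i))"
    by (rule prod.mono_neutral_right[OF I J(2)]) (simp add: z)
  have Rr: "(\<Sum>i\<in>I. ennreal (p i) * x i) = (\<Sum>i\<in>J. ennreal (p i) * x i)"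
    by (rule sum.mono_neutral_right[OF I J(2)]) (simp add: z)
  consider i where "i \<in> J" "x i = \<infinity>" | i where "i \<in> J" "x i = 0" | "\<forall>i\<in>J. x i \<noteq> \<infinity> \<and> x i \<noteq> 0" by blast
  then show ?thesis
  proof cases
    case 1
    then have "ennreal (p i) * x i = \<infinity>" by (simp add: J_def ennreal_mult_top)
    moreover have "ennreal (p i) * x i \<le> (\<Sum>i\<in>J. ennreal (p i) * x i)"
      by (rule member_le_sum[OF 1(1)]) (use J in auto)
    ultimately show ?thesis unfolding L Rr by (simp add: top_unique)
  next
    case 2
    then have "epow (x i) (p i) = 0" by (simp add: J_def epow_zero)
    then have "(\<Prod>i\<in>J. epow (x i) (p i)) = 0" using 2(1) J(1) by auto
    then show ?thesis unfolding L by (simp only: zero_le)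
  next
    case 3
    define a where "a i = enn2real (x i)" for i
    have a: "x i = ennreal (a i)" "a i > 0" if "i \<in> J" for i
      using 3 that by (auto simp: a_def enn2real_positive_iff less_top[symmetric] zero_less_iff_neq_zero)
    have "J \<noteq> {}" using pJ by auto
    then have "exp (\<Sum>i\<in>J. p i *\<^sub>R ln (a i)) \<le> (\<Sum>i\<in>J. p i * exp (ln (a i)))"
      using J pJ by (intro convex_on_sum[OF _ _ exp_convex]) (auto simp: J_def)
    also have "exp (\<Sum>i\<in>J. p i *\<^sub>R ln (a i)) = (\<Prod>i\<in>J. a i powr p i)"
      unfolding exp_sum[OF J(1)]
    proof (intro prod.cong refl)
      fix i assume "i \<in> J"
      then show "exp (p i *\<^sub>R ln (a i)) = a i powr p i" using a(2)[of i] by (simp add: powr_def)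
    qed
    also have "(\<Sum>i\<in>J. p i * exp (ln (a i))) = (\<Sum>i\<in>J. p i * a i)"
    proof (intro sum.cong refl)
      fix i assume "i \<in> J"
      then show "p i * exp (ln (a i)) = p i * a i" using a(2)[of i] by simp
    qed
    finally have "ennreal (\<Prod>i\<in>J. a i powr p i) \<le> ennreal (\<Sum>i\<in>J. p i * a i)" by (rule ennreal_leI)
    moreover have "ennreal (\<Prod>i\<in>J. a i powr p i) = (\<Prod>i\<in>J. epow (x i) (p i))"
      using a by (subst prod_ennreal[symmetric]) (auto intro!: prod.cong simp: J_def epow_ennreal less_imp_le)
    moreover have "ennreal (\<Sum>i\<in>J. p i * a i) = (\<Sum>i\<in>J. ennreal (p i) * x i)"
      using a by (subst sum_ennreal[symmetric]) (auto intro!: sum.cong mult_nonneg_nonneg simp: J_def ennreal_mult less_imp_le)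
    ultimately show ?thesis unfolding L Rr by simp
  qed
qed

text \<open>AM-GM for the functions normalized to integral 1. Among the indices with positive
  exponent, an integral 0 makes the product vanish almost everywhere; if there is none, an infinite
  integral makes the right side infinite.\<close>

lemma nn_integral_holder:
  assumes I: "finite I" and p: "\<And>i. i \<in> I \<Longrightarrow> p i \<ge> 0" "sum p I = 1"
    and f: "\<And>i. i \<in> I \<Longrightarrow> f i \<in> borel_measurable M"
  shows "(\<integral>\<^sup>+x. (\<Prod>i\<in>I. epow (f i x) (p i)) \<partial>M) \<le> (\<Prod>i\<in>I. epow (\<integral>\<^sup>+x. f i x \<partial>M) (p i))"
proof -
  define N where "N i = (\<integral>\<^sup>+x. f i x \<partial>M)" for i
  consider i where "i \<in> I" "p i > 0" "N i = 0"
    | i where "i \<in> I" "p i > 0" "N i = \<infinity>" "\<forall>i\<in>I. p i > 0 \<longrightarrow> N i \<noteq> 0"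
    | "\<forall>i\<in>I. p i > 0 \<longrightarrow> N i \<noteq> 0 \<and> N i \<noteq> \<infinity>" by blast
  then show ?thesis
  proof cases
    case 1
    then have "AE x in M. f i x = 0" using f[OF 1(1)] by (simp add: N_def nn_integral_0_iff_AE)
    then have "AE x in M. (\<Prod>i\<in>I. epow (f i x) (p i)) = 0"
    proof eventually_elim
      case (elim x)
      then have "epow (f i x) (p i) = 0" using 1(2) by (simp add: epow_zero)
      then show ?case using 1(1) I by auto
    qed
    then have "(\<integral>\<^sup>+x. (\<Prod>i\<in>I. epow (f i x) (p i)) \<partial>M) = (\<integral>\<^sup>+x. 0 \<partial>M)" by (rule nn_integral_cong_AE)
    then show ?thesis by simp
  next
    case 2
    have "(\<Prod>j\<in>I - {i}. epow (N j) (p j)) \<noteq> 0"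
    proof
      assume "(\<Prod>j\<in>I - {i}. epow (N j) (p j)) = 0"
      then obtain j where "j \<in> I" "epow (N j) (p j) = 0" using I by auto
      then show False using 2(4) p(1)[of j] epow_ne_0[of "N j" "p j"] by (cases "p j = 0") auto
    qed
    then have "(\<Prod>j\<in>I. epow (N j) (p j)) = \<infinity>"
      using 2(1-3) I by (simp add: prod.remove[OF I 2(1)] epow_def ennreal_top_mult)
    then show ?thesis by (simp add: N_def)
  next
    case 3
    \<comment> \<open>For exponent 0 the factor is 1 whatever c is; the value 1 keeps c
      positive.\<close>
    define c where "c i = (if p i > 0 then enn2real (N i) else 1)" for i
    have c: "c i > 0" if "i \<in> I" for i
      using 3 that by (auto simp: c_def enn2real_positive_iff less_top[symmetric] zero_less_iff_neq_zero)
    have cN: "N i = ennreal (c i)" if "i \<in> I" "p i > 0" for i using 3 that by (auto simp: c_def less_top[symmetric])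
    define K where "K = (\<Prod>i\<in>I. epow (ennreal (c i)) (p i))"
    have sc: "(\<Prod>i\<in>I. epow (f i x) (p i)) = K * (\<Prod>i\<in>I. epow (ennreal (1 / c i) * f i x) (p i))" for x
      unfolding K_def prod.distrib[symmetric]
    proof (intro prod.cong refl)
      fix i assume i: "i \<in> I"
      have "ennreal (c i) * (ennreal (1 / c i) * f i x) = f i x"
        using c[OF i] by (simp add: mult.assoc[symmetric] ennreal_mult[symmetric])
      then show "epow (f i x) (p i) = epow (ennreal (c i)) (p i) * epow (ennreal (1 / c i) * f i x) (p i)"
        using epow_mult[OF c[OF i] p(1)[OF i], of "ennreal (1 / c i) * f i x"] by simp
    qed
    have "(\<integral>\<^sup>+x. (\<Prod>i\<in>I. epow (f i x) (p i)) \<partial>M) \<le> (\<integral>\<^sup>+x. K * (\<Sum>i\<in>I. ennreal (p i) * (ennreal (1 / c i) * f i x)) \<partial>M)"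
      unfolding sc by (intro nn_integral_mono mult_left_mono epow_amgm I p) auto
    also have "\<dots> = K * (\<Sum>i\<in>I. ennreal (p i) * (ennreal (1 / c i) * N i))"
      using f by (simp add: nn_integral_cmult nn_integral_sum N_def)
    also have "(\<Sum>i\<in>I. ennreal (p i) * (ennreal (1 / c i) * N i)) = (\<Sum>i\<in>I. ennreal (p i))"
    proof (intro sum.cong refl)
      fix i assume i: "i \<in> I"
      show "ennreal (p i) * (ennreal (1 / c i) * N i) = ennreal (p i)"
        using cN[OF i] c[OF i] p(1)[OF i] by (cases "p i > 0") (auto simp: ennreal_mult[symmetric])
    qed
    also have "(\<Sum>i\<in>I. ennreal (p i)) = 1" using p by (simp add: sum_ennreal)
    also have "K * 1 = (\<Prod>i\<in>I. epow (N i) (p i))"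
    proof -
      have "epow (ennreal (c i)) (p i) = epow (N i) (p i)" if "i \<in> I" for i
        using cN[OF that] p(1)[OF that] by (cases "p i = 0") auto
      then show ?thesis unfolding K_def by simp
    qed
    finally show ?thesis by (simp add: N_def)
  qed
qed

section \<open>Integration along coordinate lines\<close>

interpretation PL: product_sigma_finite "\<lambda>_. lborel :: real measure"
  by standard

definition line_integral :: "'i \<Rightarrow> (('i \<Rightarrow> real) \<Rightarrow> ennreal) \<Rightarrow> ('i \<Rightarrow> real) \<Rightarrow> ennreal" where
  "line_integral i F x = (\<integral>\<^sup>+t. F (x(i := t)) \<partial>lborel)"

lemma measurable_upd:
  assumes "F \<in> borel_measurable (PiM (insert i I) (\<lambda>_. lborel :: real measure))"
  shows "(\<lambda>(x, t). F (x(i := t))) \<in> borel_measurable (PiM I (\<lambda>_. lborel) \<Otimes>\<^sub>M lborel)"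
proof -
  have "(\<lambda>z. (fst z)(i := snd z)) \<in> measurable (PiM I (\<lambda>_. lborel) \<Otimes>\<^sub>M lborel) (PiM (insert i I) (\<lambda>_. lborel :: real measure))"
    by (rule measurable_fun_upd[where J=I]) auto
  from measurable_compose[OF this assms] show ?thesis by (simp add: split_beta)
qed

lemma measurable_line_integral:
  assumes "F \<in> borel_measurable (PiM (insert i I) (\<lambda>_. lborel :: real measure))"
  shows "line_integral i F \<in> borel_measurable (PiM I (\<lambda>_. lborel))"
  unfolding line_integral_def[abs_def]
  using lborel.borel_measurable_nn_integral[OF measurable_upd[OF assms]] by simp

text \<open>The grid-lines inequality: integrating out one variable at a time, Hoelder's inequality
  turns each step into an instance with fewer variables.\<close>

lemma grid_lines:
  assumes "finite I" "p \<ge> 0" "(real (card I) - 1) * p \<le> 1"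
    and "F \<in> borel_measurable (PiM I (\<lambda>_. lborel :: real measure))"
  shows "(\<integral>\<^sup>+x. epow (F x) (1 - (real (card I) - 1) * p) * (\<Prod>i\<in>I. epow (line_integral i F x) p) \<partial>PiM I (\<lambda>_. lborel))
    \<le> epow (\<integral>\<^sup>+x. F x \<partial>PiM I (\<lambda>_. lborel)) (1 + p)"
  using assms(1,3,4)
proof (induction I arbitrary: F)
  case empty
  then show ?case by (simp add: PL.nn_integral_empty)
next
  case (insert j I)
  define n where "n = real (card I)"
  define e where "e = 1 - n * p"
  have card: "real (card (insert j I)) - 1 = n" using insert.hyps by (simp add: n_def)
  have e: "e \<ge> 0" using insert.prems(1) unfolding card by (simp add: e_def)
  note F = insert.prems(2)
  define F' where "F' = line_integral j F"
  have F': "F' \<in> borel_measurable (PiM I (\<lambda>_. lborel))" unfolding F'_def by (rule measurable_line_integral[OF F])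
  have Aline: "line_integral i F \<in> borel_measurable (PiM (insert j I) (\<lambda>_. lborel))" if "i \<in> insert j I" for i
    by (rule measurable_line_integral) (use F that in \<open>simp add: insert_absorb\<close>)
  let ?H = "\<lambda>x. epow (F x) e * (\<Prod>i\<in>insert j I. epow (line_integral i F x) p)"
  have H: "?H \<in> borel_measurable (PiM (insert j I) (\<lambda>_. lborel))"
    using Aline F insert.hyps by (intro borel_measurable_times_ennreal measurable_epow borel_measurable_prod_ennreal) auto
  have inner: "(\<integral>\<^sup>+t. ?H (x(j := t)) \<partial>lborel) \<le> epow (F' x) (1 - (n - 1) * p) * (\<Prod>i\<in>I. epow (line_integral i F' x) p)"
    if x: "x \<in> space (PiM I (\<lambda>_. lborel :: real measure))" for x
  proof -
    have Fx: "(\<lambda>t. F (x(j := t))) \<in> borel_measurable lborel"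
      using measurable_compose_Pair1[OF x measurable_upd[OF F]] by (simp add: fun_upd_def)
    have Ax: "(\<lambda>t. line_integral i F (x(j := t))) \<in> borel_measurable lborel" if "i \<in> I" for i
      using measurable_compose_Pair1[OF x measurable_upd[OF Aline]] that by (simp add: fun_upd_def)
    \<comment> \<open>The line integral in direction j is constant along that direction, so its
      factor leaves the integral over t.\<close>
    have jj: "line_integral j F (x(j := t)) = F' x" for t by (simp add: F'_def line_integral_def)
    \<comment> \<open>The remaining factors are indexed by options: \<open>None\<close> stands for F
      with exponent e, \<open>Some i\<close> for the line integral in direction i with exponent p.
      The exponents add up to e + n p = 1, as Hoelder's inequality needs.\<close>
    define h where "h k t = (case k of None \<Rightarrow> F (x(j := t)) | Some i \<Rightarrow> line_integral i F (x(j := t)))" for k t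
    define w where "w k = (case k of None \<Rightarrow> e | Some i \<Rightarrow> p)" for k :: "'a option"
    have hN: "h None = (\<lambda>t. F (x(j := t)))" "h (Some i) = (\<lambda>t. line_integral i F (x(j := t)))" for i
      by (simp_all add: h_def fun_eq_iff)
    let ?K = "insert None (Some ` I)"
    have pr: "(\<Prod>k\<in>?K. G k) = G None * (\<Prod>i\<in>I. G (Some i))" for G :: "'a option \<Rightarrow> ennreal"
      using insert.hyps(1) by (subst prod.insert) (auto simp: prod.reindex)
    have sm: "sum w ?K = 1"
      using insert.hyps(1) by (subst sum.insert) (auto simp: sum.reindex w_def e_def n_def)
    have "(\<integral>\<^sup>+t. ?H (x(j := t)) \<partial>lborel) = (\<integral>\<^sup>+t. epow (F' x) p * (\<Prod>k\<in>?K. epow (h k t) (w k)) \<partial>lborel)"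
      unfolding pr using insert.hyps by (simp add: jj h_def w_def mult_ac)
    also have "\<dots> = epow (F' x) p * (\<integral>\<^sup>+t. (\<Prod>k\<in>?K. epow (h k t) (w k)) \<partial>lborel)"
      using Fx Ax insert.hyps(1) by (intro nn_integral_cmult borel_measurable_prod_ennreal measurable_epow) (auto simp: h_def)
    also have "\<dots> \<le> epow (F' x) p * (\<Prod>k\<in>?K. epow (\<integral>\<^sup>+t. h k t \<partial>lborel) (w k))"
      by (intro mult_left_mono nn_integral_holder sm)
         (use insert.hyps(1) e assms(2) Fx Ax in \<open>auto simp: h_def w_def\<close>)
    also have "\<dots> = epow (F' x) (p + e) * (\<Prod>i\<in>I. epow (\<integral>\<^sup>+t. line_integral i F (x(j := t)) \<partial>lborel) p)"
      unfolding pr hN using e assms(2) by (simp add: w_def epow_add F'_def line_integral_def mult.assoc)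
    also have "(\<Prod>i\<in>I. epow (\<integral>\<^sup>+t. line_integral i F (x(j := t)) \<partial>lborel) p) = (\<Prod>i\<in>I. epow (line_integral i F' x) p)"
    proof (intro prod.cong refl arg_cong[where f="\<lambda>z. epow z p"])
      fix i assume i: "i \<in> I"
      then have ij: "i \<noteq> j" using insert.hyps(2) by blast
      have "(\<lambda>z. (x(j := fst z))(i := snd z)) \<in> measurable (lborel \<Otimes>\<^sub>M lborel) (PiM (insert j I) (\<lambda>_. lborel :: real measure))"
        by (rule measurable_fun_upd[where J="insert j I"], use i in blast,
            rule measurable_fun_upd[where J=I]) (use x in auto)
      from measurable_compose[OF this F]
      have m: "(\<lambda>(t, s). F ((x(j := t))(i := s))) \<in> borel_measurable (lborel \<Otimes>\<^sub>M lborel)" by (simp add: split_beta fun_upd_def)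
      have "(\<integral>\<^sup>+t. line_integral i F (x(j := t)) \<partial>lborel) = (\<integral>\<^sup>+s. \<integral>\<^sup>+t. F ((x(j := t))(i := s)) \<partial>lborel \<partial>lborel)"
        unfolding line_integral_def by (rule lborel_pair.Fubini'[OF m, symmetric])
      also have "\<dots> = line_integral i F' x"
        unfolding F'_def line_integral_def using ij by (simp add: fun_upd_twist)
      finally show "(\<integral>\<^sup>+t. line_integral i F (x(j := t)) \<partial>lborel) = line_integral i F' x" .
    qed
    \<comment> \<open>This is the exponent that the induction hypothesis, whose index set has n
      elements, gives to F'.\<close>
    also have "p + e = 1 - (n - 1) * p" by (simp add: e_def algebra_simps)
    finally show ?thesis .
  qed
  have "(\<integral>\<^sup>+x. ?H x \<partial>PiM (insert j I) (\<lambda>_. lborel)) = (\<integral>\<^sup>+x. \<integral>\<^sup>+t. ?H (x(j := t)) \<partial>lborel \<partial>PiM I (\<lambda>_. lborel))"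
    by (rule PL.product_nn_integral_insert[OF insert.hyps(1,2) H])
  also have "\<dots> \<le> (\<integral>\<^sup>+x. epow (F' x) (1 - (n - 1) * p) * (\<Prod>i\<in>I. epow (line_integral i F' x) p) \<partial>PiM I (\<lambda>_. lborel))"
    by (rule nn_integral_mono) (rule inner)
  also have "\<dots> \<le> epow (\<integral>\<^sup>+x. F' x \<partial>PiM I (\<lambda>_. lborel)) (1 + p)"
  proof (unfold n_def, rule insert.IH[OF _ F'])
    have "(n - 1) * p \<le> n * p" using assms(2) by (simp add: algebra_simps)
    then show "(real (card I) - 1) * p \<le> 1" using e unfolding e_def n_def by linarith
  qed
  also have "(\<integral>\<^sup>+x. F' x \<partial>PiM I (\<lambda>_. lborel)) = (\<integral>\<^sup>+x. F x \<partial>PiM (insert j I) (\<lambda>_. lborel))"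
    unfolding F'_def line_integral_def by (rule PL.product_nn_integral_insert[OF insert.hyps(1,2) F, symmetric])
  finally show ?case unfolding card e_def .
qed

section \<open>From coordinate lines to the Sobolev inequality\<close>

lemma lborel_vec: "lborel = distr (PiM UNIV (\<lambda>_. lborel :: real measure)) borel (\<lambda>x. (\<chi> i. x i) :: real^'n::finite)"
proof (rule lborel_eqI)
  have m: "(\<lambda>x. (\<chi> i. x i) :: real^'n) \<in> measurable (PiM UNIV (\<lambda>_. lborel :: real measure)) borel"
    by (rule borel_measurable_euclidean_space[THEN iffD2]) (auto simp: Basis_vec_def inner_axis)
  fix l u :: "real^'n" assume lu: "\<And>b. b \<in> Basis \<Longrightarrow> l \<bullet> b \<le> u \<bullet> b"
  have lu': "l $ i \<le> u $ i" for i using lu[of "axis i 1"] by (simp add: inner_axis axis_in_Basis_iff)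
  have "emeasure (distr (PiM UNIV (\<lambda>_. lborel :: real measure)) borel (\<lambda>x. (\<chi> i. x i) :: real^'n)) (box l u)
      = emeasure (PiM UNIV (\<lambda>_. lborel :: real measure)) (Pi\<^sub>E UNIV (\<lambda>i. {l $ i<..<u $ i}))"
    by (subst emeasure_distr[OF m]) (auto simp: mem_box_cart space_PiM PiE_iff intro!: arg_cong2[where f=emeasure])
  also have "\<dots> = (\<Prod>i\<in>UNIV. emeasure lborel {l $ i<..<u $ i})"
    by (rule PL.emeasure_PiM) auto
  also have "\<dots> = ennreal (\<Prod>b\<in>Basis. (u - l) \<bullet> b)"
    unfolding prod_Basis_vec using lu' by (simp add: prod_ennreal)
  finally show "emeasure (distr (PiM UNIV (\<lambda>_. lborel :: real measure)) borel (\<lambda>x. (\<chi> i. x i) :: real^'n)) (box l u)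
     = ennreal (\<Prod>b\<in>Basis. (u - l) \<bullet> b)" .
qed simp

lemma abs_integral_le_nn:
  fixes f :: "real \<Rightarrow> real"
  assumes "a \<le> b" "continuous_on {a..b} f'" "\<And>t. t \<in> {a..b} \<Longrightarrow> (f has_real_derivative f' t) (at t)"
  shows "ennreal \<bar>f b - f a\<bar> \<le> (\<integral>\<^sup>+t\<in>{a..b}. ennreal \<bar>f' t\<bar> \<partial>lborel)"
proof -
  have i1: "(f' has_integral (f b - f a)) {a..b}"
    by (rule fundamental_theorem_of_calculus[OF assms(1)])
       (use assms(3) in \<open>auto simp: has_real_derivative_iff_has_vector_derivative intro: has_vector_derivative_at_within\<close>)
  have i2: "((\<lambda>t. \<bar>f' t\<bar>) has_integral integral {a..b} (\<lambda>t. \<bar>f' t\<bar>)) {a..b}"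
    by (intro integrable_integral integrable_continuous_real continuous_intros assms(2))
  have "\<bar>integral {a..b} f'\<bar> \<le> integral {a..b} (\<lambda>t. \<bar>f' t\<bar>)"
    using integral_norm_bound_integral[of f' "{a..b}" "\<lambda>t. \<bar>f' t\<bar>"] i1 i2 by auto
  then have "ennreal \<bar>f b - f a\<bar> \<le> ennreal (integral {a..b} (\<lambda>t. \<bar>f' t\<bar>))"
    using integral_unique[OF i1] by (intro ennreal_leI) simp
  also have "\<dots> = (\<integral>\<^sup>+t\<in>{a..b}. ennreal \<bar>f' t\<bar> \<partial>lborel)"
    by (rule nn_integral_has_integral_lebesgue'[OF _ i2, symmetric]) simp
  finally show ?thesis .
qed

definition grad_sum :: "(real^'n::finite \<Rightarrow> real) \<Rightarrow> real^'n \<Rightarrow> real" where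
  "grad_sum h x = (\<Sum>i\<in>UNIV. \<bar>frechet_derivative h (at x) (axis i 1)\<bar>)"

text \<open>As h vanishes far out, |h(x)| is at most the integral of \<open>grad_sum h\<close> along
  each coordinate line through x. The product of these n bounds to the power p = 1/(n-1) dominates
  |h|^(1+p) and is the integrand of \<open>grid_lines\<close> in the critical case (n-1) p =
  1.\<close>

lemma gagliardo_nirenberg:
  fixes h :: "real^'n::finite \<Rightarrow> real"
  assumes n: "CARD('n) \<ge> 2"
    and d: "\<And>x. h differentiable (at x)" and c: "\<And>v. continuous_on UNIV (\<lambda>x. frechet_derivative h (at x) v)"
    and supp: "\<And>x. norm x \<ge> L \<Longrightarrow> h x = 0"
  shows "(\<integral>\<^sup>+x. epow (ennreal \<bar>h x\<bar>) (CARD('n) / (real CARD('n) - 1)) \<partial>lborel)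
    \<le> epow (\<integral>\<^sup>+x. ennreal (grad_sum h x) \<partial>lborel) (CARD('n) / (real CARD('n) - 1))"
proof -
  define p where "p = 1 / (real CARD('n) - 1)"
  have p: "p > 0" "(real CARD('n) - 1) * p = 1" "CARD('n) / (real CARD('n) - 1) = 1 + p"
    using n by (auto simp: p_def field_simps)
  define G where "G x = ennreal (grad_sum h x)" for x
  have cg: "continuous_on UNIV (grad_sum h)" unfolding grad_sum_def[abs_def] by (intro continuous_intros c)
  then have "(\<lambda>x. grad_sum h x) \<in> borel_measurable borel" by (rule borel_measurable_continuous_onI)
  then have G[measurable]: "G \<in> borel_measurable borel"
    unfolding G_def[abs_def] by (rule measurable_compose) simp
  have ch: "continuous_on UNIV h" using d by (auto intro!: continuous_at_imp_continuous_on differentiable_imp_continuous_within)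
  then have h[measurable]: "h \<in> borel_measurable borel" by (rule borel_measurable_continuous_onI)
  define vec where "vec x = ((\<chi> i. x i) :: real^'n)" for x
  have vm[measurable]: "vec \<in> measurable (PiM UNIV (\<lambda>_. lborel :: real measure)) borel"
    unfolding vec_def
    by (rule borel_measurable_euclidean_space[THEN iffD2]) (auto simp: Basis_vec_def inner_axis)
  have lb: "lborel = distr (PiM UNIV (\<lambda>_. lborel :: real measure)) borel vec"
    unfolding vec_def by (rule lborel_vec)
  define F where "F x = G (vec x)" for x
  have F: "F \<in> borel_measurable (PiM UNIV (\<lambda>_. lborel :: real measure))" unfolding F_def by measurable
  have line: "ennreal \<bar>h (vec x)\<bar> \<le> line_integral i F x" for x i
  proof -
    define y where "y t = vec (x(i := t))" for t
    have yt: "y t = vec x + (t - x i) *\<^sub>R axis i 1" for t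
      by (auto simp: y_def vec_def vec_eq_iff axis_def)
    \<comment> \<open>A starting point on the line, not beyond x, whose distance from the origin is
      at least L.\<close>
    define a where "a = min (x i) (- \<bar>L\<bar>)"
    have ya: "h (y a) = 0"
    proof (rule supp)
      have "\<bar>y a $ i\<bar> \<le> norm (y a)" by (rule component_le_norm_cart)
      then show "L \<le> norm (y a)" by (auto simp: y_def vec_def a_def min_def split: if_splits)
    qed
    have "(y has_derivative (\<lambda>s. s *\<^sub>R axis i 1)) (at t)" for t
      unfolding yt[abs_def] by (auto intro!: derivative_eq_intros)
    from diff_chain_at[OF this has_frechet_derivative[OF d]]
    have "((\<lambda>t. h (y t)) has_derivative (\<lambda>s. frechet_derivative h (at (y t)) (s *\<^sub>R axis i 1))) (at t)" for t
      by (simp add: o_def)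
    then have der: "((\<lambda>t. h (y t)) has_real_derivative frechet_derivative h (at (y t)) (axis i 1)) (at t)" for t
      unfolding has_field_derivative_def
      by (rule has_derivative_eq_rhs)
         (simp add: linear_scale[OF has_derivative_linear[OF has_frechet_derivative[OF d]]] fun_eq_iff)
    have cy: "continuous_on {a..x i} (\<lambda>t. frechet_derivative h (at (y t)) (axis i 1))"
      by (rule continuous_on_compose2[OF c]) (auto simp: yt intro!: continuous_intros)
    have "ennreal \<bar>h (y (x i)) - h (y a)\<bar> \<le> (\<integral>\<^sup>+t\<in>{a..x i}. ennreal \<bar>frechet_derivative h (at (y t)) (axis i 1)\<bar> \<partial>lborel)"
      by (rule abs_integral_le_nn[OF _ cy der]) (simp add: a_def)
    also have "\<dots> \<le> (\<integral>\<^sup>+t. F (x(i := t)) \<partial>lborel)"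
    proof (rule nn_integral_mono)
      fix t
      have "\<bar>frechet_derivative h (at (y t)) (axis i 1)\<bar> \<le> grad_sum h (y t)"
        unfolding grad_sum_def by (rule member_le_sum[of i UNIV]) auto
      then show "ennreal \<bar>frechet_derivative h (at (y t)) (axis i 1)\<bar> * indicator {a..x i} t \<le> F (x(i := t))"
        by (auto simp: F_def G_def y_def[symmetric] indicator_def intro!: ennreal_leI)
    qed
    finally show ?thesis by (simp add: ya line_integral_def) (simp add: y_def)
  qed
  have "(\<integral>\<^sup>+x. epow (ennreal \<bar>h x\<bar>) (1 + p) \<partial>lborel) = (\<integral>\<^sup>+x. epow (ennreal \<bar>h (vec x)\<bar>) (1 + p) \<partial>PiM UNIV (\<lambda>_. lborel))"
    by (subst lb, subst nn_integral_distr) auto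
  also have "\<dots> \<le> (\<integral>\<^sup>+x. epow (F x) (1 - (real CARD('n) - 1) * p) * (\<Prod>i\<in>UNIV. epow (line_integral i F x) p) \<partial>PiM UNIV (\<lambda>_. lborel))"
  proof (rule nn_integral_mono)
    fix x
    have pw: "(\<Prod>i\<in>(UNIV :: 'n set). epow z p) = epow z (real CARD('n) * p)" for z
    proof -
      have "(\<Prod>i\<in>S. epow z p) = epow z (real (card S) * p)" if "finite S" for S :: "'n set"
        using that
      proof induction
        case (insert i S)
        have "real (card (insert i S)) * p = p + real (card S) * p" using insert.hyps by (simp add: algebra_simps)
        then show ?case using insert p(1) by (simp add: epow_add)
      qed simp
      then show ?thesis by simp
    qed
    have "epow (ennreal \<bar>h (vec x)\<bar>) (1 + p) = (\<Prod>i\<in>(UNIV :: 'n set). epow (ennreal \<bar>h (vec x)\<bar>) p)"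
      unfolding pw using p(2) by (simp add: algebra_simps)
    also have "\<dots> \<le> (\<Prod>i\<in>UNIV. epow (line_integral i F x) p)"
      using p(1) by (intro prod_mono_ennreal epow_mono line) auto
    finally show "epow (ennreal \<bar>h (vec x)\<bar>) (1 + p) \<le> epow (F x) (1 - (real CARD('n) - 1) * p) * (\<Prod>i\<in>UNIV. epow (line_integral i F x) p)"
      using p(2) by simp
  qed
  also have "\<dots> \<le> epow (\<integral>\<^sup>+x. F x \<partial>PiM UNIV (\<lambda>_. lborel)) (1 + p)"
    by (rule grid_lines[OF _ _ _ F]) (use p in auto)
  also have "(\<integral>\<^sup>+x. F x \<partial>PiM UNIV (\<lambda>_. lborel)) = (\<integral>\<^sup>+x. G x \<partial>lborel)"
    unfolding F_def by (subst lb, subst nn_integral_distr) auto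
  finally show ?thesis by (simp add: p(3) G_def)
qed

text \<open>At zeros of w the derivative is 0 because q > 1. The proof passes to |t|^q, which is
  differentiable on the whole line and agrees with the power on the values of w.\<close>

lemma powr_abs_has_derivative:
  fixes w :: "'e::real_normed_vector \<Rightarrow> real"
  assumes q: "q > 1" and w: "(w has_derivative D) (at x)" "\<And>y. w y \<ge> 0"
  shows "((\<lambda>y. w y powr q) has_derivative (\<lambda>v. q * w x powr (q - 1) * D v)) (at x)"
proof -
  have "((\<lambda>t::real. \<bar>t\<bar> powr q) has_real_derivative q * w x powr (q - 1)) (at (w x))"
  proof (cases "w x = 0")
    case True
    have "((\<lambda>t::real. \<bar>t\<bar> powr (q - 1)) \<longlongrightarrow> 0) (at 0)"
      by (rule tendsto_eq_rhs[OF tendsto_powr'[of _ 0 _ _ "q - 1"]]) (use q in \<open>auto intro!: tendsto_eq_intros\<close>)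
    then have "((\<lambda>t::real. \<bar>t\<bar> powr q / t) \<longlongrightarrow> 0) (at 0)"
    proof (rule Lim_null_comparison[rotated])
      show "\<forall>\<^sub>F t in at 0. norm (\<bar>t\<bar> powr q / t) \<le> \<bar>t\<bar> powr (q - 1)"
        by (rule eventually_at_filter[THEN iffD2]) (auto simp: powr_diff abs_divide)
    qed
    then show ?thesis using True q by (simp add: has_field_derivative_iff)
  next
    case False
    then have pos: "w x > 0" using w(2)[of x] by simp
    have "((\<lambda>t. t powr q) has_real_derivative q * w x powr (q - 1)) (at (w x))"
      by (rule has_real_derivative_powr[OF pos])
    then show ?thesis
      by (rule has_field_derivative_transform_within_open[where S="{0<..}"]) (use pos in auto)
  qed
  then have "((\<lambda>t::real. \<bar>t\<bar> powr q) has_derivative (*) (q * w x powr (q - 1))) (at (w x))"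
    by (simp add: has_field_derivative_def)
  from diff_chain_at[OF w(1) this] show ?thesis using w(2) by (simp add: o_def)
qed

text \<open>\<open>gagliardo_nirenberg\<close> is applied to w^q with q = 2(n-1)/(n-2). Its left
  side is the integral N of w^s with s = q n/(n-1). As q - 1 = s/2, Cauchy-Schwarz bounds the right
  side in terms of sqrt(N) and the gradient integral, and the power of N is divided out.\<close>

lemma sobolev_euclidean:
  fixes w :: "real^'n::finite \<Rightarrow> real"
  assumes n: "CARD('n) \<ge> 3" and w: "smooth_on UNIV w" "\<And>x. w x \<ge> 0" "\<And>x. norm x \<ge> L \<Longrightarrow> w x = 0"
  shows "(\<integral>x. w x powr (2 * CARD('n) / (real CARD('n) - 2)) \<partial>lborel) powr ((real CARD('n) - 2) / CARD('n))
    \<le> (2 * (real CARD('n) - 1) / (real CARD('n) - 2))\<^sup>2 * (\<integral>x. (grad_sum w x)\<^sup>2 \<partial>lborel)"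
    "integrable lborel (\<lambda>x. w x powr (2 * CARD('n) / (real CARD('n) - 2)))"
    "integrable lborel (\<lambda>x. (grad_sum w x)\<^sup>2)"
proof -
  define m where "m = real CARD('n)"
  have m: "m \<ge> 3" using n by (simp add: m_def)
  define s where "s = 2 * m / (m - 2)"
  define q where "q = 2 * (m - 1) / (m - 2)"
  have q: "q > 1" "q - 1 = s / 2" using m by (auto simp: q_def s_def field_simps)
  have q3: "q * (m / (m - 1)) = s"
  proof -
    have "q * (m / (m - 1)) = (2 * m / (m - 2)) * ((m - 1) / (m - 1))" by (simp only: q_def times_divide_times_eq mult_ac)
    moreover have "(m - 1) / (m - 1) = 1" using m by simp
    ultimately show ?thesis by (simp only: s_def mult_1_right)
  qed
  have s: "s > 0" using m by (simp add: s_def)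
  define D where "D x v = frechet_derivative w (at x) v" for x v
  have dw: "(w has_derivative D x) (at x)" for x unfolding D_def by (rule smooth_on_has_derivative[OF w(1)]) simp
  have cw: "continuous_on UNIV w" by (rule smooth_on_continuous[OF w(1)])
  have cD: "continuous_on UNIV (\<lambda>x. D x v)" for v
    unfolding D_def by (rule smooth_on_continuous[OF smooth_on_frechet_derivative[OF w(1)]])
  have cpow: "continuous_on UNIV (\<lambda>x. w x powr a)" if "a > 0" for a
    by (rule continuous_on_powr') (use cw w(2) that in \<open>auto intro: continuous_intros\<close>)
  have g0: "grad_sum w x = 0" if "norm x > \<bar>L\<bar>" for x
  proof -
    have "frechet_derivative w (at x) = frechet_derivative (\<lambda>_. 0) (at x)"
      by (rule frechet_derivative_cong_open[of "- cball 0 \<bar>L\<bar>"]) (use that w(3) in auto)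
    then show ?thesis by (simp add: grad_sum_def frechet_derivative_const)
  qed
  have cg: "continuous_on UNIV (grad_sum w)" unfolding grad_sum_def[abs_def] D_def[symmetric] by (intro continuous_intros cD)
  have int: "integrable lborel f" if "continuous_on UNIV f" "\<And>x. norm x > \<bar>L\<bar> \<Longrightarrow> f x = 0" for f :: "real^'n \<Rightarrow> real"
  proof -
    have "integrable lborel (\<lambda>x. indicator (cball 0 \<bar>L\<bar>) x *\<^sub>R f x)"
      by (rule borel_integrable_compact) (use that(1) in \<open>auto intro: continuous_on_subset\<close>)
    moreover have "(\<lambda>x. indicator (cball 0 \<bar>L\<bar>) x *\<^sub>R f x) = f"
      using that(2) by (auto simp: fun_eq_iff indicator_def not_le)
    ultimately show ?thesis by simp
  qed
  have iN: "integrable lborel (\<lambda>x. w x powr s)" by (rule int[OF cpow[OF s]]) (simp add: w(3))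
  have iG: "integrable lborel (\<lambda>x. (grad_sum w x)\<^sup>2)" by (rule int) (auto intro!: continuous_intros cg simp: g0)
  define N where "N = (\<integral>x. w x powr s \<partial>lborel)"
  define E where "E = (\<integral>x. (grad_sum w x)\<^sup>2 \<partial>lborel)"
  have N0: "N \<ge> 0" and E0: "E \<ge> 0" unfolding N_def E_def by (auto intro!: Bochner_Integration.integral_nonneg)
  define h where "h x = w x powr q" for x
  have dh: "(h has_derivative (\<lambda>v. q * w x powr (q - 1) * D x v)) (at x)" for x
    unfolding h_def by (rule powr_abs_has_derivative[OF q(1) dw w(2)])
  have fh: "frechet_derivative h (at x) = (\<lambda>v. q * w x powr (q - 1) * D x v)" for x
    by (rule frechet_derivative_eq[OF dh])
  have gh: "grad_sum h x = q * (w x powr (s / 2) * grad_sum w x)" for x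
    unfolding grad_sum_def fh q(2) D_def using q(1)
    by (simp add: abs_mult sum_distrib_left mult.assoc)
  have "(\<integral>\<^sup>+x. epow (ennreal \<bar>h x\<bar>) (m / (m - 1)) \<partial>lborel) \<le> epow (\<integral>\<^sup>+x. ennreal (grad_sum h x) \<partial>lborel) (m / (m - 1))"
    unfolding m_def
  proof (rule gagliardo_nirenberg)
    show "h differentiable at x" for x using dh by (auto simp: differentiable_def)
    show "continuous_on UNIV (\<lambda>x. frechet_derivative h (at x) v)" for v
      unfolding fh by (intro continuous_intros cD cpow) (use q in simp)
    show "h x = 0" if "norm x \<ge> L" for x using w(3)[OF that] by (simp add: h_def)
  qed (use n in simp)
  also have "(\<integral>\<^sup>+x. epow (ennreal \<bar>h x\<bar>) (m / (m - 1)) \<partial>lborel) = (\<integral>\<^sup>+x. ennreal (w x powr s) \<partial>lborel)"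
    using m by (intro nn_integral_cong) (simp add: h_def epow_ennreal powr_powr q3[simplified])
  also have "\<dots> = ennreal N" unfolding N_def by (rule nn_integral_eq_integral[OF iN]) simp
  finally have 1: "ennreal N \<le> epow (\<integral>\<^sup>+x. ennreal (grad_sum h x) \<partial>lborel) (m / (m - 1))" .
  have gn: "grad_sum w x \<ge> 0" for x by (simp add: grad_sum_def sum_nonneg)
  have bm: "(\<lambda>x. w x powr a) \<in> borel_measurable borel" if "a > 0" for a
    by (rule borel_measurable_continuous_onI[OF cpow[OF that]])
  have bg: "(\<lambda>x. grad_sum w x) \<in> borel_measurable borel"
    by (rule borel_measurable_continuous_onI[OF cg])
  have prod_meas: "(\<lambda>x. ennreal (w x powr (s / 2)) * ennreal (grad_sum w x)) \<in> borel_measurable lborel"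
    using measurable_compose[OF bm measurable_ennreal, of "s / 2"] measurable_compose[OF bg measurable_ennreal] s
    by (simp add: borel_measurable_times_ennreal)
  have "(\<integral>\<^sup>+x. ennreal (grad_sum h x) \<partial>lborel) = ennreal q * (\<integral>\<^sup>+x. ennreal (w x powr (s / 2)) * ennreal (grad_sum w x) \<partial>lborel)"
    using q(1) gn unfolding gh nn_integral_cmult[OF prod_meas, symmetric] by (simp add: ennreal_mult)
  \<comment> \<open>Cauchy-Schwarz, written as Hoelder's inequality over the two booleans with
    exponents 1/2.\<close>
  also have "(\<integral>\<^sup>+x. ennreal (w x powr (s / 2)) * ennreal (grad_sum w x) \<partial>lborel)
      = (\<integral>\<^sup>+x. (\<Prod>b\<in>UNIV. epow (if b then ennreal (w x powr s) else ennreal ((grad_sum w x)\<^sup>2)) (1 / 2)) \<partial>lborel)"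
  proof (intro nn_integral_cong)
    fix x
    have "epow (ennreal (w x powr s)) (1 / 2) = ennreal (w x powr (s / 2))" by (simp add: epow_ennreal powr_powr)
    moreover have "epow (ennreal ((grad_sum w x)\<^sup>2)) (1 / 2) = ennreal (grad_sum w x)"
      using gn by (simp add: epow_ennreal powr_half_sqrt)
    ultimately show "ennreal (w x powr (s / 2)) * ennreal (grad_sum w x)
        = (\<Prod>b\<in>UNIV. epow (if b then ennreal (w x powr s) else ennreal ((grad_sum w x)\<^sup>2)) (1 / 2))"
      by (simp add: UNIV_bool mult.commute)
  qed
  also have "\<dots> \<le> (\<Prod>b\<in>UNIV. epow (\<integral>\<^sup>+x. (if b then ennreal (w x powr s) else ennreal ((grad_sum w x)\<^sup>2)) \<partial>lborel) (1 / 2))"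
    by (rule nn_integral_holder)
       (use bm[OF s] bg in \<open>auto simp: UNIV_bool\<close>)
  also have "\<dots> = ennreal (N powr (1/2) * E powr (1/2))"
    unfolding N_def E_def using iN iG N0 E0
    by (simp add: UNIV_bool nn_integral_eq_integral epow_ennreal ennreal_mult mult.commute)
  finally have 2: "(\<integral>\<^sup>+x. ennreal (grad_sum h x) \<partial>lborel) \<le> ennreal (q * (N powr (1/2) * E powr (1/2)))"
    using q(1) by (simp add: ennreal_mult mult_left_mono)
  \<comment> \<open>As b < 2, dividing by N^(b/2) leaves a positive power of N, and raising to 2/b
    turns its exponent 1 - b/2 into (m - 2) / m.\<close>
  define b where "b = m / (m - 1)"
  have b: "b > 0" "b < 2" using m by (auto simp: b_def field_simps)
  have "ennreal N \<le> epow (ennreal (q * (N powr (1/2) * E powr (1/2)))) b"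
    using 1 epow_mono[OF 2, of b] b unfolding b_def by (meson less_imp_le order_trans)
  also have "\<dots> = ennreal ((q * (N powr (1/2) * E powr (1/2))) powr b)"
    using q(1) b by (intro epow_ennreal) auto
  finally have 3: "N \<le> (q * (N powr (1/2) * E powr (1/2))) powr b" by simp
  have "N powr ((m - 2) / m) \<le> q\<^sup>2 * E"
  proof (cases "N = 0")
    case False
    then have Np: "N > 0" using N0 by simp
    have "(q * (N powr (1/2) * E powr (1/2))) powr b = N powr (b / 2) * (q * E powr (1/2)) powr b"
      using q(1) by (simp add: powr_mult powr_powr mult_ac)
    then have "N powr 1 \<le> N powr (b / 2) * (q * E powr (1/2)) powr b" using 3 Np by simp
    moreover have "N powr 1 = N powr (b / 2) * N powr (1 - b / 2)" by (simp add: powr_add[symmetric])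
    ultimately have "N powr (b / 2) * N powr (1 - b / 2) \<le> N powr (b / 2) * (q * E powr (1/2)) powr b"
      by (simp only:)
    then have "N powr (1 - b / 2) \<le> (q * E powr (1/2)) powr b"
      by (rule mult_left_le_imp_le) (use Np in simp)
    then have "(N powr (1 - b / 2)) powr (2 / b) \<le> ((q * E powr (1/2)) powr b) powr (2 / b)"
      using b by (intro powr_mono2) auto
    moreover have "((q * E powr (1/2)) powr b) powr (2 / b) = q\<^sup>2 * E"
      using b q(1) E0 by (simp add: powr_powr powr_mult)
    moreover have "(N powr (1 - b / 2)) powr (2 / b) = N powr ((m - 2) / m)"
    proof -
      have "(1 - b / 2) * (2 / b) = (m - 2) / m" using m by (simp add: b_def field_simps)
      then show ?thesis by (simp add: powr_powr)
    qed
    ultimately show ?thesis by simp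
  qed (use E0 in simp)
  then show "(\<integral>x. w x powr (2 * CARD('n) / (real CARD('n) - 2)) \<partial>lborel) powr ((real CARD('n) - 2) / CARD('n))
    \<le> (2 * (real CARD('n) - 1) / (real CARD('n) - 2))\<^sup>2 * (\<integral>x. (grad_sum w x)\<^sup>2 \<partial>lborel)"
    by (simp add: N_def E_def s_def q_def m_def)
  show "integrable lborel (\<lambda>x. w x powr (2 * CARD('n) / (real CARD('n) - 2)))"
    using iN by (simp add: s_def m_def)
  show "integrable lborel (\<lambda>x. (grad_sum w x)\<^sup>2)" by (rule iG)
qed

section \<open>Positivity of the Yamabe constant\<close>

context closed_riemannian
begin

text \<open>\<phi> is cut off by a bump in the chart and the Euclidean inequality is applied. On the
  ball of radius 2r the volume density lies between positive bounds, and the metric norm is at most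
  b times the Euclidean one.\<close>

lemma local_sobolev:
  assumes n3: "CARD('n) \<ge> 3" and c: "c \<in> A" and r: "r > 0" and ball: "cball a (3 * r) \<subseteq> chart_img c"
  obtains C where "C \<ge> 0"
    "\<And>\<phi>. smooth_function A \<phi> \<Longrightarrow> (\<And>p. p \<in> M \<Longrightarrow> \<phi> p \<ge> 0) \<Longrightarrow>
      (\<integral>\<^sup>+p\<in>chart_inv c ` ball a r. ennreal (\<phi> p powr (2 * CARD('n) / (real CARD('n) - 2))) \<partial>vol)
      \<le> ennreal (C * (\<integral>p. grad_norm_sq A g \<phi> p + (\<phi> p)\<^sup>2 \<partial>vol) powr (CARD('n) / (real CARD('n) - 2)))"
proof -
  define m where "m = real CARD('n)"
  define s where "s = 2 * m / (m - 2)"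
  have m: "m \<ge> 3" using n3 by (simp add: m_def)
  define q where "q = 2 * (m - 1) / (m - 2)"
  define K where "K = cball a (2 * r)"
  have K: "compact K" "K \<subseteq> chart_img c" "K \<noteq> {}" "ball a r \<subseteq> K"
    using ball r by (auto simp: K_def)
  obtain b where b: "b > 0" "\<And>x v. x \<in> K \<Longrightarrow> gnorm c x v \<le> b * norm v"
    using gnorm_bound_compact[OF c K(1,2)] by blast
  have cv: "continuous_on K (vden c)" by (rule continuous_on_subset[OF continuous_vden[OF c] K(2)])
  obtain x0 where x0: "x0 \<in> K" "\<And>x. x \<in> K \<Longrightarrow> vden c x0 \<le> vden c x"
    using continuous_attains_inf[OF K(1,3) cv] by blast
  obtain x1 where x1: "x1 \<in> K" "\<And>x. x \<in> K \<Longrightarrow> vden c x \<le> vden c x1"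
    using continuous_attains_sup[OF K(1,3) cv] by blast
  have v0: "vden c x0 > 0" using vden_pos[OF c] x0(1) K(2) by blast
  have v1: "vden c x1 > 0" using vden_pos[OF c] x1(1) K(2) by blast
  define \<beta> where "\<beta> z = smooth_bump r (z - a)" for z :: "real^'n"
  have sm\<beta>: "smooth_on UNIV \<beta>" unfolding \<beta>_def
    by (rule smooth_on_compose[OF _ _ _ _ smooth_on_bump]) (auto intro!: smooth_on_diff)
  have \<beta>01: "0 \<le> \<beta> z" "\<beta> z \<le> 1" for z unfolding \<beta>_def by (rule smooth_bump_range)+
  have \<beta>1: "\<beta> z = 1" if "z \<in> ball a r" for z
    unfolding \<beta>_def by (rule smooth_bump_1[OF r]) (use that in \<open>simp add: dist_norm norm_minus_commute\<close>)
  have \<beta>0: "\<beta> z = 0" if "norm (z - a) \<ge> 2 * r" for z unfolding \<beta>_def by (rule smooth_bump_0[OF r that])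
  have "continuous_on K (grad_sum \<beta>)" unfolding grad_sum_def[abs_def]
    by (intro continuous_intros continuous_on_subset[OF smooth_on_continuous[OF smooth_on_frechet_derivative[OF sm\<beta>]]]) auto
  then obtain x2 where x2: "\<And>x. x \<in> K \<Longrightarrow> grad_sum \<beta> x \<le> grad_sum \<beta> x2"
    using continuous_attains_sup[OF K(1,3)] by blast
  define k where "k = grad_sum \<beta> x2"
  have k0: "k \<ge> 0" by (simp add: k_def grad_sum_def sum_nonneg)
  \<comment> \<open>From (m b x + k y)^2 <= 2 (m b)^2 x^2 + 2 k^2 y^2, where x is the norm of the
    gradient of \<phi>, y the value of \<phi>, and m counts the coordinate directions.\<close>
  define C1 where "C1 = 2 * (m * b)\<^sup>2 + 2 * k\<^sup>2"
  have C1: "C1 \<ge> 0" by (simp add: C1_def)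
  define C2 where "C2 = C1 / vden c x0"
  have C2: "C2 \<ge> 0" using C1 v0 by (simp add: C2_def)
  show thesis
  proof (rule that[of "vden c x1 * (q\<^sup>2 * C2) powr (m / (m - 2))"])
    show "0 \<le> vden c x1 * (q\<^sup>2 * C2) powr (m / (m - 2))" using v1 by (intro mult_nonneg_nonneg) auto
    fix \<phi> :: "'a \<Rightarrow> real" assume \<phi>: "smooth_function A \<phi>" and \<phi>0: "\<And>p. p \<in> M \<Longrightarrow> \<phi> p \<ge> 0"
    define F where "F p = grad_norm_sq A g \<phi> p + (\<phi> p)\<^sup>2" for p
    have F0: "F p \<ge> 0" if "p \<in> M" for p unfolding F_def using gbound_grad_norm_sq(1)[OF \<phi> that] by simp
    have cF: "continuous_on M F" unfolding F_def
      by (intro continuous_intros continuous_on_grad_norm_sq smooth_function_continuous \<phi>)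
    define E where "E = (\<integral>p. F p \<partial>vol)"
    have E0: "E \<ge> 0" unfolding E_def by (rule integral_vol_nonneg[OF F0])
    define u where "u = \<phi> \<circ> chart_inv c"
    have su: "smooth_on (chart_img c) u" unfolding u_def by (rule smooth_functionD(1)[OF \<phi> c])
    have inv: "chart_inv c z \<in> chart_dom c" "chart_inv c z \<in> M" if "z \<in> chart_img c" for z
      using chartD(6,8)[OF c] that by blast+
    have u0: "u z \<ge> 0" if "z \<in> chart_img c" for z using \<phi>0[OF inv(2)[OF that]] by (simp add: u_def)
    define w where "w z = (if z \<in> chart_img c then \<beta> z * u z else 0)" for z
    have w0: "w z \<ge> 0" for z using \<beta>01 u0 by (simp add: w_def)
    have wK: "w z = 0" if "z \<notin> K" for z using \<beta>0[of z] that by (auto simp: w_def K_def dist_norm norm_minus_commute)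
    have sprod: "smooth_on (chart_img c) (\<lambda>z. \<beta> z * u z)"
      by (rule smooth_on_mult[OF chartD(2)[OF c] smooth_on_subset[OF sm\<beta>] su]) simp
    have sw: "smooth_on UNIV w"
    proof (rule smooth_on_local)
      fix z :: "real^'n"
      show "\<exists>T. open T \<and> z \<in> T \<and> smooth_on T w"
      proof (cases "z \<in> chart_img c")
        case True
        have "smooth_on (chart_img c) w"
          by (rule smooth_on_cong[OF chartD(2)[OF c] sprod]) (simp add: w_def)
        then show ?thesis using True chartD(2)[OF c] by blast
      next
        case False
        have o: "open (- K)" by (simp add: K_def open_Compl)
        have "smooth_on (- K) w"
          by (rule smooth_on_cong[OF o smooth_on_const[of _ 0]]) (use wK in auto)
        then show ?thesis using False K(2) o by blast
      qed
    qed
    have wL: "w z = 0" if "norm z \<ge> norm a + 2 * r" for z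
    proof -
      have "norm (z - a) \<ge> 2 * r" using that norm_triangle_ineq2[of z a] by linarith
      then show ?thesis using \<beta>0 by (simp add: w_def)
    qed
    note sob = sobolev_euclidean[where L="norm a + 2 * r", OF n3 sw w0 wL, folded m_def]
    have grad: "(grad_sum w z)\<^sup>2 \<le> C1 * F (chart_inv c z)" if z: "z \<in> K" for z
    proof -
      have zi: "z \<in> chart_img c" using z K(2) by blast
      have gz: "gns c \<phi> z = grad_norm_sq A g \<phi> (chart_inv c z)"
        using grad_norm_sq_chart[OF \<phi> c inv(1)[OF zi]] chartD(7)[OF c] zi by simp
      have g0: "gns c \<phi> z \<ge> 0" by (rule gns_bound(1)[OF \<phi> c zi])
      have d\<beta>: "(\<beta> has_derivative frechet_derivative \<beta> (at z)) (at z)"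
        by (rule smooth_on_has_derivative[OF sm\<beta>]) simp
      have du: "(u has_derivative frechet_derivative u (at z)) (at z)"
        by (rule smooth_on_has_derivative[OF su zi])
      have "((\<lambda>z. \<beta> z * u z) has_derivative (\<lambda>v. \<beta> z * frechet_derivative u (at z) v + frechet_derivative \<beta> (at z) v * u z)) (at z)"
        by (rule has_derivative_mult[OF d\<beta> du])
      then have "(w has_derivative (\<lambda>v. \<beta> z * frechet_derivative u (at z) v + frechet_derivative \<beta> (at z) v * u z)) (at z)"
        by (rule has_derivative_transform_within_open[OF _ chartD(2)[OF c] zi]) (simp add: w_def)
      from frechet_derivative_eq[OF this]
      have "grad_sum w z = (\<Sum>i\<in>UNIV. \<bar>\<beta> z * frechet_derivative u (at z) (axis i 1) + frechet_derivative \<beta> (at z) (axis i 1) * u z\<bar>)"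
        by (simp add: grad_sum_def)
      also have "\<dots> \<le> (\<Sum>i\<in>UNIV. b * sqrt (gns c \<phi> z) + \<bar>frechet_derivative \<beta> (at z) (axis i 1)\<bar> * u z)"
      proof (rule sum_mono)
        fix i :: 'n
        have "\<bar>frechet_derivative u (at z) (axis i 1)\<bar> \<le> sqrt (gns c \<phi> z) * gnorm c z (axis i 1)"
          unfolding u_def by (rule gns_bound(2)[OF \<phi> c zi])
        also have "\<dots> \<le> sqrt (gns c \<phi> z) * (b * 1)"
          using b(2)[OF z, of "axis i 1"] g0 by (intro mult_left_mono) (auto simp: norm_axis_1)
        finally have 1: "\<bar>frechet_derivative u (at z) (axis i 1)\<bar> \<le> b * sqrt (gns c \<phi> z)" by (simp add: mult.commute)
        have "\<bar>\<beta> z * frechet_derivative u (at z) (axis i 1)\<bar> \<le> 1 * \<bar>frechet_derivative u (at z) (axis i 1)\<bar>"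
          unfolding abs_mult by (rule mult_right_mono) (use \<beta>01[of z] in auto)
        moreover have "\<bar>frechet_derivative \<beta> (at z) (axis i 1) * u z\<bar> = \<bar>frechet_derivative \<beta> (at z) (axis i 1)\<bar> * u z"
          using u0[OF zi] by (simp add: abs_mult)
        ultimately show "\<bar>\<beta> z * frechet_derivative u (at z) (axis i 1) + frechet_derivative \<beta> (at z) (axis i 1) * u z\<bar>
            \<le> b * sqrt (gns c \<phi> z) + \<bar>frechet_derivative \<beta> (at z) (axis i 1)\<bar> * u z"
          using 1 abs_triangle_ineq[of "\<beta> z * frechet_derivative u (at z) (axis i 1)" "frechet_derivative \<beta> (at z) (axis i 1) * u z"]
          by linarith
      qed
      also have "\<dots> = m * b * sqrt (gns c \<phi> z) + grad_sum \<beta> z * u z"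
        by (simp add: sum.distrib sum_distrib_right[symmetric] m_def grad_sum_def mult.assoc)
      also have "\<dots> \<le> m * b * sqrt (gns c \<phi> z) + k * u z"
        using mult_right_mono[OF x2[OF z] u0[OF zi]] by (simp add: k_def)
      finally have "(grad_sum w z)\<^sup>2 \<le> (m * b * sqrt (gns c \<phi> z) + k * u z)\<^sup>2"
        by (rule power_mono) (simp add: grad_sum_def sum_nonneg)
      also have "\<dots> \<le> 2 * (m * b * sqrt (gns c \<phi> z))\<^sup>2 + 2 * (k * u z)\<^sup>2"
        using sum_squares_bound[of "m * b * sqrt (gns c \<phi> z)" "k * u z"] by (simp add: power2_sum)
      also have "\<dots> = 2 * (m * b)\<^sup>2 * gns c \<phi> z + 2 * k\<^sup>2 * (u z)\<^sup>2"
        using g0 by (simp add: power_mult_distrib)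
      also have "\<dots> \<le> C1 * gns c \<phi> z + C1 * (u z)\<^sup>2"
        using g0 by (intro add_mono mult_right_mono) (auto simp: C1_def)
      finally show ?thesis by (simp add: F_def gz u_def distrib_left)
    qed
    have gK: "grad_sum w z = 0" if "z \<notin> K" for z
    proof -
      have "frechet_derivative w (at z) = frechet_derivative (\<lambda>_. 0) (at z)"
        by (rule frechet_derivative_cong_open[of "- K"]) (use that wK in \<open>auto simp: K_def open_Compl\<close>)
      then show ?thesis by (simp add: grad_sum_def frechet_derivative_const)
    qed
    define D where "D = (\<integral>z. (grad_sum w z)\<^sup>2 \<partial>lborel)"
    have "ennreal D = (\<integral>\<^sup>+z. ennreal ((grad_sum w z)\<^sup>2) \<partial>lborel)"
      unfolding D_def by (rule nn_integral_eq_integral[OF sob(3), symmetric]) simp_all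
    also have "\<dots> \<le> (\<integral>\<^sup>+z\<in>chart_img c. ennreal (vden c z) * ennreal (C2 * F (chart_inv c z)) \<partial>lborel)"
    proof (rule nn_integral_mono)
      fix z
      show "ennreal ((grad_sum w z)\<^sup>2) \<le> ennreal (vden c z) * ennreal (C2 * F (chart_inv c z)) * indicator (chart_img c) z"
      proof (cases "z \<in> K")
        case True
        then have zi: "z \<in> chart_img c" using K(2) by blast
        have Fz: "F (chart_inv c z) \<ge> 0" by (rule F0[OF inv(2)[OF zi]])
        have "C1 * F (chart_inv c z) = vden c x0 * (C2 * F (chart_inv c z))" using v0 by (simp add: C2_def)
        also have "\<dots> \<le> vden c z * (C2 * F (chart_inv c z))"
          by (rule mult_right_mono[OF x0(2)[OF True]]) (use C2 Fz in simp)
        finally have "(grad_sum w z)\<^sup>2 \<le> vden c z * (C2 * F (chart_inv c z))" using grad[OF True] by linarith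
        then have "ennreal ((grad_sum w z)\<^sup>2) \<le> ennreal (vden c z * (C2 * F (chart_inv c z)))" by (rule ennreal_leI)
        also have "\<dots> = ennreal (vden c z) * ennreal (C2 * F (chart_inv c z))"
          using vden_pos[OF c zi] C2 Fz by (intro ennreal_mult) auto
        finally show ?thesis using zi by simp
      qed (simp add: gK)
    qed
    also have "\<dots> = (\<integral>\<^sup>+p\<in>chart_dom c. ennreal (C2 * F p) \<partial>vol)"
      by (rule nn_integral_vol_chart[OF c, symmetric], rule measurable_compose[OF measurable_vol measurable_ennreal])
         (intro continuous_intros cF)
    also have "\<dots> \<le> (\<integral>\<^sup>+p. ennreal (C2 * F p) \<partial>vol)"
      by (rule nn_integral_mono) (auto simp: indicator_def)
    also have "\<dots> = ennreal (\<integral>p. C2 * F p \<partial>vol)"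
      by (rule nn_integral_eq_integral) (use C2 F0 in \<open>auto intro!: integrable_vol continuous_intros cF AE_I2\<close>)
    also have "\<dots> = ennreal (C2 * E)" by (simp add: E_def)
    finally have DE: "D \<le> C2 * E" using C2 E0 by (simp add: ennreal_le_iff)
    define N where "N = (\<integral>z. w z powr s \<partial>lborel)"
    have N0: "N \<ge> 0" unfolding N_def by (intro Bochner_Integration.integral_nonneg) simp
    have "N powr ((m - 2) / m) \<le> q\<^sup>2 * D" using sob(1) by (simp add: N_def D_def q_def s_def m_def)
    also have "\<dots> \<le> q\<^sup>2 * (C2 * E)" by (rule mult_left_mono[OF DE]) simp
    finally have "(N powr ((m - 2) / m)) powr (m / (m - 2)) \<le> (q\<^sup>2 * C2 * E) powr (m / (m - 2))"
      using m by (intro powr_mono2) (auto simp: mult.assoc)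
    moreover have "(N powr ((m - 2) / m)) powr (m / (m - 2)) = N" using m N0 by (simp add: powr_powr)
    ultimately have NE: "N \<le> (q\<^sup>2 * C2) powr (m / (m - 2)) * E powr (m / (m - 2))"
      using C2 E0 by (simp add: powr_mult)
    define B where "B = chart_inv c ` ball a r"
    have B: "B \<in> msets" "B \<subseteq> chart_dom c"
      using openin_msets[OF open_chart_image[OF c, of "ball a r"]] inv(1) K(2,4) unfolding B_def by blast+
    have mB: "(\<lambda>p. ennreal (\<phi> p powr s) * indicator B p) \<in> borel_measurable vol"
    proof (intro borel_measurable_times_ennreal borel_measurable_indicator)
      have [measurable]: "\<phi> \<in> borel_measurable vol" by (rule measurable_vol[OF smooth_function_continuous[OF \<phi>]])
      show "(\<lambda>p. ennreal (\<phi> p powr s)) \<in> borel_measurable vol" by measurable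
    qed (use B in auto)
    have "(\<integral>\<^sup>+p\<in>B. ennreal (\<phi> p powr s) \<partial>vol) = (\<integral>\<^sup>+p\<in>chart_dom c. ennreal (\<phi> p powr s) * indicator B p \<partial>vol)"
      by (rule nn_integral_cong) (use B(2) in \<open>auto simp: indicator_def\<close>)
    also have "\<dots> = (\<integral>\<^sup>+z\<in>chart_img c. ennreal (vden c z) * (ennreal (\<phi> (chart_inv c z) powr s) * indicator B (chart_inv c z)) \<partial>lborel)"
      by (rule nn_integral_vol_chart[OF c mB])
    also have "\<dots> \<le> (\<integral>\<^sup>+z. ennreal (vden c x1 * w z powr s) \<partial>lborel)"
    proof (rule nn_integral_mono)
      fix z
      show "ennreal (vden c z) * (ennreal (\<phi> (chart_inv c z) powr s) * indicator B (chart_inv c z)) * indicator (chart_img c) z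
          \<le> ennreal (vden c x1 * w z powr s)"
      proof (cases "z \<in> chart_img c \<and> chart_inv c z \<in> B")
        case True
        then obtain y where y: "y \<in> ball a r" "chart_inv c z = chart_inv c y" unfolding B_def by blast
        then have "z = y" using chartD(7)[OF c] True K by (metis subsetD)
        then have zb: "z \<in> ball a r" using y by simp
        then have wz: "w z = \<phi> (chart_inv c z)" using True \<beta>1 by (simp add: w_def u_def)
        have "vden c z * \<phi> (chart_inv c z) powr s \<le> vden c x1 * w z powr s"
          unfolding wz by (rule mult_right_mono[OF x1(2)]) (use zb K in auto)
        then show ?thesis using True vden_pos[OF c, of z] by (simp add: ennreal_mult[symmetric] ennreal_leI)
      qed auto
    qed
    also have "\<dots> = ennreal (\<integral>z. vden c x1 * w z powr s \<partial>lborel)"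
      by (rule nn_integral_eq_integral) (use sob(2) v1 in \<open>auto simp: s_def m_def\<close>)
    also have "\<dots> = ennreal (vden c x1 * N)" by (simp add: N_def)
    also have "\<dots> \<le> ennreal (vden c x1 * (q\<^sup>2 * C2) powr (m / (m - 2)) * E powr (m / (m - 2)))"
      using mult_left_mono[OF NE, of "vden c x1"] v1 by (intro ennreal_leI) (simp add: mult.assoc)
    finally show "(\<integral>\<^sup>+p\<in>chart_inv c ` ball a r. ennreal (\<phi> p powr (2 * CARD('n) / (real CARD('n) - 2))) \<partial>vol)
      \<le> ennreal (vden c x1 * (q\<^sup>2 * C2) powr (m / (m - 2)) *
          (\<integral>p. grad_norm_sq A g \<phi> p + (\<phi> p)\<^sup>2 \<partial>vol) powr (CARD('n) / (real CARD('n) - 2)))"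
      by (simp add: B_def E_def F_def s_def m_def)
  qed
qed

text \<open>Each slab of a constant function around its value is the whole manifold, so
  \<open>slab_lower\<close> gives positivity.\<close>

lemma measure_vol_pos: "measure vol M > 0"
proof -
  obtain z where z: "z \<in> M" using M_nonempty by blast
  have "gbound (\<lambda>p. 0) 1 p" if "p \<in> M" for p
    using gnorm_nonneg chart_at[OF that] by (simp add: gbound_def o_def frechet_derivative_const)
  from slab_lower[OF smooth_function_const this z]
  obtain c s0 where "c > 0" "s0 > 0" "\<And>s. 0 < s \<Longrightarrow> s < s0 \<Longrightarrow> c * s ^ CARD('n) \<le> measure vol (slab (\<lambda>p. 0) 0 s)" by blast
  then have "0 < c * (s0 / 2) ^ CARD('n)" "c * (s0 / 2) ^ CARD('n) \<le> measure vol (slab (\<lambda>p. 0) 0 (s0 / 2))" by auto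
  moreover have "measure vol (slab (\<lambda>p. 0) 0 (s0 / 2)) \<le> measure vol M"
    by (rule finite_measure_mono) (use sets.top[of vol] in \<open>auto simp: slab_def\<close>)
  ultimately show ?thesis by linarith
qed

text \<open>The local Sobolev inequalities, summed over the good cover, bound the denominator of the
  quotient by a multiple of E, the squared H^1 norm. As R has a positive minimum, the numerator is
  at least a positive multiple of E.\<close>

theorem yamabe_constant_pos:
  assumes Rpos: "\<forall>p\<in>M. R p > 0" and n3: "CARD('n) \<ge> 3"
  shows "yamabe_constant M A g > 0"
proof -
  define m where "m = real CARD('n)"
  define s where "s = 2 * m / (m - 2)"
  have m: "m \<ge> 3" using n3 by (simp add: m_def)
  define E where "E \<phi> = (\<integral>p. grad_norm_sq A g \<phi> p + (\<phi> p)\<^sup>2 \<partial>vol)" for \<phi>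
  obtain P where P: "finite P"
    "\<forall>(c, a, r)\<in>P. c \<in> A \<and> r > 0 \<and> cball a (3 * r) \<subseteq> chart_img c"
    "M = (\<Union>(c, a, r)\<in>P. chart_inv c ` ball a r)" by (rule good_cover)
  define B where "B i = (case i of (c, a, r) \<Rightarrow> chart_inv c ` ball a r)" for i :: "('a, 'n) chart \<times> (real^'n) \<times> real"
  have MB: "M = (\<Union>i\<in>P. B i)" unfolding B_def by (rule P(3))
  define sob where "sob i C \<longleftrightarrow> C \<ge> 0 \<and> (\<forall>\<phi>. smooth_function A \<phi> \<longrightarrow> (\<forall>p\<in>M. \<phi> p \<ge> 0) \<longrightarrow>
      (\<integral>\<^sup>+p\<in>B i. ennreal (\<phi> p powr s) \<partial>vol) \<le> ennreal (C * E \<phi> powr (m / (m - 2))))" for i C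
  have "\<exists>C. sob i C" if i: "i \<in> P" for i
  proof -
    obtain c a r where i': "i = (c, a, r)" by (cases i)
    have car: "c \<in> A" "r > 0" "cball a (3 * r) \<subseteq> chart_img c" using P(2) i i' by auto
    show ?thesis
    proof (rule local_sobolev[OF n3 car])
      fix C :: real assume "C \<ge> 0" and "\<And>\<phi>. smooth_function A \<phi> \<Longrightarrow> (\<And>p. p \<in> M \<Longrightarrow> \<phi> p \<ge> 0) \<Longrightarrow>
        (\<integral>\<^sup>+p\<in>chart_inv c ` ball a r. ennreal (\<phi> p powr (2 * CARD('n) / (real CARD('n) - 2))) \<partial>vol)
        \<le> ennreal (C * (\<integral>p. grad_norm_sq A g \<phi> p + (\<phi> p)\<^sup>2 \<partial>vol) powr (CARD('n) / (real CARD('n) - 2)))"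
      then have "sob i C" by (simp add: sob_def i' B_def E_def s_def m_def)
      then show ?thesis by blast
    qed
  qed
  then have "\<forall>i\<in>P. \<exists>C. sob i C" by blast
  from bchoice[OF this] obtain C where sob: "\<forall>i\<in>P. sob i (C i)" by blast
  have C: "C i \<ge> 0" "smooth_function A \<phi> \<Longrightarrow> (\<forall>p\<in>M. \<phi> p \<ge> 0) \<Longrightarrow>
      (\<integral>\<^sup>+p\<in>B i. ennreal (\<phi> p powr s) \<partial>vol) \<le> ennreal (C i * E \<phi> powr (m / (m - 2)))" if "i \<in> P" for i \<phi>
    using bspec[OF sob that] unfolding sob_def by blast+
  define T where "T = (\<Sum>i\<in>P. C i) + 1"
  have T: "T > 0" using sum_nonneg[of P C] C(1) by (simp add: T_def)
  define T' where "T' = T powr ((m - 2) / m)"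
  have T': "T' > 0" using T by (simp add: T'_def)
  obtain R0 R1 where R0: "R0 > 0" "\<And>p. p \<in> M \<Longrightarrow> R0 \<le> R p" by (rule R_bounds[OF Rpos]) blast
  \<comment> \<open>Here 4 is a lower bound for the gradient coefficient 4(n-1)/(n-2), and R0 is one
    for R.\<close>
  define \<kappa> where "\<kappa> = min 4 R0"
  have \<kappa>: "\<kappa> > 0" "\<kappa> \<le> 4" "\<kappa> \<le> R0" using R0 by (auto simp: \<kappa>_def)
  have quot: "\<kappa> / T' \<le> yamabe_quotient M A g \<phi>" if \<phi>: "smooth_function A \<phi>" "\<forall>p\<in>M. 0 < \<phi> p" for \<phi>
  proof -
    have c\<phi>: "continuous_on M \<phi>" by (rule smooth_function_continuous[OF \<phi>(1)])
    have cG: "continuous_on M (grad_norm_sq A g \<phi>)" by (rule continuous_on_grad_norm_sq[OF \<phi>(1)])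
    have G0: "grad_norm_sq A g \<phi> p \<ge> 0" if "p \<in> M" for p by (rule gbound_grad_norm_sq(1)[OF \<phi>(1) that])
    have cs: "continuous_on M (\<lambda>p. \<phi> p powr s)"
      by (intro continuous_on_powr c\<phi> continuous_on_const) (use \<phi>(2) in auto)
    define N where "N = (\<integral>p. \<phi> p powr s \<partial>vol)"
    have B: "B i \<in> msets" if "i \<in> P" for i
    proof -
      obtain c a r where i': "i = (c, a, r)" by (cases i)
      have car: "c \<in> A" "r > 0" "cball a (3 * r) \<subseteq> chart_img c" using P(2) that i' by auto
      have "ball a r \<subseteq> cball a (3 * r)" using car(2) by auto
      then have "ball a r \<subseteq> chart_img c" using car(3) by blast
      then show ?thesis using openin_msets[OF open_chart_image[OF car(1) open_ball]] by (simp add: B_def i')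
    qed
    have "ennreal N = (\<integral>\<^sup>+p. ennreal (\<phi> p powr s) \<partial>vol)"
      unfolding N_def by (rule nn_integral_eq_integral[symmetric, OF integrable_vol[OF cs]]) simp
    also have "\<dots> \<le> (\<integral>\<^sup>+p. (\<Sum>i\<in>P. ennreal (\<phi> p powr s) * indicator (B i) p) \<partial>vol)"
    proof (rule nn_integral_mono)
      fix p assume "p \<in> space vol"
      then have "p \<in> M" by simp
      then have "p \<in> (\<Union>i\<in>P. B i)" by (simp only: MB[symmetric])
      then obtain i where i: "i \<in> P" "p \<in> B i" by (rule UN_E)
      have "ennreal (\<phi> p powr s) * indicator (B i) p \<le> (\<Sum>i\<in>P. ennreal (\<phi> p powr s) * indicator (B i) p)"
        by (rule member_le_sum[OF i(1) _ P(1)]) simp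
      then show "ennreal (\<phi> p powr s) \<le> (\<Sum>i\<in>P. ennreal (\<phi> p powr s) * indicator (B i) p)" using i(2) by simp
    qed
    also have "\<dots> = (\<Sum>i\<in>P. \<integral>\<^sup>+p\<in>B i. ennreal (\<phi> p powr s) \<partial>vol)"
      by (intro nn_integral_sum borel_measurable_times_ennreal borel_measurable_indicator
          measurable_compose[OF measurable_vol[OF cs] measurable_ennreal]) (use B in auto)
    also have "\<dots> \<le> (\<Sum>i\<in>P. ennreal (C i * E \<phi> powr (m / (m - 2))))"
      using \<phi> by (intro sum_mono C(2)) (auto simp: less_imp_le)
    also have "\<dots> = ennreal (\<Sum>i\<in>P. C i * E \<phi> powr (m / (m - 2)))"
      by (rule sum_ennreal) (use C(1) in auto)
    also have "\<dots> \<le> ennreal (T * E \<phi> powr (m / (m - 2)))"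
      by (intro ennreal_leI) (simp add: T_def sum_distrib_right[symmetric] mult_right_mono)
    finally have "N \<le> T * E \<phi> powr (m / (m - 2))" using T by (simp add: ennreal_le_iff)
    moreover have Npos: "N > 0"
    proof -
      obtain p0 where p0: "p0 \<in> M" "\<And>p. p \<in> M \<Longrightarrow> \<phi> p0 powr s \<le> \<phi> p powr s"
        using continuous_attains_inf[OF compact_M M_nonempty cs] by blast
      have "(\<integral>p. \<phi> p0 powr s \<partial>vol) \<le> N"
        unfolding N_def by (rule integral_mono[OF integrable_const integrable_vol[OF cs]]) (use p0 in simp)
      moreover have "(\<integral>p. \<phi> p0 powr s \<partial>vol) = measure vol M * \<phi> p0 powr s" by simp
      moreover have "measure vol M * \<phi> p0 powr s > 0" using measure_vol_pos \<phi>(2) p0(1) by auto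
      ultimately show ?thesis by linarith
    qed
    ultimately have "N powr ((m - 2) / m) \<le> (T * E \<phi> powr (m / (m - 2))) powr ((m - 2) / m)"
      using m by (intro powr_mono2) auto
    moreover have E0: "E \<phi> \<ge> 0" unfolding E_def by (rule integral_vol_nonneg) (simp add: G0)
    moreover have "(T * E \<phi> powr (m / (m - 2))) powr ((m - 2) / m) = T' * E \<phi>"
      using T E0 m by (simp add: powr_mult powr_powr T'_def)
    ultimately have den: "N powr ((m - 2) / m) \<le> T' * E \<phi>" by simp
    define G where "G = (\<integral>p. grad_norm_sq A g \<phi> p \<partial>vol)"
    define S where "S = (\<integral>p. R p * (\<phi> p)\<^sup>2 \<partial>vol)"
    have iG: "integrable vol (grad_norm_sq A g \<phi>)" by (rule integrable_vol[OF cG])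
    have i2: "integrable vol (\<lambda>p. (\<phi> p)\<^sup>2)" by (intro integrable_vol continuous_intros c\<phi>)
    have "E \<phi> = G + (\<integral>p. (\<phi> p)\<^sup>2 \<partial>vol)"
      unfolding E_def G_def by (rule Bochner_Integration.integral_add[OF iG i2])
    then have "\<kappa> * E \<phi> = \<kappa> * G + (\<integral>p. \<kappa> * (\<phi> p)\<^sup>2 \<partial>vol)" by (simp add: distrib_left)
    moreover have "(\<integral>p. \<kappa> * (\<phi> p)\<^sup>2 \<partial>vol) \<le> S" unfolding S_def
    proof (rule integral_mono)
      show "integrable vol (\<lambda>p. \<kappa> * (\<phi> p)\<^sup>2)" using i2 by simp
      show "integrable vol (\<lambda>p. R p * (\<phi> p)\<^sup>2)" by (intro integrable_vol continuous_intros c\<phi> continuous_on_R)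
      show "\<kappa> * (\<phi> p)\<^sup>2 \<le> R p * (\<phi> p)\<^sup>2" if "p \<in> space vol" for p
        using R0(2)[of p] that \<kappa>(3) by (intro mult_right_mono) auto
    qed
    moreover have "\<kappa> * G \<le> 4 * (m - 1) / (m - 2) * G"
    proof (rule mult_right_mono)
      have "4 * (m - 2) \<le> 4 * (m - 1)" by simp
      then have "4 \<le> 4 * (m - 1) / (m - 2)" using m by (simp add: pos_le_divide_eq)
      then show "\<kappa> \<le> 4 * (m - 1) / (m - 2)" using \<kappa>(2) by linarith
      show "0 \<le> G" unfolding G_def by (rule integral_vol_nonneg[OF G0])
    qed
    ultimately have num: "\<kappa> * E \<phi> \<le> 4 * (m - 1) / (m - 2) * G + S" by linarith
    have "\<kappa> / T' * N powr ((m - 2) / m) \<le> \<kappa> / T' * (T' * E \<phi>)"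
      by (rule mult_left_mono[OF den]) (use \<kappa> T' in simp)
    also have "\<dots> = \<kappa> * E \<phi>" using T' by simp
    also note num
    finally have "\<kappa> / T' \<le> (4 * (m - 1) / (m - 2) * G + S) / N powr ((m - 2) / m)"
      using Npos by (subst pos_le_divide_eq) auto
    then show ?thesis by (simp add: yamabe_quotient_def Let_def G_def S_def N_def m_def s_def)
  qed
  have "\<kappa> / T' \<le> yamabe_constant M A g"
    unfolding yamabe_constant_def
  proof (rule cInf_greatest)
    show "{yamabe_quotient M A g \<phi> |\<phi>. smooth_function A \<phi> \<and> (\<forall>p\<in>M. 0 < \<phi> p)} \<noteq> {}"
      using smooth_function_const[of 1] zero_less_one by blast
  qed (use quot in blast)
  moreover have "\<kappa> / T' > 0" using \<kappa> T' by simp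
  ultimately show ?thesis by linarith
qed

end

theorem theorem1p1:
  assumes "CARD('n::finite) \<ge> 3"
  shows "\<exists>C :: real \<Rightarrow> real.
    (\<forall>(M :: 'a::topological_space set) (A :: ('a, 'n) chart set) (g :: ('a, 'n) metric_field).
       closed_riemannian_manifold M A g \<and> simply_connected M \<and>
       (\<forall>p\<in>M. scalar_curvature A g p > 0) \<longrightarrow>
       riemannian_diameter M A g \<le>
         C (yamabe_constant M A g) *
         (\<integral>p. scalar_curvature A g p powr ((real CARD('n) - 1) / 2) \<partial>riemannian_volume M A g)) \<and>
    (\<forall>Y > 0. C Y = 4 * max (1 / unit_sphere_volume TYPE('n))
       ((2 * exp 1 / real CARD('n) * Y) powr (- real CARD('n) / 2) *
        exp ((17 * real CARD('n) - 18) / (real CARD('n) - 2) * 2 ^ CARD('n))))"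
proof (intro exI conjI allI impI)
  let ?K = "\<lambda>Y. (2 * exp 1 / real CARD('n) * Y) powr (- real CARD('n) / 2) *
    exp ((17 * real CARD('n) - 18) / (real CARD('n) - 2) * 2 ^ CARD('n))"
  let ?C = "\<lambda>Y. 4 * max (1 / unit_sphere_volume TYPE('n)) (?K Y)"
  show "?C Y = 4 * max (1 / unit_sphere_volume TYPE('n)) (?K Y)" for Y by (rule refl)
  fix M :: "'a set" and A :: "('a, 'n) chart set" and g :: "('a, 'n) metric_field"
  assume a: "closed_riemannian_manifold M A g \<and> simply_connected M \<and> (\<forall>p\<in>M. scalar_curvature A g p > 0)"
  interpret closed_riemannian M A g by unfold_locales (use a in blast)
  have R: "\<forall>p\<in>M. R p > 0" and conn: "connected M" using a simply_connected_connected by blast+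
  have "riemannian_diameter M A g \<le> 4 * ?K (yamabe_constant M A g) * (\<integral>p. R p powr ((real CARD('n) - 1) / 2) \<partial>vol)"
    by (rule diameter_bound[OF R assms yamabe_constant_pos[OF R assms] conn])
  also have "\<dots> \<le> ?C (yamabe_constant M A g) * (\<integral>p. R p powr ((real CARD('n) - 1) / 2) \<partial>vol)"
    by (intro mult_right_mono mult_left_mono integral_vol_nonneg max.cobounded2) auto
  finally show "riemannian_diameter M A g \<le> ?C (yamabe_constant M A g) * (\<integral>p. R p powr ((real CARD('n) - 1) / 2) \<partial>vol)" .
qed

end
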